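(* Let $X$ be a strictly unbounded toric symplectic $4$-manifold with moment polytope $P$ and let $D=\sum_{i=1}^mD_i$ be a divisor on $X$ such that each $D_i$ is an irreducible prime divisor invariant under the torus action, corresponding to a bounded edge of $P$, and $D_i\cap D_j=\emptyset$ for $i\ne j$. Let $I$ be the set of indices of the edges of $P$ corresponding to the $D_i$. Assume $g$ is a toric scalar-flat Kähler metric on $X\setminus D$ whose symplectic potential $u$ is of $S_{\alpha,\beta}$ type along $D$ (for some constants $\alpha_k>0$, $\beta_k\in\mathbb R$, $k\in I$). Then $g=g_\nu$ for some $\nu\in\mathbb R^2$ with $\det(\nu,\nu_1)\ge0$ and $\det(\nu,\nu_d)\ge0$, where $g_\nu$ are the explicit toric scalar-flat Kähler metrics of Poincaré type defined in the context.
   Context: Notation: $\det(v,w)=v_1w_2-v_2w_1$. A toric symplectic $4$-manifold is a symplectic $4$-manifold $(X,\omega)$ with an effective Hamiltonian $\mathbb T^2$-action whose moment map is proper onto its image $P=\{x\in\mathbb R^2:\ell_i(x)=\langle x,\nu_i\rangle+\lambda_i\ge0,\ i=1,\dots,d\}$, where $\nu_i=(\alpha_i,\beta_i)\in\mathbb Z^2$ are primitive interior normals. Edges are ordered so that the edges $\ell_1=0$ and $\ell_d=0$ are unbounded, consecutive edges meet, and $\det(\nu_i,\nu_{i+1})=-1$ for $1\le i\le d-1$. $X$ is strictly unbounded if $P$ is unbounded with finitely many edges and its unbounded edges are not parallel. The index set $I=\{i_1<\dots<i_m\}$ satisfies $i_1>1$, $i_{j+1}>i_j+1$, $i_m<d$.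 A toric Kähler metric is, on $P^\circ$ with action-angle coordinates $(x,\theta)$, $\omega=\sum dx_i\wedge d\theta_i$, of the form $g=\sum_{i,j}(u_{ij}dx_idx_j+u^{ij}d\theta_id\theta_j)$, with symplectic potential $u$, $(u_{ij})=\mathrm{Hess}\,u>0$, $(u^{ij})=(u_{ij})^{-1}$; it is scalar-flat iff $\sum\partial^2u^{ij}/\partial x_i\partial x_j=0$. $u$ is of $S_{\alpha,\beta}$ type along $D$ if $u$ is smooth and strictly convex on $P^\circ$, its restriction to the interior of each edge of $P$ not indexed by $I$ is smooth and strictly convex, and $$u+\sum_{k\in I}(\alpha_k+\beta_k\ell_k)\log\ell_k-\tfrac12\sum_{i\notin I}\ell_i\log\ell_i$$ is smooth on $P$ (here the constants $\alpha_k>0,\beta_k\in\mathbb R$, $k\in I$, are not the components of $\nu_k$). The metrics $g_\nu$: translate $P$ so that $\lambda_1=0$. Let $a_1'<\dots<a_{d-1}'$ be the reals determined by $\sum_{i=1}^ja_i'\det(\nu_{i+1}-\nu_i,\nu_{j+1})=\lambda_{j+1}$, $1\le j\le d-1$; put $\Lambda_k=a_k'-a_{k-1}'$ for $k\in I$ and $a_j=a_j'-\sum_{k\in I,k\le j}\Lambda_k$. For $\nu=(\alpha,\beta)$ with $\det(\nu,\nu_1),\det(\nu,\nu_d)\ge0$, and $(H,r)\in\mathbb R\times(0,\infty)$, $H_i=H+a_i$, $\rho_i=\sqrt{H_i^2+r^2}$, set $$\xi_1=\alpha_1\log r+\tfrac12\sum_{i=1}^{d-1}(\alpha_{i+1}-\alpha_i)\log(H_i+\rho_i)-\tfrac12\sum_{k\in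 I}\frac{\Lambda_k\alpha_k}{\rho_{k-1}}+\alpha H,$$ $$\xi_2=\beta_1\log r+\tfrac12\sum_{i=1}^{d-1}(\beta_{i+1}-\beta_i)\log(H_i+\rho_i)-\tfrac12\sum_{k\in I}\frac{\Lambda_k\beta_k}{\rho_{k-1}}+\beta H,$$ where $\alpha_i,\beta_i$ are the components of $\nu_i$. Let $$x_1=\beta_1H+\tfrac12\sum_{i=1}^{d-1}(\beta_{i+1}-\beta_i)(H_i-\rho_i)-\tfrac12\sum_{k\in I}\Lambda_k\beta_k\Big(1-\frac{H_{k-1}}{\rho_{k-1}}\Big)-\tfrac{\beta}{2}r^2,$$ $$x_2=-\alpha_1H-\tfrac12\sum_{i=1}^{d-1}(\alpha_{i+1}-\alpha_i)(H_i-\rho_i)+\tfrac12\sum_{k\in I}\Lambda_k\alpha_k\Big(1-\frac{H_{k-1}}{\rho_{k-1}}\Big)+\tfrac{\alpha}{2}r^2.$$ Then $(H,r)\mapsto x$ is a diffeomorphism onto $P^\circ$ and $g_\nu$ is the toric metric with symplectic potential $u_\nu$ given (up to a constant) by $du_\nu=\xi_1dx_1+\xi_2dx_2$. *)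

theory Defs
  imports "HOL-Analysis.Analysis"
begin

section \<open>Smooth functions\<close>

definition dir_deriv :: "'a::real_normed_vector \<Rightarrow> ('a \<Rightarrow> real) \<Rightarrow> 'a \<Rightarrow> real" where
  "dir_deriv h f x = frechet_derivative f (at x) h"

text \<open>Only meant for open sets \<open>S\<close>: all iterated directional derivatives exist on \<open>S\<close> and
  are differentiable there.\<close>

definition smooth_fun :: "'a::real_normed_vector set \<Rightarrow> ('a \<Rightarrow> real) \<Rightarrow> bool" where
  "smooth_fun S f \<longleftrightarrow> (\<forall>hs. \<forall>x\<in>S. foldr dir_deriv hs f differentiable (at x))"

text \<open>Smoothness up to the boundary: extension to a smooth function on an open neighbourhood of
  \<open>P\<close>. The function itself need only be given on a subset \<open>A\<close> of \<open>P\<close>, dense in the application.\<close>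

definition extends_smoothly :: "'a::real_normed_vector set \<Rightarrow> 'a set \<Rightarrow> ('a \<Rightarrow> real) \<Rightarrow> bool" where
  "extends_smoothly A P f \<longleftrightarrow>
     (\<exists>W v. open W \<and> P \<subseteq> W \<and> smooth_fun W v \<and> (\<forall>x\<in>A. f x = v x))"

text \<open>Strict convexity of a smooth function is positive definiteness of its Hessian.\<close>

definition smooth_strictly_convex :: "'a::real_normed_vector set \<Rightarrow> ('a \<Rightarrow> real) \<Rightarrow> bool" where
  "smooth_strictly_convex S f \<longleftrightarrow>
     smooth_fun S f \<and> (\<forall>x\<in>S. \<forall>h. h \<noteq> 0 \<longrightarrow> dir_deriv h (dir_deriv h f) x > 0)"

section \<open>Moment polytopes\<close>

definition det2 :: "real^2 \<Rightarrow> real^2 \<Rightarrow> real" where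
  "det2 v w = v$1 * w$2 - v$2 * w$1"

definition real_vec :: "int^2 \<Rightarrow> real^2" where
  "real_vec v = (\<chi> i. real_of_int (v$i))"

text \<open>A moment polytope is given by the number \<open>d\<close> of edges, the interior normals \<open>\<nu> i\<close>
  and the constants \<open>lam i\<close>, for \<open>i = 1, \<dots>, d\<close>; values at other indices are irrelevant.\<close>

definition ell :: "(nat \<Rightarrow> int^2) \<Rightarrow> (nat \<Rightarrow> real) \<Rightarrow> nat \<Rightarrow> real^2 \<Rightarrow> real" where
  "ell \<nu> lam i x = x \<bullet> real_vec (\<nu> i) + lam i"

definition polytope_of :: "nat \<Rightarrow> (nat \<Rightarrow> int^2) \<Rightarrow> (nat \<Rightarrow> real) \<Rightarrow> (real^2) set" where
  "polytope_of d \<nu> lam = {x. \<forall>i\<in>{1..d}. ell \<nu> lam i x \<ge> 0}"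

definition edge :: "nat \<Rightarrow> (nat \<Rightarrow> int^2) \<Rightarrow> (nat \<Rightarrow> real) \<Rightarrow> nat \<Rightarrow> (real^2) set" where
  "edge d \<nu> lam i = {x \<in> polytope_of d \<nu> lam. ell \<nu> lam i x = 0}"

text \<open>The moment polytopes of strictly unbounded toric symplectic 4-manifolds, with their edges
  in the standard order. The condition \<open>edge_of\<close> says that no inequality is redundant.\<close>

definition strictly_unbounded :: "nat \<Rightarrow> (nat \<Rightarrow> int^2) \<Rightarrow> (nat \<Rightarrow> real) \<Rightarrow> bool" where
  "strictly_unbounded d \<nu> lam \<longleftrightarrow>
     2 \<le> d \<and>
     (\<forall>i\<in>{1..d}. coprime (\<nu> i $ 1) (\<nu> i $ 2)) \<and>
     (\<forall>i\<in>{1..d}. edge d \<nu> lam i edge_of polytope_of d \<nu> lam) \<and>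
     inj_on (edge d \<nu> lam) {1..d} \<and>
     (\<forall>i\<in>{1..<d}. edge d \<nu> lam i \<inter> edge d \<nu> lam (Suc i) \<noteq> {}) \<and>
     (\<forall>i\<in>{1..<d}. det2 (real_vec (\<nu> i)) (real_vec (\<nu> (Suc i))) = -1) \<and>
     \<not> bounded (edge d \<nu> lam 1) \<and> \<not> bounded (edge d \<nu> lam d) \<and>
     det2 (real_vec (\<nu> 1)) (real_vec (\<nu> d)) \<noteq> 0"

text \<open>The index set of a torus-invariant divisor \<open>D\<close> whose components correspond to bounded edges
  and are pairwise disjoint; a component is the preimage of its edge under the moment map.\<close>

definition divisor_indices :: "nat \<Rightarrow> (nat \<Rightarrow> int^2) \<Rightarrow> (nat \<Rightarrow> real) \<Rightarrow> nat set \<Rightarrow> bool" where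
  "divisor_indices d \<nu> lam I \<longleftrightarrow>
     I \<subseteq> {1..d} \<and> (\<forall>k\<in>I. bounded (edge d \<nu> lam k)) \<and>
     (\<forall>k\<in>I. \<forall>l\<in>I. k \<noteq> l \<longrightarrow> edge d \<nu> lam k \<inter> edge d \<nu> lam l = {})"

section \<open>Toric Kaehler metrics and symplectic potentials\<close>

definition partial_deriv :: "2 \<Rightarrow> (real^2 \<Rightarrow> real) \<Rightarrow> real^2 \<Rightarrow> real" where
  "partial_deriv i = dir_deriv (axis i 1)"

definition hessian :: "(real^2 \<Rightarrow> real) \<Rightarrow> real^2 \<Rightarrow> real^2^2" where
  "hessian u x = (\<chi> i j. partial_deriv i (partial_deriv j u) x)"

text \<open>Metric tensors on the open orbit in action-angle coordinates: the base point is \<open>(x, \<theta>)\<close>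
  and tangent vectors are \<open>(v, a)\<close>, meaning \<open>v\<close> in the \<open>x\<close>-directions and \<open>a\<close> in the
  \<open>\<theta>\<close>-directions. The angles range over the universal cover of the torus.\<close>

type_synonym metric_tensor =
  "(real^2) \<times> (real^2) \<Rightarrow> (real^2) \<times> (real^2) \<Rightarrow> (real^2) \<times> (real^2) \<Rightarrow> real"

definition toric_metric :: "(real^2 \<Rightarrow> real) \<Rightarrow> metric_tensor" where
  "toric_metric u = (\<lambda>(x, \<theta>) (v, a) (w, b).
     (\<Sum>i\<in>UNIV. \<Sum>j\<in>UNIV. hessian u x $ i $ j * v$i * w$j
        + matrix_inv (hessian u x) $ i $ j * a$i * b$j))"

definition is_toric_kaehler_metric ::
    "(real^2) set \<Rightarrow> metric_tensor \<Rightarrow> (real^2 \<Rightarrow> real) \<Rightarrow> bool" where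
  "is_toric_kaehler_metric P g u \<longleftrightarrow>
     smooth_strictly_convex (interior P) u \<and>
     (\<forall>x\<in>interior P. \<forall>\<theta>. g (x, \<theta>) = toric_metric u (x, \<theta>))"

definition scalar_flat :: "(real^2) set \<Rightarrow> (real^2 \<Rightarrow> real) \<Rightarrow> bool" where
  "scalar_flat P u \<longleftrightarrow>
     (\<forall>x\<in>interior P. (\<Sum>i\<in>UNIV. \<Sum>j\<in>UNIV.
        partial_deriv i (partial_deriv j (\<lambda>y. matrix_inv (hessian u y) $ i $ j)) x) = 0)"

definition edge_direction :: "(nat \<Rightarrow> int^2) \<Rightarrow> nat \<Rightarrow> real^2" where
  "edge_direction \<nu> i = vector [real_of_int (\<nu> i $ 2), - real_of_int (\<nu> i $ 1)]"

text \<open>Here \<open>u\<close> is a function on \<open>P\<close> minus the edges indexed by \<open>I\<close>, where it tends to infinity.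
  On the remaining edges the terms \<open>ell log ell\<close> vanish, as they should, because \<open>ln 0 = 0\<close>.
  The restriction of \<open>u\<close> to an open edge is expressed through affine parametrisations.\<close>

definition S_type :: "nat \<Rightarrow> (nat \<Rightarrow> int^2) \<Rightarrow> (nat \<Rightarrow> real) \<Rightarrow> nat set \<Rightarrow>
    (nat \<Rightarrow> real) \<Rightarrow> (nat \<Rightarrow> real) \<Rightarrow> (real^2 \<Rightarrow> real) \<Rightarrow> bool" where
  "S_type d \<nu> lam I \<alpha> \<beta> u \<longleftrightarrow>
     smooth_strictly_convex (interior (polytope_of d \<nu> lam)) u \<and>
     (\<forall>i\<in>{1..d} - I. \<forall>p \<in> edge d \<nu> lam i.
        smooth_strictly_convex
          {t. p + t *\<^sub>R edge_direction \<nu> i \<in> rel_interior (edge d \<nu> lam i)}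
          (\<lambda>t. u (p + t *\<^sub>R edge_direction \<nu> i))) \<and>
     extends_smoothly
       (polytope_of d \<nu> lam - (\<Union>k\<in>I. edge d \<nu> lam k)) (polytope_of d \<nu> lam)
       (\<lambda>x. u x + (\<Sum>k\<in>I. (\<alpha> k + \<beta> k * ell \<nu> lam k x) * ln (ell \<nu> lam k x))
              - 1/2 * (\<Sum>i\<in>{1..d} - I. ell \<nu> lam i x * ln (ell \<nu> lam i x)))"

section \<open>The metrics \<open>g_nu\<close>\<close>

text \<open>The formulas for \<open>g_nu\<close> are for polytopes with \<open>lam 1 = 0\<close>. We translate \<open>P\<close> by
  \<open>normal_shift\<close> to achieve this. Any other translation that does so differs from this one by a
  translation along the first edge, which amounts to a shift of \<open>H\<close> and changes the potential
  by an affine function only.\<close>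

definition normal_shift :: "(nat \<Rightarrow> int^2) \<Rightarrow> (nat \<Rightarrow> real) \<Rightarrow> real^2" where
  "normal_shift \<nu> lam =
     (lam 1 / (real_vec (\<nu> 1) \<bullet> real_vec (\<nu> 1))) *\<^sub>R real_vec (\<nu> 1)"

definition lam_shifted :: "(nat \<Rightarrow> int^2) \<Rightarrow> (nat \<Rightarrow> real) \<Rightarrow> nat \<Rightarrow> real" where
  "lam_shifted \<nu> lam i = lam i - normal_shift \<nu> lam \<bullet> real_vec (\<nu> i)"

text \<open>The system is triangular with unit diagonal, since
  \<open>det (\<nu> (j+1) - \<nu> j, \<nu> (j+1)) = - det (\<nu> j, \<nu> (j+1)) = 1\<close>, so it determines
  \<open>a' 1, \<dots>, a' (d-1)\<close>, the only values used.\<close>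

definition a_prime :: "nat \<Rightarrow> (nat \<Rightarrow> int^2) \<Rightarrow> (nat \<Rightarrow> real) \<Rightarrow> nat \<Rightarrow> real" where
  "a_prime d \<nu> lam = (SOME a'. \<forall>j\<in>{1..d-1}.
     (\<Sum>i=1..j. a' i * det2 (real_vec (\<nu> (i+1)) - real_vec (\<nu> i)) (real_vec (\<nu> (j+1))))
       = lam_shifted \<nu> lam (j+1))"

definition Lam :: "nat \<Rightarrow> (nat \<Rightarrow> int^2) \<Rightarrow> (nat \<Rightarrow> real) \<Rightarrow> nat \<Rightarrow> real" where
  "Lam d \<nu> lam k = a_prime d \<nu> lam k - a_prime d \<nu> lam (k-1)"

definition H_shift :: "nat \<Rightarrow> (nat \<Rightarrow> int^2) \<Rightarrow> (nat \<Rightarrow> real) \<Rightarrow> nat set \<Rightarrow> real \<Rightarrow> nat \<Rightarrow> real" where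
  "H_shift d \<nu> lam I H j =
     H + (a_prime d \<nu> lam j - (\<Sum>k\<in>{k\<in>I. k \<le> j}. Lam d \<nu> lam k))"

definition rho :: "nat \<Rightarrow> (nat \<Rightarrow> int^2) \<Rightarrow> (nat \<Rightarrow> real) \<Rightarrow> nat set \<Rightarrow> real \<Rightarrow> real \<Rightarrow> nat \<Rightarrow> real" where
  "rho d \<nu> lam I H r j = sqrt ((H_shift d \<nu> lam I H j)\<^sup>2 + r\<^sup>2)"

text \<open>The parameter vector \<open>\<nu> = (\<alpha>, \<beta>)\<close> of the family is called \<open>n\<close>.\<close>

definition xi :: "nat \<Rightarrow> (nat \<Rightarrow> int^2) \<Rightarrow> (nat \<Rightarrow> real) \<Rightarrow> nat set \<Rightarrow> real^2 \<Rightarrow>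
    real \<Rightarrow> real \<Rightarrow> real^2" where
  "xi d \<nu> lam I n H r = (\<chi> c.
     real_vec (\<nu> 1) $ c * ln r
     + 1/2 * (\<Sum>i=1..d-1. (real_vec (\<nu> (i+1)) $ c - real_vec (\<nu> i) $ c)
                * ln (H_shift d \<nu> lam I H i + rho d \<nu> lam I H r i))
     - 1/2 * (\<Sum>k\<in>I. Lam d \<nu> lam k * real_vec (\<nu> k) $ c / rho d \<nu> lam I H r (k-1))
     + n $ c * H)"

text \<open>The two coordinates of \<open>x\<close> have the same shape: with \<open>z c\<close> formed from the \<open>c\<close>-th
  components of the normals and of \<open>n\<close>, they are \<open>z 2\<close> and \<open>- z 1\<close>. Subtracting
  \<open>normal_shift\<close> undoes the translation of \<open>P\<close>.\<close>

definition x_chart :: "nat \<Rightarrow> (nat \<Rightarrow> int^2) \<Rightarrow> (nat \<Rightarrow> real) \<Rightarrow> nat set \<Rightarrow> real^2 \<Rightarrow>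
    real \<Rightarrow> real \<Rightarrow> real^2" where
  "x_chart d \<nu> lam I n H r =
     (let z = (\<lambda>c. real_vec (\<nu> 1) $ c * H
        + 1/2 * (\<Sum>i=1..d-1. (real_vec (\<nu> (i+1)) $ c - real_vec (\<nu> i) $ c)
                   * (H_shift d \<nu> lam I H i - rho d \<nu> lam I H r i))
        - 1/2 * (\<Sum>k\<in>I. Lam d \<nu> lam k * real_vec (\<nu> k) $ c
                   * (1 - H_shift d \<nu> lam I H (k-1) / rho d \<nu> lam I H r (k-1)))
        - n $ c / 2 * r\<^sup>2)
      in vector [z 2, - z 1] - normal_shift \<nu> lam)"

text \<open>A function \<open>u\<close> with \<open>du = xi1 dx1 + xi2 dx2\<close>. As \<open>x_chart\<close> is a diffeomorphism from the
  half-plane \<open>r > 0\<close> onto the interior of \<open>P\<close>, this fixes \<open>u\<close> there up to a constant.\<close>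

definition u_nu :: "nat \<Rightarrow> (nat \<Rightarrow> int^2) \<Rightarrow> (nat \<Rightarrow> real) \<Rightarrow> nat set \<Rightarrow> real^2 \<Rightarrow>
    real^2 \<Rightarrow> real" where
  "u_nu d \<nu> lam I n = (SOME u. \<forall>H r. r > 0 \<longrightarrow>
     (u has_derivative (\<lambda>h. xi d \<nu> lam I n H r \<bullet> h)) (at (x_chart d \<nu> lam I n H r)))"

definition g_nu :: "nat \<Rightarrow> (nat \<Rightarrow> int^2) \<Rightarrow> (nat \<Rightarrow> real) \<Rightarrow> nat set \<Rightarrow> real^2 \<Rightarrow>
    metric_tensor" where
  "g_nu d \<nu> lam I n = toric_metric (u_nu d \<nu> lam I n)"

end

theory Submission
  imports Defs
begin

text \<open>On the interior of the polygon let \<open>L\<close> be the second-order operator whose coefficient matrix is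
  the adjugate of \<open>Hess u\<close>. The potential \<open>u\<close> is scalar-flat iff \<open>L q = 0\<close> for \<open>q = 1 / det Hess u\<close>. Then
  \<open>q = r\<^sup>2\<close> has a conjugate function \<open>H\<close> such that \<open>(H, r)\<close> are isothermal coordinates, and affine functions
  of \<open>x\<close>, \<open>H\<close>, \<open>\<rho> = sqrt ((H + c)\<^sup>2 + r\<^sup>2)\<close> and \<open>(H + c) / \<rho>\<close> are all solutions of \<open>L s = 0\<close>. By the boundary
  conditions, \<open>q\<close> tends to 0 at the boundary, and \<open>H\<close> extends to it, with slope 1 along the edges not
  in \<open>I\<close> and slope 0 along those in \<open>I\<close>. Hence the difference \<open>y\<close> of \<open>x\<close> and the explicit map of
  \<open>(H, r)\<close> for the parameter 0 vanishes on the edges not in \<open>I\<close>. A maximum principle, with a barrier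
  that is infinite on the edges in \<open>I\<close>, gives that \<open>(H, r)\<close> is proper and that the products of \<open>y\<close> with
  the normals of the two unbounded edges are nonnegative.

  For almost all large \<open>R\<close>, the level set \<open>H\<^sup>2 + r\<^sup>2 = R\<^sup>2\<close> is mapped bijectively onto a half-circle. On these
  half-circles a solution that vanishes on the boundary expands into Gegenbauer polynomials, whose
  coefficients scale with different powers of \<open>R\<close>. If the solution is nonnegative, then only the lowest
  of them occurs, and the solution is a multiple of \<open>r\<^sup>2\<close>. So \<open>y\<close> is \<open>r\<^sup>2\<close> times a constant vector, which
  is the parameter of the metric: \<open>x\<close> is the explicit function of \<open>(H, r)\<close>, and \<open>du\<close> is obtained from it by
  conjugation.\<close>

section \<open>Calculus of smooth functions\<close>

text \<open>In the coordinates \<open>(H, r)\<close> the operator \<open>L\<close> becomes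
  \<open>S\<close> times \<open>d_H^2 + d_r^2 - (1/r) d_r\<close>, with \<open>S = Gam H H\<close>.
  But \<open>S\<close> may vanish and \<open>(H, r)\<close> may fail to be injective; that it is a
  chart comes out only at the very end, from the formula for \<open>x\<close>. So the analysis stays
  on the polygon, with solutions written through \<open>H\<close> and \<open>q\<close>, and
  half-circles are used only at radii that are regular for \<open>rh 0\<close>. Two more obstacles:
  convexity is assumed along the edges outside \<open>I\<close> only, so on an edge in
  \<open>I\<close> the nondegeneracy that lets \<open>q\<close> and \<open>H\<close> extend to the
  boundary has to be drawn from the equation itself; and as the polygon is unbounded, properness of
  \<open>(H, r)\<close> needs the topology of the plane besides the boundary values. An edge in
  \<open>I\<close> is collapsed to a single boundary point of the half-plane. So \<open>H\<close>
  skips its length \<open>Lam k\<close>, which turns \<open>a'\<close> into \<open>a\<close>, and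
  the terms \<open>1 / rho\<close> and \<open>(H + c) / rho\<close> centred at that point make up
  for it.\<close>

lemma smooth_fun_differentiable:
  "smooth_fun S f \<Longrightarrow> x \<in> S \<Longrightarrow> f differentiable (at x)"
  unfolding smooth_fun_def by (metis foldr.simps(1) id_apply)

lemma smooth_fun_dir_deriv: "smooth_fun S f \<Longrightarrow> smooth_fun S (dir_deriv h f)"
  unfolding smooth_fun_def
proof (intro allI ballI)
  fix hs x assume *: "\<forall>hs. \<forall>x\<in>S. foldr dir_deriv hs f differentiable at x" and "x \<in> S"
  then have "foldr dir_deriv (hs @ [h]) f differentiable at x" by blast
  then show "foldr dir_deriv hs (dir_deriv h f) differentiable at x" by simp
qed

lemma smooth_fun_subset: "smooth_fun S f \<Longrightarrow> T \<subseteq> S \<Longrightarrow> smooth_fun T f"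
  unfolding smooth_fun_def by blast

lemma dir_deriv_eqI: "(f has_derivative f') (at x) \<Longrightarrow> dir_deriv h f x = f' h"
  unfolding dir_deriv_def by (metis frechet_derivative_at)

lemma has_derivative_dir_deriv:
  "f differentiable (at x) \<Longrightarrow> (f has_derivative (\<lambda>h. dir_deriv h f x)) (at x)"
  unfolding dir_deriv_def using frechet_derivative_works by (metis eta_contract_eq)

lemma has_derivative_cong_open:
  fixes f g :: "'a::real_normed_vector \<Rightarrow> real"
  assumes "open S" "x \<in> S" "\<And>y. y \<in> S \<Longrightarrow> f y = g y"
  shows "(f has_derivative f') (at x) \<longleftrightarrow> (g has_derivative f') (at x)"
  using has_derivative_transform_within_open assms by metis

lemma dir_deriv_cong:
  fixes f g :: "'a::real_normed_vector \<Rightarrow> real"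
  assumes "open S" "x \<in> S" "\<And>y. y \<in> S \<Longrightarrow> f y = g y"
  shows "dir_deriv h f x = dir_deriv h g x"
proof -
  have "(f has_derivative f') (at x) \<longleftrightarrow> (g has_derivative f') (at x)" for f'
    by (rule has_derivative_cong_open[OF assms])
  then show ?thesis unfolding dir_deriv_def frechet_derivative_def by simp
qed

lemma differentiable_cong_open:
  fixes f g :: "'a::real_normed_vector \<Rightarrow> real"
  assumes "open S" "x \<in> S" "\<And>y. y \<in> S \<Longrightarrow> f y = g y"
  shows "f differentiable (at x) \<longleftrightarrow> g differentiable (at x)"
proof -
  have "(f has_derivative f') (at x) \<longleftrightarrow> (g has_derivative f') (at x)" for f'
    by (rule has_derivative_cong_open[OF assms])
  then show ?thesis unfolding differentiable_def by simp
qed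

lemma foldr_dir_deriv_cong:
  assumes "open S" "\<And>y. y \<in> S \<Longrightarrow> f y = g y" "x \<in> S"
  shows "foldr dir_deriv hs f x = foldr dir_deriv hs g x"
  using assms(3)
proof (induction hs arbitrary: x)
  case (Cons h hs)
  show ?case using dir_deriv_cong[OF assms(1) Cons.prems, of "foldr dir_deriv hs f" "foldr dir_deriv hs g"]
    Cons.IH by simp
qed (use assms in simp)

text \<open>Bounding the order makes the closure properties provable by induction: the derivative of
  a product, inverse or root involves only the functions themselves and their derivatives, all
  available to one order less.\<close>

definition smooth_upto :: "nat \<Rightarrow> 'a::real_normed_vector set \<Rightarrow> ('a \<Rightarrow> real) \<Rightarrow> bool" where
  "smooth_upto n S f \<longleftrightarrow> (\<forall>hs. length hs \<le> n \<longrightarrow> (\<forall>x\<in>S. foldr dir_deriv hs f differentiable (at x)))"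

lemma smooth_fun_iff_upto: "smooth_fun S f \<longleftrightarrow> (\<forall>n. smooth_upto n S f)"
  unfolding smooth_fun_def smooth_upto_def by blast

lemma smooth_upto_0: "smooth_upto 0 S f \<longleftrightarrow> (\<forall>x\<in>S. f differentiable (at x))"
  unfolding smooth_upto_def by auto

text \<open>\<open>foldr\<close> applies the last direction of a list first. So lists are split at
  their end, which turns derivatives of \<open>f\<close> into derivatives of its first
  derivatives.\<close>

lemma smooth_upto_Suc:
  "smooth_upto (Suc n) S f \<longleftrightarrow>
     (\<forall>x\<in>S. f differentiable (at x)) \<and> (\<forall>h. smooth_upto n S (dir_deriv h f))"
proof
  assume *: "smooth_upto (Suc n) S f"
  have "f differentiable (at x)" if "x \<in> S" for x
    using * that unfolding smooth_upto_def by (metis foldr.simps(1) id_apply le0 list.size(3))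
  moreover have "foldr dir_deriv hs (dir_deriv h f) differentiable (at x)"
    if "length hs \<le> n" "x \<in> S" for h hs x
  proof -
    have "foldr dir_deriv (hs @ [h]) f differentiable (at x)"
      using * that unfolding smooth_upto_def by (metis Suc_le_mono length_append_singleton)
    then show ?thesis by simp
  qed
  ultimately show "(\<forall>x\<in>S. f differentiable (at x)) \<and> (\<forall>h. smooth_upto n S (dir_deriv h f))"
    unfolding smooth_upto_def by blast
next
  assume *: "(\<forall>x\<in>S. f differentiable (at x)) \<and> (\<forall>h. smooth_upto n S (dir_deriv h f))"
  show "smooth_upto (Suc n) S f" unfolding smooth_upto_def
  proof (intro allI impI ballI)
    fix hs :: "'a list" and x assume "length hs \<le> Suc n" "x \<in> S"
    then show "foldr dir_deriv hs f differentiable (at x)"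
      using * unfolding smooth_upto_def by (cases hs rule: rev_cases) auto
  qed
qed

lemma smooth_upto_SucD: "smooth_upto (Suc n) S f \<Longrightarrow> smooth_upto n S f"
  unfolding smooth_upto_def by auto

lemma smooth_upto_differentiable:
  "smooth_upto n S f \<Longrightarrow> x \<in> S \<Longrightarrow> f differentiable (at x)"
  by (cases n) (auto simp: smooth_upto_0 smooth_upto_Suc)

lemma smooth_upto_cong:
  assumes "open S" "\<And>y. y \<in> S \<Longrightarrow> f y = g y"
  shows "smooth_upto n S f \<longleftrightarrow> smooth_upto n S g"
proof -
  have "foldr dir_deriv hs f differentiable (at x) \<longleftrightarrow> foldr dir_deriv hs g differentiable (at x)"
    if "x \<in> S" for hs x
    by (rule differentiable_cong_open[OF assms(1) that]) (rule foldr_dir_deriv_cong[OF assms])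
  then show ?thesis unfolding smooth_upto_def by simp
qed

section \<open>Differentiation rules and closure properties of smooth functions\<close>

lemma dir_deriv_const [simp]: "dir_deriv h (\<lambda>x. c) = (\<lambda>x. 0)"
  by (rule ext, rule dir_deriv_eqI) (rule has_derivative_const)

lemma dir_deriv_add:
  assumes "f differentiable (at x)" "g differentiable (at x)"
  shows "dir_deriv h (\<lambda>x. f x + g x) x = dir_deriv h f x + dir_deriv h g x"
  by (rule dir_deriv_eqI) (intro has_derivative_add has_derivative_dir_deriv assms)

lemma dir_deriv_mult:
  assumes "f differentiable (at x)" "g differentiable (at x)"
  shows "dir_deriv h (\<lambda>x. f x * g x) x = dir_deriv h f x * g x + f x * dir_deriv h g x"
  by (rule dir_deriv_eqI[THEN trans], rule has_derivative_mult)
     (auto intro: has_derivative_dir_deriv assms)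

lemma dir_deriv_cmult:
  assumes "f differentiable (at x)"
  shows "dir_deriv h (\<lambda>x. c * f x) x = c * dir_deriv h f x"
  using dir_deriv_mult[of "\<lambda>x. c" x f h] assms by simp

lemma dir_deriv_minus:
  assumes "f differentiable (at x)"
  shows "dir_deriv h (\<lambda>x. - f x) x = - dir_deriv h f x"
  using dir_deriv_cmult[of f x h "-1"] assms by simp

lemma dir_deriv_diff:
  assumes "f differentiable (at x)" "g differentiable (at x)"
  shows "dir_deriv h (\<lambda>x. f x - g x) x = dir_deriv h f x - dir_deriv h g x"
  by (rule dir_deriv_eqI) (intro has_derivative_diff has_derivative_dir_deriv assms)

lemma dir_deriv_affine [simp]:
  "dir_deriv h (\<lambda>x. x \<bullet> v + c) = (\<lambda>x. h \<bullet> v)" for v :: "'a::real_inner"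
proof (rule ext, rule dir_deriv_eqI)
  show "((\<lambda>x. x \<bullet> v + c) has_derivative (\<lambda>h. h \<bullet> v)) (at x)" for x
    by (auto intro!: derivative_eq_intros)
qed

lemma comp_differentiable:
  fixes f :: "'a::real_normed_vector \<Rightarrow> real"
  assumes "f differentiable (at x)" "(\<phi> has_real_derivative c) (at (f x))"
  shows "(\<lambda>x. \<phi> (f x)) differentiable (at x)" "dir_deriv h (\<lambda>x. \<phi> (f x)) x = c * dir_deriv h f x"
proof -
  have "((\<lambda>x. \<phi> (f x)) has_derivative (\<lambda>h. c * dir_deriv h f x)) (at x)"
    using has_derivative_compose[OF has_derivative_dir_deriv[OF assms(1)],
        of \<phi> "\<lambda>x. c * x"] assms(2)
    unfolding has_field_derivative_def by simp
  then show "(\<lambda>x. \<phi> (f x)) differentiable (at x)" "dir_deriv h (\<lambda>x. \<phi> (f x)) x = c * dir_deriv h f x"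
    by (auto simp: differentiable_def dir_deriv_eqI)
qed

lemma dir_deriv_linear:
  assumes "f differentiable (at x)"
  shows "linear (\<lambda>h. dir_deriv h f x)"
  using has_derivative_dir_deriv[OF assms] has_derivative_linear by blast

lemma dir_deriv_lincomb:
  assumes "f differentiable (at x)"
  shows "dir_deriv (a *\<^sub>R v + b *\<^sub>R w) f x = a * dir_deriv v f x + b * dir_deriv w f x"
  using linear_add[OF dir_deriv_linear[OF assms]] linear_scale[OF dir_deriv_linear[OF assms]] by simp

lemma smooth_upto_const: "smooth_upto n S (\<lambda>x. c)"
  by (induction n arbitrary: c) (auto simp: smooth_upto_0 smooth_upto_Suc)

lemma smooth_upto_add:
  assumes "open S"
  shows "smooth_upto n S f \<Longrightarrow> smooth_upto n S g \<Longrightarrow> smooth_upto n S (\<lambda>x. f x + g x)"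
proof (induction n arbitrary: f g)
  case (Suc n)
  then have d: "\<forall>x\<in>S. f differentiable (at x)" "\<forall>x\<in>S. g differentiable (at x)"
    by (auto simp: smooth_upto_Suc)
  have "smooth_upto n S (dir_deriv h (\<lambda>x. f x + g x))" for h
  proof -
    have "smooth_upto n S (\<lambda>x. dir_deriv h f x + dir_deriv h g x)"
      using Suc by (auto simp: smooth_upto_Suc)
    then show ?thesis
      by (subst smooth_upto_cong[OF assms]) (use d in \<open>auto simp: dir_deriv_add\<close>)
  qed
  with d show ?case by (auto simp: smooth_upto_Suc)
qed (auto simp: smooth_upto_0)

lemma smooth_upto_mult:
  assumes "open S"
  shows "smooth_upto n S f \<Longrightarrow> smooth_upto n S g \<Longrightarrow> smooth_upto n S (\<lambda>x. f x * g x)"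
proof (induction n arbitrary: f g)
  case (Suc n)
  then have d: "\<forall>x\<in>S. f differentiable (at x)" "\<forall>x\<in>S. g differentiable (at x)"
    by (auto simp: smooth_upto_Suc)
  have "smooth_upto n S (dir_deriv h (\<lambda>x. f x * g x))" for h
  proof -
    have "smooth_upto n S (\<lambda>x. dir_deriv h f x * g x + f x * dir_deriv h g x)"
      using Suc.prems smooth_upto_SucD[OF Suc.prems(1)] smooth_upto_SucD[OF Suc.prems(2)]
      by (intro smooth_upto_add[OF assms] Suc.IH) (auto simp: smooth_upto_Suc)
    then show ?thesis
      by (subst smooth_upto_cong[OF assms]) (use d in \<open>auto simp: dir_deriv_mult\<close>)
  qed
  with d show ?case by (auto simp: smooth_upto_Suc intro: differentiable_mult)
qed (auto simp: smooth_upto_0 intro: differentiable_mult)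

lemma smooth_upto_inverse:
  assumes "open S" "\<And>x. x \<in> S \<Longrightarrow> f x \<noteq> 0"
  shows "smooth_upto n S f \<Longrightarrow> smooth_upto n S (\<lambda>x. inverse (f x))"
proof (induction n)
  case 0
  then show ?case using assms by (auto simp: smooth_upto_0 intro!: differentiable_inverse)
next
  case (Suc n)
  then have d: "f differentiable (at x)" if "x \<in> S" for x
    using that by (auto simp: smooth_upto_Suc)
  have i: "smooth_upto n S (\<lambda>x. inverse (f x))" using Suc smooth_upto_SucD by blast
  have dd: "((\<lambda>y::real. inverse y) has_real_derivative (-1) * (inverse (f x) * inverse (f x))) (at (f x))" if "x \<in> S" for x
    using assms(2)[OF that] by (auto intro!: derivative_eq_intros simp: power2_eq_square)
  have "smooth_upto n S (dir_deriv h (\<lambda>x. inverse (f x)))" for h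
  proof -
    have "smooth_upto n S (\<lambda>x. (-1) * (inverse (f x) * inverse (f x)) * dir_deriv h f x)"
      using Suc(2) i by (intro smooth_upto_mult[OF assms(1)] smooth_upto_const) (auto simp: smooth_upto_Suc)
    then show ?thesis
      by (subst smooth_upto_cong[OF assms(1)]) (auto simp: comp_differentiable(2)[OF d dd])
  qed
  with comp_differentiable(1)[OF d dd] show ?case by (auto simp: smooth_upto_Suc)
qed

lemma smooth_upto_sqrt:
  assumes "open S" "\<And>x. x \<in> S \<Longrightarrow> f x > 0"
  shows "smooth_upto n S f \<Longrightarrow> smooth_upto n S (\<lambda>x. sqrt (f x))"
proof (induction n)
  case 0
  have "((\<lambda>y. sqrt y) has_real_derivative inverse (sqrt (f x)) / 2) (at (f x))" if "x \<in> S" for x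
    using assms(2)[OF that] by (rule DERIV_real_sqrt)
  from comp_differentiable(1)[where \<phi> = sqrt and f = f, OF _ this] show ?case using 0 by (auto simp: smooth_upto_0)
next
  case (Suc n)
  then have d: "f differentiable (at x)" if "x \<in> S" for x
    using that by (auto simp: smooth_upto_Suc)
  have i: "smooth_upto n S (\<lambda>x. inverse (sqrt (f x)))" 
    using Suc smooth_upto_SucD assms(2) by (intro smooth_upto_inverse[OF assms(1)]) force+
  have dd: "((\<lambda>y. sqrt y) has_real_derivative (1/2) * inverse (sqrt (f x))) (at (f x))" if "x \<in> S" for x
    using DERIV_real_sqrt[OF assms(2)[OF that]] by simp
  have "smooth_upto n S (dir_deriv h (\<lambda>x. sqrt (f x)))" for h
  proof -
    have "smooth_upto n S (\<lambda>x. (1/2) * inverse (sqrt (f x)) * dir_deriv h f x)"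
      using Suc(2) i by (intro smooth_upto_mult[OF assms(1)] smooth_upto_const) (auto simp: smooth_upto_Suc)
    then show ?thesis
      by (subst smooth_upto_cong[OF assms(1)]) (auto simp: comp_differentiable(2)[OF d dd])
  qed
  with comp_differentiable(1)[OF d dd] show ?case by (auto simp: smooth_upto_Suc)
qed

lemma smooth_upto_ln:
  assumes "open S" "\<And>x. x \<in> S \<Longrightarrow> f x > 0" "smooth_upto n S f"
  shows "smooth_upto n S (\<lambda>x. ln (f x))"
proof -
  have dd: "(ln has_real_derivative inverse (f x)) (at (f x))" if "x \<in> S" for x
    using assms(2)[OF that] by (rule DERIV_ln)
  have d: "f differentiable (at x)" if "x \<in> S" for x using assms that smooth_upto_differentiable by blast
  show ?thesis
  proof (cases n)
    case 0 then show ?thesis using comp_differentiable(1)[OF d dd] by (auto simp: smooth_upto_0)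
  next
    case (Suc m)
    have "smooth_upto m S (dir_deriv h (\<lambda>x. ln (f x)))" for h
    proof -
      have "smooth_upto m S (\<lambda>x. inverse (f x) * dir_deriv h f x)"
        using assms(2) assms(3)[unfolded Suc] smooth_upto_SucD[OF assms(3)[unfolded Suc]]
        by (intro smooth_upto_mult[OF assms(1)] smooth_upto_inverse[OF assms(1)]) (auto simp: smooth_upto_Suc less_imp_neq[symmetric])
      then show ?thesis
        by (subst smooth_upto_cong[OF assms(1)]) (auto simp: comp_differentiable(2)[OF d dd])
    qed
    with comp_differentiable(1)[OF d dd] show ?thesis by (auto simp: smooth_upto_Suc Suc)
  qed
qed

lemma smooth_fun_const: "smooth_fun S (\<lambda>x. c)"
  by (simp add: smooth_fun_iff_upto smooth_upto_const)

lemma smooth_fun_add: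
  "open S \<Longrightarrow> smooth_fun S f \<Longrightarrow> smooth_fun S g \<Longrightarrow> smooth_fun S (\<lambda>x. f x + g x)"
  by (simp add: smooth_fun_iff_upto smooth_upto_add)

lemma smooth_fun_mult:
  "open S \<Longrightarrow> smooth_fun S f \<Longrightarrow> smooth_fun S g \<Longrightarrow> smooth_fun S (\<lambda>x. f x * g x)"
  by (simp add: smooth_fun_iff_upto smooth_upto_mult)

lemma smooth_fun_minus:
  "open S \<Longrightarrow> smooth_fun S f \<Longrightarrow> smooth_fun S (\<lambda>x. - f x)"
  using smooth_fun_mult[of S "\<lambda>x. -1" f] by (simp add: smooth_fun_const)

lemma smooth_fun_diff:
  "open S \<Longrightarrow> smooth_fun S f \<Longrightarrow> smooth_fun S g \<Longrightarrow> smooth_fun S (\<lambda>x. f x - g x)"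
  using smooth_fun_add[of S f "\<lambda>x. - g x"] by (simp add: smooth_fun_minus)

lemma smooth_fun_inverse:
  "open S \<Longrightarrow> smooth_fun S f \<Longrightarrow> (\<And>x. x \<in> S \<Longrightarrow> f x \<noteq> 0) \<Longrightarrow> smooth_fun S (\<lambda>x. inverse (f x))"
  by (simp add: smooth_fun_iff_upto smooth_upto_inverse)

lemma smooth_fun_divide:
  "open S \<Longrightarrow> smooth_fun S f \<Longrightarrow> smooth_fun S g \<Longrightarrow> (\<And>x. x \<in> S \<Longrightarrow> g x \<noteq> 0) \<Longrightarrow> smooth_fun S (\<lambda>x. f x / g x)"
  unfolding divide_inverse by (intro smooth_fun_mult smooth_fun_inverse)

lemma smooth_fun_sqrt:
  "open S \<Longrightarrow> smooth_fun S f \<Longrightarrow> (\<And>x. x \<in> S \<Longrightarrow> f x > 0) \<Longrightarrow> smooth_fun S (\<lambda>x. sqrt (f x))"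
  by (simp add: smooth_fun_iff_upto smooth_upto_sqrt)

lemma smooth_fun_ln:
  "open S \<Longrightarrow> smooth_fun S f \<Longrightarrow> (\<And>x. x \<in> S \<Longrightarrow> f x > 0) \<Longrightarrow> smooth_fun S (\<lambda>x. ln (f x))"
  by (simp add: smooth_fun_iff_upto smooth_upto_ln)

lemma smooth_fun_power:
  "open S \<Longrightarrow> smooth_fun S f \<Longrightarrow> smooth_fun S (\<lambda>x. f x ^ n)"
  by (induction n) (auto intro: smooth_fun_const smooth_fun_mult)

lemma smooth_fun_sum:
  "open S \<Longrightarrow> (\<And>i. i \<in> A \<Longrightarrow> smooth_fun S (f i)) \<Longrightarrow> smooth_fun S (\<lambda>x. \<Sum>i\<in>A. f i x)"
  by (induction A rule: infinite_finite_induct) (auto intro: smooth_fun_const smooth_fun_add)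

lemma smooth_fun_affine: "smooth_fun S (\<lambda>x. x \<bullet> v + c)" for v :: "'a::real_inner"
proof -
  have "smooth_upto n S (\<lambda>x. x \<bullet> v + c)" for n
    by (cases n) (auto simp: smooth_upto_0 smooth_upto_Suc intro: smooth_upto_const differentiable_add differentiable_inner)
  then show ?thesis by (simp add: smooth_fun_iff_upto)
qed

lemmas smooth_intros = smooth_fun_const smooth_fun_affine smooth_fun_add smooth_fun_mult smooth_fun_minus
  smooth_fun_diff smooth_fun_inverse smooth_fun_divide smooth_fun_sqrt smooth_fun_ln smooth_fun_power
  smooth_fun_sum smooth_fun_dir_deriv

lemma smooth_fun_continuous_on: "smooth_fun S f \<Longrightarrow> continuous_on S f"
  by (meson continuous_at_imp_continuous_on differentiable_imp_continuous_within smooth_fun_differentiable)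

section \<open>Restriction to lines, and symmetry of second derivatives\<close>

lemma DERIV_along_line:
  assumes "f differentiable (at (x + t *\<^sub>R h))"
  shows "((\<lambda>t. f (x + t *\<^sub>R h)) has_real_derivative dir_deriv h f (x + t *\<^sub>R h)) (at t)"
proof -
  have "((\<lambda>t. x + t *\<^sub>R h) has_derivative (\<lambda>s. s *\<^sub>R h)) (at t)"
    by (auto intro!: derivative_eq_intros)
  from has_derivative_compose[OF this has_derivative_dir_deriv[OF assms]]
  have "((\<lambda>t. f (x + t *\<^sub>R h)) has_derivative (\<lambda>s. dir_deriv (s *\<^sub>R h) f (x + t *\<^sub>R h))) (at t)" .
  moreover have "dir_deriv (s *\<^sub>R h) f (x + t *\<^sub>R h) = dir_deriv h f (x + t *\<^sub>R h) * s" for s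
    using linear_scale[OF dir_deriv_linear[OF assms]] by (simp add: mult.commute)
  ultimately show ?thesis unfolding has_field_derivative_def by (simp add: fun_eq_iff)
qed

text \<open>Otherwise the derivative along the line, which is zero at the maximum, would be positive
  just after it, and \<open>f\<close> would increase beyond its maximum.\<close>

lemma second_derivative_local_max:
  assumes "open S" "smooth_fun S f" "x \<in> S" "\<And>y. y \<in> S \<Longrightarrow> f y \<le> f x"
  shows "dir_deriv h (dir_deriv h f) x \<le> 0"
proof (rule ccontr)
  assume "\<not> ?thesis"
  then have pos: "dir_deriv h (dir_deriv h f) x > 0" by simp
  have "open ((\<lambda>t. x + t *\<^sub>R h) -` S)"
    by (intro open_vimage assms) (auto intro!: continuous_intros)
  moreover have "0 \<in> (\<lambda>t. x + t *\<^sub>R h) -` S" using assms by simp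
  ultimately obtain e where e: "e > 0" "ball 0 e \<subseteq> (\<lambda>t. x + t *\<^sub>R h) -` S"
    using open_contains_ball by blast
  have inS: "x + t *\<^sub>R h \<in> S" if "\<bar>t\<bar> < e" for t
    using e(2) that by auto
  have d1: "((\<lambda>t. f (x + t *\<^sub>R h)) has_real_derivative dir_deriv h f (x + t *\<^sub>R h)) (at t)" if "\<bar>t\<bar> < e" for t
    by (intro DERIV_along_line smooth_fun_differentiable[OF assms(2)] inS that)
  have d2: "((\<lambda>t. dir_deriv h f (x + t *\<^sub>R h)) has_real_derivative dir_deriv h (dir_deriv h f) x) (at 0)"
    using DERIV_along_line[of "dir_deriv h f" x 0 h] smooth_fun_differentiable[OF smooth_fun_dir_deriv[OF assms(2)]] assms(3)
    by simp
  have z: "dir_deriv h f (x + 0 *\<^sub>R h) = 0"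
  proof (rule DERIV_local_max[OF d1[of 0] e(1)])
    show "\<forall>y. \<bar>0 - y\<bar> < e \<longrightarrow> f (x + y *\<^sub>R h) \<le> f (x + 0 *\<^sub>R h)"
      using assms(4) inS by simp
  qed (use e in auto)
  obtain d where d: "d > 0" "\<And>t. 0 < t \<Longrightarrow> t < d \<Longrightarrow> dir_deriv h f (x + t *\<^sub>R h) > 0"
    using DERIV_pos_inc_right[OF d2 pos] z by fastforce
  define t where "t = min d e / 2"
  have t: "0 < t" "t < d" "t < e" using d e by (auto simp: t_def)
  have "f (x + 0 *\<^sub>R h) < f (x + t *\<^sub>R h)"
  proof (rule DERIV_pos_imp_increasing_open[OF t(1)])
    fix s assume "0 < s" "s < t"
    then show "\<exists>y. DERIV (\<lambda>t. f (x + t *\<^sub>R h)) s :> y \<and> 0 < y"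
      using d1[of s] d(2)[of s] t by (intro exI[of _ "dir_deriv h f (x + s *\<^sub>R h)"] conjI) auto
  next
    have "isCont (\<lambda>t. f (x + t *\<^sub>R h)) s" if "s \<in> {0..t}" for s
      by (rule DERIV_isCont[OF d1]) (use that t in auto)
    then show "continuous_on {0..t} (\<lambda>t. f (x + t *\<^sub>R h))"
      by (intro continuous_at_imp_continuous_on) blast
  qed
  then show False using assms(4)[OF inS[of t]] t by simp
qed

text \<open>The difference \<open>f (z s t) - f (z (-r) t)\<close> is the integral of the
  \<open>a\<close>-derivative. Differentiating it in \<open>t\<close> under the integral sign and
  then in \<open>s\<close> by the fundamental theorem produces both orders of
  differentiation.\<close>

lemma dir_deriv_commute:
  fixes f :: "'a::real_normed_vector \<Rightarrow> real"
  assumes S: "open S" and f: "smooth_fun S f" and x: "x \<in> S"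
  shows "dir_deriv a (dir_deriv b f) x = dir_deriv b (dir_deriv a f) x"
proof -
  define z where "z s t = x + s *\<^sub>R a + t *\<^sub>R b" for s t :: real
  have zc: "continuous_on T (\<lambda>y. z (fst y) (snd y))" for T unfolding z_def by (intro continuous_intros)
  have "open ((\<lambda>y. z (fst y) (snd y)) -` S)" by (rule open_vimage[OF S zc])
  moreover have "(0, 0) \<in> (\<lambda>y. z (fst y) (snd y)) -` S" using x by (simp add: z_def)
  ultimately obtain A B where AB: "open A" "open B" "0 \<in> A" "0 \<in> B" "A \<times> B \<subseteq> (\<lambda>y. z (fst y) (snd y)) -` S"
    by (rule open_prod_elim) auto
  then have "open (A \<inter> B)" "0 \<in> A \<inter> B" by auto
  then obtain r where r: "r > 0" "cball 0 r \<subseteq> A \<inter> B" using open_contains_cball by blast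
  define U where "U = {-r..r}"
  have U: "cball 0 r = U" "0 \<in> interior U" "0 \<in> U" using r(1) by (auto simp: U_def cball_eq_atLeastAtMost)
  have zS: "z s t \<in> S" if "s \<in> U" "t \<in> U" for s t using AB(5) r(2) that unfolding U(1) by fastforce
  have za: "((\<lambda>s. g (z s t)) has_real_derivative dir_deriv a g (z s t)) (at s)" 
    and zb: "((\<lambda>t. g (z s t)) has_real_derivative dir_deriv b g (z s t)) (at t)" if "smooth_fun S g" "s \<in> U" "t \<in> U" for g s t
    using DERIV_along_line[of g "x + t *\<^sub>R b" s a] DERIV_along_line[of g "x + s *\<^sub>R a" t b] smooth_fun_differentiable[OF that(1) zS[OF that(2,3)]]
    by (simp_all add: z_def algebra_simps)
  let ?D = "\<lambda>s. dir_deriv b (dir_deriv a f) (z s 0)"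
  have sm: "smooth_fun S (dir_deriv a f)" "smooth_fun S (dir_deriv b (dir_deriv a f))" "smooth_fun S (dir_deriv b f)"
    by (intro smooth_fun_dir_deriv f)+
  have cont: "continuous_on T (\<lambda>y. g (z (fst y) (snd y)))" if "smooth_fun S g" "T \<subseteq> U \<times> U" for g T
    by (rule continuous_on_compose2[OF smooth_fun_continuous_on[OF that(1)] zc]) (use that(2) zS in auto)
  have cont1: "continuous_on {-r..s} (\<lambda>s. g (z s t))" if "smooth_fun S g" "s \<in> U" "t \<in> U" for g s t
    by (intro continuous_at_imp_continuous_on ballI DERIV_isCont[OF za[OF that(1)]]) (use that in \<open>auto simp: U_def\<close>)
  have I: "integral {-r..s} ?D = dir_deriv b f (z s 0) - dir_deriv b f (z (-r) 0)" if s: "s \<in> U" for s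
  proof -
    have L: "((\<lambda>t. integral (cbox (-r) s) (\<lambda>s. dir_deriv a f (z s t))) has_field_derivative integral (cbox (-r) s) ?D) (at 0 within U)"
    proof (rule leibniz_rule_field_derivative)
      show "((\<lambda>t. dir_deriv a f (z s' t)) has_field_derivative dir_deriv b (dir_deriv a f) (z s' t)) (at t within U)"
        if "t \<in> U" "s' \<in> cbox (-r) s" for s' t
        by (rule has_field_derivative_at_within[OF zb[OF sm(1)]]) (use that s in \<open>auto simp: U_def\<close>)
      show "(\<lambda>s. dir_deriv a f (z s t)) integrable_on cbox (-r) s" if "t \<in> U" for t
        by (simp add: integrable_continuous_real cont1[OF sm(1) s that])
      show "continuous_on (U \<times> cbox (-r) s) (\<lambda>(t, s). dir_deriv b (dir_deriv a f) (z s t))"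
        unfolding split_beta
        by (rule continuous_on_compose2[OF smooth_fun_continuous_on[OF sm(2)]]) (use s zS in \<open>auto simp: z_def U_def intro!: continuous_intros\<close>)
    qed (use r in \<open>auto simp: U_def\<close>)
    have E: "integral (cbox (-r) s) (\<lambda>s. dir_deriv a f (z s t)) = f (z s t) - f (z (-r) t)" if t: "t \<in> U" for t
    proof -
      have "((\<lambda>s. dir_deriv a f (z s t)) has_integral f (z s t) - f (z (-r) t)) {-r..s}"
      proof (rule fundamental_theorem_of_calculus)
        fix s' assume "s' \<in> {-r..s}"
        then have s': "s' \<in> U" using s by (simp add: U_def)
        show "((\<lambda>s. f (z s t)) has_vector_derivative dir_deriv a f (z s' t)) (at s' within {-r..s})"
          unfolding has_real_derivative_iff_has_vector_derivative[symmetric]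
          by (rule has_field_derivative_at_within[OF za[OF f s' t]])
      qed (use s in \<open>simp add: U_def\<close>)
      then show ?thesis by (simp add: integral_unique)
    qed
    have "((\<lambda>t. f (z s t) - f (z (-r) t)) has_field_derivative integral (cbox (-r) s) ?D) (at 0 within U)"
      by (rule has_field_derivative_transform_within[OF L zero_less_one U(3) E])
    then have "((\<lambda>t. f (z s t) - f (z (-r) t)) has_field_derivative integral (cbox (-r) s) ?D) (at 0)"
      by (simp add: at_within_interior[OF U(2)])
    moreover have "((\<lambda>t. f (z s t) - f (z (-r) t)) has_field_derivative dir_deriv b f (z s 0) - dir_deriv b f (z (-r) 0)) (at 0)"
      by (rule DERIV_diff[OF zb[OF f] zb[OF f]]) (use s r in \<open>auto simp: U_def\<close>)
    ultimately show ?thesis using DERIV_unique by fastforce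
  qed
  have L: "((\<lambda>s. integral {-r..s} ?D) has_real_derivative ?D 0) (at 0 within U)"
    unfolding U_def by (rule integral_has_real_derivative) (use r cont1[OF sm(2), of r 0] in \<open>auto simp: U_def\<close>)
  have "((\<lambda>s. dir_deriv b f (z s 0) - dir_deriv b f (z (-r) 0)) has_real_derivative ?D 0) (at 0 within U)"
    by (rule has_field_derivative_transform_within[OF L zero_less_one U(3) I])
  then have "((\<lambda>s. dir_deriv b f (z s 0) - dir_deriv b f (z (-r) 0)) has_real_derivative ?D 0) (at 0)"
    by (simp add: at_within_interior[OF U(2)])
  moreover have "((\<lambda>s. dir_deriv b f (z s 0) - dir_deriv b f (z (-r) 0)) has_real_derivative dir_deriv a (dir_deriv b f) (z 0 0) - 0) (at 0)"
    by (rule DERIV_diff[OF za[OF sm(3)] DERIV_const]) (use r in \<open>auto simp: U_def\<close>)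
  ultimately have "?D 0 = dir_deriv a (dir_deriv b f) (z 0 0) - 0" by (rule DERIV_unique)
  then show ?thesis by (simp add: z_def)
qed

section \<open>The conformal structure of a scalar-flat toric metric\<close>

abbreviation E1 :: "real^2" where "E1 \<equiv> axis 1 1"
abbreviation E2 :: "real^2" where "E2 \<equiv> axis 2 1"

lemma vec2_eq: "h = h$1 *\<^sub>R E1 + h$2 *\<^sub>R E2" for h :: "real^2"
  by (simp add: vec_eq_iff forall_2 axis_def)

lemma inner_vec2: "x \<bullet> y = x$1 * y$1 + x$2 * y$2" for x y :: "real^2"
  by (simp add: inner_vec_def sum_2)

lemma dir_deriv_vec2:
  fixes h :: "real^2"
  assumes "f differentiable (at x)"
  shows "dir_deriv h f x = h$1 * dir_deriv E1 f x + h$2 * dir_deriv E2 f x"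
  by (subst vec2_eq[of h], subst dir_deriv_lincomb[OF assms]) simp

lemma smooth_fun_has_derivative:
  assumes "open S" "\<And>x. x \<in> S \<Longrightarrow> (H has_derivative F x) (at x)" "\<And>h. smooth_fun S (\<lambda>x. F x h)"
  shows "smooth_fun S H"
proof -
  have "smooth_upto n S H" for n
  proof (cases n)
    case 0 then show ?thesis using assms(2) by (auto simp: smooth_upto_0 differentiable_def)
  next
    case (Suc m)
    have "smooth_upto m S (dir_deriv h H)" for h
      by (subst smooth_upto_cong[OF assms(1), where g = "\<lambda>x. F x h"])
         (use assms(3) in \<open>auto simp: smooth_fun_iff_upto intro: dir_deriv_eqI assms(2)\<close>)
    then show ?thesis using assms(2) by (auto simp: Suc smooth_upto_Suc differentiable_def)
  qed
  then show ?thesis by (simp add: smooth_fun_iff_upto)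
qed

text \<open>Poincare lemma on a convex set: the form is integrated along segments from a base point
  \<open>p\<close>. By closedness the \<open>x\<close>-derivative of the integrand has components
  \<open>a F1\<close> and \<open>a F2\<close>, and \<open>a G x t\<close> is the
  \<open>t\<close>-derivative of \<open>t * G (z x t)\<close>, so that integration returns
  \<open>F1\<close> and \<open>F2\<close>.\<close>

lemma closed_form_potential:
  fixes F1 F2 :: "real^2 \<Rightarrow> real"
  assumes S: "open S" "convex S" and F: "smooth_fun S F1" "smooth_fun S F2"
    and closed: "\<And>x. x \<in> S \<Longrightarrow> dir_deriv E2 F1 x = dir_deriv E1 F2 x"
  obtains H where "\<And>x. x \<in> S \<Longrightarrow> (H has_derivative (\<lambda>h. F1 x * h$1 + F2 x * h$2)) (at x)"
proof (cases "S = {}")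
  case False
  then obtain p where p: "p \<in> S" by blast
  define z where "z x t = p + t *\<^sub>R (x - p)" for x t
  have z: "z x t \<in> S" if "x \<in> S" "t \<in> {0..1}" for x t
    using convexD_alt[OF S(2) p that(1), of t] that by (simp add: z_def algebra_simps)
  define a where "a G x t = G (z x t) + t * dir_deriv (x - p) G (z x t)" for G x t
  define pr where "pr i = Blinfun (\<lambda>h::real^2. h$i)" for i
  have pr: "blinfun_apply (pr i) h = h$i" for i h
    unfolding pr_def by (simp add: bounded_linear_Blinfun_apply bounded_linear_vec_nth)
  define f where "f x t = F1 (z x t) * (x - p)$1 + F2 (z x t) * (x - p)$2" for x t
  define f' where "f' x t = a F1 x t *\<^sub>R pr 1 + a F2 x t *\<^sub>R pr 2" for x t
  have zc: "continuous_on T (\<lambda>y. z (fst y) (snd y))" "continuous_on T' (z x)" for T T' x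
    unfolding z_def by (intro continuous_intros)+
  have ac: "continuous_on (S \<times> {0..1}) (\<lambda>y. a G (fst y) (snd y))" if G: "smooth_fun S G" for G
  proof -
    have c: "continuous_on (S \<times> {0..1}) (\<lambda>y. g (z (fst y) (snd y)))" if "smooth_fun S g" for g
      by (rule continuous_on_compose2[OF smooth_fun_continuous_on[OF that] zc(1)]) (auto intro: z)
    have "continuous_on (S \<times> {0..1}) (\<lambda>y. G (z (fst y) (snd y)) + snd y *
        ((fst y - p)$1 * dir_deriv E1 G (z (fst y) (snd y)) + (fst y - p)$2 * dir_deriv E2 G (z (fst y) (snd y))))"
      by (intro continuous_intros c G smooth_fun_dir_deriv)
    then show ?thesis
      by (rule continuous_on_eq) (auto simp: a_def z smooth_fun_differentiable[OF G] dir_deriv_vec2[of _ _ "_ - p"])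
  qed
  have aI: "(a G x has_integral G x) {0..1}" if G: "smooth_fun S G" and x: "x \<in> S" for G x
  proof -
    have "(a G x has_integral (1 * G (z x 1) - 0 * G (z x 0))) {0..1}"
    proof (rule fundamental_theorem_of_calculus)
      fix t :: real assume t: "t \<in> {0..1}"
      have "((\<lambda>t. t * G (z x t)) has_real_derivative 1 * G (z x t) + dir_deriv (x - p) G (z x t) * t) (at t)"
        unfolding z_def by (intro DERIV_mult DERIV_ident DERIV_along_line smooth_fun_differentiable[OF G] z[OF x t, unfolded z_def])
      then show "((\<lambda>t. t * G (z x t)) has_vector_derivative a G x t) (at t within {0..1})"
        by (simp add: a_def mult.commute has_real_derivative_iff_has_vector_derivative has_vector_derivative_at_within)
    qed simp
    then show ?thesis by (simp add: z_def)
  qed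
  have der: "((\<lambda>x. f x t) has_derivative blinfun_apply (f' x t)) (at x within S)" if x: "x \<in> S" and t: "t \<in> {0..1}" for x t
  proof -
    note zS = z[OF x t]
    note d = smooth_fun_differentiable[OF F(1) zS] smooth_fun_differentiable[OF F(2) zS]
    have dz: "((\<lambda>x. z x t) has_derivative (\<lambda>h. t *\<^sub>R h)) (at x)" unfolding z_def by (auto intro!: derivative_eq_intros)
    have dc: "((\<lambda>x. (x - p)$i) has_derivative (\<lambda>h. h$i)) (at x)" for i
      by (auto intro!: derivative_eq_intros bounded_linear_imp_has_derivative[OF bounded_linear_vec_nth])
    note der = has_derivative_add[OF has_derivative_mult[OF has_derivative_compose[OF dz has_derivative_dir_deriv[OF d(1)]] dc[of 1]]
        has_derivative_mult[OF has_derivative_compose[OF dz has_derivative_dir_deriv[OF d(2)]] dc[of 2]]]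
    have "F1 (z x t) * h$1 + dir_deriv (t *\<^sub>R h) F1 (z x t) * (x - p)$1 + (F2 (z x t) * h$2 + dir_deriv (t *\<^sub>R h) F2 (z x t) * (x - p)$2)
        = blinfun_apply (f' x t) h" for h
      unfolding f'_def blinfun.add_left blinfun.scaleR_left pr a_def dir_deriv_vec2[OF d(1), of "t *\<^sub>R h"] dir_deriv_vec2[OF d(2), of "t *\<^sub>R h"]
        dir_deriv_vec2[OF d(1), of "x - p"] dir_deriv_vec2[OF d(2), of "x - p"] closed[OF zS]
      by (simp add: algebra_simps)
    then show ?thesis using der unfolding f_def by (simp add: has_derivative_at_withinI)
  qed
  show ?thesis
  proof (rule that[of "\<lambda>x. integral (cbox 0 1) (f x)"])
    fix x assume x: "x \<in> S"
    have "((\<lambda>x. integral (cbox 0 1) (f x)) has_derivative blinfun_apply (integral (cbox 0 1) (f' x))) (at x within S)"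
    proof (rule leibniz_rule[OF _ _ _ x S(2)])
      show "f y integrable_on cbox 0 1" if "y \<in> S" for y
        unfolding f_def using that
        by (intro integrable_continuous continuous_intros continuous_on_compose2[OF smooth_fun_continuous_on[OF F(1)] zc(2)]
            continuous_on_compose2[OF smooth_fun_continuous_on[OF F(2)] zc(2)]) (auto intro: z)
      show "continuous_on (S \<times> cbox 0 1) (\<lambda>(x, t). f' x t)"
        unfolding f'_def split_beta using ac[OF F(1)] ac[OF F(2)] by (auto intro!: continuous_intros)
    qed (use der in simp)
    moreover have "integral (cbox 0 1) (f' x) = F1 x *\<^sub>R pr 1 + F2 x *\<^sub>R pr 2"
      unfolding f'_def using aI[OF F(1) x] aI[OF F(2) x] by (intro integral_unique has_integral_add has_integral_scaleR_left) simp_all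
    moreover have "blinfun_apply (F1 x *\<^sub>R pr 1 + F2 x *\<^sub>R pr 2) = (\<lambda>h. F1 x * h$1 + F2 x * h$2)"
      by (simp add: fun_eq_iff pr blinfun.add_left blinfun.scaleR_left)
    ultimately show "((\<lambda>x. integral (cbox 0 1) (f x)) has_derivative (\<lambda>h. F1 x * h$1 + F2 x * h$2)) (at x)"
      using at_within_open[OF x S(1)] by simp
  qed
qed (use that in auto)

lemma dir_deriv_mult2:
  assumes S: "open S" and f: "smooth_fun S f" and g: "smooth_fun S g" and x: "x \<in> S"
  shows "dir_deriv a (dir_deriv b (\<lambda>x. f x * g x)) x =
    dir_deriv a (dir_deriv b f) x * g x + dir_deriv b f x * dir_deriv a g x
    + dir_deriv a f x * dir_deriv b g x + f x * dir_deriv a (dir_deriv b g) x"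
proof -
  have d: "smooth_fun S h \<Longrightarrow> h differentiable (at x)" for h using x smooth_fun_differentiable by blast
  have "dir_deriv a (dir_deriv b (\<lambda>x. f x * g x)) x = dir_deriv a (\<lambda>x. dir_deriv b f x * g x + f x * dir_deriv b g x) x"
    by (rule dir_deriv_cong[OF S x]) (intro dir_deriv_mult smooth_fun_differentiable[OF f] smooth_fun_differentiable[OF g])
  also have "\<dots> = dir_deriv a (\<lambda>x. dir_deriv b f x * g x) x + dir_deriv a (\<lambda>x. f x * dir_deriv b g x) x"
    by (intro dir_deriv_add d smooth_intros S f g)
  also have "\<dots> = (dir_deriv a (dir_deriv b f) x * g x + dir_deriv b f x * dir_deriv a g x)
      + (dir_deriv a f x * dir_deriv b g x + f x * dir_deriv a (dir_deriv b g) x)"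
    by (intro arg_cong2[of _ _ _ _ "(+)"] dir_deriv_mult d smooth_fun_dir_deriv f g)
  finally show ?thesis by simp
qed

lemma dir_deriv_comp2:
  assumes S: "open S" and f: "smooth_fun S f" and x: "x \<in> S"
    and \<phi>: "\<And>y. y \<in> S \<Longrightarrow> (\<phi> has_real_derivative \<phi>' (f y)) (at (f y))"
    and \<phi>': "(\<phi>' has_real_derivative c) (at (f x))"
  shows "dir_deriv a (dir_deriv b (\<lambda>x. \<phi> (f x))) x =
    c * dir_deriv a f x * dir_deriv b f x + \<phi>' (f x) * dir_deriv a (dir_deriv b f) x"
proof -
  have "dir_deriv a (dir_deriv b (\<lambda>x. \<phi> (f x))) x = dir_deriv a (\<lambda>x. \<phi>' (f x) * dir_deriv b f x) x"
    by (rule dir_deriv_cong[OF S x]) (rule comp_differentiable(2)[OF smooth_fun_differentiable[OF f] \<phi>])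
  also have "\<dots> = dir_deriv a (\<lambda>x. \<phi>' (f x)) x * dir_deriv b f x + \<phi>' (f x) * dir_deriv a (dir_deriv b f) x"
    by (rule dir_deriv_mult[OF comp_differentiable(1)[where \<phi> = \<phi>' and f = f, OF smooth_fun_differentiable[OF f x] \<phi>']
        smooth_fun_differentiable[OF smooth_fun_dir_deriv[OF f] x]])
  also have "dir_deriv a (\<lambda>x. \<phi>' (f x)) x = c * dir_deriv a f x"
    by (rule comp_differentiable(2)[where \<phi> = \<phi>' and f = f, OF smooth_fun_differentiable[OF f x] \<phi>'])
  finally show ?thesis .
qed

section \<open>The operator of the adjugate Hessian\<close>

locale convex_potential =
  fixes \<Omega> :: "(real^2) set" and u :: "real^2 \<Rightarrow> real"
  assumes open_\<Omega>: "open \<Omega>" and convex_\<Omega>: "convex \<Omega>" and nonempty_\<Omega>: "\<Omega> \<noteq> {}"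
    and ssc: "smooth_strictly_convex \<Omega> u"
    and flat: "\<And>x. x \<in> \<Omega> \<Longrightarrow> (\<Sum>i\<in>UNIV. \<Sum>j\<in>UNIV.
        partial_deriv i (partial_deriv j (\<lambda>y. matrix_inv (hessian u y) $ i $ j)) x) = 0"
begin

text \<open>Arbitrary directions are allowed because near the boundary the Hessian is evaluated in
  frames adapted to the edges.\<close>

definition hs :: "real^2 \<Rightarrow> real^2 \<Rightarrow> real^2 \<Rightarrow> real" where "hs a b = dir_deriv a (dir_deriv b u)"
definition hdet :: "real^2 \<Rightarrow> real" where "hdet x = hs E1 E1 x * hs E2 E2 x - hs E1 E2 x * hs E1 E2 x"

text \<open>\<open>q\<close> is the square of the coordinate \<open>r\<close>.\<close>

definition q :: "real^2 \<Rightarrow> real" where "q x = inverse (hdet x)"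
definition Lop :: "(real^2 \<Rightarrow> real) \<Rightarrow> real^2 \<Rightarrow> real" where
  "Lop s x = hs E2 E2 x * dir_deriv E1 (dir_deriv E1 s) x - 2 * hs E1 E2 x * dir_deriv E1 (dir_deriv E2 s) x
     + hs E1 E1 x * dir_deriv E2 (dir_deriv E2 s) x"
text \<open>The carre du champ of \<open>Lop\<close>, that is, the quadratic form of the adjugate
  Hessian on gradients; \<open>Lop_mult\<close> shows its role.\<close>

definition Gam :: "(real^2 \<Rightarrow> real) \<Rightarrow> (real^2 \<Rightarrow> real) \<Rightarrow> real^2 \<Rightarrow> real" where
  "Gam s t x = hs E2 E2 x * dir_deriv E1 s x * dir_deriv E1 t x
     - hs E1 E2 x * (dir_deriv E1 s x * dir_deriv E2 t x + dir_deriv E2 s x * dir_deriv E1 t x)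
     + hs E1 E1 x * dir_deriv E2 s x * dir_deriv E2 t x"

lemma smooth_u: "smooth_fun \<Omega> u"
  using ssc unfolding smooth_strictly_convex_def by blast

lemma smooth_hs: "smooth_fun \<Omega> (hs a b)"
  unfolding hs_def by (intro smooth_intros smooth_u)

lemma hs_commute: "x \<in> \<Omega> \<Longrightarrow> hs a b x = hs b a x"
  unfolding hs_def by (rule dir_deriv_commute[OF open_\<Omega> smooth_u])

lemma hs_lincomb1: "x \<in> \<Omega> \<Longrightarrow> hs (s *\<^sub>R v + t *\<^sub>R w) b x = s * hs v b x + t * hs w b x"
  unfolding hs_def by (rule dir_deriv_lincomb[OF smooth_fun_differentiable[OF smooth_fun_dir_deriv[OF smooth_u]]])

lemma hs_lincomb2: "x \<in> \<Omega> \<Longrightarrow> hs a (s *\<^sub>R v + t *\<^sub>R w) x = s * hs a v x + t * hs a w x"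
  using hs_lincomb1 hs_commute by metis

lemma hs_pos: "x \<in> \<Omega> \<Longrightarrow> h \<noteq> 0 \<Longrightarrow> hs h h x > 0"
  using ssc unfolding smooth_strictly_convex_def hs_def by blast

lemma hs11_pos: "x \<in> \<Omega> \<Longrightarrow> hs E1 E1 x > 0"
  by (rule hs_pos) (auto simp: axis_eq_0_iff)

lemma hdet_pos: assumes x: "x \<in> \<Omega>" shows "hdet x > 0"
proof -
  let ?h = "(- hs E1 E2 x) *\<^sub>R E1 + hs E1 E1 x *\<^sub>R E2"
  have "?h $ 2 = hs E1 E1 x" by (simp add: axis_def)
  then have "?h \<noteq> 0" using hs11_pos[OF x] by (metis less_irrefl zero_index)
  then have "0 < hs ?h ?h x" by (rule hs_pos[OF x])
  also have "hs ?h ?h x = hs E1 E1 x * hdet x"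
    unfolding hs_lincomb1[OF x] hs_lincomb2[OF x] hdet_def hs_commute[OF x, of E2 E1] by (simp add: algebra_simps)
  finally show ?thesis using hs11_pos[OF x] by (simp add: zero_less_mult_iff)
qed

lemma smooth_hdet: "smooth_fun \<Omega> hdet"
  unfolding hdet_def[abs_def] by (intro smooth_intros open_\<Omega> smooth_hs)

lemma q_pos: "x \<in> \<Omega> \<Longrightarrow> q x > 0"
  by (simp add: q_def hdet_pos)

lemma smooth_q: "smooth_fun \<Omega> q"
  unfolding q_def[abs_def] by (intro smooth_intros open_\<Omega> smooth_hdet) (use hdet_pos in force)

lemma hdet_q: "x \<in> \<Omega> \<Longrightarrow> hdet x * q x = 1"
  using hdet_pos[of x] by (simp add: q_def)

lemma hs_third:
  assumes x: "x \<in> \<Omega>"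
  shows "dir_deriv E1 (hs E2 E2) x = dir_deriv E2 (hs E1 E2) x"
    and "dir_deriv E2 (hs E1 E1) x = dir_deriv E1 (hs E1 E2) x"
proof -
  show "dir_deriv E1 (hs E2 E2) x = dir_deriv E2 (hs E1 E2) x"
    unfolding hs_def by (intro dir_deriv_commute[OF open_\<Omega> _ x] smooth_intros smooth_u)
  have "dir_deriv E2 (hs E1 E1) x = dir_deriv E1 (hs E2 E1) x"
    unfolding hs_def by (intro dir_deriv_commute[OF open_\<Omega> _ x] smooth_intros smooth_u)
  also have "\<dots> = dir_deriv E1 (hs E1 E2) x" by (rule dir_deriv_cong[OF open_\<Omega> x]) (rule hs_commute)
  finally show "dir_deriv E2 (hs E1 E1) x = dir_deriv E1 (hs E1 E2) x" .
qed

text \<open>The inverse Hessian is \<open>q\<close> times the adjugate, and the adjugate of a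
  Hessian is divergence-free because third derivatives are symmetric (\<open>hs_third\<close>). So
  only the second derivatives of \<open>q\<close> survive in the scalar-flat equation.\<close>

lemma Lop_q: assumes x: "x \<in> \<Omega>" shows "Lop q x = 0"
proof -
  have hess: "hessian u y $ i $ j = hs (axis i 1) (axis j 1) y" for y i j
    by (simp add: hessian_def partial_deriv_def hs_def)
  have inv: "matrix_inv (hessian u y) $ 1 $ 1 = hs E2 E2 y * q y"
      "matrix_inv (hessian u y) $ 1 $ 2 = (-1) * hs E1 E2 y * q y"
      "matrix_inv (hessian u y) $ 2 $ 1 = (-1) * hs E1 E2 y * q y"
      "matrix_inv (hessian u y) $ 2 $ 2 = hs E1 E1 y * q y" if y: "y \<in> \<Omega>" for y
  proof -
    let ?B = "(\<chi> i j. if i = 1 then (if j = 1 then hs E2 E2 y * q y else - hs E1 E2 y * q y)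
       else (if j = 1 then - hs E1 E2 y * q y else hs E1 E1 y * q y)) :: real^2^2"
    have d: "hs E1 E1 y * hs E2 E2 y * q y - hs E1 E2 y * hs E1 E2 y * q y = 1"
      using hdet_q[OF y] by (simp add: hdet_def algebra_simps)
    have B: "hessian u y ** ?B = mat 1" "?B ** hessian u y = mat 1"
      using d hs_commute[OF y, of E2 E1]
      by (simp_all add: vec_eq_iff matrix_matrix_mult_def sum_2 forall_2 hess mat_def algebra_simps)
    have "matrix_inv (hessian u y) = ?B"
      unfolding matrix_inv_def
    proof (rule some_equality)
      fix A' assume A': "hessian u y ** A' = mat 1 \<and> A' ** hessian u y = mat 1"
      have "A' = A' ** (hessian u y ** ?B)" by (simp only: B matrix_mul_rid)
      also have "\<dots> = ?B" by (simp only: matrix_mul_assoc A' matrix_mul_lid)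
      finally show "A' = ?B" .
    qed (simp only: B simp_thms)
    then show "matrix_inv (hessian u y) $ 1 $ 1 = hs E2 E2 y * q y"
      "matrix_inv (hessian u y) $ 1 $ 2 = (-1) * hs E1 E2 y * q y"
      "matrix_inv (hessian u y) $ 2 $ 1 = (-1) * hs E1 E2 y * q y"
      "matrix_inv (hessian u y) $ 2 $ 2 = hs E1 E1 y * q y" by simp_all
  qed
  have cong2: "dir_deriv a (dir_deriv b f) x = dir_deriv a (dir_deriv b g) x" if "\<And>y. y \<in> \<Omega> \<Longrightarrow> f y = g y"
    for a b :: "real^2" and f g :: "real^2 \<Rightarrow> real"
    using foldr_dir_deriv_cong[OF open_\<Omega> that x, where hs = "[a,b]"] by simp
  have s12: "smooth_fun \<Omega> (\<lambda>y. (-1) * hs E1 E2 y)" by (intro smooth_intros open_\<Omega> smooth_hs)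
  have d: "smooth_fun \<Omega> h \<Longrightarrow> h differentiable (at x)" for h :: "real^2 \<Rightarrow> real" using x smooth_fun_differentiable by blast
  have m1: "dir_deriv a (\<lambda>y. (-1) * hs E1 E2 y) y = (-1) * dir_deriv a (hs E1 E2) y" if "y \<in> \<Omega>" for a y
    by (rule dir_deriv_cmult) (intro smooth_fun_differentiable[OF smooth_hs] that)
  have m2: "dir_deriv b (dir_deriv a (\<lambda>y. (-1) * hs E1 E2 y)) x = (-1) * dir_deriv b (dir_deriv a (hs E1 E2)) x" for a b
    by (subst dir_deriv_cong[OF open_\<Omega> x m1], assumption)
       (intro dir_deriv_cmult d smooth_intros smooth_hs)
  have "0 = dir_deriv E1 (dir_deriv E1 (\<lambda>y. hs E2 E2 y * q y)) x
      + dir_deriv E1 (dir_deriv E2 (\<lambda>y. (-1) * hs E1 E2 y * q y)) x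
      + dir_deriv E2 (dir_deriv E1 (\<lambda>y. (-1) * hs E1 E2 y * q y)) x
      + dir_deriv E2 (dir_deriv E2 (\<lambda>y. hs E1 E1 y * q y)) x"
    using flat[OF x] unfolding partial_deriv_def
    by (simp only: sum_2 cong2[OF inv(1)] cong2[OF inv(2)] cong2[OF inv(3)] cong2[OF inv(4)] add.assoc)
  also have "\<dots> = Lop q x + q x * (dir_deriv E1 (dir_deriv E1 (hs E2 E2)) x - dir_deriv E1 (dir_deriv E2 (hs E1 E2)) x
       - dir_deriv E2 (dir_deriv E1 (hs E1 E2)) x + dir_deriv E2 (dir_deriv E2 (hs E1 E1)) x)
     + 2 * dir_deriv E1 q x * (dir_deriv E1 (hs E2 E2) x - dir_deriv E2 (hs E1 E2) x)
     + 2 * dir_deriv E2 q x * (dir_deriv E2 (hs E1 E1) x - dir_deriv E1 (hs E1 E2) x)"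
    unfolding dir_deriv_mult2[OF open_\<Omega> smooth_hs smooth_q x] dir_deriv_mult2[OF open_\<Omega> s12 smooth_q x]
      m1[OF x] m2 Lop_def dir_deriv_commute[OF open_\<Omega> smooth_q x, of E2 E1]
    by (simp add: algebra_simps)
  also have "dir_deriv E1 (dir_deriv E1 (hs E2 E2)) x = dir_deriv E1 (dir_deriv E2 (hs E1 E2)) x"
    by (rule dir_deriv_cong[OF open_\<Omega> x]) (rule hs_third)
  also have "dir_deriv E2 (dir_deriv E2 (hs E1 E1)) x = dir_deriv E2 (dir_deriv E1 (hs E1 E2)) x"
    by (rule dir_deriv_cong[OF open_\<Omega> x]) (rule hs_third)
  finally show ?thesis using hs_third[OF x] by simp
qed

text \<open>\<open>conj1\<close> and \<open>conj2\<close> are the components of minus the Hodge star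
  of \<open>dr\<close> for the Hessian metric, where \<open>r^2 = q\<close>; they will be those of
  \<open>dH\<close>.\<close>

definition conj1 :: "real^2 \<Rightarrow> real" where
  "conj1 x = 1/2 * (hs E1 E1 x * dir_deriv E2 q x - hs E1 E2 x * dir_deriv E1 q x)"
definition conj2 :: "real^2 \<Rightarrow> real" where
  "conj2 x = 1/2 * (hs E1 E2 x * dir_deriv E2 q x - hs E2 E2 x * dir_deriv E1 q x)"

lemma smooth_conj: "smooth_fun \<Omega> conj1" "smooth_fun \<Omega> conj2"
  unfolding conj1_def[abs_def] conj2_def[abs_def] by (intro smooth_intros open_\<Omega> smooth_hs smooth_q)+

lemma dd_q: "x \<in> \<Omega> \<Longrightarrow> dir_deriv a q differentiable (at x)"
  by (intro smooth_fun_differentiable[of \<Omega>] smooth_intros smooth_q)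

lemma hs_diff: "x \<in> \<Omega> \<Longrightarrow> hs a b differentiable (at x)"
  by (intro smooth_fun_differentiable[of \<Omega>] smooth_hs)

lemma dir_deriv_conj1:
  assumes x: "x \<in> \<Omega>"
  shows "dir_deriv a conj1 x = 1/2 * (dir_deriv a (hs E1 E1) x * dir_deriv E2 q x + hs E1 E1 x * dir_deriv a (dir_deriv E2 q) x
     - dir_deriv a (hs E1 E2) x * dir_deriv E1 q x - hs E1 E2 x * dir_deriv a (dir_deriv E1 q) x)"
proof -
  have m: "(\<lambda>x. hs v w x * dir_deriv a q x) differentiable (at x)" for v w a
    by (intro differentiable_mult hs_diff dd_q x)
  show ?thesis unfolding conj1_def[abs_def]
    by (simp only: dir_deriv_cmult[OF differentiable_diff[OF m m]] dir_deriv_diff[OF m m]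
        dir_deriv_mult[OF hs_diff[OF x] dd_q[OF x]]) (simp add: algebra_simps)
qed

lemma dir_deriv_conj2:
  assumes x: "x \<in> \<Omega>"
  shows "dir_deriv a conj2 x = 1/2 * (dir_deriv a (hs E1 E2) x * dir_deriv E2 q x + hs E1 E2 x * dir_deriv a (dir_deriv E2 q) x
     - dir_deriv a (hs E2 E2) x * dir_deriv E1 q x - hs E2 E2 x * dir_deriv a (dir_deriv E1 q) x)"
proof -
  have m: "(\<lambda>x. hs v w x * dir_deriv a q x) differentiable (at x)" for v w a
    by (intro differentiable_mult hs_diff dd_q x)
  show ?thesis unfolding conj2_def[abs_def]
    by (simp only: dir_deriv_cmult[OF differentiable_diff[OF m m]] dir_deriv_diff[OF m m]
        dir_deriv_mult[OF hs_diff[OF x] dd_q[OF x]]) (simp add: algebra_simps)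
qed

text \<open>Up to third derivatives, which cancel by symmetry, the exterior derivative of the form
  is half of \<open>Lop q\<close>. This is where scalar-flatness produces \<open>H\<close>.\<close>

lemma conj_closed: assumes x: "x \<in> \<Omega>" shows "dir_deriv E2 conj1 x = dir_deriv E1 conj2 x"
proof -
  have "dir_deriv E2 conj1 x - dir_deriv E1 conj2 x = 1/2 * Lop q x
     + 1/2 * (dir_deriv E2 (hs E1 E1) x - dir_deriv E1 (hs E1 E2) x) * dir_deriv E2 q x
     + 1/2 * (dir_deriv E1 (hs E2 E2) x - dir_deriv E2 (hs E1 E2) x) * dir_deriv E1 q x"
    unfolding dir_deriv_conj1[OF x] dir_deriv_conj2[OF x] Lop_def dir_deriv_commute[OF open_\<Omega> smooth_q x, of E2 E1]
    by (simp add: algebra_simps)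
  then show ?thesis using Lop_q[OF x] hs_third[OF x] by simp
qed

lemma conjugate_exists:
  obtains H where "\<And>x. x \<in> \<Omega> \<Longrightarrow> (H has_derivative (\<lambda>h. conj1 x * h$1 + conj2 x * h$2)) (at x)"
  using closed_form_potential[OF open_\<Omega> convex_\<Omega> smooth_conj conj_closed] by blast

lemma Gam_commute: "Gam s t x = Gam t s x"
  by (simp add: Gam_def algebra_simps)

lemma Lop_const [simp]: "Lop (\<lambda>x. c) x = 0"
  by (simp add: Lop_def)

lemma Gam_const [simp]: "Gam (\<lambda>x. c) t x = 0" "Gam t (\<lambda>x. c) x = 0"
  by (simp_all add: Gam_def)

lemma Lop_affine [simp]: "Lop (\<lambda>x. x \<bullet> v + c) x = 0"
  by (simp add: Lop_def)

lemma Lop_mult: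
  assumes "smooth_fun \<Omega> s" "smooth_fun \<Omega> t" "x \<in> \<Omega>"
  shows "Lop (\<lambda>y. s y * t y) x = s x * Lop t x + t x * Lop s x + 2 * Gam s t x"
  unfolding Lop_def Gam_def dir_deriv_mult2[OF open_\<Omega> assms] by (simp add: algebra_simps)

lemma Lop_cmult:
  assumes "smooth_fun \<Omega> s" "x \<in> \<Omega>"
  shows "Lop (\<lambda>y. c * s y) x = c * Lop s x"
  using Lop_mult[of "\<lambda>_. c" s x] assms smooth_fun_const by auto

lemma Lop_add:
  assumes s: "smooth_fun \<Omega> s" and t: "smooth_fun \<Omega> t" and x: "x \<in> \<Omega>"
  shows "Lop (\<lambda>y. s y + t y) x = Lop s x + Lop t x"
proof -
  have "dir_deriv a (dir_deriv b (\<lambda>y. s y + t y)) x = dir_deriv a (dir_deriv b s) x + dir_deriv a (dir_deriv b t) x" for a b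
  proof -
    have "dir_deriv a (dir_deriv b (\<lambda>y. s y + t y)) x = dir_deriv a (\<lambda>y. dir_deriv b s y + dir_deriv b t y) x"
      by (rule dir_deriv_cong[OF open_\<Omega> x]) (intro dir_deriv_add smooth_fun_differentiable[OF s] smooth_fun_differentiable[OF t])
    also have "\<dots> = dir_deriv a (dir_deriv b s) x + dir_deriv a (dir_deriv b t) x"
      by (intro dir_deriv_add smooth_fun_differentiable[OF _ x] smooth_intros s t)
    finally show ?thesis .
  qed
  then show ?thesis by (simp add: Lop_def algebra_simps)
qed

lemma Lop_minus:
  assumes "smooth_fun \<Omega> s" "x \<in> \<Omega>"
  shows "Lop (\<lambda>y. - s y) x = - Lop s x"
  using Lop_cmult[OF assms, of "-1"] by simp

lemma Lop_diff:
  assumes "smooth_fun \<Omega> s" "smooth_fun \<Omega> t" "x \<in> \<Omega>"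
  shows "Lop (\<lambda>y. s y - t y) x = Lop s x - Lop t x"
  using Lop_add[of s "\<lambda>y. - t y" x] Lop_minus[of t x] assms smooth_fun_minus[OF open_\<Omega>] by simp

lemma Lop_sum:
  assumes "\<And>i. i \<in> A \<Longrightarrow> smooth_fun \<Omega> (s i)" "x \<in> \<Omega>"
  shows "Lop (\<lambda>y. \<Sum>i\<in>A. s i y) x = (\<Sum>i\<in>A. Lop (s i) x)"
  using assms(1)
proof (induction A rule: infinite_finite_induct)
  case (insert a A)
  then show ?case using Lop_add[of "s a" "\<lambda>y. \<Sum>i\<in>A. s i y" x] assms(2) smooth_fun_sum[OF open_\<Omega>, of A s] by auto
qed simp_all

lemma Lop_comp:
  assumes "smooth_fun \<Omega> s" "x \<in> \<Omega>"
    and "\<And>y. y \<in> \<Omega> \<Longrightarrow> (\<phi> has_real_derivative \<phi>' (s y)) (at (s y))"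
    and "(\<phi>' has_real_derivative c) (at (s x))"
  shows "Lop (\<lambda>y. \<phi> (s y)) x = \<phi>' (s x) * Lop s x + c * Gam s s x"
proof -
  have "dir_deriv a (dir_deriv b (\<lambda>y. \<phi> (s y))) x =
    c * dir_deriv a s x * dir_deriv b s x + \<phi>' (s x) * dir_deriv a (dir_deriv b s) x" for a b
    by (rule dir_deriv_comp2[OF open_\<Omega> assms])
  then show ?thesis unfolding Lop_def Gam_def by (simp add: algebra_simps)
qed

lemma Gam_comp:
  assumes "smooth_fun \<Omega> s" "x \<in> \<Omega>" "(\<phi> has_real_derivative c) (at (s x))"
  shows "Gam (\<lambda>y. \<phi> (s y)) t x = c * Gam s t x"
proof -
  have "dir_deriv a (\<lambda>y. \<phi> (s y)) x = c * dir_deriv a s x" for a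
    by (rule comp_differentiable(2)[where \<phi> = \<phi> and f = s, OF smooth_fun_differentiable[OF assms(1,2)] assms(3)])
  then show ?thesis unfolding Gam_def by (simp add: algebra_simps)
qed

lemma Gam_mult:
  assumes "smooth_fun \<Omega> s" "smooth_fun \<Omega> t" "x \<in> \<Omega>"
  shows "Gam (\<lambda>y. s y * t y) v x = s x * Gam t v x + t x * Gam s v x"
  unfolding Gam_def dir_deriv_mult[OF smooth_fun_differentiable[OF assms(1,3)] smooth_fun_differentiable[OF assms(2,3)]] by (simp add: algebra_simps)

lemma Gam_add:
  assumes "smooth_fun \<Omega> s" "smooth_fun \<Omega> t" "x \<in> \<Omega>"
  shows "Gam (\<lambda>y. s y + t y) v x = Gam s v x + Gam t v x"
  unfolding Gam_def dir_deriv_add[OF smooth_fun_differentiable[OF assms(1,3)] smooth_fun_differentiable[OF assms(2,3)]] by (simp add: algebra_simps)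

lemma Gam_diff:
  assumes "smooth_fun \<Omega> s" "smooth_fun \<Omega> t" "x \<in> \<Omega>"
  shows "Gam (\<lambda>y. s y - t y) v x = Gam s v x - Gam t v x"
  unfolding Gam_def dir_deriv_diff[OF smooth_fun_differentiable[OF assms(1,3)] smooth_fun_differentiable[OF assms(2,3)]] by (simp add: algebra_simps)

text \<open>Completing the square writes \<open>hs E1 E1 x * Lop s x\<close> as a positive
  combination of two pure second derivatives, each of which is nonpositive at a maximum.\<close>

lemma Lop_le_0_at_max:
  assumes U: "open U" "U \<subseteq> \<Omega>" and s: "smooth_fun U s" and x: "x \<in> U" and max: "\<And>y. y \<in> U \<Longrightarrow> s y \<le> s x"
  shows "Lop s x \<le> 0"
proof -
  have xO: "x \<in> \<Omega>" using x U by blast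
  let ?h = "hs E1 E1 x *\<^sub>R E2 + (- hs E1 E2 x) *\<^sub>R E1"
  have d: "dir_deriv a s differentiable (at x)" for a
    by (intro smooth_fun_differentiable[OF _ x] smooth_intros s)
  have d': "dir_deriv v (dir_deriv (a *\<^sub>R w + b *\<^sub>R w') s) x = a * dir_deriv v (dir_deriv w s) x + b * dir_deriv v (dir_deriv w' s) x"
    for v a b w w'
  proof -
    have "dir_deriv v (dir_deriv (a *\<^sub>R w + b *\<^sub>R w') s) x = dir_deriv v (\<lambda>y. a * dir_deriv w s y + b * dir_deriv w' s y) x"
      by (rule dir_deriv_cong[OF U(1) x]) (intro dir_deriv_lincomb smooth_fun_differentiable[OF s])
    also have "\<dots> = a * dir_deriv v (dir_deriv w s) x + b * dir_deriv v (dir_deriv w' s) x"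
      using d by (subst dir_deriv_add) (auto simp: dir_deriv_cmult intro: differentiable_mult)
    finally show ?thesis .
  qed
  have c: "dir_deriv E2 (dir_deriv E1 s) x = dir_deriv E1 (dir_deriv E2 s) x"
    by (rule dir_deriv_commute[OF U(1) s x])
  have "hs E1 E1 x * Lop s x = dir_deriv ?h (dir_deriv ?h s) x + hdet x * dir_deriv E1 (dir_deriv E1 s) x"
    unfolding d' dir_deriv_lincomb[OF d] Lop_def hdet_def c by (simp add: algebra_simps)
  also have "\<dots> \<le> 0"
    using second_derivative_local_max[OF U(1) s x max] hdet_pos[OF xO]
    by (intro add_nonpos_nonpos mult_nonneg_nonpos) auto
  finally show ?thesis using hs11_pos[OF xO] by (simp add: mult_le_0_iff)
qed

end

lemma smooth_fun_poly:
  "open S \<Longrightarrow> smooth_fun S f \<Longrightarrow> smooth_fun S (\<lambda>x. poly p (f x))"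
  by (induction p) (auto intro: smooth_fun_const smooth_fun_add smooth_fun_mult)

lemma frame_coefficients:
  fixes a b v :: "real^2"
  assumes "det2 a b = 1"
  shows "v = det2 v b *\<^sub>R a + det2 a v *\<^sub>R b"
proof -
  have "(a$1 * b$2 - a$2 * b$1) * v$1 = v$1" "(a$1 * b$2 - a$2 * b$1) * v$2 = v$2"
    using assms by (simp_all add: det2_def)
  then show ?thesis by (simp add: vec_eq_iff forall_2 det2_def algebra_simps)
qed

section \<open>The conjugate function, and solutions built from \<open>H\<close> and
  \<open>q\<close>\<close>

locale conjugate_pair = convex_potential +
  fixes H :: "real^2 \<Rightarrow> real"
  assumes H_deriv: "\<And>x. x \<in> \<Omega> \<Longrightarrow> (H has_derivative (\<lambda>h. conj1 x * h$1 + conj2 x * h$2)) (at x)"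
begin

lemma dir_deriv_H: "x \<in> \<Omega> \<Longrightarrow> dir_deriv v H x = conj1 x * v$1 + conj2 x * v$2"
  by (rule dir_deriv_eqI[OF H_deriv])

lemma smooth_H: "smooth_fun \<Omega> H"
  by (rule smooth_fun_has_derivative[OF open_\<Omega> H_deriv], assumption) (intro smooth_intros open_\<Omega> smooth_conj)

text \<open>The formulas defining \<open>conj1\<close> and \<open>conj2\<close> are invariant under
  frames of determinant 1. This makes them usable in the frames of edge vectors at a vertex.\<close>

lemma dir_deriv_H_frame:
  assumes x: "x \<in> \<Omega>" and ab: "det2 a b = 1"
  shows "2 * dir_deriv v H x = hs v a x * dir_deriv b q x - hs v b x * dir_deriv a q x"
proof -
  have dq: "dir_deriv w q x = w$1 * dir_deriv E1 q x + w$2 * dir_deriv E2 q x" for w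
    by (rule dir_deriv_vec2[OF smooth_fun_differentiable[OF smooth_q x]])
  have hv: "hs v w x = v$1 * (w$1 * hs E1 E1 x + w$2 * hs E1 E2 x) + v$2 * (w$1 * hs E1 E2 x + w$2 * hs E2 E2 x)" for w
  proof -
    have "hs v w x = hs (v$1 *\<^sub>R E1 + v$2 *\<^sub>R E2) (w$1 *\<^sub>R E1 + w$2 *\<^sub>R E2) x" using vec2_eq by metis
    then show ?thesis
      unfolding hs_lincomb1[OF x] hs_lincomb2[OF x] hs_commute[OF x, of E2 E1] by (simp add: algebra_simps)
  qed
  have "hs v a x * dir_deriv b q x - hs v b x * dir_deriv a q x
     = det2 a b * ((v$1 * hs E1 E1 x + v$2 * hs E1 E2 x) * dir_deriv E2 q x
          - (v$1 * hs E1 E2 x + v$2 * hs E2 E2 x) * dir_deriv E1 q x)"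
    unfolding dq[of a] dq[of b] hv[of a] hv[of b] det2_def by (simp add: algebra_simps)
  also have "\<dots> = 2 * dir_deriv v H x"
    unfolding dir_deriv_H[OF x] conj1_def conj2_def ab by (simp add: algebra_simps)
  finally show ?thesis ..
qed

lemma dir_deriv_H_E: "x \<in> \<Omega> \<Longrightarrow> dir_deriv E1 H x = conj1 x" "x \<in> \<Omega> \<Longrightarrow> dir_deriv E2 H x = conj2 x"
  by (simp_all add: dir_deriv_H axis_def)

text \<open>The conformal factor. By \<open>jacobian_eq\<close>, its zeros are the points where
  \<open>(H, q)\<close> has vanishing Jacobian.\<close>

definition S :: "real^2 \<Rightarrow> real" where "S = Gam H H"

lemma Gam_nonneg: assumes x: "x \<in> \<Omega>" shows "Gam s s x \<ge> 0"
proof -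
  have "hs E1 E1 x * Gam s s x = (hs E1 E1 x * dir_deriv E2 s x - hs E1 E2 x * dir_deriv E1 s x)\<^sup>2
      + hdet x * (dir_deriv E1 s x)\<^sup>2"
    unfolding Gam_def hdet_def by (simp add: algebra_simps power2_eq_square)
  also have "\<dots> \<ge> 0" using hdet_pos[OF x] by simp
  finally show ?thesis using hs11_pos[OF x] by (simp add: zero_le_mult_iff)
qed

lemma Gam_eq_0: assumes x: "x \<in> \<Omega>" and 0: "Gam s s x = 0" shows "dir_deriv E1 s x = 0" "dir_deriv E2 s x = 0"
proof -
  have *: "hs E1 E1 x * Gam s s x = (hs E1 E1 x * dir_deriv E2 s x - hs E1 E2 x * dir_deriv E1 s x)\<^sup>2
      + hdet x * (dir_deriv E1 s x)\<^sup>2"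
    unfolding Gam_def hdet_def by (simp add: algebra_simps power2_eq_square)
  have "hdet x * (dir_deriv E1 s x)\<^sup>2 \<ge> 0" using hdet_pos[OF x] by simp
  with *[unfolded 0] have "hdet x * (dir_deriv E1 s x)\<^sup>2 = 0" "(hs E1 E1 x * dir_deriv E2 s x - hs E1 E2 x * dir_deriv E1 s x)\<^sup>2 = 0"
    using zero_le_power2[of "hs E1 E1 x * dir_deriv E2 s x - hs E1 E2 x * dir_deriv E1 s x"] by linarith+
  then show "dir_deriv E1 s x = 0" "dir_deriv E2 s x = 0"
    using hdet_pos[OF x] hs11_pos[OF x] by auto
qed

lemma S_nonneg: "x \<in> \<Omega> \<Longrightarrow> S x \<ge> 0"
  unfolding S_def by (rule Gam_nonneg)

lemma Gam_H_q: assumes x: "x \<in> \<Omega>" shows "Gam H q x = 0" "Gam q H x = 0"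
proof -
  show "Gam H q x = 0"
    unfolding Gam_def dir_deriv_H_E[OF x] conj1_def conj2_def by (simp add: algebra_simps)
  then show "Gam q H x = 0" by (simp add: Gam_commute)
qed

text \<open>Since \<open>q = r^2\<close>, this says that \<open>dr\<close> is as long as
  \<open>dH\<close>; with the orthogonality in \<open>Gam_H_q\<close> it is conformality of
  \<open>(H, r)\<close>.\<close>

lemma Gam_q_q: assumes x: "x \<in> \<Omega>" shows "Gam q q x = 4 * q x * S x"
proof -
  have "4 * S x = hdet x * Gam q q x"
    unfolding S_def Gam_def dir_deriv_H_E[OF x] conj1_def conj2_def hdet_def by (simp add: field_simps)
  then have "4 * q x * S x = (hdet x * q x) * Gam q q x" by (simp add: algebra_simps)
  then show ?thesis by (simp add: hdet_q[OF x])
qed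

lemma jacobian_eq: assumes x: "x \<in> \<Omega>"
  shows "dir_deriv E1 H x * dir_deriv E2 q x - dir_deriv E2 H x * dir_deriv E1 q x = 2 * q x * S x"
proof -
  have "2 * (dir_deriv E1 H x * dir_deriv E2 q x - dir_deriv E2 H x * dir_deriv E1 q x) = Gam q q x"
    unfolding Gam_def dir_deriv_H_E[OF x] conj1_def conj2_def by (simp add: field_simps)
  then show ?thesis using Gam_q_q[OF x] by simp
qed

text \<open>After cancellation, \<open>2 * Lop H\<close> is the Jacobian determinant of
  \<open>hdet\<close> and \<open>q\<close>, and it vanishes because
  \<open>hdet * q = 1\<close>.\<close>

lemma Lop_H: assumes x: "x \<in> \<Omega>" shows "Lop H x = 0"
proof -
  have c: "dir_deriv a (dir_deriv E1 H) x = dir_deriv a conj1 x" "dir_deriv a (dir_deriv E2 H) x = dir_deriv a conj2 x" for a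
    by (rule dir_deriv_cong[OF open_\<Omega> x], simp add: dir_deriv_H_E)+
  have dh: "dir_deriv a hdet x = dir_deriv a (hs E1 E1) x * hs E2 E2 x + hs E1 E1 x * dir_deriv a (hs E2 E2) x
     - 2 * (hs E1 E2 x * dir_deriv a (hs E1 E2) x)" for a
    unfolding hdet_def[abs_def] using hs_diff[OF x]
    by (simp add: dir_deriv_diff dir_deriv_mult differentiable_mult)
  have "dir_deriv a (\<lambda>y. hdet y * q y) x = dir_deriv a (\<lambda>y. 1) x" for a
    by (rule dir_deriv_cong[OF open_\<Omega> x]) (rule hdet_q)
  then have hq: "dir_deriv a hdet x * q x + hdet x * dir_deriv a q x = 0" for a
    by (simp add: dir_deriv_mult[OF smooth_fun_differentiable[OF smooth_hdet x] smooth_fun_differentiable[OF smooth_q x]])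
  have "2 * Lop H x = hs E2 E2 x * (2 * dir_deriv E1 conj1 x) - hs E1 E2 x * (2 * dir_deriv E1 conj2 x)
      - hs E1 E2 x * (2 * dir_deriv E2 conj1 x) + hs E1 E1 x * (2 * dir_deriv E2 conj2 x)"
    unfolding Lop_def c using conj_closed[OF x] by simp
  also have "\<dots> = dir_deriv E1 hdet x * dir_deriv E2 q x - dir_deriv E2 hdet x * dir_deriv E1 q x"
    unfolding dh dir_deriv_conj1[OF x] dir_deriv_conj2[OF x] dir_deriv_commute[OF open_\<Omega> smooth_q x, of E2 E1]
      hs_third[OF x] by (simp add: algebra_simps)
  finally have "q x * (2 * Lop H x) = (dir_deriv E1 hdet x * q x) * dir_deriv E2 q x - (dir_deriv E2 hdet x * q x) * dir_deriv E1 q x"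
    by (simp only: right_diff_distrib mult_ac)
  also have "dir_deriv E1 hdet x * q x = - (hdet x * dir_deriv E1 q x)" using hq[of E1] by simp
  also have "dir_deriv E2 hdet x * q x = - (hdet x * dir_deriv E2 q x)" using hq[of E2] by simp
  finally show ?thesis using q_pos[OF x] by simp
qed

text \<open>Polar coordinates around the boundary point \<open>(- c, 0)\<close> of the half-plane:
  \<open>rh c\<close> is the distance from it, and \<open>cs c\<close> the cosine of the angle with
  the positive \<open>H\<close>-axis.\<close>

definition rho2 :: "real \<Rightarrow> real^2 \<Rightarrow> real" where "rho2 c x = (H x + c) * (H x + c) + q x"
definition rh :: "real \<Rightarrow> real^2 \<Rightarrow> real" where "rh c x = sqrt (rho2 c x)"
definition cs :: "real \<Rightarrow> real^2 \<Rightarrow> real" where "cs c x = (H x + c) / rh c x"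

lemma smooth_Hc: "smooth_fun \<Omega> (\<lambda>x. H x + c)"
  by (intro smooth_intros open_\<Omega> smooth_H)

lemma rho2_pos: "x \<in> \<Omega> \<Longrightarrow> rho2 c x > 0"
  using q_pos[of x] by (simp add: rho2_def add_nonneg_pos)

lemma smooth_rho2: "smooth_fun \<Omega> (rho2 c)"
  unfolding rho2_def[abs_def] by (intro smooth_intros open_\<Omega> smooth_H smooth_q)

lemma smooth_rh: "smooth_fun \<Omega> (rh c)"
  unfolding rh_def[abs_def] by (intro smooth_intros open_\<Omega> smooth_rho2 rho2_pos)

lemma rh_pos: "x \<in> \<Omega> \<Longrightarrow> rh c x > 0"
  by (simp add: rh_def rho2_pos)

lemma rh_sq: "x \<in> \<Omega> \<Longrightarrow> (rh c x)\<^sup>2 = (H x + c)\<^sup>2 + q x"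
  using rho2_pos[of x c] by (simp add: rh_def rho2_def power2_eq_square)

lemma smooth_cs: "smooth_fun \<Omega> (cs c)"
  unfolding cs_def[abs_def] by (intro smooth_intros open_\<Omega> smooth_H smooth_rh) (metis rh_pos less_irrefl)

lemma abs_Hc_less: assumes "x \<in> \<Omega>" shows "\<bar>H x + c\<bar> < rh c x"
proof -
  have "\<bar>H x + c\<bar>\<^sup>2 < (rh c x)\<^sup>2" using rh_sq[OF assms, of c] q_pos[OF assms] by simp
  then show ?thesis using rh_pos[OF assms, of c] by (meson less_imp_le power_less_imp_less_base)
qed

lemma abs_cs_less: "x \<in> \<Omega> \<Longrightarrow> \<bar>cs c x\<bar> < 1"
  using abs_Hc_less[of x c] rh_pos[of x c] by (simp add: cs_def abs_divide)

lemma q_eq_rh_cs: "x \<in> \<Omega> \<Longrightarrow> q x = (rh c x)\<^sup>2 * (1 - (cs c x)\<^sup>2)"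
proof -
  assume x: "x \<in> \<Omega>"
  have "cs c x * rh c x = H x + c" using rh_pos[OF x, of c] by (simp add: cs_def)
  moreover have "(rh c x)\<^sup>2 * (1 - (cs c x)\<^sup>2) = (rh c x)\<^sup>2 - (cs c x * rh c x)\<^sup>2"
    by (simp add: algebra_simps power_mult_distrib)
  ultimately show ?thesis using rh_sq[OF x, of c] by simp
qed

lemma Gam_Hc: "x \<in> \<Omega> \<Longrightarrow> Gam (\<lambda>x. H x + c) t x = Gam H t x"
  by (simp add: Gam_add[OF smooth_H smooth_fun_const])

lemma Gam_H_Hc: "x \<in> \<Omega> \<Longrightarrow> Gam H (\<lambda>x. H x + c) x = S x"
  by (subst Gam_commute) (simp add: Gam_Hc S_def)

lemma Lop_Hc: "x \<in> \<Omega> \<Longrightarrow> Lop (\<lambda>x. H x + c) x = 0"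
  by (simp add: Lop_add[OF smooth_H smooth_fun_const] Lop_H)

lemma Gam_rho2: "x \<in> \<Omega> \<Longrightarrow> Gam (rho2 c) t x = 2 * (H x + c) * Gam H t x + Gam q t x"
  unfolding rho2_def[abs_def]
  by (simp add: Gam_add[OF smooth_fun_mult[OF open_\<Omega> smooth_Hc smooth_Hc] smooth_q] Gam_mult[OF smooth_Hc smooth_Hc] Gam_Hc)

lemma Gam_H_rho2: "x \<in> \<Omega> \<Longrightarrow> Gam H (rho2 c) x = 2 * (H x + c) * S x"
  by (subst Gam_commute) (simp add: Gam_rho2 Gam_H_q S_def)

lemma Gam_rho2_rho2: assumes "x \<in> \<Omega>" shows "Gam (rho2 c) (rho2 c) x = 4 * rho2 c x * S x"
proof -
  have "Gam q (rho2 c) x = 4 * q x * S x"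
    using assms by (subst Gam_commute) (simp add: Gam_rho2 Gam_H_q Gam_q_q)
  then show ?thesis using assms by (simp add: Gam_rho2 Gam_H_rho2) (simp add: rho2_def algebra_simps)
qed

lemma Lop_rho2: "x \<in> \<Omega> \<Longrightarrow> Lop (rho2 c) x = 2 * S x"
  unfolding rho2_def[abs_def]
  by (simp add: Lop_add[OF smooth_fun_mult[OF open_\<Omega> smooth_Hc smooth_Hc] smooth_q] Lop_mult[OF smooth_Hc smooth_Hc]
      Lop_Hc Lop_q Gam_Hc Gam_H_Hc)

lemma sqrt_deriv2:
  assumes "y > 0"
  shows "(sqrt has_real_derivative inverse (sqrt y) / 2) (at y)"
    and "((\<lambda>y. inverse (sqrt y) / 2) has_real_derivative - (1/4) * inverse (y * sqrt y)) (at y)"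
proof -
  show "(sqrt has_real_derivative inverse (sqrt y) / 2) (at y)" by (rule DERIV_real_sqrt[OF assms])
  have "((\<lambda>y. inverse (sqrt y) / 2) has_real_derivative - (inverse (sqrt y) * (inverse (sqrt y) / 2) * inverse (sqrt y)) / 2) (at y)"
    by (intro DERIV_cdivide DERIV_inverse' DERIV_real_sqrt assms) (use assms in auto)
  moreover
  have "inverse (y * sqrt y) = inverse (sqrt y) * inverse (sqrt y) * inverse (sqrt y)"
  proof -
    have "inverse (sqrt y) * inverse (sqrt y) * inverse (sqrt y) = inverse (sqrt y * sqrt y * sqrt y)"
      by (simp only: inverse_mult_distrib)
    also have "sqrt y * sqrt y = y" using assms by (intro real_sqrt_mult_self[THEN trans]) simp
    finally show ?thesis ..
  qed
  then have "- (1/4) * inverse (y * sqrt y) = - (inverse (sqrt y) * (inverse (sqrt y) / 2) * inverse (sqrt y)) / 2"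
    by (simp only:)
  ultimately show "((\<lambda>y. inverse (sqrt y) / 2) has_real_derivative - (1/4) * inverse (y * sqrt y)) (at y)"
    by (simp only:)
qed

lemma Gam_rh: assumes x: "x \<in> \<Omega>" shows "Gam (rh c) t x = Gam (rho2 c) t x / (2 * rh c x)"
  unfolding rh_def[abs_def]
  by (simp add: Gam_comp[OF smooth_rho2 x sqrt_deriv2(1)[OF rho2_pos[OF x]]] field_simps)

lemma Gam_H_rh: "x \<in> \<Omega> \<Longrightarrow> Gam H (rh c) x = (H x + c) * S x / rh c x"
proof -
  assume x: "x \<in> \<Omega>"
  have "Gam H (rh c) x = Gam H (rho2 c) x / (2 * rh c x)"
    using Gam_rh[OF x, of c H] by (simp only: Gam_commute[of "rh c" H] Gam_commute[of "rho2 c" H])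
  then show ?thesis unfolding Gam_H_rho2[OF x] mult.assoc by simp
qed

lemma Gam_rh_rh: assumes x: "x \<in> \<Omega>" shows "Gam (rh c) (rh c) x = S x"
proof -
  have "Gam (rho2 c) (rh c) x = 2 * rh c x * S x"
    using rh_sq[OF x, of c] rh_pos[OF x, of c] unfolding Gam_commute[of "rho2 c" "rh c"] Gam_rh[OF x] Gam_rho2_rho2[OF x]
    by (simp add: rho2_def field_simps power2_eq_square)
  then show ?thesis using rh_pos[OF x, of c] by (simp add: Gam_rh[OF x])
qed

lemma Lop_rh: assumes x: "x \<in> \<Omega>" shows "Lop (rh c) x = 0"
proof -
  have "Lop (\<lambda>y. sqrt (rho2 c y)) x = inverse (sqrt (rho2 c x)) / 2 * Lop (rho2 c) x
     + (- (1/4) * inverse (rho2 c x * sqrt (rho2 c x))) * Gam (rho2 c) (rho2 c) x"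
    by (rule Lop_comp[OF smooth_rho2 x sqrt_deriv2(1)[OF rho2_pos] sqrt_deriv2(2)[OF rho2_pos[OF x]]])
  then show ?thesis unfolding rh_def[abs_def] using rho2_pos[OF x, of c]
    by (simp add: Lop_rho2[OF x] Gam_rho2_rho2[OF x] field_simps)
qed

lemma inverse_deriv2:
  assumes "y \<noteq> (0::real)"
  shows "(inverse has_real_derivative - (inverse y ^ 2)) (at y)"
    and "((\<lambda>y. - (inverse y ^ 2)) has_real_derivative 2 * inverse y ^ 3) (at y)"
  using assms by (auto intro!: derivative_eq_intros simp: field_simps power2_eq_square power3_eq_cube)

lemma smooth_inverse_rh: "smooth_fun \<Omega> (\<lambda>x. inverse (rh c x))"
  by (intro smooth_intros open_\<Omega> smooth_rh) (metis rh_pos less_irrefl)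

lemma Lop_div_rh:
  assumes x: "x \<in> \<Omega>" and s: "smooth_fun \<Omega> s"
  shows "Lop (\<lambda>y. s y / rh c y) x = Lop s x / rh c x + 2 * s x * S x / rh c x ^ 3 - 2 * Gam s (rh c) x / (rh c x)\<^sup>2"
proof -
  have nz: "rh c y \<noteq> 0" if "y \<in> \<Omega>" for y using rh_pos[OF that, of c] by simp
  have "Lop (\<lambda>y. inverse (rh c y)) x = - (inverse (rh c x) ^ 2) * Lop (rh c) x + (2 * inverse (rh c x) ^ 3) * Gam (rh c) (rh c) x"
    by (rule Lop_comp[OF smooth_rh x inverse_deriv2(1)[OF nz] inverse_deriv2(2)[OF nz[OF x]]])
  moreover have "Gam (\<lambda>y. inverse (rh c y)) s x = - (inverse (rh c x) ^ 2) * Gam (rh c) s x"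
    by (rule Gam_comp[OF smooth_rh x inverse_deriv2(1)[OF nz[OF x]]])
  ultimately show ?thesis
    unfolding divide_inverse Lop_mult[OF s smooth_inverse_rh x] Gam_commute[of s "\<lambda>y. inverse (rh c y)"] Gam_commute[of s "rh c"]
    by (simp add: Lop_rh[OF x] Gam_rh_rh[OF x] power_inverse algebra_simps)
qed

lemma Gam_div_rh:
  assumes x: "x \<in> \<Omega>" and s: "smooth_fun \<Omega> s"
  shows "Gam (\<lambda>y. s y / rh c y) t x = Gam s t x / rh c x - s x * Gam (rh c) t x / (rh c x)\<^sup>2"
proof -
  have nz: "rh c x \<noteq> 0" using rh_pos[OF x, of c] by simp
  have "Gam (\<lambda>y. inverse (rh c y)) t x = - (inverse (rh c x) ^ 2) * Gam (rh c) t x"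
    by (rule Gam_comp[OF smooth_rh x inverse_deriv2(1)[OF nz]])
  then show ?thesis unfolding divide_inverse Gam_mult[OF s smooth_inverse_rh x]
    by (simp add: power_inverse algebra_simps)
qed

lemma Lop_cs: assumes x: "x \<in> \<Omega>" shows "Lop (cs c) x = 0"
  unfolding cs_def[abs_def] Lop_div_rh[OF x smooth_Hc] Lop_Hc[OF x] Gam_Hc[OF x] Gam_H_rh[OF x]
  using rh_pos[OF x, of c] by (simp add: field_simps power3_eq_cube power2_eq_square)

lemma Gam_rh_cs: assumes x: "x \<in> \<Omega>" shows "Gam (rh c) (cs c) x = 0"
proof -
  have "Gam (cs c) (rh c) x = 0"
    unfolding cs_def[abs_def] Gam_div_rh[OF x smooth_Hc] Gam_Hc[OF x] Gam_H_rh[OF x] Gam_rh_rh[OF x]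
    using rh_pos[OF x, of c] by (simp add: field_simps power2_eq_square)
  then show ?thesis by (simp add: Gam_commute)
qed

lemma Gam_cs_cs: assumes x: "x \<in> \<Omega>" shows "Gam (cs c) (cs c) x = S x * (1 - (cs c x)\<^sup>2) / (rh c x)\<^sup>2"
proof -
  have 1: "Gam (cs c) H x = S x * (1 - (cs c x)\<^sup>2) / rh c x"
    unfolding cs_def[abs_def] Gam_div_rh[OF x smooth_Hc] Gam_Hc[OF x] Gam_commute[of "rh c" H] Gam_H_rh[OF x] S_def[symmetric]
    using rh_pos[OF x, of c] by (simp add: field_simps power2_eq_square)
  have "Gam (cs c) (cs c) x = Gam (\<lambda>y. (H y + c) / rh c y) (cs c) x" by (simp add: cs_def[abs_def])
  also have "\<dots> = Gam H (cs c) x / rh c x"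
    unfolding Gam_div_rh[OF x smooth_Hc] by (simp add: Gam_Hc[OF x] Gam_rh_cs[OF x])
  finally show ?thesis using 1 by (simp add: Gam_commute[of H "cs c"] power2_eq_square)
qed

text \<open>Separation of variables in polar coordinates. There is no mixed term, because
  \<open>rh\<close> and \<open>cs\<close> are orthogonal for \<open>Gam\<close>, so solutions of the
  ordinary equation \<open>(1 - s^2) p'' = - (m + 1) (m + 2) p\<close> give solutions of
  \<open>Lop\<close>.\<close>

lemma Lop_rh_power_poly:
  assumes x: "x \<in> \<Omega>"
  shows "Lop (\<lambda>y. rh c y ^ Suc (Suc m) * poly p (cs c y)) x
    = S x * rh c x ^ m * (real (Suc (Suc m)) * real (Suc m) * poly p (cs c x)
        + (1 - (cs c x)\<^sup>2) * poly (pderiv (pderiv p)) (cs c x))"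
proof -
  let ?k = "Suc (Suc m)"
  have sp: "smooth_fun \<Omega> (\<lambda>y. rh c y ^ ?k)" by (intro smooth_intros open_\<Omega> smooth_rh)
  have sq: "smooth_fun \<Omega> (\<lambda>y. poly p (cs c y))" by (intro smooth_fun_poly open_\<Omega> smooth_cs)
  have D: "((\<lambda>y::real. y ^ ?k) has_real_derivative real ?k * y ^ Suc m) (at y)" for y
    by (rule DERIV_cong[OF DERIV_pow]) simp
  have D': "((\<lambda>y::real. real ?k * y ^ Suc m) has_real_derivative real ?k * (real (Suc m) * y ^ m)) (at y)" for y
    by (intro DERIV_cmult DERIV_cong[OF DERIV_pow]) simp
  have "Lop (\<lambda>y. rh c y ^ ?k) x = (real ?k * rh c x ^ Suc m) * Lop (rh c) x + (real ?k * (real (Suc m) * rh c x ^ m)) * Gam (rh c) (rh c) x"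
    by (rule Lop_comp[OF smooth_rh x D D'])
  then have 1: "Lop (\<lambda>y. rh c y ^ ?k) x = real ?k * (real (Suc m) * rh c x ^ m) * S x"
    by (simp add: Lop_rh[OF x] Gam_rh_rh[OF x])
  have "Lop (\<lambda>y. poly p (cs c y)) x = poly (pderiv p) (cs c x) * Lop (cs c) x + poly (pderiv (pderiv p)) (cs c x) * Gam (cs c) (cs c) x"
    by (rule Lop_comp[OF smooth_cs x poly_DERIV poly_DERIV])
  then have 2: "Lop (\<lambda>y. poly p (cs c y)) x = poly (pderiv (pderiv p)) (cs c x) * (S x * (1 - (cs c x)\<^sup>2) / (rh c x)\<^sup>2)"
    by (simp add: Lop_cs[OF x] Gam_cs_cs[OF x])
  have "Gam (\<lambda>y. rh c y ^ ?k) (\<lambda>y. poly p (cs c y)) x = (real ?k * rh c x ^ Suc m) * Gam (rh c) (\<lambda>y. poly p (cs c y)) x"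
    by (rule Gam_comp[OF smooth_rh x D])
  also have "Gam (rh c) (\<lambda>y. poly p (cs c y)) x = poly (pderiv p) (cs c x) * Gam (cs c) (rh c) x"
    unfolding Gam_commute[of "rh c" "\<lambda>y. poly p (cs c y)"] by (rule Gam_comp[OF smooth_cs x poly_DERIV])
  finally have 3: "Gam (\<lambda>y. rh c y ^ ?k) (\<lambda>y. poly p (cs c y)) x = 0"
    using Gam_rh_cs[OF x, of c] by (simp add: Gam_commute[of "cs c" "rh c"])
  show ?thesis unfolding Lop_mult[OF sp sq x] 1 2 3
    using rh_pos[OF x, of c] by (simp add: field_simps power2_eq_square)
qed

text \<open>The barrier is the solution on the half-plane with boundary values \<open>- ln |2 (H + c)|\<close>.\<close>

definition barr :: "real \<Rightarrow> real^2 \<Rightarrow> real" where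
  "barr c x = 2 * rh c x - (1/2) * (((rh c x + (H x + c)) * ln (rh c x + (H x + c))
      + (rh c x - (H x + c)) * ln (rh c x - (H x + c))) / rh c x)"

lemma xlnx_deriv2:
  assumes "y > (0::real)"
  shows "((\<lambda>y. y * ln y) has_real_derivative ln y + 1) (at y)"
    and "((\<lambda>y. ln y + 1) has_real_derivative inverse y) (at y)"
  using assms by (auto intro!: derivative_eq_intros simp: field_simps)

lemma smooth_pm:
  "smooth_fun \<Omega> (\<lambda>x. rh c x + (H x + c))" "smooth_fun \<Omega> (\<lambda>x. rh c x - (H x + c))"
  by (intro smooth_intros open_\<Omega> smooth_rh smooth_H)+

lemma pm_pos: assumes "x \<in> \<Omega>" shows "rh c x + (H x + c) > 0" "rh c x - (H x + c) > 0"
  using abs_Hc_less[OF assms, of c] by linarith+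

lemma smooth_barr: "smooth_fun \<Omega> (barr c)"
  unfolding barr_def[abs_def]
  by (intro smooth_intros open_\<Omega> smooth_rh smooth_H pm_pos) (metis rh_pos less_irrefl)+

text \<open>Both \<open>A = rh + (H + c)\<close> and \<open>C = rh - (H + c)\<close> are solutions
  with \<open>Gam A A / A = 2 * S / rh\<close>, and likewise for \<open>C\<close>. So
  \<open>Lop\<close> takes \<open>A ln A\<close> and \<open>C ln C\<close> to
  \<open>2 * S / rh\<close>, and the division by \<open>rh\<close> cancels this.\<close>

lemma Lop_barr: assumes x: "x \<in> \<Omega>" shows "Lop (barr c) x = 0"
proof -
  let ?A = "\<lambda>x. rh c x + (H x + c)" and ?C = "\<lambda>x. rh c x - (H x + c)"
  let ?TA = "\<lambda>x. ?A x * ln (?A x)" and ?TC = "\<lambda>x. ?C x * ln (?C x)"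
  note [simp] = rh_pos[OF x, of c] rh_pos[OF x, of c, THEN less_imp_neq, THEN not_sym]
  have sT: "smooth_fun \<Omega> ?TA" "smooth_fun \<Omega> ?TC"
    by (intro smooth_intros open_\<Omega> smooth_rh smooth_H pm_pos | assumption)+
  have G1: "Gam ?A t x = Gam (rh c) t x + Gam H t x" "Gam ?C t x = Gam (rh c) t x - Gam H t x" for t
    by (simp_all add: Gam_add[OF smooth_rh smooth_Hc x] Gam_diff[OF smooth_rh smooth_Hc x] Gam_Hc[OF x])
  have GH: "Gam ?A H x = S x + (H x + c) * S x / rh c x" "Gam ?C H x = (H x + c) * S x / rh c x - S x"
    by (simp_all add: G1 Gam_commute[of "rh c" H] Gam_H_rh[OF x] S_def)
  have Gr: "Gam ?A (rh c) x = S x * ?A x / rh c x" "Gam ?C (rh c) x = S x * ?C x / rh c x"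
    unfolding G1 Gam_rh_rh[OF x] Gam_H_rh[OF x] by (simp_all add: field_simps)
  have GAA: "Gam ?A ?A x = 2 * S x * ?A x / rh c x" "Gam ?C ?C x = 2 * S x * ?C x / rh c x"
    unfolding G1(1)[of ?A] G1(2)[of ?C] Gam_commute[of "rh c" "?A"] Gam_commute[of H "?A"] Gam_commute[of "rh c" "?C"] Gam_commute[of H "?C"] GH Gr
    by (simp_all add: field_simps)
  have LA: "Lop ?A x = 0" "Lop ?C x = 0"
    by (simp_all add: Lop_add[OF smooth_rh smooth_Hc x] Lop_diff[OF smooth_rh smooth_Hc x] Lop_Hc[OF x] Lop_rh[OF x])
  have aux: "l * 0 + inverse a * (2 * s * a / r) = 2 * s / r" if "a > 0" for a l s r :: real
    using that by simp
  have "Lop ?TA x = (ln (?A x) + 1) * Lop ?A x + inverse (?A x) * Gam ?A ?A x"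
    by (rule Lop_comp[OF smooth_pm(1) x xlnx_deriv2(1)[OF pm_pos(1)] xlnx_deriv2(2)[OF pm_pos(1)[OF x]]])
  then have LTA: "Lop ?TA x = 2 * S x / rh c x" by (simp only: LA GAA aux[OF pm_pos(1)[OF x]])
  have "Lop ?TC x = (ln (?C x) + 1) * Lop ?C x + inverse (?C x) * Gam ?C ?C x"
    by (rule Lop_comp[OF smooth_pm(2) x xlnx_deriv2(1)[OF pm_pos(2)] xlnx_deriv2(2)[OF pm_pos(2)[OF x]]])
  then have LTC: "Lop ?TC x = 2 * S x / rh c x" by (simp only: LA GAA aux[OF pm_pos(2)[OF x]])
  have "Gam ?TA (rh c) x = (ln (?A x) + 1) * Gam ?A (rh c) x"
    by (rule Gam_comp[OF smooth_pm(1) x xlnx_deriv2(1)[OF pm_pos(1)[OF x]]])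
  moreover have "Gam ?TC (rh c) x = (ln (?C x) + 1) * Gam ?C (rh c) x"
    by (rule Gam_comp[OF smooth_pm(2) x xlnx_deriv2(1)[OF pm_pos(2)[OF x]]])
  ultimately have GT: "Gam (\<lambda>x. ?TA x + ?TC x) (rh c) x = S x * (?TA x + ?TC x + 2 * rh c x) / rh c x"
    unfolding Gam_add[OF sT x] Gr by (simp add: field_simps)
  have LT: "Lop (\<lambda>x. ?TA x + ?TC x) x = 4 * S x / rh c x"
    unfolding Lop_add[OF sT x] LTA LTC by simp
  have sTT: "smooth_fun \<Omega> (\<lambda>x. ?TA x + ?TC x)" by (intro smooth_intros open_\<Omega> sT)
  have "Lop (\<lambda>y. (?TA y + ?TC y) / rh c y) x = 0"
    unfolding Lop_div_rh[OF x sTT] GT LT by (simp add: field_simps power3_eq_cube power2_eq_square)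
  moreover have "smooth_fun \<Omega> (\<lambda>y. (?TA y + ?TC y) / rh c y)"
    by (intro smooth_intros open_\<Omega> sT smooth_rh) (metis rh_pos less_irrefl)
  ultimately show ?thesis unfolding barr_def[abs_def]
    by (simp only: Lop_diff[OF smooth_fun_mult[OF open_\<Omega> smooth_fun_const smooth_rh] smooth_fun_mult[OF open_\<Omega> smooth_fun_const] x]
        Lop_cmult[OF smooth_rh x] Lop_cmult[OF _ x] Lop_rh[OF x])
qed

text \<open>Both logarithms are at most \<open>ln (2 * rh)\<close> and their coefficients add up to
  \<open>2 * rh\<close>. The bound yields positivity as well as the blow-up at the centre.\<close>

lemma barr_ge: assumes x: "x \<in> \<Omega>" shows "barr c x \<ge> 2 * rh c x - ln (2 * rh c x)"
proof -
  let ?A = "rh c x + (H x + c)" and ?C = "rh c x - (H x + c)"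
  note p = pm_pos[OF x, of c] rh_pos[OF x, of c]
  have "?A * ln ?A + ?C * ln ?C \<le> ?A * ln (2 * rh c x) + ?C * ln (2 * rh c x)"
    using p by (intro add_mono mult_left_mono) auto
  also have "\<dots> = 2 * rh c x * ln (2 * rh c x)" by (simp add: algebra_simps)
  finally have "(?A * ln ?A + ?C * ln ?C) / rh c x \<le> 2 * ln (2 * rh c x)"
    using p by (simp add: field_simps)
  then show ?thesis unfolding barr_def by simp
qed

lemma barr_pos: assumes x: "x \<in> \<Omega>" shows "barr c x > 0"
  using barr_ge[OF x, of c] ln_less_self[of "2 * rh c x"] rh_pos[OF x, of c] by linarith

end

section \<open>Geometry of the moment polygon\<close>

text \<open>The quarter turn that takes normals to edge directions; it is also the passage from
  \<open>z\<close> to the coordinates \<open>x\<close> in \<open>x_chart\<close>.\<close>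

definition rot :: "real^2 \<Rightarrow> real^2" where "rot z = vector [z$2, - z$1]"

lemma rot_nth [simp]: "rot z $ 1 = z$2" "rot z $ 2 = - z$1"
  by (simp_all add: rot_def)

lemma rot_inner: "rot z \<bullet> v = det2 v z"
  by (simp add: inner_vec2 det2_def)

lemma rot_add: "rot (z + w) = rot z + rot w"
  and rot_diff: "rot (z - w) = rot z - rot w"
  and rot_scale: "rot (c *\<^sub>R z) = c *\<^sub>R rot z"
  by (simp_all add: vec_eq_iff forall_2)

lemma det2_add1: "det2 (a + b) c = det2 a c + det2 b c"
  and det2_add2: "det2 a (b + c) = det2 a b + det2 a c"
  and det2_diff1: "det2 (a - b) c = det2 a c - det2 b c"
  and det2_diff2: "det2 a (b - c) = det2 a b - det2 a c"
  and det2_scale1: "det2 (s *\<^sub>R a) c = s * det2 a c"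
  and det2_scale2: "det2 a (s *\<^sub>R c) = s * det2 a c"
  and det2_minus2: "det2 a (- c) = - det2 a c"
  and det2_self: "det2 a a = 0"
  and det2_swap: "det2 a b = - det2 b a"
  by (simp_all add: det2_def algebra_simps)

lemma det2_sum2: "det2 c (sum f A) = (\<Sum>i\<in>A. det2 c (f i))"
  by (induction A rule: infinite_finite_induct) (simp_all add: det2_add2, simp_all add: det2_def)

lemma det2_plucker: "det2 a d * det2 b c = det2 a c * det2 b d - det2 a b * det2 c d"
  by (simp add: det2_def algebra_simps)

lemma inner_determines:
  fixes x y :: "real^2"
  assumes "det2 a b \<noteq> 0" "x \<bullet> a = y \<bullet> a" "x \<bullet> b = y \<bullet> b"
  shows "x = y"
proof -
  have "det2 a b * (x - y)$1 = b$2 * ((x - y) \<bullet> a) - a$2 * ((x - y) \<bullet> b)"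
    "det2 a b * (x - y)$2 = a$1 * ((x - y) \<bullet> b) - b$1 * ((x - y) \<bullet> a)"
    by (simp_all add: det2_def inner_vec2 algebra_simps)
  then show ?thesis using assms by (simp add: inner_diff_left vec_eq_iff forall_2)
qed

locale moment_polygon =
  fixes d :: nat and \<nu> :: "nat \<Rightarrow> int^2" and lam :: "nat \<Rightarrow> real"
  assumes su: "strictly_unbounded d \<nu> lam"
begin

definition nv :: "nat \<Rightarrow> real^2" where "nv i = real_vec (\<nu> i)"
abbreviation ll :: "nat \<Rightarrow> real^2 \<Rightarrow> real" where "ll \<equiv> ell \<nu> lam"
abbreviation P :: "(real^2) set" where "P \<equiv> polytope_of d \<nu> lam"
abbreviation eg :: "nat \<Rightarrow> (real^2) set" where "eg \<equiv> edge d \<nu> lam"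
text \<open>Oriented so that \<open>ll (Suc i)\<close> has slope 1 along edge \<open>i\<close>: the
  vector leads away from edge \<open>i + 1\<close>, towards the end of the boundary on edge
  1.\<close>

definition ev :: "nat \<Rightarrow> real^2" where "ev i = rot (nv i)"
abbreviation DD :: "nat \<Rightarrow> nat \<Rightarrow> real" where "DD i j \<equiv> det2 (nv i) (nv j)"

lemma edge_direction_eq: "edge_direction \<nu> i = ev i"
  by (simp add: edge_direction_def ev_def rot_def nv_def real_vec_def)

lemma ll_eq: "ll i x = x \<bullet> nv i + lam i"
  by (simp add: ell_def nv_def)

lemma ll_add: "ll i (x + v) = ll i x + v \<bullet> nv i"
  by (simp add: ll_eq inner_add_left)

lemma ev_nv: "ev i \<bullet> nv j = - DD i j"
  by (simp add: ev_def rot_inner) (rule det2_swap)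

lemma d2: "2 \<le> d" using su by (simp add: strictly_unbounded_def)

lemma DD_Suc: "1 \<le> i \<Longrightarrow> i < d \<Longrightarrow> DD i (Suc i) = -1"
  using su by (simp add: strictly_unbounded_def nv_def)

lemma DD_Suc': "1 \<le> i \<Longrightarrow> i < d \<Longrightarrow> DD (Suc i) i = 1"
  using DD_Suc[of i] det2_swap[of "nv (Suc i)" "nv i"] by simp

lemma mem_P: "x \<in> P \<longleftrightarrow> (\<forall>i\<in>{1..d}. ll i x \<ge> 0)"
  by (simp add: polytope_of_def)

lemma mem_eg: "x \<in> eg i \<longleftrightarrow> x \<in> P \<and> ll i x = 0"
  by (simp add: edge_def)

lemma ll_ge: "ll i x \<ge> 0 \<longleftrightarrow> nv i \<bullet> x \<ge> - lam i"
  and ll_gt: "ll i x > 0 \<longleftrightarrow> nv i \<bullet> x > - lam i"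
  and ll_0: "ll i x = 0 \<longleftrightarrow> nv i \<bullet> x = - lam i"
  by (simp_all add: ll_eq inner_commute[of x]) linarith+

lemma convex_P: "convex P"
proof -
  have "P = (\<Inter>i\<in>{1..d}. {x. nv i \<bullet> x \<ge> - lam i})"
    by (auto simp: mem_P ll_ge)
  then show ?thesis by (auto intro!: convex_INT convex_halfspace_ge)
qed

lemma closed_P: "closed P"
proof -
  have "P = (\<Inter>i\<in>{1..d}. {x. nv i \<bullet> x \<ge> - lam i})"
    by (auto simp: mem_P ll_ge)
  then show ?thesis by (auto intro!: closed_INT closed_halfspace_ge)
qed

lemma convex_eg: "convex (eg i)"
proof -
  have "eg i = P \<inter> {x. nv i \<bullet> x = - lam i}"
    by (auto simp: mem_eg ll_0)
  then show ?thesis by (simp add: convex_Int convex_P convex_hyperplane)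
qed

lemma eg_two_points:
  assumes "i \<in> {1..d}"
  obtains x y where "x \<in> eg i" "y \<in> eg i" "x \<noteq> y"
proof -
  have "aff_dim (eg i) = 1"
    using su assms by (simp add: strictly_unbounded_def edge_of_def)
  then show ?thesis using that
    by (metis aff_dim_empty aff_dim_sing is_singletonI' is_singleton_def one_neq_neg_one zero_neq_one)
qed

lemma line_param:
  assumes i: "1 \<le> i" "i < d" and "ll i x = 0" "ll i y = 0"
  shows "x = y + (ll (Suc i) x - ll (Suc i) y) *\<^sub>R ev i"
    and "x = y - (ll i x - ll i y) *\<^sub>R ev (Suc i) + (ll (Suc i) x - ll (Suc i) y) *\<^sub>R ev i"
proof -
  have "x = y + (ll (Suc i) x - ll (Suc i) y) *\<^sub>R ev i"
  proof (rule inner_determines[of "nv i" "nv (Suc i)"])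
    show "DD i (Suc i) \<noteq> 0" using DD_Suc[OF i] by simp
    show "x \<bullet> nv i = (y + (ll (Suc i) x - ll (Suc i) y) *\<^sub>R ev i) \<bullet> nv i"
      using assms by (simp add: inner_add_left ev_nv det2_self ll_eq)
    show "x \<bullet> nv (Suc i) = (y + (ll (Suc i) x - ll (Suc i) y) *\<^sub>R ev i) \<bullet> nv (Suc i)"
      by (simp add: inner_add_left ev_nv DD_Suc[OF i] ll_eq)
  qed
  then show "x = y + (ll (Suc i) x - ll (Suc i) y) *\<^sub>R ev i"
    "x = y - (ll i x - ll i y) *\<^sub>R ev (Suc i) + (ll (Suc i) x - ll (Suc i) y) *\<^sub>R ev i" using assms by simp_all
qed

lemma line_param':
  assumes i: "1 \<le> i" "i < d" and "ll (Suc i) x = 0" "ll (Suc i) y = 0"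
  shows "x = y - (ll i x - ll i y) *\<^sub>R ev (Suc i)"
proof (rule inner_determines[of "nv i" "nv (Suc i)"])
  show "DD i (Suc i) \<noteq> 0" using DD_Suc[OF i] by simp
  show "x \<bullet> nv i = (y - (ll i x - ll i y) *\<^sub>R ev (Suc i)) \<bullet> nv i"
    by (simp add: inner_diff_left ev_nv DD_Suc'[OF i] ll_eq)
  show "x \<bullet> nv (Suc i) = (y - (ll i x - ll i y) *\<^sub>R ev (Suc i)) \<bullet> nv (Suc i)"
    using assms by (simp add: inner_diff_left ev_nv det2_self ll_eq)
qed

text \<open>If some \<open>ll i\<close> decreased along the ray, the polygon would cut the ray off
  at a finite length.\<close>

lemma unbounded_ray_nonneg:
  fixes p :: "real^2"
  assumes unb: "\<not> bounded E" and E: "\<And>x. x \<in> E \<Longrightarrow> x \<in> P \<and> (\<exists>t\<ge>0. x = p + t *\<^sub>R v)" and i: "i \<in> {1..d}"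
  shows "v \<bullet> nv i \<ge> 0"
proof (rule ccontr)
  assume neg: "\<not> ?thesis"
  have "bounded E"
  proof (rule boundedI)
    fix x assume "x \<in> E"
    then obtain t where t: "t \<ge> 0" "x = p + t *\<^sub>R v" "x \<in> P" using E by blast
    then have "ll i p + t * (v \<bullet> nv i) \<ge> 0" using i by (auto simp: mem_P ll_add)
    then have "t \<le> ll i p / - (v \<bullet> nv i)" using neg by (simp add: field_simps)
    then have "t * norm v \<le> ll i p / - (v \<bullet> nv i) * norm v" by (intro mult_right_mono) auto
    then show "norm x \<le> norm p + ll i p / - (v \<bullet> nv i) * norm v"
      using t norm_triangle_ineq[of p "t *\<^sub>R v"] by simp
  qed
  then show False using unb by simp
qed

lemma DD_1: assumes "i \<in> {1..d}" shows "DD 1 i \<le> 0"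
proof -
  obtain p where p: "p \<in> eg 1" using eg_two_points[of 1] d2 by auto
  have "ev 1 \<bullet> nv i \<ge> 0"
  proof (rule unbounded_ray_nonneg[of "eg 1" "p - ll 2 p *\<^sub>R ev 1"])
    show "\<not> bounded (eg 1)" using su by (simp add: strictly_unbounded_def)
    fix x assume x: "x \<in> eg 1"
    have "x = p + (ll (Suc 1) x - ll (Suc 1) p) *\<^sub>R ev 1"
      by (rule line_param(1)) (use x p d2 in \<open>auto simp: mem_eg\<close>)
    moreover have "ll 2 x \<ge> 0" using x d2 by (auto simp: mem_eg mem_P)
    ultimately show "x \<in> P \<and> (\<exists>t\<ge>0. x = p - ll 2 p *\<^sub>R ev 1 + t *\<^sub>R ev 1)"
      using x by (auto simp: mem_eg numeral_2_eq_2 algebra_simps)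
  qed (use assms in auto)
  then show ?thesis by (simp add: ev_nv)
qed

lemma DD_d: assumes "i \<in> {1..d}" shows "DD i d \<le> 0"
proof -
  obtain p where p: "p \<in> eg d" using eg_two_points[of d] d2 by auto
  obtain c where c: "d = Suc c" "1 \<le> c" using d2 by (cases d) auto
  have "(- ev d) \<bullet> nv i \<ge> 0"
  proof (rule unbounded_ray_nonneg[of "eg d" "p + ll c p *\<^sub>R ev d"])
    show "\<not> bounded (eg d)" using su by (simp add: strictly_unbounded_def)
    fix x assume x: "x \<in> eg d"
    have "x = p - (ll c x - ll c p) *\<^sub>R ev (Suc c)"
      by (rule line_param') (use x[unfolded mem_eg] p[unfolded mem_eg] c in auto)
    moreover have "ll c x \<ge> 0" using x[unfolded mem_eg mem_P] c by simp
    moreover have "p - (ll c x - ll c p) *\<^sub>R ev (Suc c) = p + ll c p *\<^sub>R ev d + ll c x *\<^sub>R (- ev d)"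
      by (simp add: c(1) algebra_simps)
    moreover have "x \<in> P" using x by (simp add: mem_eg)
    ultimately show "x \<in> P \<and> (\<exists>t\<ge>0. x = p + ll c p *\<^sub>R ev d + t *\<^sub>R (- ev d))"
      by metis
  qed (use assms in auto)
  then show ?thesis using det2_swap[of "nv i" "nv d"] by (simp add: ev_nv)
qed

lemma DD_1d: "DD 1 d < 0"
  using DD_1[of d] d2 su by (simp add: strictly_unbounded_def nv_def)

text \<open>All normals lie in the cone of \<open>nv 1\<close> and \<open>nv d\<close>, where
  \<open>A i\<close> and \<open>B i\<close> are their coordinates up to a common positive factor.
  The determinants of neighbours force \<open>B / A\<close> to increase strictly, that is, the
  normals turn in one direction.\<close>

lemma DD_neg:
  assumes "1 \<le> i" "i < j" "j \<le> d"
  shows "DD i j < 0"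
proof -
  define A B where "A i = - DD i d" and "B i = - DD 1 i" for i
  have nn: "A i \<ge> 0" "B i \<ge> 0" if "i \<in> {1..d}" for i
    using DD_1[OF that] DD_d[OF that] by (auto simp: A_def B_def)
  have plu: "DD 1 d * DD i j = B j * A i - B i * A j" for i j
    unfolding A_def B_def using det2_plucker[of "nv 1" "nv d" "nv i" "nv j"] by (simp add: algebra_simps)
  have step: "B (Suc i) * A i - B i * A (Suc i) > 0" if "1 \<le> i" "i < d" for i
    using plu[of i "Suc i"] DD_Suc[OF that] DD_1d by simp
  have Apos: "A i > 0" if "1 \<le> i" "i < d" for i
  proof -
    have "B (Suc i) * A i > 0" using step[OF that] nn[of i] nn[of "Suc i"] that
      by (smt (verit) atLeastAtMost_iff less_imp_le Suc_leI le_SucI mult_nonneg_nonneg)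
    then show ?thesis using nn[of i] that by (auto simp: zero_less_mult_iff less_le)
  qed
  have "B j * A i - B i * A j > 0" if "i < j" "j \<le> d" for j
    using that
  proof (induction j)
    case (Suc j)
    show ?case
    proof (cases "i = j")
      case True then show ?thesis using step[of j] Suc assms by auto
    next
      case False
      then have ij: "i < j" "j < d" using Suc by auto
      have IH: "B j * A i - B i * A j > 0" using Suc ij by simp
      have "A j * (B (Suc j) * A i - B i * A (Suc j)) = A i * (B (Suc j) * A j - B j * A (Suc j))
         + A (Suc j) * (B j * A i - B i * A j)" by (simp add: algebra_simps)
      also have "\<dots> > 0" using step[of j] IH Apos[of i] nn(1)[of "Suc j"] ij assms
        by (intro add_pos_nonneg mult_pos_pos mult_nonneg_nonneg) auto
      finally show ?thesis using Apos[of j] ij assms by (simp add: zero_less_mult_iff)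
    qed
  qed simp
  then have "DD 1 d * DD i j > 0" using plu assms by simp
  then show ?thesis using DD_1d by (simp add: zero_less_mult_iff)
qed

text \<open>Otherwise \<open>nv (Suc i)\<close> would be a positive combination of
  \<open>nv i\<close> and \<open>nv j\<close>, and the edge \<open>i + 1\<close> could contain no
  point but \<open>b\<close>.\<close>

lemma active_consecutive:
  assumes b: "b \<in> P" and ij: "1 \<le> i" "i < j" "j \<le> d" and 0: "ll i b = 0" "ll j b = 0"
  shows "j = Suc i"
proof (rule ccontr)
  assume "j \<noteq> Suc i"
  then have k: "i < Suc i" "Suc i < j" using ij by auto
  let ?k = "Suc i"
  obtain x y where xy: "x \<in> eg ?k" "y \<in> eg ?k" "x \<noteq> y" using eg_two_points[of ?k] k ij by auto
  have "x = b" if x: "x \<in> eg ?k" for x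
  proof (rule inner_determines[of "nv i" "nv j"])
    show nz: "DD i j \<noteq> 0" using DD_neg[OF ij] by simp
    have "DD i j *\<^sub>R nv ?k = DD ?k j *\<^sub>R nv i + DD i ?k *\<^sub>R nv j"
      by (simp add: vec_eq_iff forall_2 det2_def algebra_simps)
    from arg_cong[OF this, of "\<lambda>v. (x - b) \<bullet> v"]
    have "DD i j * ((x - b) \<bullet> nv ?k) = DD ?k j * ((x - b) \<bullet> nv i) + DD i ?k * ((x - b) \<bullet> nv j)"
      by (simp only: inner_add_right inner_scaleR_right)
    moreover have "(x - b) \<bullet> nv ?k = ll ?k x - ll ?k b" "(x - b) \<bullet> nv i = ll i x" "(x - b) \<bullet> nv j = ll j x"
      using 0 by (simp_all add: ll_eq inner_diff_left)
    ultimately have e: "DD i j * (ll ?k x - ll ?k b) = DD ?k j * ll i x + DD i ?k * ll j x" by simp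
    have p: "ll ?k x = 0" "ll ?k b \<ge> 0" "ll i x \<ge> 0" "ll j x \<ge> 0"
      using x b k ij by (auto simp: mem_eg mem_P)
    have n: "DD ?k j < 0" "DD i ?k < 0" "DD i j < 0" using DD_neg k ij by auto
    have "DD i j * (ll ?k x - ll ?k b) \<ge> 0" using p n by (intro mult_nonpos_nonpos) auto
    moreover have "DD ?k j * ll i x \<le> 0" "DD i ?k * ll j x \<le> 0"
      using p n by (auto intro!: mult_nonpos_nonneg)
    ultimately have "DD ?k j * ll i x + DD i ?k * ll j x \<ge> 0" "DD ?k j * ll i x \<le> 0" "DD i ?k * ll j x \<le> 0"
      using e by linarith+
    then have "DD ?k j * ll i x = 0" "DD i ?k * ll j x = 0" by linarith+
    then have "ll i x = 0" "ll j x = 0" using n by auto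
    then show "x \<bullet> nv i = b \<bullet> nv i" "x \<bullet> nv j = b \<bullet> nv j" using 0 by (simp_all add: ll_eq)
  qed
  then show False using xy by blast
qed

lemma nv_nz: "i \<in> {1..d} \<Longrightarrow> nv i \<noteq> 0"
proof
  assume i: "i \<in> {1..d}" and "nv i = 0"
  then have "DD i j = 0" "DD j i = 0" for j by (simp_all add: det2_def)
  moreover have "i < d \<or> 1 < i" using i d2 by auto
  ultimately show False using DD_neg[of i d] DD_neg[of 1 i] i by auto
qed

lemma interior_P: "interior P = {x. \<forall>i\<in>{1..d}. ll i x > 0}"
proof
  have "open {x. \<forall>i\<in>{1..d}. ll i x > 0}"
  proof -
    have "{x. \<forall>i\<in>{1..d}. ll i x > 0} = (\<Inter>i\<in>{1..d}. {x. nv i \<bullet> x > - lam i})"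
      by (auto simp: ll_gt)
    then show ?thesis by (auto intro!: open_INT open_halfspace_gt)
  qed
  then show "{x. \<forall>i\<in>{1..d}. ll i x > 0} \<subseteq> interior P"
    by (intro interior_maximal) (auto simp: mem_P less_imp_le)
  show "interior P \<subseteq> {x. \<forall>i\<in>{1..d}. ll i x > 0}"
  proof safe
    fix x i assume x: "x \<in> interior P" and i: "i \<in> {1..d}"
    then obtain e where e: "e > 0" "cball x e \<subseteq> P" by (meson mem_interior_cball)
    let ?y = "x - (e / norm (nv i)) *\<^sub>R nv i"
    have "?y \<in> P" using e nv_nz[OF i] by (auto intro!: subsetD[OF e(2)] simp: dist_norm)
    then have "0 \<le> ll i ?y" using i by (auto simp: mem_P)
    also have "ll i ?y = ll i x - e / norm (nv i) * (nv i \<bullet> nv i)"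
      by (simp add: ll_eq inner_diff_left)
    finally show "ll i x > 0" using e nv_nz[OF i]
      by (smt (verit) inner_gt_zero_iff mult_pos_pos zero_less_divide_iff zero_less_norm_iff)
  qed
qed

text \<open>The sum of the directions of the two unbounded edges. It lies inside the recession cone,
  so that translation by it moves all of \<open>P\<close> into the interior.\<close>

definition wv :: "real^2" where "wv = ev 1 - ev d"

lemma wv_nv: assumes i: "i \<in> {1..d}" shows "wv \<bullet> nv i > 0"
proof -
  have "wv \<bullet> nv i = - DD 1 i - DD i d"
    using det2_swap[of "nv d" "nv i"] by (simp add: wv_def inner_diff_left ev_nv)
  moreover have "DD 1 i \<le> 0" "DD i d \<le> 0" using DD_1[OF i] DD_d[OF i] by auto
  moreover have "i < d \<or> 1 < i" using i d2 by auto
  ultimately show ?thesis using DD_neg[of i d] DD_neg[of 1 i] i by auto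
qed

lemma push_in: "b \<in> P \<Longrightarrow> t > 0 \<Longrightarrow> b + t *\<^sub>R wv \<in> interior P"
  using wv_nv by (auto simp: interior_P mem_P ll_add intro!: add_nonneg_pos)

lemma interior_nonempty: "interior P \<noteq> {}"
proof -
  obtain x where "x \<in> eg 1" using eg_two_points[of 1] d2 by auto
  then show ?thesis using push_in[of x 1] by (auto simp: mem_eg)
qed

lemma closure_interior_P: "closure (interior P) = P"
  using convex_closure_interior[OF convex_P interior_nonempty] closed_P by simp

lemma mem_frontier: "b \<in> frontier (interior P) \<longleftrightarrow> b \<in> P \<and> (\<exists>i\<in>{1..d}. ll i b = 0)"
proof -
  have "frontier (interior P) = P - interior P"
    by (simp add: frontier_def closure_interior_P)
  then show ?thesis by (auto simp: interior_P mem_P less_le)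
qed

text \<open>An affine function that is proper on \<open>P\<close>, because \<open>nv 1\<close> and
  \<open>nv d\<close> are linearly independent. It measures the distance to infinity.\<close>

definition ff :: "real^2 \<Rightarrow> real" where "ff x = ll 1 x + ll d x"

lemma ff_nonneg: "x \<in> P \<Longrightarrow> ff x \<ge> 0"
  using d2 by (auto simp: ff_def mem_P)

lemma ff_affine: "ff x = x \<bullet> (nv 1 + nv d) + (lam 1 + lam d)"
  by (simp add: ff_def ll_eq inner_add_right)

lemma bounded_ff: "bounded {x \<in> P. ff x \<le> N}"
proof -
  have D: "DD 1 d \<noteq> 0" using DD_1d by simp
  define C where "C = (\<bar>nv 1$1\<bar> + \<bar>nv 1$2\<bar> + \<bar>nv d$1\<bar> + \<bar>nv d$2\<bar>) / \<bar>DD 1 d\<bar>"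
  have C0: "C \<ge> 0" by (simp add: C_def)
  have key: "norm x \<le> 2 * C * (\<bar>x \<bullet> nv 1\<bar> + \<bar>x \<bullet> nv d\<bar>)" for x
  proof -
    have e: "DD 1 d * x$1 = nv d$2 * (x \<bullet> nv 1) - nv 1$2 * (x \<bullet> nv d)"
      "DD 1 d * x$2 = nv 1$1 * (x \<bullet> nv d) - nv d$1 * (x \<bullet> nv 1)"
      by (simp_all add: det2_def inner_vec2 algebra_simps)
    have comp: "\<bar>DD 1 d\<bar> * \<bar>x$i\<bar> \<le> (C * \<bar>DD 1 d\<bar>) * (\<bar>x \<bullet> nv 1\<bar> + \<bar>x \<bullet> nv d\<bar>)" for i
    proof -
      have CD: "C * \<bar>DD 1 d\<bar> = \<bar>nv 1$1\<bar> + \<bar>nv 1$2\<bar> + \<bar>nv d$1\<bar> + \<bar>nv d$2\<bar>" using D by (simp add: C_def)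
      have ab: "\<bar>a * p - b * q\<bar> \<le> (C * \<bar>DD 1 d\<bar>) * (\<bar>p\<bar> + \<bar>q\<bar>)" if "\<bar>a\<bar> \<le> C * \<bar>DD 1 d\<bar>" "\<bar>b\<bar> \<le> C * \<bar>DD 1 d\<bar>" for a b p q :: real
      proof -
        have "\<bar>a * p - b * q\<bar> \<le> \<bar>a\<bar> * \<bar>p\<bar> + \<bar>b\<bar> * \<bar>q\<bar>" by (metis abs_mult abs_triangle_ineq4)
        also have "\<dots> \<le> (C * \<bar>DD 1 d\<bar>) * \<bar>p\<bar> + (C * \<bar>DD 1 d\<bar>) * \<bar>q\<bar>"
          using that by (intro add_mono mult_right_mono) auto
        finally show ?thesis by (simp add: algebra_simps)
      qed
      show ?thesis
      proof (cases "i = 1")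
        case True
        then show ?thesis using ab[of "nv d$2" "nv 1$2" "x \<bullet> nv 1" "x \<bullet> nv d"] e(1) CD by (simp add: abs_mult[symmetric])
      next
        case False
        then have "i = 2" using exhaust_2 by blast
        then show ?thesis using ab[of "nv 1$1" "nv d$1" "x \<bullet> nv d" "x \<bullet> nv 1"] e(2) CD
          by (simp add: abs_mult[symmetric] add.commute)
      qed
    qed
    have "\<bar>x$i\<bar> \<le> C * (\<bar>x \<bullet> nv 1\<bar> + \<bar>x \<bullet> nv d\<bar>)" for i
    proof -
      have "\<bar>DD 1 d\<bar> * \<bar>x$i\<bar> \<le> \<bar>DD 1 d\<bar> * (C * (\<bar>x \<bullet> nv 1\<bar> + \<bar>x \<bullet> nv d\<bar>))"
        using comp[of i] by (simp only: mult_ac)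
      then show ?thesis using D by (simp only: mult_le_cancel_left_pos zero_less_abs_iff not_False_eq_True)
    qed
    from this[of 1] this[of 2] have "\<bar>x$1\<bar> + \<bar>x$2\<bar> \<le> 2 * C * (\<bar>x \<bullet> nv 1\<bar> + \<bar>x \<bullet> nv d\<bar>)" by linarith
    moreover have "norm x \<le> \<bar>x$1\<bar> + \<bar>x$2\<bar>" using norm_le_l1_cart[of x] by (simp add: sum_2)
    ultimately show ?thesis by linarith
  qed
  show ?thesis
  proof (rule boundedI)
    fix x assume x: "x \<in> {x \<in> P. ff x \<le> N}"
    then have "ll 1 x \<ge> 0" "ll d x \<ge> 0" using d2 by (auto simp: mem_P)
    then have "\<bar>x \<bullet> nv 1\<bar> + \<bar>x \<bullet> nv d\<bar> \<le> 2 * N + 2 * \<bar>lam 1\<bar> + 2 * \<bar>lam d\<bar>" using x unfolding ff_def ll_eq mem_Collect_eq by linarith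
    then show "norm x \<le> 2 * C * (2 * N + 2 * \<bar>lam 1\<bar> + 2 * \<bar>lam d\<bar>)"
      using key[of x] C0 by (meson mult_left_mono order_trans mult_nonneg_nonneg zero_le_numeral)
  qed
qed

section \<open>The vertices and the constants \<open>ap\<close>\<close>

abbreviation ap :: "nat \<Rightarrow> real" where "ap \<equiv> a_prime d \<nu> lam"
abbreviation sh :: "real^2" where "sh \<equiv> normal_shift \<nu> lam"
abbreviation lams :: "nat \<Rightarrow> real" where "lams \<equiv> lam_shifted \<nu> lam"

lemma lams_eq: "lams i = lam i - sh \<bullet> nv i"
  by (simp add: lam_shifted_def nv_def)

lemma lams_1: "lams 1 = 0"
proof -
  have "nv 1 \<bullet> nv 1 \<noteq> 0" using nv_nz[of 1] d2 by simp
  then show ?thesis by (simp add: lams_eq normal_shift_def nv_def[symmetric])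
qed

lemma ll_shift: "ll i (rot z - sh) = det2 (nv i) z + lams i"
  by (simp add: ll_eq lams_eq inner_diff_left rot_inner)

lemma ap_system:
  assumes "j \<in> {1..d-1}"
  shows "(\<Sum>i=1..j. ap i * det2 (nv (Suc i) - nv i) (nv (Suc j))) = lams (Suc j)"
proof -
  have "\<exists>a'. \<forall>j\<in>{1..n}. (\<Sum>i=1..j. a' i * det2 (nv (Suc i) - nv i) (nv (Suc j))) = lams (Suc j)" if "n \<le> d - 1" for n
    using that
  proof (induction n)
    case (Suc n)
    then obtain a' where a': "\<forall>j\<in>{1..n}. (\<Sum>i=1..j. a' i * det2 (nv (Suc i) - nv i) (nv (Suc j))) = lams (Suc j)" by auto
    define b where "b = a'(Suc n := lams (Suc (Suc n)) - (\<Sum>i=1..n. a' i * det2 (nv (Suc i) - nv i) (nv (Suc (Suc n)))))"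
    have "(\<Sum>i=1..j. b i * det2 (nv (Suc i) - nv i) (nv (Suc j))) = lams (Suc j)" if "j \<in> {1..Suc n}" for j
    proof (cases "j = Suc n")
      case False
      have "(\<Sum>i=1..j. b i * det2 (nv (Suc i) - nv i) (nv (Suc j))) = (\<Sum>i=1..j. a' i * det2 (nv (Suc i) - nv i) (nv (Suc j)))"
        by (rule sum.cong) (use False that in \<open>auto simp: b_def\<close>)
      then show ?thesis using a' False that by auto
    next
      case True
      have "(\<Sum>i=1..n. b i * det2 (nv (Suc i) - nv i) (nv (Suc (Suc n)))) = (\<Sum>i=1..n. a' i * det2 (nv (Suc i) - nv i) (nv (Suc (Suc n))))"
        by (rule sum.cong) (auto simp: b_def)
      moreover have "det2 (nv (Suc (Suc n)) - nv (Suc n)) (nv (Suc (Suc n))) = 1"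
        using DD_Suc[of "Suc n"] Suc.prems by (simp add: det2_diff1 det2_self)
      ultimately show ?thesis unfolding True by (simp add: b_def)
    qed
    then show ?case by blast
  qed simp
  then obtain a' where a': "\<forall>j\<in>{1..d-1}. (\<Sum>i=1..j. a' i * det2 (nv (Suc i) - nv i) (nv (Suc j))) = lams (Suc j)"
    by blast
  have "\<forall>j\<in>{1..d-1}. (\<Sum>i=1..j. ap i * det2 (real_vec (\<nu> (i+1)) - real_vec (\<nu> i)) (real_vec (\<nu> (j+1)))) = lams (j+1)"
    unfolding a_prime_def by (rule someI[of _ a']) (use a' in \<open>simp add: nv_def\<close>)
  then show ?thesis using assms by (simp add: nv_def)
qed

text \<open>The value of the model map for empty \<open>I\<close> at \<open>H = - ap j\<close>,
  \<open>r = 0\<close>. The triangular system for \<open>ap\<close> says exactly that the resulting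
  point \<open>vx j\<close> is the vertex on the edges \<open>j\<close> and
  \<open>j + 1\<close>.\<close>

definition zv :: "nat \<Rightarrow> real^2" where
  "zv j = (\<Sum>i\<in>{1..<j}. ap i *\<^sub>R (nv (Suc i) - nv i)) - ap j *\<^sub>R nv j"

definition vx :: "nat \<Rightarrow> real^2" where "vx j = rot (zv j) - sh"

lemma zv_alt:
  assumes "1 \<le> j"
  shows "zv j = (\<Sum>i\<in>{1..j}. ap i *\<^sub>R (nv (Suc i) - nv i)) - ap j *\<^sub>R nv (Suc j)"
proof -
  have "{1..j} = insert j {1..<j}" using assms by auto
  then show ?thesis by (simp add: zv_def algebra_simps)
qed

lemma ll_vx:
  assumes j: "1 \<le> j" "j < d"
  shows "ll j (vx j) = 0" "ll (Suc j) (vx j) = 0"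
proof -
  show "ll j (vx j) = 0"
  proof (cases "j = 1")
    case True then show ?thesis using lams_1 by (simp add: vx_def ll_shift zv_def det2_minus2 det2_scale2 det2_self)
  next
    case False
    then obtain k where k: "j = Suc k" "1 \<le> k" using j by (cases j) auto
    have "{1..<Suc k} = {1..k}" by auto
    then have "det2 (nv j) (zv j) = (\<Sum>i=1..k. ap i * det2 (nv (Suc k)) (nv (Suc i) - nv i))"
      by (simp add: zv_def k det2_diff2 det2_scale2 det2_self det2_sum2)
    also have "\<dots> = - (\<Sum>i=1..k. ap i * det2 (nv (Suc i) - nv i) (nv (Suc k)))"
      by (simp add: sum_negf[symmetric] det2_swap[of "nv (Suc k)" "nv (Suc _) - nv _"])
    finally show ?thesis using ap_system[of k] k j by (simp add: vx_def ll_shift)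
  qed
  have "det2 (nv (Suc j)) (zv j) = (\<Sum>i=1..j. ap i * det2 (nv (Suc j)) (nv (Suc i) - nv i))"
    by (simp add: zv_alt[OF j(1)] det2_diff2 det2_scale2 det2_self det2_sum2)
  also have "\<dots> = - (\<Sum>i=1..j. ap i * det2 (nv (Suc i) - nv i) (nv (Suc j)))"
    by (simp add: sum_negf[symmetric] det2_swap[of "nv (Suc j)" "nv (Suc _) - nv _"])
  finally show "ll (Suc j) (vx j) = 0" using ap_system[of j] j by (simp add: vx_def ll_shift)
qed

lemma vx_in_P: assumes j: "1 \<le> j" "j < d" shows "vx j \<in> P"
proof -
  have "eg j \<inter> eg (Suc j) \<noteq> {}" using su j by (simp add: strictly_unbounded_def)
  then obtain p where p: "p \<in> P" "ll j p = 0" "ll (Suc j) p = 0" by (auto simp: mem_eg)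
  have "vx j = p + (ll (Suc j) (vx j) - ll (Suc j) p) *\<^sub>R ev j"
    by (rule line_param(1)) (use j p ll_vx[OF j] in auto)
  then show ?thesis using p ll_vx[OF j] by simp
qed

lemma vx_step:
  assumes j: "1 \<le> j" "Suc j < d"
  shows "vx (Suc j) = vx j - (ap (Suc j) - ap j) *\<^sub>R ev (Suc j)"
proof -
  have "{1..<Suc j} = {1..j}" by auto
  then have "zv (Suc j) = zv j - (ap (Suc j) - ap j) *\<^sub>R nv (Suc j)"
    unfolding zv_alt[OF j(1)] by (simp add: zv_def algebra_simps)
  then show ?thesis by (simp add: vx_def rot_diff rot_scale ev_def)
qed

text \<open>By \<open>vx_step\<close> the difference is the signed affine length of edge
  \<open>j + 1\<close>. It cannot vanish, since then the vertex \<open>vx j\<close> would lie on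
  edge \<open>j + 2\<close> as well.\<close>

lemma ap_less:
  assumes j: "1 \<le> j" "Suc j < d"
  shows "ap j < ap (Suc j)"
proof -
  let ?k = "Suc (Suc j)"
  have "ll ?k (vx j) = ll ?k (vx (Suc j) + (ap (Suc j) - ap j) *\<^sub>R ev (Suc j))" using vx_step[OF j] by simp
  also have "\<dots> = ap (Suc j) - ap j"
    using ll_vx(2)[of "Suc j"] DD_Suc[of "Suc j"] j by (simp add: ll_add ev_nv)
  finally have e: "ll ?k (vx j) = ap (Suc j) - ap j" .
  moreover have "ll ?k (vx j) \<ge> 0" using vx_in_P[of j] j by (auto simp: mem_P)
  moreover have "ll ?k (vx j) \<noteq> 0"
    using active_consecutive[of "vx j" j ?k] vx_in_P[of j] ll_vx(1)[of j] j by auto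
  ultimately show ?thesis by linarith
qed

lemma eg_param_left:
  assumes j: "1 \<le> j" "j < d" and b: "b \<in> eg j"
  shows "b = vx j + ll (Suc j) b *\<^sub>R ev j" "ll (Suc j) b \<ge> 0"
proof -
  show "b = vx j + ll (Suc j) b *\<^sub>R ev j"
    using line_param(1)[OF j, of b "vx j"] ll_vx[OF j] b by (simp add: mem_eg)
  show "ll (Suc j) b \<ge> 0" using b j by (auto simp: mem_eg mem_P)
qed

lemma eg_param_right:
  assumes j: "1 \<le> j" "j < d" and b: "b \<in> eg (Suc j)"
  shows "b = vx j - ll j b *\<^sub>R ev (Suc j)" "ll j b \<ge> 0"
proof -
  show "b = vx j - ll j b *\<^sub>R ev (Suc j)"
    using line_param'[OF j, of b "vx j"] ll_vx[OF j] b by (simp add: mem_eg)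
  show "ll j b \<ge> 0" using b j by (auto simp: mem_eg mem_P)
qed

end

section \<open>Behaviour at the boundary\<close>

lemma second_expand:
  fixes v w :: "real^2"
  assumes U: "open U" "smooth_fun U s" "x \<in> U"
  shows "dir_deriv v (dir_deriv w s) x = v$1 * (w$1 * dir_deriv E1 (dir_deriv E1 s) x + w$2 * dir_deriv E1 (dir_deriv E2 s) x)
    + v$2 * (w$1 * dir_deriv E1 (dir_deriv E2 s) x + w$2 * dir_deriv E2 (dir_deriv E2 s) x)"
proof -
  have d: "dir_deriv a s differentiable (at x)" for a
    by (intro smooth_fun_differentiable[OF _ U(3)] smooth_intros U)
  have 1: "dir_deriv v (dir_deriv w s) x = v$1 * dir_deriv E1 (dir_deriv w s) x + v$2 * dir_deriv E2 (dir_deriv w s) x"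
    by (rule dir_deriv_vec2[OF d])
  have 2: "dir_deriv a (dir_deriv w s) x = w$1 * dir_deriv a (dir_deriv E1 s) x + w$2 * dir_deriv a (dir_deriv E2 s) x" for a
  proof -
    have "dir_deriv a (dir_deriv w s) x = dir_deriv a (\<lambda>y. w$1 * dir_deriv E1 s y + w$2 * dir_deriv E2 s y) x"
      by (rule dir_deriv_cong[OF U(1,3)]) (rule dir_deriv_vec2[OF smooth_fun_differentiable[OF U(2)]])
    also have "\<dots> = w$1 * dir_deriv a (dir_deriv E1 s) x + w$2 * dir_deriv a (dir_deriv E2 s) x"
      using d by (subst dir_deriv_add) (auto simp: dir_deriv_cmult intro: differentiable_mult)
    finally show ?thesis .
  qed
  show ?thesis unfolding 1 2[of E1] 2[of E2] dir_deriv_commute[OF U, of E2 E1] by simp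
qed

context convex_potential
begin

lemma hs_expand:
  assumes x: "x \<in> \<Omega>"
  shows "hs v w x = v$1 * (w$1 * hs E1 E1 x + w$2 * hs E1 E2 x) + v$2 * (w$1 * hs E1 E2 x + w$2 * hs E2 E2 x)"
proof -
  have "hs v w x = hs (v$1 *\<^sub>R E1 + v$2 *\<^sub>R E2) (w$1 *\<^sub>R E1 + w$2 *\<^sub>R E2) x" using vec2_eq by metis
  then show ?thesis
    unfolding hs_lincomb1[OF x] hs_lincomb2[OF x] hs_commute[OF x, of E2 E1] by (simp add: algebra_simps)
qed

lemma hdet_frame:
  assumes x: "x \<in> \<Omega>" and ab: "det2 a b = 1"
  shows "hs a a x * hs b b x - hs a b x * hs a b x = hdet x"
proof -
  have "hs a a x * hs b b x - hs a b x * hs a b x = (det2 a b)\<^sup>2 * hdet x"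
    unfolding hs_expand[OF x, of a a] hs_expand[OF x, of a b] hs_expand[OF x, of b b] hdet_def det2_def
    by (simp add: algebra_simps power2_eq_square)
  then show ?thesis by (simp add: ab)
qed

lemma Lop_frame:
  assumes U: "open U" "smooth_fun U s" "x \<in> U" and x: "x \<in> \<Omega>" and ab: "det2 a b = 1"
  shows "Lop s x = hs b b x * dir_deriv a (dir_deriv a s) x - 2 * hs a b x * dir_deriv a (dir_deriv b s) x
     + hs a a x * dir_deriv b (dir_deriv b s) x"
proof -
  have "hs b b x * dir_deriv a (dir_deriv a s) x - 2 * hs a b x * dir_deriv a (dir_deriv b s) x
     + hs a a x * dir_deriv b (dir_deriv b s) x = (det2 a b)\<^sup>2 * Lop s x"
    unfolding hs_expand[OF x, of a a] hs_expand[OF x, of a b] hs_expand[OF x, of b b]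
      second_expand[OF U, of a a] second_expand[OF U, of a b] second_expand[OF U, of b b] Lop_def det2_def
    by (simp add: algebra_simps power2_eq_square)
  then show ?thesis by (simp add: ab)
qed

end

text \<open>A strict derivative at a point that need not belong to the domain.\<close>

definition strict_deriv :: "'a::real_normed_vector set \<Rightarrow> ('a \<Rightarrow> real) \<Rightarrow> ('a \<Rightarrow> real) \<Rightarrow> 'a \<Rightarrow> bool" where
  "strict_deriv S f A b \<longleftrightarrow> (\<forall>\<epsilon>>0. \<exists>\<delta>>0. \<forall>x\<in>S \<inter> ball b \<delta>. \<forall>y\<in>S \<inter> ball b \<delta>.
     \<bar>f x - f y - A (x - y)\<bar> \<le> \<epsilon> * norm (x - y))"

text \<open>Mean value theorem on segments inside the convex set \<open>S\<close>. The point
  \<open>b\<close> enters only through the continuity of \<open>g1\<close> and \<open>g2\<close>, so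
  it may lie on the boundary of \<open>S\<close>.\<close>

lemma strict_derivI:
  fixes f g1 g2 :: "real^2 \<Rightarrow> real"
  assumes S: "convex S" and f: "\<And>x. x \<in> S \<Longrightarrow> f differentiable (at x)"
    and N: "open N" "b \<in> N" and g: "isCont g1 b" "isCont g2 b"
    and d: "\<And>x v. x \<in> S \<inter> N \<Longrightarrow> dir_deriv v f x = c1 v * g1 x + c2 v * g2 x"
    and C: "\<And>v. \<bar>c1 v\<bar> \<le> C * norm v" "\<And>v. \<bar>c2 v\<bar> \<le> C * norm v" "C > 0"
  shows "strict_deriv S f (\<lambda>v. c1 v * g1 b + c2 v * g2 b) b"
  unfolding strict_deriv_def
proof (intro allI impI)
  fix \<epsilon> :: real assume "\<epsilon> > 0"
  then have e: "\<epsilon> / (2 * C) > 0" using C by simp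
  obtain d1 where d1: "d1 > 0" "\<And>y. dist y b < d1 \<Longrightarrow> dist (g1 y) (g1 b) < \<epsilon> / (2 * C)"
    using g(1) e unfolding continuous_at_eps_delta by blast
  obtain d2 where d2: "d2 > 0" "\<And>y. dist y b < d2 \<Longrightarrow> dist (g2 y) (g2 b) < \<epsilon> / (2 * C)"
    using g(2) e unfolding continuous_at_eps_delta by blast
  obtain d3 where d3: "d3 > 0" "ball b d3 \<subseteq> N" using N open_contains_ball by blast
  define \<delta> where "\<delta> = min d1 (min d2 d3)"
  have "\<bar>f x - f y - (c1 (x - y) * g1 b + c2 (x - y) * g2 b)\<bar> \<le> \<epsilon> * norm (x - y)"
    if x: "x \<in> S \<inter> ball b \<delta>" and y: "y \<in> S \<inter> ball b \<delta>" for x y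
  proof -
    have seg: "y + t *\<^sub>R (x - y) \<in> S \<inter> ball b \<delta>" if "0 \<le> t" "t \<le> 1" for t
      using convexD_alt[OF convex_Int[OF S convex_ball] y x that] by (simp add: algebra_simps)
    have "\<exists>z>0. z < 1 \<and> f (y + 1 *\<^sub>R (x - y)) - f (y + 0 *\<^sub>R (x - y)) = (1 - 0) * dir_deriv (x - y) f (y + z *\<^sub>R (x - y))"
      by (rule MVT2) (use seg in \<open>auto intro!: DERIV_along_line f\<close>)
    then obtain z where z: "0 < z" "z < 1" "f x - f y = dir_deriv (x - y) f (y + z *\<^sub>R (x - y))" by auto
    define w where "w = y + z *\<^sub>R (x - y)"
    have w: "w \<in> S" "dist w b < \<delta>" using seg[of z] z by (auto simp: w_def dist_commute)
    have wN: "w \<in> S \<inter> N" using w d3 by (auto simp: \<delta>_def dist_commute subset_iff)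
    have "\<bar>f x - f y - (c1 (x - y) * g1 b + c2 (x - y) * g2 b)\<bar> = \<bar>c1 (x - y) * (g1 w - g1 b) + c2 (x - y) * (g2 w - g2 b)\<bar>"
      using d[OF wN, of "x - y"] z(3) by (simp add: w_def algebra_simps)
    also have "\<dots> \<le> \<bar>c1 (x - y)\<bar> * \<bar>g1 w - g1 b\<bar> + \<bar>c2 (x - y)\<bar> * \<bar>g2 w - g2 b\<bar>"
      by (rule order_trans[OF abs_triangle_ineq]) (simp add: abs_mult)
    also have "\<dots> \<le> (C * norm (x - y)) * (\<epsilon> / (2 * C)) + (C * norm (x - y)) * (\<epsilon> / (2 * C))"
      using C d1(2)[of w] d2(2)[of w] w by (intro add_mono mult_mono) (auto simp: \<delta>_def dist_real_def)
    also have "\<dots> = \<epsilon> * norm (x - y)" using C by (simp add: field_simps)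
    finally show ?thesis .
  qed
  then show "\<exists>\<delta>>0. \<forall>x\<in>S \<inter> ball b \<delta>. \<forall>y\<in>S \<inter> ball b \<delta>.
      \<bar>f x - f y - (c1 (x - y) * g1 b + c2 (x - y) * g2 b)\<bar> \<le> \<epsilon> * norm (x - y)"
    using d1 d2 d3 by (intro exI[of _ \<delta>]) (auto simp: \<delta>_def)
qed

lemma abs_det2_le: "\<bar>det2 v w\<bar> \<le> 2 * norm w * norm v"
proof -
  have "\<bar>det2 v w\<bar> \<le> \<bar>v$1\<bar> * \<bar>w$2\<bar> + \<bar>v$2\<bar> * \<bar>w$1\<bar>"
    unfolding det2_def by (rule order_trans[OF abs_triangle_ineq4]) (simp add: abs_mult)
  also have "\<dots> \<le> norm v * norm w + norm v * norm w"
    by (intro add_mono mult_mono component_le_norm_cart) auto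
  finally show ?thesis by (simp add: algebra_simps)
qed

lemma isCont_smooth: "smooth_fun S f \<Longrightarrow> x \<in> S \<Longrightarrow> isCont f x"
  using smooth_fun_differentiable differentiable_imp_continuous_within by blast

context conjugate_pair
begin

text \<open>The frame \<open>D2, D1\<close> is dual to the two normals at a boundary point; \<open>mu1\<close> and \<open>mu2\<close> vanish on
  the edges through the point, and the singular parts of the Hessian are absorbed in them.\<close>

lemma local_boundary:
  assumes N: "open N" and D: "det2 D2 D1 = 1"
    and sm: "smooth_fun N mu1" "smooth_fun N mu2" "smooth_fun N M1" "smooth_fun N M2" "smooth_fun N w"
    and pos: "\<And>x. x \<in> N \<inter> \<Omega> \<Longrightarrow> mu1 x > 0 \<and> mu2 x > 0"
    and dmu: "\<And>x. x \<in> N \<Longrightarrow> dir_deriv D2 mu1 x = 0 \<and> dir_deriv D1 mu2 x = 0"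
    and hss: "\<And>x. x \<in> N \<inter> \<Omega> \<Longrightarrow> hs D1 D1 x = M1 x / mu1 x \<and> hs D2 D2 x = M2 x / mu2 x \<and> hs D1 D2 x = w x"
    and den: "\<And>x. x \<in> N \<Longrightarrow> M1 x * M2 x - mu1 x * mu2 x * (w x * w x) > 0"
  defines "\<kappa> \<equiv> \<lambda>x. inverse (M1 x * M2 x - mu1 x * mu2 x * (w x * w x))"
  shows "smooth_fun N \<kappa>" and "x \<in> N \<inter> \<Omega> \<Longrightarrow> q x = mu1 x * mu2 x * \<kappa> x"
    and "x \<in> N \<inter> \<Omega> \<Longrightarrow> 2 * dir_deriv D2 H x = M2 x * dir_deriv D1 (\<lambda>y. mu1 y * \<kappa> y) x
        - w x * (mu1 x * dir_deriv D2 (\<lambda>y. mu2 y * \<kappa> y) x)"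
    and "x \<in> N \<inter> \<Omega> \<Longrightarrow> 2 * dir_deriv D1 H x = w x * (mu2 x * dir_deriv D1 (\<lambda>y. mu1 y * \<kappa> y) x)
        - M1 x * dir_deriv D2 (\<lambda>y. mu2 y * \<kappa> y) x"
proof -
  show sk: "smooth_fun N \<kappa>" unfolding \<kappa>_def
    by (intro smooth_intros N sm) (use den in force)
  have qe: "q x = mu1 x * mu2 x * \<kappa> x" if x: "x \<in> N \<inter> \<Omega>" for x
  proof -
    have p: "mu1 x > 0" "mu2 x > 0" using pos[OF x] by auto
    have "hdet x = hs D2 D2 x * hs D1 D1 x - hs D2 D1 x * hs D2 D1 x"
      using hdet_frame[OF _ D] x by simp
    also have "\<dots> = (M1 x * M2 x - mu1 x * mu2 x * (w x * w x)) / (mu1 x * mu2 x)"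
    proof -
      have h: "hs D1 D1 x = M1 x / mu1 x" "hs D2 D2 x = M2 x / mu2 x" "hs D2 D1 x = w x"
        using hss[OF x] hs_commute[of x D2 D1] x by auto
      show ?thesis unfolding h using p by (simp add: field_simps)
    qed
    finally show ?thesis using p den[of x] x by (simp add: q_def \<kappa>_def divide_inverse)
  qed
  then show "x \<in> N \<inter> \<Omega> \<Longrightarrow> q x = mu1 x * mu2 x * \<kappa> x" .
  have NO: "open (N \<inter> \<Omega>)" by (intro open_Int N open_\<Omega>)
  \<comment> \<open>As \<open>mu2\<close> is constant along \<open>D1\<close>, it factors out of
    this derivative and cancels the denominator of \<open>hs D2 D2\<close> in
    \<open>dir_deriv_H_frame\<close>. The other derivative is symmetric.\<close>
  have dq1: "dir_deriv D1 q x = mu2 x * dir_deriv D1 (\<lambda>y. mu1 y * \<kappa> y) x" if x: "x \<in> N \<inter> \<Omega>" for x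
  proof -
    have "dir_deriv D1 q x = dir_deriv D1 (\<lambda>y. mu2 y * (mu1 y * \<kappa> y)) x"
      by (rule dir_deriv_cong[OF NO x]) (simp add: qe)
    also have "\<dots> = dir_deriv D1 mu2 x * (mu1 x * \<kappa> x) + mu2 x * dir_deriv D1 (\<lambda>y. mu1 y * \<kappa> y) x"
      by (rule dir_deriv_mult) (rule smooth_fun_differentiable[of N], intro smooth_intros N sm sk, use x in simp)+
    finally show ?thesis using dmu x by simp
  qed
  have dq2: "dir_deriv D2 q x = mu1 x * dir_deriv D2 (\<lambda>y. mu2 y * \<kappa> y) x" if x: "x \<in> N \<inter> \<Omega>" for x
  proof -
    have "dir_deriv D2 q x = dir_deriv D2 (\<lambda>y. mu1 y * (mu2 y * \<kappa> y)) x"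
      by (rule dir_deriv_cong[OF NO x]) (simp add: qe)
    also have "\<dots> = dir_deriv D2 mu1 x * (mu2 x * \<kappa> x) + mu1 x * dir_deriv D2 (\<lambda>y. mu2 y * \<kappa> y) x"
      by (rule dir_deriv_mult) (rule smooth_fun_differentiable[of N], intro smooth_intros N sm sk, use x in simp)+
    finally show ?thesis using dmu x by simp
  qed
  show "2 * dir_deriv D2 H x = M2 x * dir_deriv D1 (\<lambda>y. mu1 y * \<kappa> y) x
        - w x * (mu1 x * dir_deriv D2 (\<lambda>y. mu2 y * \<kappa> y) x)" if x: "x \<in> N \<inter> \<Omega>"
    using dir_deriv_H_frame[OF _ D, of x D2] hss[OF x] hs_commute[of x D2 D1] pos[OF x] x
    by (simp add: dq1[OF x] dq2[OF x])
  show "2 * dir_deriv D1 H x = w x * (mu2 x * dir_deriv D1 (\<lambda>y. mu1 y * \<kappa> y) x)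
        - M1 x * dir_deriv D2 (\<lambda>y. mu2 y * \<kappa> y) x" if x: "x \<in> N \<inter> \<Omega>"
    using dir_deriv_H_frame[OF _ D, of x D1] hss[OF x] pos[OF x] x
    by (simp add: dq1[OF x] dq2[OF x])
qed

end

section \<open>The singular terms of the potential\<close>

locale toric = moment_polygon d \<nu> lam + conjugate_pair "interior (polytope_of d \<nu> lam)" u H
  for d :: nat and \<nu> :: "nat \<Rightarrow> int^2" and lam :: "nat \<Rightarrow> real" and u H :: "real^2 \<Rightarrow> real" +
  fixes I :: "nat set" and \<alpha> \<beta> :: "nat \<Rightarrow> real" and W :: "(real^2) set" and vext :: "real^2 \<Rightarrow> real"
  assumes div_idx: "divisor_indices d \<nu> lam I"
    and \<alpha>_pos: "\<And>k. k \<in> I \<Longrightarrow> \<alpha> k > 0"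
    and edge_convex: "\<And>i p. i \<in> {1..d} - I \<Longrightarrow> p \<in> edge d \<nu> lam i \<Longrightarrow>
        smooth_strictly_convex {t. p + t *\<^sub>R edge_direction \<nu> i \<in> rel_interior (edge d \<nu> lam i)}
          (\<lambda>t. u (p + t *\<^sub>R edge_direction \<nu> i))"
    and W: "open W" "polytope_of d \<nu> lam \<subseteq> W" "smooth_fun W vext"
    and u_vext: "\<And>x. x \<in> polytope_of d \<nu> lam - (\<Union>k\<in>I. edge d \<nu> lam k) \<Longrightarrow>
        u x + (\<Sum>k\<in>I. (\<alpha> k + \<beta> k * ell \<nu> lam k x) * ln (ell \<nu> lam k x))
              - 1/2 * (\<Sum>i\<in>{1..d} - I. ell \<nu> lam i x * ln (ell \<nu> lam i x)) = vext x"
begin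

abbreviation \<Omega> :: "(real^2) set" where "\<Omega> \<equiv> interior P"

lemma I_sub: "I \<subseteq> {1..d}" and finite_I: "finite I"
  using div_idx finite_subset[of I "{1..d}"] by (auto simp: divisor_indices_def)

lemma I_range: assumes "k \<in> I" shows "1 < k" "k < d"
proof -
  have "bounded (eg k)" using assms div_idx by (simp add: divisor_indices_def)
  then have "k \<noteq> 1" "k \<noteq> d" using su by (auto simp: strictly_unbounded_def)
  then show "1 < k" "k < d" using I_sub assms by force+
qed

lemma I_Suc: assumes "k \<in> I" shows "Suc k \<notin> I"
proof
  assume "Suc k \<in> I"
  then have "eg k \<inter> eg (Suc k) = {}" using assms div_idx by (auto simp: divisor_indices_def)
  then show False using su I_range[OF assms] by (auto simp: strictly_unbounded_def)
qed

definition sg :: "nat \<Rightarrow> real^2 \<Rightarrow> real" where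
  "sg j x = (if j \<in> I then - ((\<alpha> j + \<beta> j * ll j x) * ln (ll j x)) else (1/2) * (ll j x * ln (ll j x)))"

lemma u_eq:
  assumes "x \<in> P" "\<And>k. k \<in> I \<Longrightarrow> ll k x \<noteq> 0"
  shows "u x = vext x + (\<Sum>j\<in>{1..d}. sg j x)"
proof -
  have "(\<Sum>j\<in>{1..d}. sg j x) = (\<Sum>j\<in>I. sg j x) + (\<Sum>j\<in>{1..d} - I. sg j x)"
    using I_sub by (simp add: sum.subset_diff add.commute)
  also have "(\<Sum>j\<in>I. sg j x) = - (\<Sum>k\<in>I. (\<alpha> k + \<beta> k * ll k x) * ln (ll k x))"
    unfolding sum_negf[symmetric] by (rule sum.cong) (auto simp: sg_def)
  also have "(\<Sum>j\<in>{1..d} - I. sg j x) = 1/2 * (\<Sum>i\<in>{1..d} - I. ll i x * ln (ll i x))"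
    unfolding sum_distrib_left by (rule sum.cong) (auto simp: sg_def)
  finally show ?thesis using u_vext[of x] assms by (auto simp: mem_eg)
qed

text \<open>The potential without the singular terms of the edges in \<open>Act\<close>. It is
  smooth on \<open>NN Act\<close>, which contains every point of \<open>P\<close> that lies on no
  edge outside \<open>Act\<close>.\<close>

definition vv :: "nat set \<Rightarrow> real^2 \<Rightarrow> real" where
  "vv Act x = vext x + (\<Sum>j\<in>{1..d} - Act. sg j x)"
definition NN :: "nat set \<Rightarrow> (real^2) set" where
  "NN Act = W \<inter> {x. \<forall>j\<in>{1..d} - Act. ll j x > 0}"

lemma open_NN: "open (NN Act)"
proof -
  have "{x. \<forall>j\<in>{1..d} - Act. ll j x > 0} = (\<Inter>j\<in>{1..d} - Act. {x. nv j \<bullet> x > - lam j})"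
    by (auto simp: ll_gt)
  then show ?thesis unfolding NN_def using W(1) by (auto intro!: open_Int open_INT open_halfspace_gt)
qed

lemma smooth_ll: "smooth_fun T (ll j)"
  unfolding ll_eq[abs_def] by (rule smooth_fun_affine)

lemma dir_deriv_ll: "dir_deriv h (ll j) x = h \<bullet> nv j"
  unfolding ll_eq[abs_def] by simp

lemma smooth_sg: "open T \<Longrightarrow> (\<And>x. x \<in> T \<Longrightarrow> ll j x > 0) \<Longrightarrow> smooth_fun T (sg j)"
  unfolding sg_def[abs_def] by (cases "j \<in> I") (auto intro!: smooth_intros smooth_ll)

lemma smooth_vv: "smooth_fun (NN Act) (vv Act)"
  unfolding vv_def[abs_def]
proof (intro smooth_intros open_NN smooth_sg)
  show "smooth_fun (NN Act) vext" by (rule smooth_fun_subset[OF W(3)]) (auto simp: NN_def)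
qed (auto simp: NN_def)

lemma P_in_NN: "b \<in> P \<Longrightarrow> (\<And>j. j \<in> {1..d} - Act \<Longrightarrow> ll j b \<noteq> 0) \<Longrightarrow> b \<in> NN Act"
  using W(2) by (force simp: NN_def mem_P less_le)

lemma \<Omega>_NN: "\<Omega> \<subseteq> NN Act"
  using W(2) by (auto simp: NN_def interior_P mem_P less_imp_le intro!: subsetD[OF W(2)])

lemma u_vv:
  assumes "x \<in> P" "\<And>k. k \<in> I \<Longrightarrow> ll k x \<noteq> 0" "Act \<subseteq> {1..d}"
  shows "u x = vv Act x + (\<Sum>j\<in>Act. sg j x)"
proof -
  have "(\<Sum>j\<in>{1..d}. sg j x) = (\<Sum>j\<in>{1..d} - Act. sg j x) + (\<Sum>j\<in>Act. sg j x)"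
    using assms(3) by (simp add: sum.subset_diff)
  then show ?thesis using u_eq[OF assms(1,2)] by (simp add: vv_def)
qed

definition sg2 :: "nat \<Rightarrow> real^2 \<Rightarrow> real" where
  "sg2 j x = (if j \<in> I then (\<alpha> j - \<beta> j * ll j x) / (ll j x)\<^sup>2 else 1 / (2 * ll j x))"

lemma dir_deriv_sg2:
  assumes x: "x \<in> {x. ll j x > 0}"
  shows "dir_deriv a (dir_deriv b (sg j)) x = sg2 j x * (a \<bullet> nv j) * (b \<bullet> nv j)"
proof -
  have o: "open {x. ll j x > 0}" using open_halfspace_gt[of "- lam j" "nv j"] by (simp add: ll_gt)
  define \<phi> :: "real \<Rightarrow> real" where "\<phi> = (\<lambda>y. if j \<in> I then - ((\<alpha> j + \<beta> j * y) * ln y) else (1/2) * (y * ln y))"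
  define \<phi>' :: "real \<Rightarrow> real" where "\<phi>' = (\<lambda>y. if j \<in> I then - (\<beta> j * ln y + \<alpha> j / y + \<beta> j) else (1/2) * (ln y + 1))"
  have 1: "(\<phi> has_real_derivative \<phi>' y) (at y)" if "y > 0" for y
  proof (cases "j \<in> I")
    case True
    then have "\<phi> = (\<lambda>y. - ((\<alpha> j + \<beta> j * y) * ln y))" "\<phi>' y = - (\<beta> j * ln y + \<alpha> j / y + \<beta> j)" by (auto simp: \<phi>_def \<phi>'_def)
    then show ?thesis using that by (auto intro!: derivative_eq_intros simp: field_simps)
  next
    case False
    then have "\<phi> = (\<lambda>y. (1/2) * (y * ln y))" "\<phi>' y = (1/2) * (ln y + 1)" by (auto simp: \<phi>_def \<phi>'_def)
    then show ?thesis using that by (auto intro!: derivative_eq_intros simp: field_simps)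
  qed
  have 2: "(\<phi>' has_real_derivative sg2 j x) (at (ll j x))"
  proof (cases "j \<in> I")
    case True
    then have "\<phi>' = (\<lambda>y. - (\<beta> j * ln y + \<alpha> j / y + \<beta> j))" by (auto simp: \<phi>'_def)
    then show ?thesis using x True by (auto intro!: derivative_eq_intros simp: field_simps sg2_def power2_eq_square)
  next
    case False
    then have "\<phi>' = (\<lambda>y. (1/2) * (ln y + 1))" by (auto simp: \<phi>'_def)
    then show ?thesis using x False by (auto intro!: derivative_eq_intros simp: field_simps sg2_def)
  qed
  have e: "sg j = (\<lambda>y. \<phi> (ll j y))" by (auto simp: sg_def \<phi>_def)
  have c: "dir_deriv b (ll j) = (\<lambda>x. b \<bullet> nv j)" by (rule ext) (rule dir_deriv_ll)
  have "dir_deriv a (dir_deriv b (\<lambda>y. \<phi> (ll j y))) x = sg2 j x * dir_deriv a (ll j) x * dir_deriv b (ll j) x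
      + \<phi>' (ll j x) * dir_deriv a (dir_deriv b (ll j)) x"
    by (rule dir_deriv_comp2[OF o smooth_ll x 1 2]) auto
  then show ?thesis unfolding e c dir_deriv_ll by simp
qed

lemma dir_deriv2_add:
  assumes "open T" "smooth_fun T f" "smooth_fun T g" "x \<in> T"
  shows "dir_deriv a (dir_deriv b (\<lambda>y. f y + g y)) x = dir_deriv a (dir_deriv b f) x + dir_deriv a (dir_deriv b g) x"
proof -
  have "dir_deriv a (dir_deriv b (\<lambda>y. f y + g y)) x = dir_deriv a (\<lambda>y. dir_deriv b f y + dir_deriv b g y) x"
    using assms by (intro dir_deriv_cong[OF assms(1,4)] dir_deriv_add smooth_fun_differentiable)
  also have "\<dots> = dir_deriv a (dir_deriv b f) x + dir_deriv a (dir_deriv b g) x"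
    by (intro dir_deriv_add smooth_fun_differentiable[OF _ assms(4)] smooth_intros assms)
  finally show ?thesis .
qed

lemma vv_step:
  assumes A: "Act \<subseteq> {1..d}" "j \<in> {1..d}" "j \<notin> Act" and x: "x \<in> NN Act"
  shows "dir_deriv a (dir_deriv b (vv Act)) x
     = dir_deriv a (dir_deriv b (vv (insert j Act))) x + sg2 j x * (a \<bullet> nv j) * (b \<bullet> nv j)"
proof -
  have lx: "ll j y > 0" if "y \<in> NN Act" for y using that A by (auto simp: NN_def)
  have e: "vv Act y = vv (insert j Act) y + sg j y" for y
  proof -
    have "{1..d} - Act = insert j ({1..d} - insert j Act)" using A by auto
    then have "(\<Sum>i\<in>{1..d} - Act. sg i y) = (\<Sum>i\<in>insert j ({1..d} - insert j Act). sg i y)" by (rule arg_cong)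
    also have "\<dots> = sg j y + (\<Sum>i\<in>{1..d} - insert j Act. sg i y)" by (rule sum.insert) auto
    finally show ?thesis unfolding vv_def by linarith
  qed
  have "NN Act \<subseteq> NN (insert j Act)" by (auto simp: NN_def)
  then have s: "smooth_fun (NN Act) (vv (insert j Act))" using smooth_vv smooth_fun_subset by blast
  have "dir_deriv a (dir_deriv b (vv Act)) x = dir_deriv a (dir_deriv b (\<lambda>y. vv (insert j Act) y + sg j y)) x"
    unfolding e[abs_def] ..
  also have "\<dots> = dir_deriv a (dir_deriv b (vv (insert j Act))) x + dir_deriv a (dir_deriv b (sg j)) x"
    by (rule dir_deriv2_add[OF open_NN s smooth_sg[OF open_NN lx] x])
  finally show ?thesis using dir_deriv_sg2[of x j a b] lx[OF x] by simp
qed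

lemma hs_vv0:
  assumes x: "x \<in> \<Omega>"
  shows "hs a b x = dir_deriv a (dir_deriv b (vv {})) x"
proof -
  have "u y = vv {} y" if "y \<in> \<Omega>" for y
  proof -
    have "y \<in> P" using that interior_subset by blast
    moreover have "ll k y \<noteq> 0" if "k \<in> I" for k
    proof -
      have "k \<in> {1..d}" using that I_sub by blast
      then show ?thesis using \<open>y \<in> \<Omega>\<close> unfolding interior_P by fastforce
    qed
    ultimately show ?thesis using u_vv[of y "{}"] by simp
  qed
  then show ?thesis unfolding hs_def using foldr_dir_deriv_cong[OF open_\<Omega> _ x, of u "vv {}" "[a,b]"] by simp
qed

lemma hs_vv1:
  assumes x: "x \<in> \<Omega>" and i: "i \<in> {1..d}"
  shows "hs a b x = dir_deriv a (dir_deriv b (vv {i})) x + sg2 i x * (a \<bullet> nv i) * (b \<bullet> nv i)"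
  using hs_vv0[OF x] vv_step[of "{}" i x a b] \<Omega>_NN x i by auto

lemma hs_vv2:
  assumes x: "x \<in> \<Omega>" and i: "i \<in> {1..d}" "j \<in> {1..d}" "i \<noteq> j"
  shows "hs a b x = dir_deriv a (dir_deriv b (vv {i,j})) x + sg2 i x * (a \<bullet> nv i) * (b \<bullet> nv i) + sg2 j x * (a \<bullet> nv j) * (b \<bullet> nv j)"
  using hs_vv1[OF x i(1)] vv_step[of "{i}" j x a b] \<Omega>_NN x i by (auto simp: insert_commute)

end

context toric
begin

lemma limit_from_inside:
  assumes b: "b \<in> P" and f: "isCont f b" and N: "open N" "b \<in> N"
    and nn: "\<And>x. x \<in> N \<inter> \<Omega> \<Longrightarrow> f x \<ge> (0::real)"
  shows "f b \<ge> 0"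
proof -
  have lim: "((\<lambda>t. b + t *\<^sub>R wv) \<longlongrightarrow> b) (at_right 0)"
    by (auto intro!: tendsto_eq_intros)
  then have "((\<lambda>t. f (b + t *\<^sub>R wv)) \<longlongrightarrow> f b) (at_right 0)"
    using f isCont_tendsto_compose by blast
  moreover have "\<forall>\<^sub>F t in at_right 0. b + t *\<^sub>R wv \<in> N"
    using lim N topological_tendstoD by blast
  moreover have "\<forall>\<^sub>F t in at_right (0::real). t > 0" by (simp add: eventually_at_right_less)
  ultimately show ?thesis
  proof (intro tendsto_lowerbound[where F = "at_right (0::real)"])
    assume 1: "\<forall>\<^sub>F t in at_right 0. b + t *\<^sub>R wv \<in> N" and 2: "\<forall>\<^sub>F t in at_right (0::real). t > 0"
    show "\<forall>\<^sub>F t in at_right 0. f (b + t *\<^sub>R wv) \<ge> 0"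
      using 1 2 by eventually_elim (use nn push_in[OF b] in auto)
  qed auto
qed

lemma limit_from_inside_0:
  assumes "b \<in> P" "isCont f b" "open N" "b \<in> N" "\<And>x. x \<in> N \<inter> \<Omega> \<Longrightarrow> f x = (0::real)"
  shows "f b = 0"
proof -
  have "f b \<ge> 0" by (rule limit_from_inside[OF assms(1-4)]) (simp add: assms(5))
  moreover have "- f b \<ge> 0" by (rule limit_from_inside[OF assms(1) _ assms(3,4)]) (simp_all add: assms)
  ultimately show ?thesis by simp
qed

definition only_active :: "nat \<Rightarrow> real^2 \<Rightarrow> bool" where
  "only_active k b \<longleftrightarrow> k \<in> {1..d} \<and> ll k b = 0 \<and> (\<forall>j\<in>{1..d} - {k}. ll j b > 0)"

lemma only_active_P: "only_active k b \<Longrightarrow> b \<in> P"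
  by (auto simp: only_active_def mem_P) (metis DiffI atLeastAtMost_iff empty_iff insert_iff less_imp_le order_refl)

lemma only_active_NN: "only_active k b \<Longrightarrow> b \<in> NN {k}"
  using only_active_P[of k b] by (intro P_in_NN) (force simp: only_active_def)+

lemma dir_deriv_along_line:
  assumes "f differentiable (at (b + t *\<^sub>R h))"
  shows "dir_deriv 1 (\<lambda>t. f (b + t *\<^sub>R h)) t = dir_deriv h f (b + t *\<^sub>R h)"
  using DERIV_along_line[OF assms] unfolding has_field_derivative_def by (simp add: dir_deriv_eqI)

text \<open>On the edge \<open>ll k\<close> vanishes, and with it the term
  \<open>ll k * ln (ll k)\<close>, as \<open>ln 0 = 0\<close>. So \<open>u\<close> restricted to the
  edge is \<open>vv {k}\<close>, and the assumed convexity along edges outside \<open>I\<close>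
  applies.\<close>

lemma edge_hessian_pos_notI:
  assumes k: "only_active k b" "k \<notin> I"
  shows "dir_deriv (ev k) (dir_deriv (ev k) (vv {k})) b > 0"
proof -
  let ?e = "ev k" and ?L = "\<lambda>t. b + t *\<^sub>R ev k"
  define T0 where "T0 = {t. \<forall>j\<in>{1..d} - {k}. ll j (?L t) > 0}"
  have kd: "k \<in> {1..d}" and k0: "ll k b = 0" using k by (auto simp: only_active_def)
  have lk: "ll k (?L t) = 0" for t using k0 by (simp add: ll_add ev_nv det2_self)
  have oa: "only_active k (?L t)" if "t \<in> T0" for t
    using that kd lk by (auto simp: T0_def only_active_def)
  have "T0 = (\<Inter>j\<in>{1..d} - {k}. (\<lambda>t. ll j (?L t)) -` {0<..})" by (auto simp: T0_def)
  then have oT: "open T0"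
    by (auto simp: ll_eq intro!: open_INT open_vimage continuous_intros)
  have T0: "0 \<in> T0" using k by (auto simp: T0_def only_active_def)
  have ue: "u (?L t) = vv {k} (?L t)" if "t \<in> T0" for t
  proof -
    have "ll j (?L t) \<noteq> 0" if "j \<in> I" for j
      using oa[OF \<open>t \<in> T0\<close>] that k I_sub unfolding only_active_def by force
    then have "u (?L t) = vv {k} (?L t) + (\<Sum>j\<in>{k}. sg j (?L t))"
      using only_active_P[OF oa[OF that]] kd by (intro u_vv) auto
    then show ?thesis using k lk by (simp add: sg_def)
  qed
  have NNk: "?L t \<in> NN {k}" if "t \<in> T0" for t using oa[OF that] only_active_NN by blast
  have "b \<in> rel_interior (eg k)"
  proof -
    define B where "B = (\<Inter>j\<in>{1..d} - {k}. {x. nv j \<bullet> x > - lam j})"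
    have "open B" unfolding B_def by (auto intro!: open_INT open_halfspace_gt)
    moreover have "b \<in> B" using k by (auto simp: B_def ll_gt[symmetric] only_active_def)
    ultimately obtain e where e: "e > 0" "ball b e \<subseteq> B" using open_contains_ball by blast
    have "eg k \<subseteq> {x. nv k \<bullet> x = - lam k}" by (auto simp: mem_eg ll_0[symmetric])
    then have "affine hull (eg k) \<subseteq> {x. nv k \<bullet> x = - lam k}" by (simp add: hull_minimal affine_hyperplane)
    moreover have "B \<inter> {x. nv k \<bullet> x = - lam k} \<subseteq> eg k"
      by (auto simp: B_def mem_eg mem_P ll_gt[symmetric] ll_0[symmetric]) (metis DiffI atLeastAtMost_iff empty_iff insert_iff less_imp_le order_refl)
    ultimately have "ball b e \<inter> affine hull (eg k) \<subseteq> eg k" using e by blast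
    moreover have "b \<in> eg k" using only_active_P[OF k(1)] k0 by (simp add: mem_eg)
    ultimately show ?thesis using e by (auto simp: mem_rel_interior_ball)
  qed
  then have pos: "dir_deriv 1 (dir_deriv 1 (\<lambda>t. u (?L t))) 0 > 0"
    using edge_convex[of k b] kd k only_active_P[OF k(1)] k0
    by (auto simp: smooth_strictly_convex_def edge_direction_eq mem_eg)
  also have "dir_deriv 1 (dir_deriv 1 (\<lambda>t. u (?L t))) 0 = dir_deriv 1 (dir_deriv 1 (\<lambda>t. vv {k} (?L t))) 0"
    using foldr_dir_deriv_cong[OF oT ue T0, where hs = "[1,1]"] by simp
  also have "\<dots> = dir_deriv 1 (\<lambda>t. dir_deriv ?e (vv {k}) (?L t)) 0"
    by (rule dir_deriv_cong[OF oT T0]) (intro dir_deriv_along_line smooth_fun_differentiable[OF smooth_vv] NNk)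
  also have "\<dots> = dir_deriv ?e (dir_deriv ?e (vv {k})) (?L 0)"
    by (intro dir_deriv_along_line smooth_fun_differentiable[OF _ NNk[OF T0]] smooth_intros smooth_vv)
  finally show ?thesis by simp
qed

text \<open>The flag \<open>a\<close> tells whether edge \<open>j\<close> counts as active. If so,
  \<open>mu\<close> is the denominator of \<open>sg2 j\<close>, with a double zero for
  \<open>j\<close> in \<open>I\<close> and a simple one otherwise, and \<open>MM\<close> below is
  the diagonal Hessian entry multiplied by it; if not, no pole has to be cleared.\<close>

definition mu :: "bool \<Rightarrow> nat \<Rightarrow> real^2 \<Rightarrow> real" where
  "mu a j x = (if a then if j \<in> I then ll j x * ll j x else 2 * ll j x else 1)"
definition MM :: "nat set \<Rightarrow> bool \<Rightarrow> nat \<Rightarrow> real^2 \<Rightarrow> real^2 \<Rightarrow> real" where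
  "MM Act a j h x = (if a then if j \<in> I then \<alpha> j - \<beta> j * ll j x + ll j x * ll j x * dir_deriv h (dir_deriv h (vv Act)) x
      else 1 + 2 * ll j x * dir_deriv h (dir_deriv h (vv Act)) x else dir_deriv h (dir_deriv h (vv Act)) x)"
definition ww :: "nat set \<Rightarrow> real^2 \<Rightarrow> real^2 \<Rightarrow> real^2 \<Rightarrow> real" where
  "ww Act h h' x = dir_deriv h (dir_deriv h' (vv Act)) x"

lemma smooth_mu: "open T \<Longrightarrow> smooth_fun T (mu a j)"
  unfolding mu_def[abs_def] by (cases a; cases "j \<in> I") (auto intro!: smooth_intros smooth_ll)

lemma smooth_MM: "smooth_fun (NN Act) (MM Act a j h)"
  unfolding MM_def[abs_def] by (cases a; cases "j \<in> I") (auto intro!: smooth_intros smooth_ll smooth_vv open_NN)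

lemma smooth_ww: "smooth_fun (NN Act) (ww Act h h')"
  unfolding ww_def[abs_def] by (intro smooth_intros smooth_vv)

lemma dir_deriv_mu:
  "dir_deriv h (mu a j) x = (if a then if j \<in> I then 2 * ll j x * (h \<bullet> nv j) else 2 * (h \<bullet> nv j) else 0)"
proof -
  have d: "ll j differentiable (at x)" by (rule smooth_fun_differentiable[OF smooth_ll, of x UNIV]) simp
  show ?thesis unfolding mu_def[abs_def] using d
    by (cases a; cases "j \<in> I") (simp_all add: dir_deriv_mult dir_deriv_cmult dir_deriv_ll)
qed

lemma MM_mu:
  assumes "ll j x > 0"
  shows "MM Act a j h x / mu a j x = dir_deriv h (dir_deriv h (vv Act)) x + (if a then sg2 j x else 0)"
  using assms by (simp add: MM_def mu_def sg2_def field_simps power2_eq_square)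

context
  fixes i :: nat and Act :: "nat set"
  assumes i: "1 \<le> i" "i < d" and Act: "Act \<subseteq> {i, Suc i}"
begin

abbreviation D1 where "D1 \<equiv> - ev (Suc i)"
abbreviation D2 where "D2 \<equiv> ev i"
abbreviation "mu1 \<equiv> mu (i \<in> Act) i"
abbreviation "mu2 \<equiv> mu (Suc i \<in> Act) (Suc i)"
abbreviation "M1 \<equiv> MM Act (i \<in> Act) i D1"
abbreviation "M2 \<equiv> MM Act (Suc i \<in> Act) (Suc i) D2"
abbreviation "w12 \<equiv> ww Act D1 D2"
text \<open>All edges through a boundary point lie in a consecutive pair, and \<open>Act\<close>
  records which of the two count as active; vertices and edge points are thus treated together. In
  the interior \<open>den\<close> is \<open>mu1 * mu2 * hdet\<close>, the Hessian determinant with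
  its poles cleared. Its positivity at the boundary is supplied by
  \<open>boundary_pair\<close>.\<close>

definition den where "den x = M1 x * M2 x - mu1 x * mu2 x * (w12 x * w12 x)"
definition kap where "kap x = inverse (den x)"
definition Nb where "Nb = {x \<in> NN Act. den x > 0}"

lemma frame: "det2 D2 D1 = 1" "D1 \<bullet> nv i = 1" "D1 \<bullet> nv (Suc i) = 0" "D2 \<bullet> nv i = 0" "D2 \<bullet> nv (Suc i) = 1"
proof -
  have "det2 D2 D1 = - DD i (Suc i)" by (simp add: ev_def det2_def)
  then show "det2 D2 D1 = 1" using DD_Suc[OF i] by simp
qed (use DD_Suc[OF i] DD_Suc'[OF i] in \<open>simp_all add: ev_nv det2_self\<close>)

lemma smooth_den: "smooth_fun (NN Act) den"
  unfolding den_def[abs_def] by (intro smooth_intros open_NN smooth_MM smooth_mu smooth_ww)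

lemma open_Nb: "open Nb"
proof -
  have "Nb = NN Act \<inter> den -` {0<..}" by (auto simp: Nb_def)
  then show ?thesis
    using continuous_open_preimage[OF smooth_fun_continuous_on[OF smooth_den] open_NN, of "{0<..}"] by simp
qed

lemma Nb_sub: "Nb \<subseteq> NN Act" by (auto simp: Nb_def)

lemma hs_Act:
  assumes x: "x \<in> \<Omega>"
  shows "hs a b x = dir_deriv a (dir_deriv b (vv Act)) x
    + (if i \<in> Act then sg2 i x * (a \<bullet> nv i) * (b \<bullet> nv i) else 0)
    + (if Suc i \<in> Act then sg2 (Suc i) x * (a \<bullet> nv (Suc i)) * (b \<bullet> nv (Suc i)) else 0)"
proof -
  have "Act = {} \<or> Act = {i} \<or> Act = {Suc i} \<or> Act = {i, Suc i}" using Act by blast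
  then show ?thesis using hs_vv0[OF x] hs_vv1[OF x, of i] hs_vv1[OF x, of "Suc i"] hs_vv2[OF x, of i "Suc i"] i
    by (elim disjE) auto
qed

lemma lb_facts:
  "smooth_fun Nb mu1" "smooth_fun Nb mu2" "smooth_fun Nb M1" "smooth_fun Nb M2" "smooth_fun Nb w12"
  "\<And>x. x \<in> Nb \<inter> \<Omega> \<Longrightarrow> mu1 x > 0 \<and> mu2 x > 0"
  "\<And>x. x \<in> Nb \<Longrightarrow> dir_deriv D2 mu1 x = 0 \<and> dir_deriv D1 mu2 x = 0"
  "\<And>x. x \<in> Nb \<inter> \<Omega> \<Longrightarrow> hs D1 D1 x = M1 x / mu1 x \<and> hs D2 D2 x = M2 x / mu2 x \<and> hs D1 D2 x = w12 x"
  "\<And>x. x \<in> Nb \<Longrightarrow> M1 x * M2 x - mu1 x * mu2 x * (w12 x * w12 x) > 0"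
proof -
  show "smooth_fun Nb mu1" "smooth_fun Nb mu2" using smooth_mu open_Nb by blast+
  show "smooth_fun Nb M1" "smooth_fun Nb M2" using smooth_MM smooth_fun_subset Nb_sub by blast+
  show "smooth_fun Nb w12" using smooth_ww smooth_fun_subset Nb_sub by blast
  fix x
  show "mu1 x > 0 \<and> mu2 x > 0" if "x \<in> Nb \<inter> \<Omega>"
    using that i by (auto simp: mu_def interior_P)
  show "dir_deriv D2 mu1 x = 0 \<and> dir_deriv D1 mu2 x = 0" unfolding dir_deriv_mu frame by simp
  show "M1 x * M2 x - mu1 x * mu2 x * (w12 x * w12 x) > 0" if "x \<in> Nb"
    using that by (simp add: Nb_def den_def)
  show "hs D1 D1 x = M1 x / mu1 x \<and> hs D2 D2 x = M2 x / mu2 x \<and> hs D1 D2 x = w12 x" if x: "x \<in> Nb \<inter> \<Omega>"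
  proof -
    have xO: "x \<in> \<Omega>" and "ll i x > 0" "ll (Suc i) x > 0" using x i by (auto simp: interior_P)
    then show ?thesis unfolding MM_mu[OF \<open>ll i x > 0\<close>] MM_mu[OF \<open>ll (Suc i) x > 0\<close>] hs_Act[OF xO] frame
      by (simp add: ww_def)
  qed
qed

lemmas lb = local_boundary[OF open_Nb frame(1) lb_facts, folded den_def kap_def, folded kap_def[abs_def]]

lemma smooth_kap: "smooth_fun Nb kap" and q_kap: "x \<in> Nb \<inter> \<Omega> \<Longrightarrow> q x = mu1 x * mu2 x * kap x"
  using lb(1,2) by (simp_all add: kap_def[abs_def])

text \<open>\<open>g2\<close> and \<open>g1\<close> extend the derivatives of \<open>H\<close> along
  the two edge directions smoothly across the boundary, see \<open>dH_g\<close>.\<close>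

definition g2 where "g2 x = (1/2) * (M2 x * dir_deriv D1 (\<lambda>y. mu1 y * kap y) x - w12 x * (mu1 x * dir_deriv D2 (\<lambda>y. mu2 y * kap y) x))"
definition g1 where "g1 x = (1/2) * (w12 x * (mu2 x * dir_deriv D1 (\<lambda>y. mu1 y * kap y) x) - M1 x * dir_deriv D2 (\<lambda>y. mu2 y * kap y) x)"

lemma dH_g: "x \<in> Nb \<inter> \<Omega> \<Longrightarrow> dir_deriv D2 H x = g2 x" "x \<in> Nb \<inter> \<Omega> \<Longrightarrow> dir_deriv D1 H x = g1 x"
  using lb(3,4)[of x] by (simp_all add: kap_def[abs_def] g1_def g2_def)

lemma smooth_g: "smooth_fun Nb g1" "smooth_fun Nb g2"
  unfolding g1_def[abs_def] g2_def[abs_def] by (intro smooth_intros open_Nb lb_facts smooth_kap)+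

lemma dir_deriv_frame:
  assumes "f differentiable (at x)"
  shows "dir_deriv v f x = det2 v D1 * dir_deriv D2 f x + det2 D2 v * dir_deriv D1 f x"
  by (subst frame_coefficients[OF frame(1), of v], rule dir_deriv_lincomb[OF assms])

definition AH where "AH b v = det2 v D1 * g2 b + det2 D2 v * g1 b"

lemma strict_deriv_pair:
  assumes f: "\<And>x. x \<in> \<Omega> \<Longrightarrow> f differentiable (at x)" and b: "b \<in> Nb"
    and g: "isCont h2 b" "isCont h1 b"
    and d: "\<And>x. x \<in> Nb \<inter> \<Omega> \<Longrightarrow> dir_deriv D2 f x = h2 x \<and> dir_deriv D1 f x = h1 x"
  shows "strict_deriv \<Omega> f (\<lambda>v. det2 v D1 * h2 b + det2 D2 v * h1 b) b"
proof (rule strict_derivI[OF convex_\<Omega> f open_Nb b g, where C = "2 * norm D1 + 2 * norm D2"])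
  show "dir_deriv v f x = det2 v D1 * h2 x + det2 D2 v * h1 x" if "x \<in> \<Omega> \<inter> Nb" for x v
    using dir_deriv_frame[OF f, of x v] d[of x] that by auto
  show "\<bar>det2 v D1\<bar> \<le> (2 * norm D1 + 2 * norm D2) * norm v" for v
    by (rule order_trans[OF abs_det2_le]) (intro mult_right_mono, auto)
  show "\<bar>det2 D2 v\<bar> \<le> (2 * norm D1 + 2 * norm D2) * norm v" for v
    unfolding det2_swap[of D2 v] abs_minus by (rule order_trans[OF abs_det2_le]) (intro mult_right_mono, auto)
  have "D2 \<noteq> 0" using frame(5) by (metis inner_zero_left zero_neq_one)
  then show "0 < 2 * norm D1 + 2 * norm D2" by (intro add_nonneg_pos) auto
qed

lemma strict_H: "b \<in> Nb \<Longrightarrow> strict_deriv \<Omega> H (AH b) b"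
  unfolding AH_def[abs_def]
  by (rule strict_deriv_pair) (auto intro!: smooth_fun_differentiable[OF smooth_H] isCont_smooth[OF smooth_g(1)] isCont_smooth[OF smooth_g(2)] simp: dH_g)

definition qq where "qq x = mu1 x * mu2 x * kap x"

lemma smooth_qq: "smooth_fun Nb qq"
  unfolding qq_def[abs_def] by (intro smooth_intros open_Nb lb_facts smooth_kap)

lemma strict_q: assumes b: "b \<in> Nb"
  shows "strict_deriv \<Omega> q (\<lambda>v. det2 v D1 * dir_deriv D2 qq b + det2 D2 v * dir_deriv D1 qq b) b"
proof (rule strict_deriv_pair[OF _ b])
  fix x assume x: "x \<in> Nb \<inter> \<Omega>"
  have "dir_deriv v q x = dir_deriv v qq x" for v
    by (rule dir_deriv_cong[OF open_Int[OF open_Nb open_\<Omega>] x]) (simp add: q_kap qq_def)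
  then show "dir_deriv D2 q x = dir_deriv D2 qq x \<and> dir_deriv D1 q x = dir_deriv D1 qq x" by simp
qed (use b in \<open>auto intro!: smooth_fun_differentiable[OF smooth_q] isCont_smooth[of Nb] smooth_intros smooth_qq\<close>)

text \<open>On edge \<open>i\<close> only the term with the derivative of \<open>mu1\<close>
  survives, which leaves \<open>M2 * kap * dir_deriv D1 mu1 / 2\<close>. Outside \<open>I\<close>
  this derivative is 2 and \<open>kap = 1 / M2\<close>, since \<open>M1 = 1\<close> there; so the
  slope is 1. In \<open>I\<close> the double zero of \<open>mu1\<close> makes it 0. Edge
  \<open>i + 1\<close> is symmetric.\<close>

lemma kap_boundary:
  assumes b: "b \<in> Nb"
  shows "i \<in> Act \<Longrightarrow> ll i b = 0 \<Longrightarrow> AH b (ev i) = (if i \<in> I then 0 else 1)"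
    and "Suc i \<in> Act \<Longrightarrow> ll (Suc i) b = 0 \<Longrightarrow> AH b (ev (Suc i)) = (if Suc i \<in> I then 0 else 1)"
proof -
  have kd: "kap differentiable (at b)" "mu a j differentiable (at b)" for a j
    using smooth_fun_differentiable[OF smooth_kap b] smooth_fun_differentiable[OF smooth_mu[OF open_Nb] b] by auto
  have dn: "den b > 0" using b by (simp add: Nb_def)
  have f1: "det2 D2 D1 = 1" by (rule frame)
  show "AH b (ev i) = (if i \<in> I then 0 else 1)" if a: "i \<in> Act" "ll i b = 0"
  proof -
    have m: "mu1 b = 0" "dir_deriv D1 mu1 b = (if i \<in> I then 0 else 2)"
      using a DD_Suc'[OF i] by (simp_all add: mu_def dir_deriv_mu ev_nv)
    have "AH b (ev i) = g2 b" using f1 by (simp add: AH_def det2_self)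
    also have "\<dots> = (1/2) * (M2 b * (dir_deriv D1 mu1 b * kap b))"
      by (simp add: g2_def m(1) dir_deriv_mult[OF kd(2) kd(1)])
    also have "\<dots> = (if i \<in> I then 0 else 1)"
    proof (cases "i \<in> I")
      case False
      then have "M1 b = 1" using a by (simp add: MM_def)
      then have "den b = M2 b" using m by (simp add: den_def)
      then show ?thesis using False dn m by (simp add: kap_def)
    qed (simp add: m)
    finally show ?thesis .
  qed
  show "AH b (ev (Suc i)) = (if Suc i \<in> I then 0 else 1)" if a: "Suc i \<in> Act" "ll (Suc i) b = 0"
  proof -
    have m: "mu2 b = 0" "dir_deriv D2 mu2 b = (if Suc i \<in> I then 0 else 2)"
      using a by (simp_all add: mu_def dir_deriv_mu frame)
    have "AH b (ev (Suc i)) = - g1 b" using f1 by (simp add: AH_def det2_self det2_minus2)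
    also have "\<dots> = (1/2) * (M1 b * (dir_deriv D2 mu2 b * kap b))"
      by (simp add: g1_def m(1) dir_deriv_mult[OF kd(2) kd(1)])
    also have "\<dots> = (if Suc i \<in> I then 0 else 1)"
    proof (cases "Suc i \<in> I")
      case False
      then have "M2 b = 1" using a by (simp add: MM_def)
      then have "den b = M1 b" using m by (simp add: den_def)
      then show ?thesis using False dn m by (simp add: kap_def)
    qed (simp add: m)
    finally show ?thesis .
  qed
qed

lemma q_tendsto_0:
  assumes b: "b \<in> Nb" and 0: "mu1 b * mu2 b = 0"
  shows "(q \<longlongrightarrow> 0) (at b within \<Omega>)"
proof -
  have "isCont qq b" by (rule isCont_smooth[OF smooth_qq b])
  then have "(qq \<longlongrightarrow> 0) (at b within \<Omega>)" using 0
    by (metis (no_types, lifting) qq_def isCont_def mult_zero_left tendsto_within_subset subset_UNIV)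
  moreover have "\<forall>\<^sub>F x in at b within \<Omega>. qq x = q x"
    using open_Nb b q_kap unfolding qq_def eventually_at_topological by (intro exI[of _ Nb]) auto
  ultimately show ?thesis by (rule Lim_transform_eventually)
qed

end

end

section \<open>Nondegeneracy along the edges in the index set\<close>

context toric
begin

lemma edge_interior_only_active:
  assumes k: "1 < k" "k < d" and t: "0 < t" "t < ap k - ap (k - 1)"
  shows "only_active k (vx k + t *\<^sub>R ev k)"
proof -
  obtain j where j: "k = Suc j" "1 \<le> j" using k by (cases k) auto
  define len where "len = ap k - ap j"
  have tl: "0 < t" "t < len" using t by (auto simp: len_def j)
  let ?x = "vx k + t *\<^sub>R ev k"
  have v: "vx k = vx j - len *\<^sub>R ev k" using vx_step[of j] k j by (simp add: len_def)
  have "?x = (1 - t / len) *\<^sub>R vx k + (t / len) *\<^sub>R vx j"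
  proof -
    have "(1 - t / len) *\<^sub>R vx k + (t / len) *\<^sub>R vx j = vx k + (t / len) *\<^sub>R (vx j - vx k)"
      by (simp add: algebra_simps)
    also have "vx j - vx k = len *\<^sub>R ev k" using v by simp
    finally show ?thesis using tl by simp
  qed
  then have xP: "?x \<in> P"
    using convexD_alt[OF convex_P vx_in_P[of k] vx_in_P[of j], of "t / len"] k j tl by simp
  have lk: "ll k ?x = 0" using ll_vx(1)[of k] k by (simp add: ll_add ev_nv det2_self)
  have l1: "ll (Suc k) ?x = t" using ll_vx(2)[of k] DD_Suc[of k] k by (simp add: ll_add ev_nv)
  have "?x = vx j + (t - len) *\<^sub>R ev k" by (simp add: v algebra_simps)
  then have l2: "ll j ?x = len - t" using ll_vx(1)[of j] DD_Suc'[of j] k j by (simp add: ll_add ev_nv)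
  have "ll i ?x > 0" if i: "i \<in> {1..d} - {k}" for i
  proof (rule ccontr)
    assume "\<not> ll i ?x > 0"
    moreover have "ll i ?x \<ge> 0" using xP i by (auto simp: mem_P)
    ultimately have z: "ll i ?x = 0" by simp
    show False
    proof (cases "i < k")
      case True
      then have "k = Suc i" using active_consecutive[OF xP, of i k] i k z lk by auto
      then show False using l2 z j tl by simp
    next
      case False
      then have "i = Suc k" using active_consecutive[OF xP, of k i] i k z lk by auto
      then show False using l1 z tl by simp
    qed
  qed
  then show ?thesis using lk k by (auto simp: only_active_def)
qed

lemma only_active_param:
  assumes k: "1 < k" "k < d" and b: "only_active k b"
  obtains t where "0 < t" "t < ap k - ap (k - 1)" "b = vx k + t *\<^sub>R ev k"
proof -
  obtain j where j: "k = Suc j" "1 \<le> j" using k by (cases k) auto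
  have bP: "b \<in> P" by (rule only_active_P[OF b])
  have e: "b \<in> eg k" "b \<in> eg (Suc j)" using b bP j by (auto simp: only_active_def mem_eg)
  have "b = vx k + ll (Suc k) b *\<^sub>R ev k" using eg_param_left(1)[OF _ k(2) e(1)] k by simp
  moreover have "ll (Suc k) b > 0" using b k by (auto simp: only_active_def)
  moreover have "ll (Suc k) b < ap k - ap (k - 1)"
  proof -
    have "b = vx j - ll j b *\<^sub>R ev k" using eg_param_right(1)[OF j(2) _ e(2)] k j by simp
    also have "vx j = vx k + (ap k - ap j) *\<^sub>R ev k" using vx_step[of j] k(2) j by simp
    also have "\<dots> - ll j b *\<^sub>R ev k = vx k + (ap k - ap j - ll j b) *\<^sub>R ev k" by (simp add: algebra_simps)
    finally have "ll (Suc k) b = ll (Suc k) (vx k + (ap k - ap j - ll j b) *\<^sub>R ev k)" by (rule arg_cong)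
    also have "\<dots> = ap k - ap j - ll j b" using ll_vx(2)[of k] DD_Suc[of k] k by (simp add: ll_add ev_nv)
    moreover have "ll j b > 0" using b j k by (auto simp: only_active_def)
    ultimately show ?thesis using j by simp
  qed
  ultimately show ?thesis using that by blast
qed

definition phi :: "nat \<Rightarrow> real^2 \<Rightarrow> real" where "phi k x = dir_deriv (ev k) (dir_deriv (ev k) (vv {k})) x"

lemma smooth_phi: "smooth_fun (NN {k}) (phi k)"
  unfolding phi_def[abs_def] by (intro smooth_intros smooth_vv)

text \<open>Near the edge \<open>q = (ll k)^2 * kap\<close>. With the poles cleared, the equation
  \<open>Lop q = 0\<close> restricts to the edge as
  \<open>\<alpha> k * kap'' + 2 * phi * kap = 0\<close>. As
  \<open>kap = 1 / (\<alpha> k * phi)\<close> there, the second derivative of \<open>kap\<close>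
  along the edge is constant.\<close>

lemma I_edge_ode:
  assumes k: "k \<in> I" and b: "only_active k b" and p: "phi k b > 0"
  shows "b \<in> Nb k {k}" "kap k {k} b = inverse (\<alpha> k * phi k b)"
    "dir_deriv (ev k) (dir_deriv (ev k) (kap k {k})) b = - 2 / (\<alpha> k)\<^sup>2"
proof -
  note kr = I_range[OF k]
  have i: "1 \<le> k" "k < d" and A: "{k} \<subseteq> {k, Suc k}" using kr by auto
  let ?M1 = "MM {k} (k \<in> {k}) k (- ev (Suc k))" and ?M2 = "MM {k} (Suc k \<in> {k}) (Suc k) (ev k)"
    and ?w = "ww {k} (- ev (Suc k)) (ev k)" and ?mu1 = "mu (k \<in> {k}) k" and ?mu2 = "mu (Suc k \<in> {k}) (Suc k)"
  let ?D1 = "- ev (Suc k)" and ?D2 = "ev k" and ?\<kappa> = "kap k {k}" and ?N = "Nb k {k}"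
  have lb0: "ll k b = 0" and bN: "b \<in> NN {k}" and bP: "b \<in> P" using b only_active_NN only_active_P by (auto simp: only_active_def)
  have M2: "?M2 x = phi k x" for x by (simp add: MM_def phi_def)
  have M1b: "?M1 b = \<alpha> k" and mu1: "?mu1 = (\<lambda>x. ll k x * ll k x)" and mu2: "?mu2 = (\<lambda>x. 1)"
    using k lb0 by (auto simp: MM_def mu_def fun_eq_iff)
  have denb: "den k {k} b = \<alpha> k * phi k b" unfolding den_def[OF i A] M1b M2 mu1 by (simp add: lb0)
  show bNb: "b \<in> ?N" using bN denb p \<alpha>_pos[OF k] by (simp add: Nb_def[OF i A])
  show kb: "?\<kappa> b = inverse (\<alpha> k * phi k b)" by (simp add: kap_def[OF i A] denb)
  note fr = frame[OF i A]
  note lbf = lb_facts[OF i A]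
  note sk = smooth_kap[OF i A]
  have oN: "open ?N" by (rule open_Nb[OF i A])
  have oNO: "open (?N \<inter> \<Omega>)" by (intro open_Int oN open_\<Omega>)
  have dll: "dir_deriv a (dir_deriv c (\<lambda>x. ll k x * ll k x)) x = 2 * (a \<bullet> nv k) * (c \<bullet> nv k)" for a c x
  proof -
    have z: "dir_deriv a (ll k) = (\<lambda>x. a \<bullet> nv k)" for a by (rule ext) (rule dir_deriv_ll)
    show ?thesis by (subst dir_deriv_mult2[OF open_UNIV smooth_ll smooth_ll]) (simp_all add: z)
  qed
  have dl: "dir_deriv a (\<lambda>x. ll k x * ll k x) x = 2 * ll k x * (a \<bullet> nv k)" for a x
    using dir_deriv_mu[of a True k x] k mu1 by simp
  have q2: "dir_deriv a (dir_deriv c q) x = 2 * (a \<bullet> nv k) * (c \<bullet> nv k) * ?\<kappa> x + 2 * ll k x * (c \<bullet> nv k) * dir_deriv a ?\<kappa> x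
      + 2 * ll k x * (a \<bullet> nv k) * dir_deriv c ?\<kappa> x + ll k x * ll k x * dir_deriv a (dir_deriv c ?\<kappa>) x"
    if x: "x \<in> ?N \<inter> \<Omega>" for a c x
  proof -
    have "q y = (ll k y * ll k y) * ?\<kappa> y" if "y \<in> ?N \<inter> \<Omega>" for y
      using q_kap[OF i A that] by (simp only: mu1 mu2 mult_1_right)
    then have "dir_deriv a (dir_deriv c q) x = dir_deriv a (dir_deriv c (\<lambda>y. (ll k y * ll k y) * ?\<kappa> y)) x"
      using foldr_dir_deriv_cong[OF oNO _ x, of q _ "[a,c]"] by simp
    also have "\<dots> = dir_deriv a (dir_deriv c (\<lambda>x. ll k x * ll k x)) x * ?\<kappa> x + dir_deriv c (\<lambda>x. ll k x * ll k x) x * dir_deriv a ?\<kappa> x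
      + dir_deriv a (\<lambda>x. ll k x * ll k x) x * dir_deriv c ?\<kappa> x + (ll k x * ll k x) * dir_deriv a (dir_deriv c ?\<kappa>) x"
      by (rule dir_deriv_mult2[OF oN smooth_fun_mult[OF oN smooth_ll smooth_ll] sk]) (use x in simp)
    finally show ?thesis unfolding dll dl by (simp add: algebra_simps)
  qed
  \<comment> \<open>\<open>Lop q\<close> in the frame of \<open>ev k\<close> and
    \<open>- ev (Suc k)\<close>, with the factor \<open>(ll k)^2\<close> from \<open>q\<close>
    cancelled against the pole of the Hessian. In this form it is smooth across the edge.\<close>
  define \<Psi> where "\<Psi> = (\<lambda>x. ?M1 x * dir_deriv ?D2 (dir_deriv ?D2 ?\<kappa>) x
     - 2 * ?w x * (2 * ll k x * dir_deriv ?D2 ?\<kappa> x + ll k x * ll k x * dir_deriv ?D2 (dir_deriv ?D1 ?\<kappa>) x)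
     + ?M2 x * (2 * ?\<kappa> x + 4 * ll k x * dir_deriv ?D1 ?\<kappa> x + ll k x * ll k x * dir_deriv ?D1 (dir_deriv ?D1 ?\<kappa>) x))"
  have "smooth_fun ?N \<Psi>" unfolding \<Psi>_def
    by (intro smooth_intros oN lbf(3) lbf(4) lbf(5) sk smooth_ll)
  then have cont: "isCont \<Psi> b" using bNb by (rule isCont_smooth)
  have "\<Psi> x = 0" if x: "x \<in> ?N \<inter> \<Omega>" for x
  proof -
    have xO: "x \<in> \<Omega>" using x by simp
    have lx: "ll k x > 0" using xO kr by (auto simp: interior_P)
    have "0 = Lop q x" using Lop_q[OF xO] by simp
    also have "\<dots> = hs ?D1 ?D1 x * dir_deriv ?D2 (dir_deriv ?D2 q) x - 2 * hs ?D2 ?D1 x * dir_deriv ?D2 (dir_deriv ?D1 q) x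
       + hs ?D2 ?D2 x * dir_deriv ?D1 (dir_deriv ?D1 q) x"
      by (rule Lop_frame[OF open_\<Omega> smooth_q xO xO fr(1)])
    also have "hs ?D1 ?D1 x = ?M1 x / (ll k x * ll k x)" using lbf(8)[OF x] by (simp only: mu1)
    also have "hs ?D2 ?D1 x = ?w x" using lbf(8)[OF x] hs_commute[OF xO] by simp
    also have "hs ?D2 ?D2 x = ?M2 x" using lbf(8)[OF x] by (simp only: mu2 div_by_1)
    finally have "0 = ?M1 x / (ll k x * ll k x) * dir_deriv ?D2 (dir_deriv ?D2 q) x - 2 * ?w x * dir_deriv ?D2 (dir_deriv ?D1 q) x
       + ?M2 x * dir_deriv ?D1 (dir_deriv ?D1 q) x" .
    then show ?thesis unfolding q2[OF x] fr \<Psi>_def using lx by (simp add: algebra_simps)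
  qed
  then have "\<Psi> b = 0" by (rule limit_from_inside_0[OF bP cont oN bNb])
  then have "\<alpha> k * dir_deriv ?D2 (dir_deriv ?D2 ?\<kappa>) b + phi k b * (2 * ?\<kappa> b) = 0"
    unfolding \<Psi>_def M1b M2 lb0 by simp
  then have "\<alpha> k * dir_deriv ?D2 (dir_deriv ?D2 ?\<kappa>) b = - 2 / \<alpha> k"
    unfolding kb using p \<alpha>_pos[OF k] by (simp add: field_simps)
  then show "dir_deriv (ev k) (dir_deriv (ev k) ?\<kappa>) b = - 2 / (\<alpha> k)\<^sup>2"
    using \<alpha>_pos[OF k] by (simp add: field_simps power2_eq_square)
qed

text \<open>By \<open>I_edge_ode\<close>, \<open>1 / phi\<close> is a quadratic polynomial along the edge as long as \<open>phi > 0\<close>. So it stays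
  bounded, and \<open>phi\<close>, which is positive near the vertex, cannot reach 0.\<close>

lemma phi_pos_I:
  assumes k: "k \<in> I" and b: "only_active k b"
  shows "phi k b > 0"
proof (rule ccontr)
  assume neg: "\<not> phi k b > 0"
  note kr = I_range[OF k]
  define len where "len = ap k - ap (k - 1)"
  let ?L = "\<lambda>t. vx k + t *\<^sub>R ev k"
  define f where "f = (\<lambda>t. phi k (?L t))"
  obtain t1 where t1: "0 < t1" "t1 < len" "b = ?L t1" using only_active_param[OF kr b] len_def by auto
  have oa: "only_active k (?L t)" if "0 < t" "t < len" for t
    using edge_interior_only_active[OF kr] that len_def by simp
  have contf: "isCont f t" if "0 < t" "t < len" for t
  proof -
    have "isCont (phi k) (?L t)" by (rule isCont_smooth[OF smooth_phi only_active_NN[OF oa[OF that]]])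
    then show ?thesis unfolding f_def by (intro isCont_o2[where f = ?L and g = "phi k"]) (auto intro!: continuous_intros)
  qed
  \<comment> \<open>At the vertex \<open>vx k\<close> the edge \<open>k + 1\<close>, which is not in
    \<open>I\<close>, contributes \<open>1 / (2 * t)\<close> to \<open>f\<close>, so
    \<open>f\<close> tends to plus infinity there.\<close>
  have near: "\<exists>\<delta>>0. \<forall>t. 0 < t \<longrightarrow> t < \<delta> \<longrightarrow> t < len \<longrightarrow> f t > 0"
  proof -
    let ?V = "\<lambda>x. dir_deriv (ev k) (dir_deriv (ev k) (vv {Suc k, k})) x"
    have "vx k \<in> NN {Suc k, k}"
    proof (rule P_in_NN)
      show "vx k \<in> P" using vx_in_P kr by simp
      fix j assume j: "j \<in> {1..d} - {Suc k, k}"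
      show "ll j (vx k) \<noteq> 0"
      proof
        assume z: "ll j (vx k) = 0"
        show False
        proof (cases "j < k")
          case True
          then show False using active_consecutive[of "vx k" j "Suc k"] vx_in_P[of k] ll_vx[of k] kr j z by auto
        next
          case False
          then show False using active_consecutive[of "vx k" k j] vx_in_P[of k] ll_vx[of k] kr j z by auto
        qed
      qed
    qed
    then have "isCont ?V (vx k)" by (intro isCont_smooth[of "NN {Suc k, k}"] smooth_intros smooth_vv)
    then have "isCont (\<lambda>t. ?V (?L t)) 0" by (intro isCont_o2[where f = ?L and g = ?V]) (auto intro!: continuous_intros)
    then obtain \<delta> where \<delta>: "\<delta> > 0" "\<And>t. dist t 0 < \<delta> \<Longrightarrow> dist (?V (?L t)) (?V (?L 0)) < 1"
      unfolding continuous_at_eps_delta by (metis zero_less_one)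
    define C where "C = \<bar>?V (vx k)\<bar> + 1"
    have C: "C > 0" by (simp add: C_def add_nonneg_pos)
    have "f t > 0" if t: "0 < t" "t < min \<delta> (1 / (2 * C))" "t < len" for t
    proof -
      have "f t = ?V (?L t) + 1 / (2 * t)"
      proof -
        have "f t = ?V (?L t) + sg2 (Suc k) (?L t) * (ev k \<bullet> nv (Suc k)) * (ev k \<bullet> nv (Suc k))"
          unfolding f_def phi_def
          using only_active_NN[OF oa[OF t(1) t(3)]] kr by (intro vv_step) auto
        moreover have "ev k \<bullet> nv (Suc k) = 1" using DD_Suc[of k] kr by (simp add: ev_nv)
        moreover have "ll (Suc k) (?L t) = t" using ll_vx(2)[of k] kr DD_Suc[of k] by (simp add: ll_add ev_nv)
        ultimately show ?thesis using I_Suc[OF k] by (simp add: sg2_def)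
      qed
      moreover have "\<bar>?V (?L t)\<bar> < C" using \<delta>(2)[of t] t unfolding C_def by (simp add: dist_real_def)
      moreover have "1 / (2 * t) > C" using t C by (simp add: field_simps)
      ultimately show ?thesis by linarith
    qed
    then show ?thesis using \<delta> C by (intro exI[of _ "min \<delta> (1 / (2 * C))"]) auto
  qed
  then obtain \<delta> where \<delta>: "\<delta> > 0" "\<And>t. 0 < t \<Longrightarrow> t < \<delta> \<Longrightarrow> t < len \<Longrightarrow> f t > 0" by blast
  define t0 where "t0 = min \<delta> t1 / 2"
  have t0: "0 < t0" "t0 < \<delta>" "t0 < t1" using \<delta> t1 by (auto simp: t0_def)
  define Z where "Z = {t0..t1} \<inter> f -` {..0}"
  have "continuous_on {t0..t1} f" using contf t0 t1 by (intro continuous_at_imp_continuous_on) auto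
  then have "closed Z" unfolding Z_def by (intro continuous_closed_preimage) auto
  moreover have "bounded Z" unfolding Z_def using bounded_closed_interval by (rule bounded_subset) auto
  moreover have "t1 \<in> Z" using neg t1 t0 by (auto simp: Z_def f_def)
  ultimately obtain ts where ts: "ts \<in> Z" "\<And>t. t \<in> Z \<Longrightarrow> ts \<le> t"
    using compact_attains_inf[of Z] compact_eq_bounded_closed by blast
  have tsr: "t0 < ts" "ts \<le> t1" "f ts \<le> 0"
    using ts(1) \<delta>(2)[of t0] t0 t1 by (auto simp: Z_def less_le)
  have fpos: "f t > 0" if "t0 \<le> t" "t < ts" for t
    using ts(2)[of t] that tsr by (force simp: Z_def)
  let ?\<kappa> = "kap k {k}"
  have i: "1 \<le> k" "k < d" and A: "{k} \<subseteq> {k, Suc k}" using kr by auto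
  have rng: "0 < t" "t < len" if "t0 \<le> t" "t < ts" for t using that t0 tsr t1 by auto
  note ode = I_edge_ode[OF k oa[OF rng] fpos[unfolded f_def]]
  have d1: "((\<lambda>t. ?\<kappa> (?L t)) has_real_derivative dir_deriv (ev k) ?\<kappa> (?L t)) (at t)" if "t0 \<le> t" "t < ts" for t
    using that by (intro DERIV_along_line smooth_fun_differentiable[OF smooth_kap[OF i A]] ode(1)) auto
  have d2: "((\<lambda>t. dir_deriv (ev k) ?\<kappa> (?L t)) has_real_derivative dir_deriv (ev k) (dir_deriv (ev k) ?\<kappa>) (?L t)) (at t)"
    if "t0 \<le> t" "t < ts" for t
    using that by (intro DERIV_along_line smooth_fun_differentiable[OF smooth_fun_dir_deriv[OF smooth_kap[OF i A]]] ode(1)) auto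
  define m where "m = dir_deriv (ev k) ?\<kappa> (?L t0)"
  have m: "dir_deriv (ev k) ?\<kappa> (?L t) \<le> m" if t: "t0 \<le> t" "t < ts" for t
    unfolding m_def
  proof (rule DERIV_nonpos_imp_nonincreasing[OF t(1)])
    fix x assume "t0 \<le> x" "x \<le> t"
    then have x: "t0 \<le> x" "x < ts" using t by auto
    have "dir_deriv (ev k) (dir_deriv (ev k) ?\<kappa>) (?L x) \<le> 0"
      unfolding ode(3)[OF x x x] by simp
    then show "\<exists>y. ((\<lambda>t. dir_deriv (ev k) ?\<kappa> (?L t)) has_real_derivative y) (at x) \<and> y \<le> 0"
      using d2[OF x] by blast
  qed
  \<comment> \<open>\<open>kap\<close> is concave along the edge by the equation. Hence its slope
    never exceeds the slope \<open>m\<close> at \<open>t0\<close>, and \<open>B\<close> bounds it up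
    to \<open>ts\<close>.\<close>
  define B where "B = ?\<kappa> (?L t0) + \<bar>m\<bar> * len"
  have kp: "?\<kappa> (?L t) = inverse (\<alpha> k * f t)" if "t0 \<le> t" "t < ts" for t
    using ode(2)[OF that that that] by (simp add: f_def)
  have B: "B > 0" unfolding B_def using kp[of t0] fpos[of t0] tsr \<alpha>_pos[OF k] t1 by (intro add_pos_nonneg) auto
  have fB: "f t \<ge> 1 / (\<alpha> k * B)" if t: "t0 \<le> t" "t < ts" for t
  proof -
    have "?\<kappa> (?L t) - m * t \<le> ?\<kappa> (?L t0) - m * t0"
    proof (rule DERIV_nonpos_imp_nonincreasing[OF t(1)])
      fix x assume "t0 \<le> x" "x \<le> t"
      then have x: "t0 \<le> x" "x < ts" using t by auto
      have "((\<lambda>t. ?\<kappa> (?L t) - m * t) has_real_derivative dir_deriv (ev k) ?\<kappa> (?L x) - m) (at x)"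
        using DERIV_diff[OF d1[OF x] DERIV_cmult[OF DERIV_ident, of m]] by simp
      then show "\<exists>y. ((\<lambda>t. ?\<kappa> (?L t) - m * t) has_real_derivative y) (at x) \<and> y \<le> 0"
        using m[OF x] by (intro exI conjI) auto
    qed
    then have "?\<kappa> (?L t) \<le> ?\<kappa> (?L t0) + m * (t - t0)" by (simp add: algebra_simps)
    also have "m * (t - t0) \<le> \<bar>m\<bar> * len" using t t0 tsr t1 by (intro mult_mono) auto
    finally have "inverse (\<alpha> k * f t) \<le> B" unfolding kp[OF t] B_def by simp
    then show ?thesis using fpos[OF t] \<alpha>_pos[OF k] B by (simp add: field_simps)
  qed
  have "isCont f ts" using contf[of ts] tsr t0 t1 by simp
  then have "(f \<longlongrightarrow> f ts) (at_left ts)" by (simp add: isCont_def filterlim_at_split)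
  moreover have "\<forall>\<^sub>F t in at_left ts. f t \<ge> 1 / (\<alpha> k * B)"
    using tsr fB unfolding eventually_at_left_field by (intro exI[of _ t0]) auto
  ultimately have "f ts \<ge> 1 / (\<alpha> k * B)" by (intro tendsto_lowerbound) auto
  moreover have "1 / (\<alpha> k * B) > 0" using B \<alpha>_pos[OF k] by simp
  ultimately show False using tsr by linarith
qed

lemma phi_pos: "only_active k b \<Longrightarrow> phi k b > 0"
  using phi_pos_I edge_hessian_pos_notI by (cases "k \<in> I") (auto simp: phi_def)

end

lemma dir_deriv_neg_dir:
  assumes "f differentiable (at x)"
  shows "dir_deriv (- h) f x = - dir_deriv h f x"
  using linear_neg[OF dir_deriv_linear[OF assms]] by simp

section \<open>Boundary values of \<open>q\<close> and \<open>H\<close>\<close>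

context toric
begin

lemma active_set:
  assumes b: "b \<in> frontier \<Omega>"
  obtains i where "1 \<le> i" "i < d" "{j\<in>{1..d}. ll j b = 0} \<in> {{i}, {Suc i}, {i, Suc i}}"
proof -
  define A where "A = {j\<in>{1..d}. ll j b = 0}"
  have bP: "b \<in> P" and "A \<noteq> {}" using b by (auto simp: mem_frontier A_def)
  have cons: "k = Suc j" if "j \<in> A" "k \<in> A" "j < k" for j k
    using active_consecutive[OF bP, of j k] that by (auto simp: A_def)
  define m where "m = Min A"
  have fA: "finite A" by (simp add: A_def)
  have m: "m \<in> A" "\<And>j. j \<in> A \<Longrightarrow> m \<le> j" using fA \<open>A \<noteq> {}\<close> by (auto simp: m_def)
  have "A \<subseteq> {m, Suc m}" using m cons[of m] by (metis insert_iff le_neq_implies_less subsetI)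
  then have A: "A = {m} \<or> A = {m, Suc m}" using m by auto
  show ?thesis
  proof (cases "m < d")
    case True
    then show ?thesis using that[of m] A m by (auto simp: A_def)
  next
    case False
    then have md: "m = d" "Suc m \<notin> A" using m by (auto simp: A_def)
    then have "A = {d}" using A by auto
    moreover obtain c where "d = Suc c" "1 \<le> c" using d2 by (cases d) auto
    ultimately show ?thesis using that[of c] by (auto simp: A_def)
  qed
qed

text \<open>At a boundary point \<open>den\<close> reduces to \<open>M1 * M2\<close>. For an active
  edge the factor is the leading coefficient, \<open>\<alpha> j\<close> or 1; for an inactive one it
  is the second derivative along the active edge, which is positive by
  \<open>phi_pos\<close>.\<close>

lemma boundary_pair:
  assumes b: "b \<in> frontier \<Omega>"
  obtains i Act where "1 \<le> i" "i < d" "Act \<subseteq> {i, Suc i}" "Act = {j\<in>{1..d}. ll j b = 0}"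
    "b \<in> Nb i Act" "mu (i \<in> Act) i b * mu (Suc i \<in> Act) (Suc i) b = 0"
proof -
  obtain i where i: "1 \<le> i" "i < d" and A0: "{j\<in>{1..d}. ll j b = 0} \<in> {{i}, {Suc i}, {i, Suc i}}"
    using active_set[OF b] by blast
  define Act where "Act = {j\<in>{1..d}. ll j b = 0}"
  have A: "Act \<subseteq> {i, Suc i}" and Ane: "Act \<noteq> {}" and A1: "Act = {i} \<or> Act = {Suc i} \<or> Act = {i, Suc i}"
    using A0 by (auto simp: Act_def)
  have bP: "b \<in> P" using b by (simp add: mem_frontier)
  have bNN: "b \<in> NN Act" by (rule P_in_NN[OF bP]) (auto simp: Act_def)
  have only: "only_active k b" if "Act = {k}" for k
  proof -
    have "k \<in> {1..d}" "ll k b = 0" using that by (auto simp: Act_def)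
    moreover have "ll j b > 0" if "j \<in> {1..d} - {k}" for j
      using that bP \<open>Act = {k}\<close> by (force simp: Act_def mem_P less_le)
    ultimately show ?thesis by (simp add: only_active_def)
  qed
  have lz: "ll j b = 0" if "j \<in> Act" for j using that by (simp add: Act_def)
  have m0: "mu (i \<in> Act) i b * mu (Suc i \<in> Act) (Suc i) b = 0"
    using A1 lz by (auto simp: mu_def)
  have Mpos: "MM Act (j \<in> Act) j h b > 0" if "j \<in> Act" for j h
    using that lz[OF that] \<alpha>_pos by (simp add: MM_def)
  have M1: "MM Act (i \<in> Act) i (- ev (Suc i)) b > 0"
  proof (cases "i \<in> Act")
    case False
    then have Ae: "Act = {Suc i}" using A1 by auto
    let ?v = "vv Act"
    have dd: "dir_deriv a ?v differentiable (at b)" for a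
      by (intro smooth_fun_differentiable[OF _ bNN] smooth_intros smooth_vv)
    have "dir_deriv (- ev (Suc i)) (dir_deriv (- ev (Suc i)) ?v) b = - dir_deriv (ev (Suc i)) (dir_deriv (- ev (Suc i)) ?v) b"
      by (rule dir_deriv_neg_dir[OF dd])
    also have "dir_deriv (ev (Suc i)) (dir_deriv (- ev (Suc i)) ?v) b = dir_deriv (ev (Suc i)) (\<lambda>x. - dir_deriv (ev (Suc i)) ?v x) b"
      by (rule dir_deriv_cong[OF open_NN bNN]) (rule dir_deriv_neg_dir[OF smooth_fun_differentiable[OF smooth_vv]])
    also have "\<dots> = - dir_deriv (ev (Suc i)) (dir_deriv (ev (Suc i)) ?v) b" by (rule dir_deriv_minus[OF dd])
    finally show ?thesis using phi_pos[OF only[OF Ae]] False by (simp add: MM_def phi_def Ae)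
  qed (rule Mpos)
  have M2: "MM Act (Suc i \<in> Act) (Suc i) (ev i) b > 0"
  proof (cases "Suc i \<in> Act")
    case False
    then have Ae: "Act = {i}" using A1 by auto
    then show ?thesis using phi_pos[OF only[OF Ae]] False by (simp add: MM_def phi_def)
  qed (rule Mpos)
  have "den i Act b > 0" unfolding den_def[OF i A] m0 using M1 M2 by simp
  then have "b \<in> Nb i Act" using bNN by (simp add: Nb_def[OF i A])
  then show ?thesis using that[OF i A _ _ m0] Act_def by blast
qed

lemma q_lim: "b \<in> frontier \<Omega> \<Longrightarrow> (q \<longlongrightarrow> 0) (at b within \<Omega>)"
proof -
  assume b: "b \<in> frontier \<Omega>"
  show ?thesis by (rule boundary_pair[OF b]) (rule q_tendsto_0)
qed

lemma H_strict:
  assumes b: "b \<in> frontier \<Omega>"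
  obtains A C where "strict_deriv \<Omega> H A b" "\<And>j. j \<in> {1..d} \<Longrightarrow> ll j b = 0 \<Longrightarrow> A (ev j) = (if j \<in> I then 0 else 1)"
    "\<And>t v. A (t *\<^sub>R v) = t * A v" "\<And>v. \<bar>A v\<bar> \<le> C * norm v" "C > 0"
proof -
  obtain i Act where i: "1 \<le> i" "i < d" and Act: "Act \<subseteq> {i, Suc i}" "Act = {j\<in>{1..d}. ll j b = 0}" and bN: "b \<in> Nb i Act"
    by (rule boundary_pair[OF b]) (rule that)
  let ?A = "AH i Act b"
  have A: "?A v = det2 v (- ev (Suc i)) * g2 i Act b + det2 (ev i) v * g1 i Act b" for v
    by (rule AH_def[OF i Act(1)])
  show ?thesis
  proof (rule that[of ?A])
    show "strict_deriv \<Omega> H ?A b" by (rule strict_H[OF i Act(1) bN])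
    show "?A (ev j) = (if j \<in> I then 0 else 1)" if "j \<in> {1..d}" "ll j b = 0" for j
    proof -
      have "j \<in> Act" using that Act(2) by simp
      then show ?thesis using kap_boundary[OF i Act(1) bN] Act(1) that by auto
    qed
    show "?A (t *\<^sub>R v) = t * ?A v" for t v
      by (simp add: A det2_scale1 det2_scale2 algebra_simps)
    let ?C = "2 * norm (ev (Suc i)) * \<bar>g2 i Act b\<bar> + 2 * norm (ev i) * \<bar>g1 i Act b\<bar> + 1"
    show "\<bar>?A v\<bar> \<le> ?C * norm v" for v
    proof -
      have "\<bar>?A v\<bar> \<le> \<bar>det2 v (- ev (Suc i))\<bar> * \<bar>g2 i Act b\<bar> + \<bar>det2 (ev i) v\<bar> * \<bar>g1 i Act b\<bar>"
        unfolding A by (rule order_trans[OF abs_triangle_ineq]) (simp add: abs_mult)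
      also have "\<dots> \<le> (2 * norm (- ev (Suc i)) * norm v) * \<bar>g2 i Act b\<bar> + (2 * norm (ev i) * norm v) * \<bar>g1 i Act b\<bar>"
        using abs_det2_le[of v "- ev (Suc i)"] abs_det2_le[of v "ev i"] det2_swap[of "ev i" v]
        by (intro add_mono mult_right_mono) auto
      also have "\<dots> \<le> ?C * norm v" by (simp add: algebra_simps)
      finally show ?thesis .
    qed
    show "?C > 0" by (intro add_nonneg_pos) auto
  qed
qed

lemma frontier_notin: "b \<in> frontier \<Omega> \<Longrightarrow> b \<notin> \<Omega>"
  by (simp add: frontier_def)

lemma push_filterlim:
  assumes b: "b \<in> frontier \<Omega>"
  shows "filterlim (\<lambda>t. b + t *\<^sub>R wv) (at b within \<Omega>) (at_right 0)"
proof -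
  have bP: "b \<in> P" using b by (simp add: mem_frontier)
  have "((\<lambda>t. b + t *\<^sub>R wv) \<longlongrightarrow> b) (at_right 0)" by (auto intro!: tendsto_eq_intros)
  moreover have "\<forall>\<^sub>F t in at_right (0::real). b + t *\<^sub>R wv \<in> \<Omega> \<and> b + t *\<^sub>R wv \<noteq> b"
    using eventually_at_right_less[of "0::real"]
  proof eventually_elim
    case (elim t)
    then have "b + t *\<^sub>R wv \<in> \<Omega>" by (rule push_in[OF bP])
    then show ?case using frontier_notin[OF b] by metis
  qed
  ultimately show ?thesis by (simp add: filterlim_at eventually_conj_iff)
qed

lemma at_frontier_nontrivial: assumes b: "b \<in> frontier \<Omega>" shows "at b within \<Omega> \<noteq> bot"
proof
  assume "at b within \<Omega> = bot"
  then have "filterlim (\<lambda>t. b + t *\<^sub>R wv) bot (at_right (0::real))" using push_filterlim[OF b] by simp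
  then have "\<forall>\<^sub>F t in at_right (0::real). False" unfolding filterlim_iff by (meson eventually_bot)
  then show False by (simp add: eventually_False)
qed

definition hb :: "real^2 \<Rightarrow> real" where "hb b = Lim (at b within \<Omega>) H"

text \<open>A strict derivative makes \<open>H\<close> Lipschitz near \<open>b\<close>, hence
  uniformly continuous, so the limit exists.\<close>

lemma H_lim: assumes b: "b \<in> frontier \<Omega>" shows "(H \<longlongrightarrow> hb b) (at b within \<Omega>)"
proof -
  obtain A C where A: "strict_deriv \<Omega> H A b" "\<And>v. \<bar>A v\<bar> \<le> C * norm v" "C > 0"
    by (rule H_strict[OF b]) (rule that)
  obtain \<delta> where \<delta>: "\<delta> > 0" "\<And>x y. x \<in> \<Omega> \<inter> ball b \<delta> \<Longrightarrow> y \<in> \<Omega> \<inter> ball b \<delta> \<Longrightarrow> \<bar>H x - H y - A (x - y)\<bar> \<le> 1 * norm (x - y)"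
    using A(1) unfolding strict_deriv_def by (meson zero_less_one)
  let ?X = "\<Omega> \<inter> ball b \<delta>"
  have lip: "dist (H x) (H y) \<le> (1 + C) * dist x y" if "x \<in> ?X" "y \<in> ?X" for x y
    using \<delta>(2)[OF that] A(2)[of "x - y"] unfolding dist_norm real_norm_def by (simp add: algebra_simps)
  have "uniformly_continuous_on ?X H"
    unfolding uniformly_continuous_on_def
  proof (intro allI impI)
    fix e :: real assume "e > 0"
    then have "dist (H x') (H x) < e" if "x \<in> ?X" "x' \<in> ?X" "dist x' x < e / (1 + C)" for x x'
      using lip[OF that(2,1)] that(3) A(3) by (smt (verit) divide_pos_pos mult.commute pos_less_divide_eq)
    then show "\<exists>d>0. \<forall>x\<in>?X. \<forall>x'\<in>?X. dist x' x < d \<longrightarrow> dist (H x') (H x) < e"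
      using A(3) \<open>e > 0\<close> by (intro exI[of _ "e / (1 + C)"]) auto
  qed
  moreover have "b \<in> closure ?X"
  proof -
    have "b \<in> closure \<Omega>" using b by (simp add: frontier_def)
    then show ?thesis using open_Int_closure_subset[of "ball b \<delta>" \<Omega>] \<delta> by (auto simp: Int_commute)
  qed
  ultimately obtain l where "(H \<longlongrightarrow> l) (at b within ?X)" by (rule uniformly_continuous_on_extension_at_closure)
  moreover have "at b within ?X = at b within \<Omega>"
    by (rule at_within_nhd[of _ "ball b \<delta>"]) (use \<delta> in auto)
  ultimately have l: "(H \<longlongrightarrow> l) (at b within \<Omega>)" by simp
  then have "hb b = l" unfolding hb_def by (rule tendsto_Lim[OF at_frontier_nontrivial[OF b]])
  then show ?thesis using l by simp
qed

lemma hb_strict: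
  assumes b: "b \<in> frontier \<Omega>"
  obtains A where "\<And>\<epsilon>. \<epsilon> > 0 \<Longrightarrow> \<exists>\<delta>>0. \<forall>b'\<in>frontier \<Omega> \<inter> ball b \<delta>. \<bar>hb b' - hb b - A (b' - b)\<bar> \<le> \<epsilon> * norm (b' - b)"
    "\<And>j. j \<in> {1..d} \<Longrightarrow> ll j b = 0 \<Longrightarrow> A (ev j) = (if j \<in> I then 0 else 1)" "\<And>t v. A (t *\<^sub>R v) = t * A v"
proof -
  obtain A C where A: "strict_deriv \<Omega> H A b" "\<And>j. j \<in> {1..d} \<Longrightarrow> ll j b = 0 \<Longrightarrow> A (ev j) = (if j \<in> I then 0 else 1)"
    "\<And>t v. A (t *\<^sub>R v) = t * A v" by (rule H_strict[OF b]) (rule that)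
  have "\<exists>\<delta>>0. \<forall>b'\<in>frontier \<Omega> \<inter> ball b \<delta>. \<bar>hb b' - hb b - A (b' - b)\<bar> \<le> \<epsilon> * norm (b' - b)" if "\<epsilon> > 0" for \<epsilon>
  proof -
    obtain \<delta> where \<delta>: "\<delta> > 0" "\<And>x y. x \<in> \<Omega> \<inter> ball b \<delta> \<Longrightarrow> y \<in> \<Omega> \<inter> ball b \<delta> \<Longrightarrow> \<bar>H x - H y - A (x - y)\<bar> \<le> \<epsilon> * norm (x - y)"
      using A(1) \<open>\<epsilon> > 0\<close> unfolding strict_deriv_def by meson
    have "\<bar>hb b' - hb b - A (b' - b)\<bar> \<le> \<epsilon> * norm (b' - b)" if b': "b' \<in> frontier \<Omega>" "b' \<in> ball b \<delta>" for b'
    proof (rule tendsto_upperbound)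
      \<comment> \<open>Both boundary points are pushed inwards by the same vector, so their
        difference, and with it the error bound, is unchanged.\<close>
      show "((\<lambda>t. \<bar>H (b' + t *\<^sub>R wv) - H (b + t *\<^sub>R wv) - A (b' - b)\<bar>) \<longlongrightarrow> \<bar>hb b' - hb b - A (b' - b)\<bar>) (at_right 0)"
        by (intro tendsto_intros filterlim_compose[OF H_lim push_filterlim] b b')
      have e: "\<forall>\<^sub>F t in at_right 0. c + t *\<^sub>R wv \<in> \<Omega> \<inter> ball b \<delta>" if c: "c \<in> frontier \<Omega>" "c \<in> ball b \<delta>" for c
      proof -
        have "((\<lambda>t. c + t *\<^sub>R wv) \<longlongrightarrow> c) (at_right 0)" by (auto intro!: tendsto_eq_intros)
        then have "\<forall>\<^sub>F t in at_right 0. c + t *\<^sub>R wv \<in> ball b \<delta>" using c open_ball topological_tendstoD by blast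
        moreover have "\<forall>\<^sub>F t in at_right (0::real). c + t *\<^sub>R wv \<in> \<Omega>"
          using eventually_at_right_less[of "0::real"]
          by eventually_elim (use push_in c in \<open>auto simp: mem_frontier\<close>)
        ultimately show ?thesis by eventually_elim auto
      qed
      have "b \<in> ball b \<delta>" using \<delta> by simp
      from e[OF b this] e[OF b']
      show "\<forall>\<^sub>F t in at_right 0. \<bar>H (b' + t *\<^sub>R wv) - H (b + t *\<^sub>R wv) - A (b' - b)\<bar> \<le> \<epsilon> * norm (b' - b)"
        by eventually_elim (use \<delta>(2)[of "b' + _ *\<^sub>R wv" "b + _ *\<^sub>R wv"] in fastforce)
    qed simp
    then show ?thesis using \<delta>(1) by blast
  qed
  then show ?thesis using that[of A] A by blast
qed

lemma eg_frontier: "j \<in> {1..d} \<Longrightarrow> b \<in> eg j \<Longrightarrow> b \<in> frontier \<Omega>"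
  by (auto simp: mem_frontier mem_eg)

text \<open>At every point of the edge, vertices included, \<open>hb_strict\<close> gives the slope
  of \<open>hb\<close> along the edge. So \<open>hb\<close> minus the linear function with this
  slope has derivative zero along the segment.\<close>

lemma hb_edge:
  assumes j: "j \<in> {1..d}" and b: "b \<in> eg j" "b + t *\<^sub>R ev j \<in> eg j"
  shows "hb (b + t *\<^sub>R ev j) = hb b + (if j \<in> I then 0 else t)"
proof -
  define c where "c = (if j \<in> I then 0 else 1::real)"
  define L where "L = (\<lambda>s. b + (s * t) *\<^sub>R ev j)"
  have L: "L s \<in> eg j" if "s \<in> {0..1}" for s
    using convexD_alt[OF convex_eg b, of s] that by (simp add: L_def algebra_simps)
  have "((\<lambda>s. hb (L s) - c * t * s) has_derivative (\<lambda>h. 0)) (at s0 within {0..1})" if s0: "s0 \<in> {0..1}" for s0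
    unfolding has_derivative_within_alt
  proof (intro conjI allI impI bounded_linear_zero)
    fix e :: real assume e: "e > 0"
    define \<epsilon> where "\<epsilon> = e / (\<bar>t\<bar> * norm (ev j) + 1)"
    have \<epsilon>: "\<epsilon> > 0" using e by (auto simp: \<epsilon>_def intro!: divide_pos_pos add_nonneg_pos)
    have fr: "L s0 \<in> frontier \<Omega>" and lz: "ll j (L s0) = 0" using L[OF s0] eg_frontier[OF j] by (auto simp: mem_eg)
    obtain A where A0: "\<And>\<epsilon>. \<epsilon> > 0 \<Longrightarrow> \<exists>\<delta>>0. \<forall>b'\<in>frontier \<Omega> \<inter> ball (L s0) \<delta>. \<bar>hb b' - hb (L s0) - A (b' - L s0)\<bar> \<le> \<epsilon> * norm (b' - L s0)"
      "\<And>j. j \<in> {1..d} \<Longrightarrow> ll j (L s0) = 0 \<Longrightarrow> A (ev j) = (if j \<in> I then 0 else 1)" "\<And>t v. A (t *\<^sub>R v) = t * A v"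
      by (rule hb_strict[OF fr]) (rule that)
    note A = A0(1)[OF \<epsilon>] A0(2)[OF j lz, folded c_def] A0(3)
    obtain \<delta> where \<delta>: "\<delta> > 0" "\<And>b'. b' \<in> frontier \<Omega> \<Longrightarrow> b' \<in> ball (L s0) \<delta> \<Longrightarrow> \<bar>hb b' - hb (L s0) - A (b' - L s0)\<bar> \<le> \<epsilon> * norm (b' - L s0)"
      using A(1) by blast
    define \<eta> where "\<eta> = \<delta> / (\<bar>t\<bar> * norm (ev j) + 1)"
    have n1: "\<bar>t\<bar> * norm (ev j) + 1 > 0" by (intro add_nonneg_pos) auto
    have "norm (hb (L s) - c * t * s - (hb (L s0) - c * t * s0) - 0) \<le> e * norm (s - s0)"
      if s: "s \<in> {0..1}" "norm (s - s0) < \<eta>" for s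
    proof -
      have d: "L s - L s0 = ((s - s0) * t) *\<^sub>R ev j" by (simp add: L_def algebra_simps)
      have nd: "norm (L s - L s0) = norm (s - s0) * (\<bar>t\<bar> * norm (ev j))" unfolding d by (simp add: abs_mult)
      also have "\<dots> \<le> norm (s - s0) * (\<bar>t\<bar> * norm (ev j) + 1)" by (intro mult_left_mono) auto
      finally have nd': "norm (L s - L s0) \<le> norm (s - s0) * (\<bar>t\<bar> * norm (ev j) + 1)" .
      also have "\<dots> < \<eta> * (\<bar>t\<bar> * norm (ev j) + 1)" using s n1 by (intro mult_strict_right_mono)
      also have "\<dots> = \<delta>" using n1 by (simp add: \<eta>_def)
      finally have "L s \<in> ball (L s0) \<delta>" by (simp add: dist_norm norm_minus_commute)
      then have "\<bar>hb (L s) - hb (L s0) - A (L s - L s0)\<bar> \<le> \<epsilon> * norm (L s - L s0)"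
        by (intro \<delta>(2) eg_frontier[OF j] L s(1))
      also have "A (L s - L s0) = c * t * (s - s0)" unfolding d A(3) A(2) by simp
      also have "\<epsilon> * norm (L s - L s0) \<le> \<epsilon> * (norm (s - s0) * (\<bar>t\<bar> * norm (ev j) + 1))"
        using nd' \<epsilon> by (intro mult_left_mono) auto
      also have "\<dots> = e * norm (s - s0)" using n1 by (simp add: \<epsilon>_def)
      finally show ?thesis by (simp add: algebra_simps)
    qed
    then show "\<exists>d>0. \<forall>y\<in>{0..1}. norm (y - s0) < d \<longrightarrow> norm (hb (L y) - c * t * y - (hb (L s0) - c * t * s0) - 0) \<le> e * norm (y - s0)"
      using \<delta>(1) n1 by (intro exI[of _ \<eta>]) (auto simp: \<eta>_def)
  qed
  then obtain k where "\<And>s. s \<in> {0..1} \<Longrightarrow> hb (L s) - c * t * s = k"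
    using has_derivative_zero_constant[of "{0..1::real}" "\<lambda>s. hb (L s) - c * t * s"] by auto
  from this[of 0] this[of 1] show ?thesis by (auto simp: L_def c_def)
qed

text \<open>These are the constants \<open>a\<^sub>j\<close>, whereas \<open>ap j\<close> is \<open>a\<^sub>j'\<close>.\<close>

definition aa :: "nat \<Rightarrow> real" where "aa j = ap j - (\<Sum>k\<in>{k\<in>I. k \<le> j}. Lam d \<nu> lam k)"

lemma aa_1: "aa 1 = ap 1"
proof -
  have "{k\<in>I. k \<le> 1} = {}" using I_range by force
  then show ?thesis unfolding aa_def by (simp only: sum.empty diff_zero)
qed

text \<open>Subtracting \<open>Lam k\<close> cancels the step of \<open>ap\<close> at
  \<open>k\<close> in \<open>I\<close>, just as \<open>hb\<close> does not change along such an
  edge.\<close>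

lemma aa_Suc: "aa (Suc j) = aa j + (if Suc j \<in> I then 0 else ap (Suc j) - ap j)"
proof (cases "Suc j \<in> I")
  case True
  then have "{k\<in>I. k \<le> Suc j} = insert (Suc j) {k\<in>I. k \<le> j}" by auto
  then show ?thesis using True finite_I by (simp add: aa_def Lam_def)
next
  case False
  then have "{k\<in>I. k \<le> Suc j} = {k\<in>I. k \<le> j}" by (auto simp: le_Suc_eq)
  then show ?thesis using False by (simp add: aa_def)
qed

lemma aa_mono: assumes "1 \<le> i" "i \<le> j" "j < d" shows "aa i \<le> aa j"
  using assms(2,3)
proof (induction j rule: dec_induct)
  case (step n)
  then show ?case using aa_Suc[of n] ap_less[of n] assms(1) by (auto split: if_splits)
qed simp

end

text \<open>\<open>H\<close> is determined only up to a constant. This choice gives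
  \<open>hb (vx j) = - aa j\<close> at all vertices, in accordance with the shifts
  \<open>H + a_j\<close> of the model.\<close>

locale toric_normalized = toric +
  assumes H_norm: "Lim (at (vx 1) within \<Omega>) H = - a_prime d \<nu> lam 1"
begin

lemma hb_vx: assumes "1 \<le> j" "j < d" shows "hb (vx j) = - aa j"
  using assms
proof (induction j rule: dec_induct)
  case base
  then show ?case using H_norm aa_1 by (simp add: hb_def)
next
  case (step n)
  have "vx (Suc n) \<in> eg (Suc n)" "vx n \<in> eg (Suc n)" using step vx_in_P ll_vx by (auto simp: mem_eg)
  moreover have "vx (Suc n) = vx n + (- (ap (Suc n) - ap n)) *\<^sub>R ev (Suc n)" using vx_step[of n] step
    by (simp only: scaleR_minus_left) simp
  ultimately have "hb (vx (Suc n)) = hb (vx n) + (if Suc n \<in> I then 0 else - (ap (Suc n) - ap n))"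
    using hb_edge[of "Suc n" "vx n" "- (ap (Suc n) - ap n)"] step by simp
  then show ?case using step aa_Suc[of n] by auto
qed

lemma hb_left:
  assumes j: "1 \<le> j" "j < d" and b: "b \<in> eg j"
  shows "hb b = - aa j + (if j \<in> I then 0 else ll (Suc j) b)"
proof -
  have "vx j \<in> eg j" using j vx_in_P ll_vx by (auto simp: mem_eg)
  then have "hb (vx j + ll (Suc j) b *\<^sub>R ev j) = hb (vx j) + (if j \<in> I then 0 else ll (Suc j) b)"
    using hb_edge[of j "vx j" "ll (Suc j) b"] eg_param_left(1)[OF j b] j b by simp
  then show ?thesis using eg_param_left(1)[OF j b] hb_vx[OF j] by simp
qed

lemma hb_right:
  assumes j: "1 \<le> j" "j < d" and b: "b \<in> eg (Suc j)"
  shows "hb b = - aa j - (if Suc j \<in> I then 0 else ll j b)"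
proof -
  have "vx j \<in> eg (Suc j)" using j vx_in_P ll_vx by (auto simp: mem_eg)
  then have "hb (vx j + (- ll j b) *\<^sub>R ev (Suc j)) = hb (vx j) + (if Suc j \<in> I then 0 else - ll j b)"
    using hb_edge[of "Suc j" "vx j" "- ll j b"] eg_param_right(1)[OF j b] j b by simp
  then show ?thesis using eg_param_right(1)[OF j b] hb_vx[OF j] by (cases "Suc j \<in> I") auto
qed

lemma hb_bounds:
  assumes "b \<in> eg j"
  shows "1 \<le> j \<Longrightarrow> j < d \<Longrightarrow> - aa j \<le> hb b" "1 \<le> j \<Longrightarrow> j < d \<Longrightarrow> b' \<in> eg (Suc j) \<Longrightarrow> hb b' \<le> - aa j"
  using hb_left[of j b] eg_param_left(2)[of j b] hb_right[of j b'] eg_param_right(2)[of j b'] assms by (auto split: if_splits)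

end

section \<open>The maximum principle\<close>

context toric_normalized
begin

definition cusps :: "(real^2) set" where "cusps = (\<Union>k\<in>I. eg k)"

lemma rh_lim: assumes b: "b \<in> frontier \<Omega>" shows "(rh c \<longlongrightarrow> \<bar>hb b + c\<bar>) (at b within \<Omega>)"
proof -
  have "((\<lambda>x. sqrt ((H x + c) * (H x + c) + q x)) \<longlongrightarrow> sqrt ((hb b + c) * (hb b + c) + 0)) (at b within \<Omega>)"
    by (intro tendsto_intros H_lim q_lim b)
  then show ?thesis by (simp add: rh_def[abs_def] rho2_def[abs_def] power2_eq_square[symmetric])
qed

lemma hb_cusp: assumes k: "k \<in> I" and b: "b \<in> eg k" shows "hb b = - aa k"
  using hb_left[of k b] I_range[OF k] b k by simp

text \<open>The whole edge is collapsed to the point \<open>(- aa k, 0)\<close> of the half-plane,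
  and the barrier centred at this point is infinite there.\<close>

lemma barr_cusp:
  assumes k: "k \<in> I" and b: "b \<in> eg k"
  shows "filterlim (barr (aa k)) at_top (at b within \<Omega>)"
proof -
  have fr: "b \<in> frontier \<Omega>" using eg_frontier[OF _ b] k I_sub by blast
  have "(rh (aa k) \<longlongrightarrow> 0) (at b within \<Omega>)" using rh_lim[OF fr, of "aa k"] hb_cusp[OF k b] by simp
  then have "((\<lambda>x. 2 * rh (aa k) x) \<longlongrightarrow> 2 * 0) (at b within \<Omega>)" by (intro tendsto_intros)
  moreover have ev: "\<forall>\<^sub>F x in at b within \<Omega>. x \<in> \<Omega>" by (simp add: eventually_at_filter)
  ultimately have 1: "filterlim (\<lambda>x. 2 * rh (aa k) x) (at_right 0) (at b within \<Omega>)"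
    unfolding filterlim_at by (auto elim!: eventually_mono simp: rh_pos less_imp_neq[OF rh_pos, symmetric])
  have "filterlim (\<lambda>x. ln (2 * rh (aa k) x)) at_bot (at b within \<Omega>)"
    by (rule filterlim_compose[OF ln_at_0 1])
  then have 2: "filterlim (\<lambda>x. - ln (2 * rh (aa k) x)) at_top (at b within \<Omega>)"
    by (simp add: filterlim_uminus_at_bot)
  show ?thesis
  proof (rule filterlim_at_top_mono[OF 2])
    show "\<forall>\<^sub>F x in at b within \<Omega>. - ln (2 * rh (aa k) x) \<le> barr (aa k) x"
      using ev by eventually_elim (use barr_ge rh_pos in \<open>force dest: less_imp_le intro: order_trans[rotated, OF barr_ge]\<close>)
  qed
qed

text \<open>A positive solution that tends to infinity both at infinity and at the edges in \<open>I\<close>, so that no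
  boundary condition is needed there in the maximum principle.\<close>

definition bb :: "real^2 \<Rightarrow> real" where "bb x = ff x + (1 + (\<Sum>k\<in>I. barr (aa k) x))"

lemma smooth_ff: "smooth_fun T ff"
  unfolding ff_affine[abs_def] by (rule smooth_fun_affine)

lemma smooth_bb: "smooth_fun \<Omega> bb"
  unfolding bb_def[abs_def] by (intro smooth_intros open_\<Omega> smooth_ff smooth_barr)

lemma Lop_bb: assumes x: "x \<in> \<Omega>" shows "Lop bb x = 0"
proof -
  have s: "smooth_fun \<Omega> (\<lambda>x. \<Sum>k\<in>I. barr (aa k) x)" by (intro smooth_intros open_\<Omega> smooth_barr)
  have "Lop (\<lambda>x. \<Sum>k\<in>I. barr (aa k) x) x = 0"
    using Lop_sum[of I "\<lambda>k. barr (aa k)" x] x by (simp add: smooth_barr Lop_barr)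
  then have "Lop (\<lambda>x. 1 + (\<Sum>k\<in>I. barr (aa k) x)) x = 0"
    using Lop_add[OF smooth_fun_const s x] by simp
  moreover have "Lop ff x = 0" unfolding ff_affine[abs_def] by simp
  ultimately show ?thesis unfolding bb_def[abs_def]
    using Lop_add[OF smooth_ff smooth_fun_add[OF open_\<Omega> smooth_fun_const s] x] by simp
qed

lemma bb_ge: assumes "x \<in> \<Omega>" shows "bb x \<ge> ff x + 1" "k \<in> I \<Longrightarrow> bb x \<ge> barr (aa k) x" "bb x > 0"
proof -
  have p: "barr (aa k) x \<ge> 0" for k using barr_pos[OF assms] less_imp_le by blast
  have f: "ff x \<ge> 0" using ff_nonneg assms interior_subset by blast
  show 1: "bb x \<ge> ff x + 1" unfolding bb_def using p by (simp add: sum_nonneg)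
  then show "bb x > 0" using f by linarith
  show "bb x \<ge> barr (aa k) x" if "k \<in> I"
    using member_le_sum[OF that _ finite_I, of "\<lambda>k. barr (aa k) x"] p f unfolding bb_def by simp
qed

lemma Lop_norm_sq: assumes x: "x \<in> \<Omega>" shows "Lop (\<lambda>x. x \<bullet> x) x > 0"
proof -
  have a: "smooth_fun \<Omega> (\<lambda>x. x \<bullet> axis i 1 + 0)" for i :: 2 by (rule smooth_fun_affine)
  have e: "(\<lambda>x. x \<bullet> x) = (\<lambda>x::real^2. (x \<bullet> E1 + 0) * (x \<bullet> E1 + 0) + (x \<bullet> E2 + 0) * (x \<bullet> E2 + 0))"
    by (simp add: fun_eq_iff inner_vec2 axis_def)
  have G: "Gam (\<lambda>x. x \<bullet> E1 + 0) (\<lambda>x. x \<bullet> E1 + 0) x = hs E2 E2 x" "Gam (\<lambda>x. x \<bullet> E2 + 0) (\<lambda>x. x \<bullet> E2 + 0) x = hs E1 E1 x"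
  proof -
    have i: "E1 \<bullet> E1 = 1" "E2 \<bullet> E2 = 1" "E1 \<bullet> E2 = 0" "E2 \<bullet> E1 = 0" by (simp_all add: inner_axis_axis)
    show "Gam (\<lambda>x. x \<bullet> E1 + 0) (\<lambda>x. x \<bullet> E1 + 0) x = hs E2 E2 x" "Gam (\<lambda>x. x \<bullet> E2 + 0) (\<lambda>x. x \<bullet> E2 + 0) x = hs E1 E1 x"
      unfolding Gam_def dir_deriv_affine i by simp_all
  qed
  have "Lop (\<lambda>x. x \<bullet> x) x = 2 * hs E2 E2 x + 2 * hs E1 E1 x"
    unfolding e Lop_add[OF smooth_fun_mult[OF open_\<Omega> a a] smooth_fun_mult[OF open_\<Omega> a a] x] Lop_mult[OF a a x] Lop_affine G
    by simp
  then show ?thesis using hs11_pos[OF x] hs_pos[OF x, of E2] by (simp add: axis_eq_0_iff)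
qed

lemma smooth_norm_sq: "smooth_fun T (\<lambda>x::real^2. x \<bullet> x)" if "open T"
proof -
  have e: "(\<lambda>x. x \<bullet> x) = (\<lambda>x::real^2. (x \<bullet> E1 + 0) * (x \<bullet> E1 + 0) + (x \<bullet> E2 + 0) * (x \<bullet> E2 + 0))"
    by (simp add: fun_eq_iff inner_vec2 axis_def)
  show ?thesis unfolding e by (intro smooth_intros that)
qed

text \<open>At infinity and at the edges in \<open>I\<close> nothing but an upper bound for
  \<open>s\<close> is required: after subtraction of a small multiple of \<open>bb\<close> the
  superlevel set \<open>K\<close> is compact inside \<open>U\<close>. A small multiple of the
  squared norm then makes the inequality strict, against \<open>Lop_le_0_at_max\<close>.\<close>

lemma max_principle:
  assumes U: "open U" "U \<subseteq> \<Omega>" and s: "smooth_fun \<Omega> s" and L: "\<And>x. x \<in> U \<Longrightarrow> Lop s x \<ge> 0"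
    and M: "\<And>x. x \<in> U \<Longrightarrow> s x \<le> M"
    and int: "\<And>b. b \<in> frontier U \<Longrightarrow> b \<in> \<Omega> \<Longrightarrow> s b \<le> 0"
    and bdy: "\<And>b \<epsilon>. b \<in> frontier U \<Longrightarrow> b \<in> frontier \<Omega> \<Longrightarrow> b \<notin> cusps \<Longrightarrow> \<epsilon> > 0 \<Longrightarrow> \<forall>\<^sub>F x in at b within \<Omega>. x \<in> U \<longrightarrow> s x < \<epsilon>"
    and x0: "x0 \<in> U"
  shows "s x0 \<le> 0"
proof (rule ccontr)
  assume neg: "\<not> s x0 \<le> 0"
  have x0O: "x0 \<in> \<Omega>" using x0 U by blast
  \<comment> \<open>Chosen so that the perturbed function \<open>t\<close> keeps half of the value
    of \<open>s\<close> at \<open>x0\<close>.\<close>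
  define \<epsilon> where "\<epsilon> = s x0 / (2 * bb x0)"
  have \<epsilon>: "\<epsilon> > 0" using neg bb_ge(3)[OF x0O] by (simp add: \<epsilon>_def)
  define t where "t = (\<lambda>x. s x - \<epsilon> * bb x)"
  define \<eta> where "\<eta> = s x0 / 2"
  have \<eta>: "\<eta> > 0" "t x0 = \<eta>" using neg bb_ge(3)[OF x0O] by (auto simp: \<eta>_def t_def \<epsilon>_def field_simps)
  have st: "smooth_fun \<Omega> t" unfolding t_def by (intro smooth_intros open_\<Omega> s smooth_bb)
  have Lt: "Lop t x \<ge> 0" if "x \<in> U" for x
  proof -
    have xO: "x \<in> \<Omega>" using that U by blast
    have "Lop t x = Lop s x - \<epsilon> * Lop bb x"
      unfolding t_def using Lop_diff[OF s smooth_fun_mult[OF open_\<Omega> smooth_fun_const smooth_bb] xO, of \<epsilon>] Lop_cmult[OF smooth_bb xO] by simp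
    then show ?thesis using L[OF that] Lop_bb[OF xO] by simp
  qed
  define K where "K = {x\<in>U. t x \<ge> \<eta> / 2}"
  have Kff: "ff x \<le> M / \<epsilon>" if "x \<in> K" for x
  proof -
    have xO: "x \<in> \<Omega>" using that U by (auto simp: K_def)
    have "\<epsilon> * ff x \<le> \<epsilon> * bb x" using bb_ge(1)[OF xO] \<epsilon> by (intro mult_left_mono) auto
    also have "\<dots> \<le> M" using that M[of x] \<eta> by (simp add: K_def t_def)
    finally show ?thesis using \<epsilon> by (simp add: field_simps)
  qed
  have "K \<subseteq> {x\<in>P. ff x \<le> M / \<epsilon>}" using Kff U interior_subset by (auto simp: K_def)
  then have bK: "bounded K" using bounded_ff bounded_subset by blast
  have "closed K" unfolding closed_sequential_limits
  proof (intro allI impI)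
    fix f l assume f: "(\<forall>n. f n \<in> K) \<and> f \<longlonglongrightarrow> l"
    then have fU: "f n \<in> U" "t (f n) \<ge> \<eta> / 2" for n by (auto simp: K_def)
    show "l \<in> K"
    proof (cases "l \<in> U")
      case True
      then have "isCont t l" using isCont_smooth[OF st] U by blast
      then have "(\<lambda>n. t (f n)) \<longlonglongrightarrow> t l" using f isCont_tendsto_compose by blast
      then have "t l \<ge> \<eta> / 2" using fU by (intro LIMSEQ_le_const) auto
      then show ?thesis using True by (simp add: K_def)
    next
      case False
      have "l \<in> closure U" using f fU closure_sequential by blast
      then have fr: "l \<in> frontier U" using False U by (simp add: frontier_def interior_open)
      have lc: "l \<in> closure \<Omega>" using \<open>l \<in> closure U\<close> U closure_mono by blast
      have fl: "filterlim f (at l within \<Omega>) sequentially"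
        unfolding filterlim_at using f fU False U by (auto intro!: always_eventually)
      have bad: "False" if "\<forall>\<^sub>F x in at l within \<Omega>. x \<in> U \<longrightarrow> t x < \<eta> / 2"
      proof -
        have "\<forall>\<^sub>F n in sequentially. f n \<in> U \<longrightarrow> t (f n) < \<eta> / 2"
          using eventually_compose_filterlim[OF that fl] .
        then obtain n where "f n \<in> U \<longrightarrow> t (f n) < \<eta> / 2"
          unfolding eventually_sequentially by blast
        then show False using fU[of n] by simp
      qed
      have evO: "\<forall>\<^sub>F x in at l within \<Omega>. x \<in> \<Omega>" by (simp add: eventually_at_filter)
      have le: "t x < \<eta> / 2" if "x \<in> \<Omega>" "s x < \<eta> / 2" for x
        using that bb_ge(3)[OF that(1)] \<epsilon> by (simp add: t_def) (smt (verit) mult_pos_pos)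
      show ?thesis
      proof (cases "l \<in> \<Omega>")
        case True
        have "isCont s l" by (rule isCont_smooth[OF s True])
        then have "(s \<longlongrightarrow> s l) (at l within \<Omega>)" by (meson continuous_at_imp_continuous_at_within continuous_within)
        moreover have "s l < \<eta> / 2" using int[OF fr True] \<eta> by linarith
        ultimately have "\<forall>\<^sub>F x in at l within \<Omega>. s x < \<eta> / 2" by (rule order_tendstoD)
        with evO have "\<forall>\<^sub>F x in at l within \<Omega>. x \<in> U \<longrightarrow> t x < \<eta> / 2" by eventually_elim (use le in blast)
        then show ?thesis using bad by blast
      next
        case False
        then have lf: "l \<in> frontier \<Omega>" using lc by (simp add: frontier_def)
        show ?thesis
        proof (cases "l \<in> cusps")
          case True
          then obtain k where k: "k \<in> I" "l \<in> eg k" by (auto simp: cusps_def)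
          have "\<forall>\<^sub>F x in at l within \<Omega>. barr (aa k) x \<ge> M / \<epsilon>"
            using barr_cusp[OF k] by (simp add: filterlim_at_top)
          with evO have "\<forall>\<^sub>F x in at l within \<Omega>. x \<in> U \<longrightarrow> t x < \<eta> / 2"
          proof eventually_elim
            case (elim x)
            show ?case
            proof
              assume xU: "x \<in> U"
              have "M \<le> \<epsilon> * barr (aa k) x" using elim(2) \<epsilon> by (simp add: field_simps)
              also have "\<dots> \<le> \<epsilon> * bb x" using bb_ge(2)[OF elim(1) k(1)] \<epsilon> by (intro mult_left_mono) auto
              finally show "t x < \<eta> / 2" using M[OF xU] \<eta> by (simp add: t_def)
            qed
          qed
          then show ?thesis using bad by blast
        next
          case False
          have "\<forall>\<^sub>F x in at l within \<Omega>. x \<in> U \<longrightarrow> s x < \<eta> / 2" by (rule bdy[OF fr lf False]) (use \<eta> in simp)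
          with evO have "\<forall>\<^sub>F x in at l within \<Omega>. x \<in> U \<longrightarrow> t x < \<eta> / 2" by eventually_elim (use le in blast)
          then show ?thesis using bad by blast
        qed
      qed
    qed
  qed
  with bK have cK: "compact K" by (simp add: compact_eq_bounded_closed)
  obtain R where R: "R > 0" "\<And>x. x \<in> K \<Longrightarrow> norm x \<le> R" using bK bounded_pos by blast
  \<comment> \<open>Within distance 1 of \<open>K\<close> the added term is at most
    \<open>\<eta> / 2\<close>. So points outside \<open>K\<close>, where \<open>t\<close> is below
    \<open>\<eta> / 2\<close>, cannot exceed the maximum over \<open>K\<close>.\<close>
  define \<delta> where "\<delta> = \<eta> / (2 * (R + 1)\<^sup>2)"
  have \<delta>: "\<delta> > 0" using \<eta> R by (simp add: \<delta>_def)
  define g where "g = (\<lambda>x. t x + \<delta> * (x \<bullet> x))"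
  have sg: "smooth_fun \<Omega> g" unfolding g_def by (intro smooth_intros open_\<Omega> st smooth_norm_sq)
  have x0K: "x0 \<in> K" using x0 \<eta> by (simp add: K_def)
  have "continuous_on K g"
    using smooth_fun_continuous_on[OF sg] by (rule continuous_on_subset) (use U in \<open>auto simp: K_def\<close>)
  then obtain x where x: "x \<in> K" "\<And>y. y \<in> K \<Longrightarrow> g y \<le> g x"
    using continuous_attains_sup[OF cK, of g] x0K by blast
  have gx: "g x \<ge> \<eta>"
  proof -
    have "\<eta> \<le> g x0" using \<eta> \<delta> by (simp add: g_def)
    then show ?thesis using x(2)[OF x0K] by simp
  qed
  have max: "g y \<le> g x" if y: "y \<in> U \<inter> ball x 1" for y
  proof (cases "y \<in> K")
    case False
    then have "t y < \<eta> / 2" using y by (simp add: K_def)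
    moreover have "norm y \<le> R + 1"
      using y R(2)[OF x(1)] norm_triangle_ineq2[of y x] by (simp add: dist_norm norm_minus_commute)
    then have "y \<bullet> y \<le> (R + 1)\<^sup>2" by (simp add: power2_norm_eq_inner[symmetric] power_mono)
    then have "\<delta> * (y \<bullet> y) \<le> \<delta> * (R + 1)\<^sup>2" using \<delta> by (intro mult_left_mono) auto
    moreover have "\<delta> * (R + 1)\<^sup>2 = \<eta> / 2" using R by (simp add: \<delta>_def)
    ultimately show ?thesis using gx by (simp add: g_def)
  qed (use x in blast)
  have xU: "x \<in> U" "x \<in> \<Omega>" using x U by (auto simp: K_def)
  have "Lop g x \<le> 0"
  proof (rule Lop_le_0_at_max[of "U \<inter> ball x 1"])
    show "smooth_fun (U \<inter> ball x 1) g" using sg by (rule smooth_fun_subset) (use U in auto)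
  qed (use U xU max in auto)
  moreover have "Lop g x = Lop t x + \<delta> * Lop (\<lambda>x. x \<bullet> x) x"
    unfolding g_def using Lop_add[OF st smooth_fun_mult[OF open_\<Omega> smooth_fun_const smooth_norm_sq[OF open_\<Omega>]] xU(2), of \<delta>]
      Lop_cmult[OF smooth_norm_sq[OF open_\<Omega>] xU(2)] by simp
  ultimately show False using Lt[OF xU(1)] Lop_norm_sq[OF xU(2)] \<delta> by (smt (verit) mult_pos_pos)
qed

text \<open>A bounded solution with boundary values 0 is nonpositive by the maximum principle,
  whereas \<open>q\<close> is positive.\<close>

lemma q_unbounded: "\<exists>x\<in>\<Omega>. q x > M"
proof (rule ccontr)
  assume "\<not> ?thesis"
  then have M: "q x \<le> M" if "x \<in> \<Omega>" for x using that by force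
  obtain x where x: "x \<in> \<Omega>" using nonempty_\<Omega> by blast
  have "q x \<le> 0"
  proof (rule max_principle[OF open_\<Omega> order_refl smooth_q _ M _ _ x])
    show "b \<in> frontier \<Omega> \<Longrightarrow> b \<in> \<Omega> \<Longrightarrow> q b \<le> 0" for b using frontier_notin by blast
    show "\<forall>\<^sub>F x in at b within \<Omega>. x \<in> \<Omega> \<longrightarrow> q x < \<epsilon>" if "b \<in> frontier \<Omega>" "\<epsilon> > 0" for b \<epsilon>
      using order_tendstoD(2)[OF q_lim[OF that(1)] that(2)] by eventually_elim simp
  qed (simp_all add: Lop_q)
  then show False using q_pos[OF x] by simp
qed

lemma component_frontier:
  fixes b :: "real^2"
  assumes G: "open G" and V: "V = connected_component_set G x0" and b: "b \<in> frontier V"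
  shows "b \<notin> G"
proof
  assume bG: "b \<in> G"
  then obtain e where e: "e > 0" "ball b e \<subseteq> G" using G open_contains_ball by blast
  have "b \<in> closure V" "b \<notin> interior V" using b by (auto simp: frontier_def)
  then obtain y where y: "y \<in> V" "dist y b < e" using e closure_approachable by blast
  have "ball b e \<subseteq> V"
  proof -
    have "connected (ball b e \<union> V)" using y unfolding V
      by (intro connected_Un connected_ball connected_connected_component) (auto simp: dist_commute)
    moreover have "x0 \<in> V" using y connected_component_eq_empty[of G x0] unfolding V by (metis connected_component_refl_eq empty_iff mem_Collect_eq)
    moreover have "ball b e \<union> V \<subseteq> G" using e connected_component_subset unfolding V by blast
    ultimately have "ball b e \<union> V \<subseteq> V" unfolding V by (intro connected_component_maximal) auto
    then show ?thesis by blast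
  qed
  then have "b \<in> interior V" using e(1) by (meson centre_in_ball interior_maximal open_ball subsetD)
  then show False using \<open>b \<notin> interior V\<close> by simp
qed

section \<open>Components of the sublevel and superlevel sets of \<open>rh 0\<close>\<close>

definition lowr :: "real \<Rightarrow> (real^2) set" where "lowr R = {x\<in>\<Omega>. rh 0 x < R}"
definition highr :: "real \<Rightarrow> (real^2) set" where "highr R = {x\<in>\<Omega>. rh 0 x > R}"

lemma open_lowr: "open (lowr R)" and open_highr: "open (highr R)"
proof -
  have "lowr R = \<Omega> \<inter> rh 0 -` {..<R}" "highr R = \<Omega> \<inter> rh 0 -` {R<..}" by (auto simp: lowr_def highr_def)
  then show "open (lowr R)" "open (highr R)"
    using continuous_open_preimage[OF smooth_fun_continuous_on[OF smooth_rh] open_\<Omega>] by simp_all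
qed

text \<open>Otherwise \<open>R - rh 0\<close>, a solution bounded by \<open>R\<close>, would have
  nonpositive limits at all of the frontier of the component outside the cusps, and hence be
  nonpositive inside it.\<close>

lemma lowr_component_touches:
  assumes x0: "x0 \<in> lowr R" and V: "V = connected_component_set (lowr R) x0"
  shows "\<exists>b \<in> frontier V \<inter> frontier \<Omega>. \<bar>hb b\<bar> < R"
proof (rule ccontr)
  assume no: "\<not> ?thesis"
  have oV: "open V" "V \<subseteq> lowr R" unfolding V by (auto intro: open_connected_component open_lowr simp: connected_component_subset)
  have VO: "V \<subseteq> \<Omega>" using oV by (auto simp: lowr_def)
  have x0V: "x0 \<in> V" using x0 by (simp add: V)
  have sm: "smooth_fun \<Omega> (\<lambda>x. R - rh 0 x)" by (intro smooth_intros open_\<Omega> smooth_rh)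
  have big: "\<bar>hb b\<bar> \<ge> R" if "b \<in> frontier V" "b \<in> frontier \<Omega>" for b
    using no that by force
  have "R - rh 0 x0 \<le> 0"
  proof (rule max_principle[OF oV(1) VO sm _ _ _ _ x0V])
    fix x assume "x \<in> V"
    then have x: "x \<in> \<Omega>" using VO by blast
    show "Lop (\<lambda>x. R - rh 0 x) x \<ge> 0" by (simp add: Lop_diff[OF smooth_fun_const smooth_rh x] Lop_rh[OF x])
    show "R - rh 0 x \<le> R" using rh_pos[OF x, of 0] by simp
  next
    fix b assume b: "b \<in> frontier V" "b \<in> \<Omega>"
    then have "b \<notin> lowr R" using component_frontier[OF open_lowr V] by blast
    then show "R - rh 0 b \<le> 0" using b by (simp add: lowr_def)
  next
    fix b and \<epsilon> :: real assume b: "b \<in> frontier V" "b \<in> frontier \<Omega>" and \<epsilon>: "\<epsilon> > 0"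
    have "((\<lambda>x. R - rh 0 x) \<longlongrightarrow> R - \<bar>hb b + 0\<bar>) (at b within \<Omega>)" by (intro tendsto_intros rh_lim b)
    moreover have "R - \<bar>hb b + 0\<bar> < \<epsilon>" using big[OF b] \<epsilon> by simp
    ultimately have "\<forall>\<^sub>F x in at b within \<Omega>. R - rh 0 x < \<epsilon>" by (rule order_tendstoD)
    then show "\<forall>\<^sub>F x in at b within \<Omega>. x \<in> V \<longrightarrow> R - rh 0 x < \<epsilon>" by eventually_elim simp
  qed
  then show False using x0 by (simp add: lowr_def)
qed

lemma cs_lim: assumes b: "b \<in> frontier \<Omega>" and "hb b + c \<noteq> 0"
  shows "(cs c \<longlongrightarrow> sgn (hb b + c)) (at b within \<Omega>)"
proof -
  have "((\<lambda>x. (H x + c) / rh c x) \<longlongrightarrow> (hb b + c) / \<bar>hb b + c\<bar>) (at b within \<Omega>)"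
    by (intro tendsto_intros H_lim rh_lim b) (use assms in auto)
  moreover have "(hb b + c) / \<bar>hb b + c\<bar> = sgn (hb b + c)"
    using assms(2) by (auto simp: sgn_real_def abs_real_def divide_eq_eq)
  ultimately show ?thesis by (simp add: cs_def[abs_def])
qed

text \<open>On a component of \<open>highr R\<close> that meets the boundary on one side only, the harmonic measure of
  a distant part of the other side is small, which bounds \<open>q\<close>.\<close>

lemma highr_one_sided:
  assumes \<sigma>: "\<sigma> = 1 \<or> \<sigma> = (-1::real)" and R: "R > 0"
    and x0: "x0 \<in> highr R" and V: "V = connected_component_set (highr R) x0"
    and side: "\<And>b. b \<in> frontier V \<Longrightarrow> b \<in> frontier \<Omega> \<Longrightarrow> \<sigma> * hb b \<ge> - R"
  shows "q x0 \<le> 2 * R\<^sup>2"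
proof -
  have oV: "open V" "V \<subseteq> highr R" unfolding V by (auto intro: open_connected_component open_highr simp: connected_component_subset)
  have VO: "V \<subseteq> \<Omega>" using oV by (auto simp: highr_def)
  have x0V: "x0 \<in> V" using x0 by (simp add: V)
  have x0O: "x0 \<in> \<Omega>" using x0V VO by blast
  have key: "q x0 * (B - R)\<^sup>2 \<le> 2 * R\<^sup>2 * ((H x0 + \<sigma> * B)\<^sup>2 + q x0)" if B: "B > R" for B
  proof -
    \<comment> \<open>On the inner part of the frontier \<open>q\<close> is at most
      \<open>R^2\<close> and the distance from the centre \<open>- \<sigma> * B\<close> is at least
      \<open>B - R\<close>; so \<open>1 - \<sigma> * cs ?c\<close> is at most \<open>m\<close>
      there. On the outer part it tends to 0.\<close>
    define m where "m = R\<^sup>2 / (B - R)\<^sup>2"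
    let ?c = "\<sigma> * B"
    let ?s = "\<lambda>x. (1 - m) - \<sigma> * cs ?c x"
    have sm: "smooth_fun \<Omega> ?s" by (intro smooth_intros open_\<Omega> smooth_cs)
    have mp: "m > 0" using R B by (simp add: m_def)
    have "?s x0 \<le> 0"
    proof (rule max_principle[OF oV(1) VO sm _ _ _ _ x0V])
      fix x assume "x \<in> V"
      then have x: "x \<in> \<Omega>" using VO by blast
      show "Lop ?s x \<ge> 0"
        by (simp add: Lop_diff[OF smooth_fun_const smooth_fun_mult[OF open_\<Omega> smooth_fun_const smooth_cs] x] Lop_cmult[OF smooth_cs x] Lop_cs[OF x])
      show "?s x \<le> 2" using abs_cs_less[OF x, of ?c] \<sigma> mp by auto
    next
      fix b assume b: "b \<in> frontier V" "b \<in> \<Omega>"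
      then have "b \<notin> highr R" using component_frontier[OF open_highr V] by blast
      then have "rh 0 b \<le> R" using b by (simp add: highr_def)
      then have "(H b)\<^sup>2 + q b \<le> R\<^sup>2" using rh_sq[OF b(2), of 0] rh_pos[OF b(2), of 0] by (metis add_0_right less_imp_le power_mono)
      then have q: "q b \<le> R\<^sup>2" and "(H b)\<^sup>2 \<le> R\<^sup>2" using q_pos[OF b(2)] zero_le_power2[of "H b"] by linarith+
      then have Hb: "\<bar>H b\<bar> \<le> R" using R abs_le_square_iff[of "H b" R] by simp
      define y where "y = \<sigma> * (H b + ?c)"
      have y: "y \<ge> B - R" "\<sigma> * cs ?c b = y / rh ?c b" "y > 0"
        using \<sigma> Hb B by (auto simp: y_def cs_def)
      have r: "rh ?c b > 0" "(rh ?c b)\<^sup>2 = y\<^sup>2 + q b"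
        using rh_pos[OF b(2)] rh_sq[OF b(2), of ?c] \<sigma> by (auto simp: y_def power_mult_distrib)
      have "y \<le> rh ?c b" by (rule power2_le_imp_le) (use r q_pos[OF b(2)] in auto)
      then have c1: "0 \<le> y / rh ?c b" "y / rh ?c b \<le> 1" using y r by auto
      have "1 - y / rh ?c b \<le> 1 - (y / rh ?c b)\<^sup>2"
        using mult_left_le[OF c1(2) c1(1)] unfolding power2_eq_square by linarith
      also have "\<dots> = ((rh ?c b)\<^sup>2 - y\<^sup>2) / (rh ?c b)\<^sup>2" using r(1) by (simp add: power_divide diff_divide_distrib)
      also have "(rh ?c b)\<^sup>2 - y\<^sup>2 = q b" using r(2) by simp
      also have "q b / (rh ?c b)\<^sup>2 \<le> R\<^sup>2 / (B - R)\<^sup>2"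
      proof (rule frac_le)
        have "(B - R)\<^sup>2 \<le> y\<^sup>2" using y B by (intro power_mono) auto
        then show "(B - R)\<^sup>2 \<le> (rh ?c b)\<^sup>2" using r q_pos[OF b(2)] by linarith
      qed (use q B in auto)
      finally show "?s b \<le> 0" using y(2) by (simp add: m_def)
    next
      fix b and \<epsilon> :: real assume b: "b \<in> frontier V" "b \<in> frontier \<Omega>" and \<epsilon>: "\<epsilon> > 0"
      have p: "\<sigma> * (hb b + ?c) > 0" using side[OF b] \<sigma> B by auto
      then have "(cs ?c \<longlongrightarrow> sgn (hb b + ?c)) (at b within \<Omega>)" by (intro cs_lim b) auto
      then have "(?s \<longlongrightarrow> (1 - m) - \<sigma> * sgn (hb b + ?c)) (at b within \<Omega>)" by (intro tendsto_intros)
      moreover have "\<sigma> * sgn (hb b + ?c) = 1" using p \<sigma> by (auto simp: sgn_real_def)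
      then have "(1 - m) - \<sigma> * sgn (hb b + ?c) < \<epsilon>" using mp \<epsilon> by simp
      ultimately have "\<forall>\<^sub>F x in at b within \<Omega>. ?s x < \<epsilon>" by (rule order_tendstoD)
      then show "\<forall>\<^sub>F x in at b within \<Omega>. x \<in> V \<longrightarrow> ?s x < \<epsilon>" by eventually_elim simp
    qed
    then have 1: "1 - \<sigma> * cs ?c x0 \<le> m" by simp
    define c where "c = \<sigma> * cs ?c x0"
    have c: "\<bar>c\<bar> < 1" using abs_cs_less[OF x0O, of ?c] \<sigma> by (auto simp: c_def)
    have "1 - c\<^sup>2 = (1 - c) * (1 + c)" by (simp add: power2_eq_square algebra_simps)
    also have "\<dots> \<le> m * 2" using 1 c mp by (intro mult_mono) (auto simp: c_def)
    finally have "1 - (cs ?c x0)\<^sup>2 \<le> 2 * m" using \<sigma> by (auto simp: c_def)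
    then have "q x0 \<le> (rh ?c x0)\<^sup>2 * (2 * m)"
      unfolding q_eq_rh_cs[OF x0O, of ?c] by (intro mult_left_mono) auto
    then have "q x0 * (B - R)\<^sup>2 \<le> (rh ?c x0)\<^sup>2 * (2 * m) * (B - R)\<^sup>2" by (intro mult_right_mono) auto
    also have "\<dots> = 2 * R\<^sup>2 * (rh ?c x0)\<^sup>2" using B by (simp add: m_def)
    finally show ?thesis using rh_sq[OF x0O, of ?c] by simp
  qed
  \<comment> \<open>Dividing \<open>key\<close> by \<open>B^2\<close> and letting \<open>B\<close>
    tend to infinity.\<close>
  have "q x0 \<le> 2 * R\<^sup>2"
  proof (rule tendsto_le[where F = at_top])
    have "((\<lambda>B::real. q x0 * (1 - R / B)\<^sup>2) \<longlongrightarrow> q x0 * (1 - 0)\<^sup>2) at_top"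
      by (intro tendsto_intros tendsto_divide_0[OF tendsto_const] filterlim_at_top_imp_at_infinity filterlim_ident)
    then show "((\<lambda>B::real. q x0 * (1 - R / B)\<^sup>2) \<longlongrightarrow> q x0) at_top" by simp
    have "((\<lambda>B::real. 2 * R\<^sup>2 * ((H x0 / B + \<sigma>)\<^sup>2 + q x0 / B * (1 / B))) \<longlongrightarrow> 2 * R\<^sup>2 * ((0 + \<sigma>)\<^sup>2 + 0 * 0)) at_top"
      by (intro tendsto_intros tendsto_divide_0[OF tendsto_const] filterlim_at_top_imp_at_infinity filterlim_ident)
    then show "((\<lambda>B::real. 2 * R\<^sup>2 * ((H x0 / B + \<sigma>)\<^sup>2 + q x0 / B * (1 / B))) \<longlongrightarrow> 2 * R\<^sup>2) at_top"
      using \<sigma> by auto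
    show "\<forall>\<^sub>F B in at_top. q x0 * (1 - R / B)\<^sup>2 \<le> 2 * R\<^sup>2 * ((H x0 / B + \<sigma>)\<^sup>2 + q x0 / B * (1 / B))"
      using eventually_gt_at_top[of R]
    proof eventually_elim
      case (elim B)
      then have Bp: "B > 0" using R by simp
      have e: "(B - R) = B * (1 - R / B)" "H x0 + \<sigma> * B = B * (H x0 / B + \<sigma>)" "q x0 = B\<^sup>2 * (q x0 / B * (1 / B))"
        using Bp by (simp_all add: field_simps power2_eq_square)
      have "q x0 * (B * (1 - R / B))\<^sup>2 \<le> 2 * R\<^sup>2 * ((B * (H x0 / B + \<sigma>))\<^sup>2 + B\<^sup>2 * (q x0 / B * (1 / B)))"
        using key[OF elim] e by metis
      then have "B\<^sup>2 * (q x0 * (1 - R / B)\<^sup>2) \<le> B\<^sup>2 * (2 * R\<^sup>2 * ((H x0 / B + \<sigma>)\<^sup>2 + q x0 / B * (1 / B)))"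
        unfolding power_mult_distrib by (simp only: distrib_left mult_ac)
      then show ?case using Bp by (simp only: mult_le_cancel_left_pos zero_less_power)
    qed
  qed simp
  then show ?thesis .
qed

end

section \<open>Properness of the conformal coordinate\<close>

context toric_normalized
begin

lemma nv_cone: "DD 1 d *\<^sub>R nv i = DD i d *\<^sub>R nv 1 + DD 1 i *\<^sub>R nv d"
  by (simp add: vec_eq_iff forall_2 det2_def algebra_simps)

lemma cone_pos:
  assumes v: "v \<bullet> nv 1 > 0" "v \<bullet> nv d > 0" and i: "i \<in> {1..d}"
  shows "v \<bullet> nv i > 0"
proof -
  have "DD 1 d * (v \<bullet> nv i) = DD i d * (v \<bullet> nv 1) + DD 1 i * (v \<bullet> nv d)"
    using arg_cong[OF nv_cone[of i], of "\<lambda>z. v \<bullet> z"] by (simp only: inner_add_right inner_scaleR_right)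
  also have "\<dots> < 0"
  proof (cases "i = d")
    case True
    then show ?thesis using DD_1d v by (simp add: det2_self mult_neg_pos)
  next
    case False
    then have "DD i d < 0" using DD_neg[of i d] i by auto
    then show ?thesis using DD_1[OF i] v by (intro add_neg_nonpos mult_neg_pos mult_nonpos_nonneg) auto
  qed
  finally show ?thesis using DD_1d by (simp add: mult_less_0_iff)
qed

text \<open>In the affine coordinates \<open>TT = (XX, ff)\<close> the direction \<open>wv\<close>
  is vertical and the boundary is a graph over \<open>XX\<close> with the polygon above it.\<close>

definition XX :: "real^2 \<Rightarrow> real" where "XX x = ll d x - ll 1 x"
definition TT :: "real^2 \<Rightarrow> real^2" where "TT x = vector [XX x, ff x]"

lemma TT_nth [simp]: "TT x $ 1 = XX x" "TT x $ 2 = ff x"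
  by (simp_all add: TT_def)

lemma ll_XX: "ll 1 x = (ff x - XX x) / 2" "ll d x = (ff x + XX x) / 2"
  by (simp_all add: XX_def ff_def)

lemma TT_inj: assumes "XX x = XX y" "ff x = ff y" shows "x = y"
proof (rule inner_determines[of "nv 1" "nv d"])
  show "DD 1 d \<noteq> 0" using DD_1d by simp
  have "ll 1 x = ll 1 y" "ll d x = ll d y" using assms by (simp_all only: ll_XX)
  then show "x \<bullet> nv 1 = y \<bullet> nv 1" "x \<bullet> nv d = y \<bullet> nv d" by (simp_all add: ll_eq)
qed

lemma continuous_TT: "continuous_on A TT"
proof -
  have "TT = (\<lambda>x. XX x *\<^sub>R E1 + ff x *\<^sub>R E2)"
    by (rule ext) (simp add: vec_eq_iff forall_2 axis_def)
  then show ?thesis by (auto simp: XX_def ff_def ll_eq intro!: continuous_intros)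
qed

lemma wv_TT: "XX (x + t *\<^sub>R wv) = XX x" "ff (x + t *\<^sub>R wv) = ff x + t * (- 2 * DD 1 d)"
proof -
  have "wv \<bullet> nv 1 = - DD 1 d" "wv \<bullet> nv d = - DD 1 d"
    using det2_swap[of "nv d" "nv 1"] by (simp_all add: wv_def inner_diff_left ev_nv det2_self)
  then show "XX (x + t *\<^sub>R wv) = XX x" "ff (x + t *\<^sub>R wv) = ff x + t * (- 2 * DD 1 d)"
    by (simp_all add: XX_def ff_def ll_add algebra_simps)
qed

lemma above_in:
  assumes x: "x \<in> \<Omega>" and y: "XX y = XX x" "ff y \<ge> ff x"
  shows "y \<in> \<Omega>"
proof -
  define t where "t = (ff y - ff x) / (- 2 * DD 1 d)"
  have t: "t \<ge> 0" using y DD_1d by (simp add: t_def divide_nonneg_neg)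
  have "y = x + t *\<^sub>R wv" by (rule TT_inj) (use y DD_1d in \<open>simp_all only: wv_TT, simp_all add: t_def\<close>)
  moreover have "x \<in> P" using x interior_subset by blast
  ultimately show ?thesis using push_in[of x t] x t by (cases "t = 0") auto
qed

text \<open>Boundary points with \<open>hb\<close> beyond \<open>R0\<close> in absolute value lie on
  the two unbounded edges, see \<open>far_right\<close> and \<open>far_left\<close>. The summand for
  \<open>j = 0\<close> only enlarges the bound.\<close>

definition R0 :: real where "R0 = (\<Sum>j<d. \<bar>aa j\<bar>)"

lemma aa_le_R0: "j < d \<Longrightarrow> \<bar>aa j\<bar> \<le> R0"
  unfolding R0_def by (rule member_le_sum) auto

lemma frontier_edge: assumes "b \<in> frontier \<Omega>" obtains j where "j \<in> {1..d}" "b \<in> eg j"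
  using assms by (auto simp: mem_frontier mem_eg)

lemma far_right: assumes b: "b \<in> frontier \<Omega>" "hb b > R0" shows "b \<in> eg 1"
proof (rule ccontr)
  assume n: "b \<notin> eg 1"
  obtain j where j: "j \<in> {1..d}" "b \<in> eg j" by (rule frontier_edge[OF b(1)]) (rule that)
  then have "j \<noteq> 1" using n by blast
  then obtain k where k: "j = Suc k" "1 \<le> k" using j by (cases j) auto
  then have "hb b \<le> - aa k" using hb_right[of k b] eg_param_right(2)[of k b] j by (auto split: if_splits)
  then show False using aa_le_R0[of k] k j b by simp
qed

lemma far_left: assumes b: "b \<in> frontier \<Omega>" "hb b < - R0" shows "b \<in> eg d"
proof (rule ccontr)
  assume n: "b \<notin> eg d"
  obtain j where j: "j \<in> {1..d}" "b \<in> eg j" by (rule frontier_edge[OF b(1)]) (rule that)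
  then have "j \<noteq> d" using n by blast
  then have "hb b \<ge> - aa j" using hb_bounds(1)[OF j(2)] j by auto
  then show False using aa_le_R0[of j] \<open>j \<noteq> d\<close> j b by simp
qed

text \<open>If \<open>b\<close> were not to the left of \<open>p\<close>, then \<open>b - p\<close>
  would point into the recession cone or along edge 1. In the first case \<open>b\<close> would be
  interior, in the second \<open>hb b\<close> would be at least \<open>hb p\<close>, as
  \<open>hb\<close> has slope 1 on edge 1.\<close>

lemma XX_right:
  assumes b: "b \<in> frontier \<Omega>" and p: "p \<in> eg 1" and h: "hb b < hb p"
  shows "XX b < XX p"
proof (rule ccontr)
  assume n: "\<not> XX b < XX p"
  have bP: "b \<in> P" and pP: "p \<in> P" using b p by (simp_all add: mem_frontier mem_eg)
  define v where "v = b - p"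
  have l: "ll i b = ll i p + v \<bullet> nv i" for i by (simp add: v_def ll_eq inner_diff_left)
  have p1: "ll 1 p = 0" using p by (simp add: mem_eg)
  have b1: "ll 1 b \<ge> 0" using bP d2 by (auto simp: mem_P)
  have vd: "v \<bullet> nv d \<ge> v \<bullet> nv 1" using n by (simp add: XX_def l)
  show False
  proof (cases "ll 1 b = 0")
    case False
    then have v1: "v \<bullet> nv 1 > 0" using b1 l[of 1] p1 by simp
    have "ll i b > 0" if "i \<in> {1..d}" for i
    proof -
      have "ll i p \<ge> 0" using pP that by (auto simp: mem_P)
      then show ?thesis using cone_pos[OF v1 _ that] v1 vd l[of i] by simp
    qed
    then have "b \<in> \<Omega>" by (simp add: interior_P)
    then show False using frontier_notin[OF b] by simp
  next
    case True
    then have be: "b \<in> eg 1" using bP by (simp add: mem_eg)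
    have i1: "1 \<notin> I" using I_range by blast
    have 1: "hb b = - aa 1 + ll 2 b" "hb p = - aa 1 + ll 2 p"
      using hb_left[of 1] be p d2 i1 by (simp_all add: numeral_2_eq_2)
    have "b = vx 1 + ll 2 b *\<^sub>R ev 1" "p = vx 1 + ll 2 p *\<^sub>R ev 1"
      using eg_param_left(1)[of 1] be p d2 by (simp_all add: numeral_2_eq_2)
    then have "v = (ll 2 b - ll 2 p) *\<^sub>R ev 1" unfolding v_def by (metis add_diff_cancel_left scaleR_left_diff_distrib)
    then have "v \<bullet> nv d = (ll 2 b - ll 2 p) * (ev 1 \<bullet> nv d)" "v \<bullet> nv 1 = (ll 2 b - ll 2 p) * (ev 1 \<bullet> nv 1)"
      by (simp_all only: inner_scaleR_left)
    then have "v \<bullet> nv d = (ll 2 p - ll 2 b) * DD 1 d" "v \<bullet> nv 1 = 0"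
      by (simp_all only: ev_nv) (simp_all add: det2_self algebra_simps)
    moreover have "ll 2 p - ll 2 b > 0" using h 1 by simp
    ultimately show False using vd DD_1d by (simp add: zero_le_mult_iff)
  qed
qed

lemma XX_left:
  assumes b: "b \<in> frontier \<Omega>" and p: "p \<in> eg d" and h: "hb p < hb b"
  shows "XX p < XX b"
proof (rule ccontr)
  assume n: "\<not> XX p < XX b"
  have bP: "b \<in> P" and pP: "p \<in> P" using b p by (simp_all add: mem_frontier mem_eg)
  define v where "v = b - p"
  have l: "ll i b = ll i p + v \<bullet> nv i" for i by (simp add: v_def ll_eq inner_diff_left)
  have pd: "ll d p = 0" using p by (simp add: mem_eg)
  have bd: "ll d b \<ge> 0" using bP d2 by (auto simp: mem_P)
  have vd: "v \<bullet> nv 1 \<ge> v \<bullet> nv d" using n by (simp add: XX_def l)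
  show False
  proof (cases "ll d b = 0")
    case False
    then have v1: "v \<bullet> nv d > 0" using bd l[of d] pd by simp
    have "ll i b > 0" if "i \<in> {1..d}" for i
    proof -
      have "ll i p \<ge> 0" using pP that by (auto simp: mem_P)
      then show ?thesis using cone_pos[OF _ v1 that] v1 vd l[of i] by simp
    qed
    then have "b \<in> \<Omega>" by (simp add: interior_P)
    then show False using frontier_notin[OF b] by simp
  next
    case True
    obtain c where c: "d = Suc c" "1 \<le> c" "c < d" using d2 by (cases d) auto
    have be: "b \<in> eg (Suc c)" "p \<in> eg (Suc c)"
      unfolding c(1)[symmetric] using bP True p by (simp_all add: mem_eg)
    have i1: "Suc c \<notin> I" using I_range c by blast
    have 1: "hb b = - aa c - ll c b" "hb p = - aa c - ll c p"
      using hb_right[OF c(2,3)] be i1 by simp_all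
    have e: "b = vx c - ll c b *\<^sub>R ev (Suc c)" "p = vx c - ll c p *\<^sub>R ev (Suc c)"
      using eg_param_right(1)[OF c(2,3)] be by simp_all
    have "v = (vx c - ll c b *\<^sub>R ev (Suc c)) - (vx c - ll c p *\<^sub>R ev (Suc c))"
      unfolding v_def using e by simp
    then have "v = (ll c p - ll c b) *\<^sub>R ev d" using c by (simp add: algebra_simps)
    then have "v \<bullet> nv 1 = (ll c p - ll c b) * (ev d \<bullet> nv 1)" "v \<bullet> nv d = (ll c p - ll c b) * (ev d \<bullet> nv d)"
      by (simp_all only: inner_scaleR_left)
    then have "v \<bullet> nv 1 = (ll c p - ll c b) * DD 1 d" "v \<bullet> nv d = 0"
      using det2_swap[of "nv d" "nv 1"] by (simp_all only: ev_nv) (simp_all add: det2_self)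
    moreover have "ll c p - ll c b > 0" using h 1 by simp
    ultimately show False using vd DD_1d by (simp add: zero_le_mult_iff)
  qed
qed

text \<open>In the coordinates \<open>TT\<close>, \<open>\<pi>\<close> is prolonged horizontally to
  the left and right sides of a large box, and \<open>\<gamma>\<close> vertically to the bottom and
  the top. The Fashoda theorem gives a common point. Below \<open>b0\<close> and beyond
  \<open>bm\<close> and \<open>bp\<close> the prolongations avoid the interior, above
  \<open>x0\<close> nothing of \<open>\<pi>\<close> is left, and \<open>\<pi>\<close> and
  \<open>\<gamma>\<close> themselves lie in disjoint sets.\<close>

lemma no_crossing:
  assumes \<pi>: "path \<pi>" "pathstart \<pi> = bm" "pathfinish \<pi> = bp" "path_image \<pi> \<subseteq> {bm, bp} \<union> highr R"
    and b: "bm \<in> frontier \<Omega>" "bp \<in> frontier \<Omega>" "bm \<in> eg d" "bp \<in> eg 1" "hb bm < hb b0" "hb b0 < hb bp"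
    and \<gamma>: "path \<gamma>" "pathstart \<gamma> = b0" "pathfinish \<gamma> = x0" "path_image \<gamma> \<subseteq> {b0} \<union> lowr R"
    and b0: "b0 \<in> frontier \<Omega>" and x0: "x0 \<in> \<Omega>" and above: "\<And>x. x \<in> path_image \<pi> \<Longrightarrow> ff x < ff x0"
  shows False
proof -
  have hO: "highr R \<subseteq> \<Omega>" and lO: "lowr R \<subseteq> \<Omega>" by (auto simp: highr_def lowr_def)
  have disj: "highr R \<inter> lowr R = {}" by (auto simp: highr_def lowr_def)
  have notin: "bm \<notin> \<Omega>" "bp \<notin> \<Omega>" "b0 \<notin> \<Omega>" using b b0 frontier_notin by auto
  have X: "XX bm < XX b0" "XX b0 < XX bp" using XX_left[OF b0 b(3,5)] XX_right[OF b0 b(4,6)] by auto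
  have inP: "bm \<in> P" "bp \<in> P" "b0 \<in> P" using b b0 by (simp_all add: mem_frontier)
  have "bounded (TT ` (path_image \<pi> \<union> path_image \<gamma>))"
    using \<pi>(1) \<gamma>(1) by (intro compact_imp_bounded compact_continuous_image continuous_TT compact_Un compact_path_image)
  then obtain M where M: "M > 0" "\<And>x. x \<in> path_image \<pi> \<union> path_image \<gamma> \<Longrightarrow> norm (TT x) \<le> M"
    unfolding bounded_pos by auto
  have M1: "\<bar>XX x\<bar> \<le> M" "\<bar>ff x\<bar> \<le> M" if "x \<in> path_image \<pi> \<union> path_image \<gamma>" for x
    using M(2)[OF that] component_le_norm_cart[of "TT x" 1] component_le_norm_cart[of "TT x" 2] by auto
  define a where "a = (vector [- M - 1, - M - 1] :: real^2)"
  define c where "c = (vector [M + 1, M + 1] :: real^2)"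
  define L where "L = (vector [- M - 1, ff bm] :: real^2)"
  define Rr where "Rr = (vector [M + 1, ff bp] :: real^2)"
  define Dn where "Dn = (vector [XX b0, - M - 1] :: real^2)"
  define Up where "Up = (vector [XX x0, M + 1] :: real^2)"
  note defs = a_def c_def L_def Rr_def Dn_def Up_def
  have ends: "bm \<in> path_image \<pi>" "bp \<in> path_image \<pi>" "b0 \<in> path_image \<gamma>" "x0 \<in> path_image \<gamma>"
    using pathstart_in_path_image[of \<pi>] pathfinish_in_path_image[of \<pi>] pathstart_in_path_image[of \<gamma>]
      pathfinish_in_path_image[of \<gamma>] by (simp_all only: \<pi>(2,3) \<gamma>(2,3))
  have box: "TT x \<in> cbox a c" if "x \<in> path_image \<pi> \<union> path_image \<gamma>" for x
    using M1[OF that] by (auto simp: mem_box_cart forall_2 defs)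
  have box2: "L \<in> cbox a c" "Rr \<in> cbox a c" "Dn \<in> cbox a c" "Up \<in> cbox a c"
  proof -
    have "bm \<in> path_image \<pi> \<union> path_image \<gamma>" "bp \<in> path_image \<pi> \<union> path_image \<gamma>"
      "b0 \<in> path_image \<pi> \<union> path_image \<gamma>" "x0 \<in> path_image \<pi> \<union> path_image \<gamma>" using ends by blast+
    note * = this[THEN M1(1)] this[THEN M1(2)]
    show "L \<in> cbox a c" "Rr \<in> cbox a c" "Dn \<in> cbox a c" "Up \<in> cbox a c"
      using * M(1) by (simp_all add: mem_box_cart forall_2 defs abs_le_iff)
  qed
  define A where "A = linepath L (TT bm) +++ (TT \<circ> \<pi>) +++ linepath (TT bp) Rr"
  define B where "B = linepath Dn (TT b0) +++ (TT \<circ> \<gamma>) +++ linepath (TT x0) Up"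
  have pc: "path (TT \<circ> \<pi>)" "path (TT \<circ> \<gamma>)" using \<pi>(1) \<gamma>(1) continuous_TT path_continuous_image by blast+
  have pathA: "path A" "path B" unfolding A_def B_def
    using pc \<pi> \<gamma> by (auto simp: pathstart_compose pathfinish_compose)
  have imA: "path_image A \<subseteq> closed_segment L (TT bm) \<union> TT ` path_image \<pi> \<union> closed_segment (TT bp) Rr"
    unfolding A_def using path_image_join_subset[of "linepath L (TT bm)" "(TT \<circ> \<pi>) +++ linepath (TT bp) Rr"]
      path_image_join_subset[of "TT \<circ> \<pi>" "linepath (TT bp) Rr"] by (auto simp: path_image_compose)
  have imB: "path_image B \<subseteq> closed_segment Dn (TT b0) \<union> TT ` path_image \<gamma> \<union> closed_segment (TT x0) Up"
    unfolding B_def using path_image_join_subset[of "linepath Dn (TT b0)" "(TT \<circ> \<gamma>) +++ linepath (TT x0) Up"]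
      path_image_join_subset[of "TT \<circ> \<gamma>" "linepath (TT x0) Up"] by (auto simp: path_image_compose)
  have seg: "closed_segment y z \<subseteq> cbox a c" if "y \<in> cbox a c" "z \<in> cbox a c" for y z
    using that by (intro closed_segment_subset convex_box)
  have A_box: "path_image A \<subseteq> cbox a c"
    using imA seg[OF box2(1) box] seg[OF box box2(2)] ends box by blast
  have B_box: "path_image B \<subseteq> cbox a c"
    using imB seg[OF box2(3) box] seg[OF box box2(4)] ends box by blast
  obtain z where z: "z \<in> path_image A" "z \<in> path_image B"
    by (rule fashoda[OF pathA A_box B_box]) (auto simp: A_def B_def defs)
  have zA: "(z$2 = ff bm \<and> z$1 \<le> XX bm) \<or> (\<exists>x\<in>path_image \<pi>. z = TT x) \<or> (z$2 = ff bp \<and> z$1 \<ge> XX bp)"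
  proof -
    consider "z \<in> closed_segment L (TT bm)" | "z \<in> TT ` path_image \<pi>" | "z \<in> closed_segment (TT bp) Rr" using z(1) imA by blast
    then show ?thesis
    proof cases
      case 1
      then obtain s where s: "z = (1 - s) *\<^sub>R L + s *\<^sub>R TT bm" "0 \<le> s" "s \<le> 1" by (auto simp: closed_segment_def)
      have "z$2 = ff bm" unfolding s(1) L_def by (simp add: algebra_simps)
      moreover have "z$1 = XX bm - (1 - s) * (XX bm + M + 1)" unfolding s(1) L_def by (simp add: algebra_simps)
      moreover have "(1 - s) * (XX bm + M + 1) \<ge> 0" using s M1[of bm] ends by (intro mult_nonneg_nonneg) auto
      ultimately show ?thesis by linarith
    next
      case 3
      then obtain s where s: "z = (1 - s) *\<^sub>R TT bp + s *\<^sub>R Rr" "0 \<le> s" "s \<le> 1" by (auto simp: closed_segment_def)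
      have "z$2 = ff bp" unfolding s(1) Rr_def by (simp add: algebra_simps)
      moreover have "z$1 = XX bp + s * (M + 1 - XX bp)" unfolding s(1) Rr_def by (simp add: algebra_simps)
      moreover have "s * (M + 1 - XX bp) \<ge> 0" using s M1[of bp] ends by (intro mult_nonneg_nonneg) auto
      ultimately show ?thesis by linarith
    qed blast
  qed
  have zB: "(z$1 = XX b0 \<and> z$2 \<le> ff b0) \<or> (\<exists>y\<in>path_image \<gamma>. z = TT y) \<or> z$2 \<ge> ff x0"
  proof -
    consider "z \<in> closed_segment Dn (TT b0)" | "z \<in> TT ` path_image \<gamma>" | "z \<in> closed_segment (TT x0) Up" using z(2) imB by blast
    then show ?thesis
    proof cases
      case 1
      then obtain s where s: "z = (1 - s) *\<^sub>R Dn + s *\<^sub>R TT b0" "0 \<le> s" "s \<le> 1" by (auto simp: closed_segment_def)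
      have "z$1 = XX b0" unfolding s(1) Dn_def by (simp add: algebra_simps)
      moreover have "z$2 = ff b0 - (1 - s) * (ff b0 + M + 1)" unfolding s(1) Dn_def by (simp add: algebra_simps)
      moreover have "(1 - s) * (ff b0 + M + 1) \<ge> 0" using s M1[of b0] ends by (intro mult_nonneg_nonneg) auto
      ultimately show ?thesis by linarith
    next
      case 3
      then obtain s where s: "z = (1 - s) *\<^sub>R TT x0 + s *\<^sub>R Up" "0 \<le> s" "s \<le> 1" by (auto simp: closed_segment_def)
      have "z$2 = ff x0 + s * (M + 1 - ff x0)" unfolding s(1) Up_def by (simp add: algebra_simps)
      moreover have "s * (M + 1 - ff x0) \<ge> 0" using s M1[of x0] ends by (intro mult_nonneg_nonneg) auto
      ultimately show ?thesis by linarith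
    qed blast
  qed
  have lm: "ll d bm = 0" "ll 1 bp = 0" using b(3,4) by (simp_all add: mem_eg)
  have yP: "y \<in> P" if "y \<in> path_image \<gamma>" for y using that \<gamma>(4) inP lO interior_subset by blast
  from zA show False
  proof (elim disjE)
    assume 1: "z$2 = ff bm \<and> z$1 \<le> XX bm"
    from zB show False
    proof (elim disjE)
      assume "\<exists>y\<in>path_image \<gamma>. z = TT y"
      then obtain y where y: "y \<in> path_image \<gamma>" "z = TT y" by blast
      have "ll d y \<le> ll d bm" using 1 y unfolding ll_XX by simp
      moreover have "d \<in> {1..d}" using d2 by simp
      ultimately have "y \<notin> \<Omega>" using lm unfolding interior_P by fastforce
      then have "y = b0" using y \<gamma>(4) lO by blast
      then show False using 1 y X by simp
    qed (use 1 X above ends in force)+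
  next
    assume 1: "z$2 = ff bp \<and> z$1 \<ge> XX bp"
    from zB show False
    proof (elim disjE)
      assume "\<exists>y\<in>path_image \<gamma>. z = TT y"
      then obtain y where y: "y \<in> path_image \<gamma>" "z = TT y" by blast
      have "ll 1 y \<le> ll 1 bp" using 1 y unfolding ll_XX by simp
      moreover have "1 \<in> {1..d}" using d2 by simp
      ultimately have "y \<notin> \<Omega>" using lm unfolding interior_P by fastforce
      then have "y = b0" using y \<gamma>(4) lO by blast
      then show False using 1 y X by simp
    qed (use 1 X above ends in force)+
  next
    assume "\<exists>x\<in>path_image \<pi>. z = TT x"
    then obtain x where x: "x \<in> path_image \<pi>" "z = TT x" by blast
    from zB show False
    proof (elim disjE)
      assume "z$1 = XX b0 \<and> z$2 \<le> ff b0"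
      then have e: "XX x = XX b0" "ff x \<le> ff b0" using x by auto
      then have "x \<noteq> bm" "x \<noteq> bp" using X by auto
      then have "x \<in> \<Omega>" using x \<pi>(4) hO by blast
      then have "b0 \<in> \<Omega>" using above_in[of x b0] e by simp
      then show False using notin by simp
    next
      assume "\<exists>y\<in>path_image \<gamma>. z = TT y"
      then obtain y where y: "y \<in> path_image \<gamma>" "z = TT y" by blast
      have "TT x = TT y" using x y by simp
      then have "XX x = XX y" "ff x = ff y" using TT_nth by metis+
      then have "x = y" by (rule TT_inj)
      then have "x \<in> {bm, bp} \<union> highr R" "x \<in> {b0} \<union> lowr R" using x y \<pi>(4) \<gamma>(4) by auto
      moreover have "b0 \<noteq> bm" "b0 \<noteq> bp" using X by auto
      ultimately show False using disj notin hO lO by auto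
    next
      assume "z$2 \<ge> ff x0"
      then show False using x above by force
    qed
  qed
qed

text \<open>Near \<open>b\<close> the set \<open>G\<close> contains the convex set of all interior
  points close to \<open>b\<close>. So this set lies in the single component \<open>V\<close>, and
  \<open>b\<close> is reached by a segment.\<close>

lemma component_path:
  assumes G: "open G" "G \<subseteq> \<Omega>" and V: "V = connected_component_set G x0" and y: "y \<in> V"
    and b: "b \<in> frontier V" "b \<in> frontier \<Omega>" and near: "\<forall>\<^sub>F x in at b within \<Omega>. x \<in> G"
  obtains \<gamma> where "path \<gamma>" "pathstart \<gamma> = b" "pathfinish \<gamma> = y" "path_image \<gamma> \<subseteq> insert b V"
proof -
  obtain \<delta> where \<delta>: "\<delta> > 0" "\<And>x. x \<in> \<Omega> \<Longrightarrow> dist x b < \<delta> \<Longrightarrow> x \<in> G"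
    using near frontier_notin[OF b(2)] unfolding eventually_at by metis
  let ?B = "\<Omega> \<inter> ball b \<delta>"
  have BG: "?B \<subseteq> G" using \<delta>(2) by (auto simp: dist_commute)
  have cB: "convex ?B" by (intro convex_Int convex_\<Omega> convex_ball)
  have "b \<in> closure V" using b by (simp add: frontier_def)
  then obtain p where p: "p \<in> V" "dist p b < \<delta>" using \<delta>(1) closure_approachable by blast
  have VG: "V \<subseteq> G" unfolding V by (rule connected_component_subset)
  have pB: "p \<in> ?B" using p VG G by (auto simp: dist_commute)
  have "V = connected_component_set G p" using p V connected_component_eq by blast
  then have BV: "?B \<subseteq> V" using connected_component_maximal[of p ?B G] pB BG convex_connected[OF cB] by simp
  have oV: "open V" unfolding V by (rule open_connected_component[OF G(1)])
  have "connected V" unfolding V by (rule connected_connected_component)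
  then have "path_connected V" using oV connected_open_path_connected by blast
  then obtain g where g: "path g" "path_image g \<subseteq> V" "pathstart g = p" "pathfinish g = y"
    using p y unfolding path_connected_def by blast
  have bP: "b \<in> P" using b by (simp add: mem_frontier)
  have "closed_segment b p \<subseteq> insert b V"
  proof
    fix x assume "x \<in> closed_segment b p"
    then obtain s where s: "x = (1 - s) *\<^sub>R b + s *\<^sub>R p" "0 \<le> s" "s \<le> 1" by (auto simp: closed_segment_def)
    show "x \<in> insert b V"
    proof (cases "s = 0")
      case False
      have "x \<in> \<Omega>" unfolding interior_P
      proof (intro CollectI ballI)
        fix i assume i: "i \<in> {1..d}"
        have "ll i x = (1 - s) * ll i b + s * ll i p" by (simp add: s ll_eq inner_add_left algebra_simps)
        moreover have "ll i b \<ge> 0" "ll i p > 0" using bP pB i by (auto simp: mem_P interior_P)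
        ultimately show "ll i x > 0" using s False by (simp add: add_nonneg_pos)
      qed
      moreover have "x \<in> ball b \<delta>"
        unfolding s using pB \<delta> s by (intro convexD_alt[OF convex_ball]) auto
      ultimately show ?thesis using BV by blast
    qed (simp add: s)
  qed
  then have "path_image (linepath b p +++ g) \<subseteq> insert b V"
    using path_image_join_subset[of "linepath b p" g] g by auto
  then show ?thesis using that[of "linepath b p +++ g"] g by auto
qed

lemma rh_near_less: "b \<in> frontier \<Omega> \<Longrightarrow> \<bar>hb b\<bar> < R \<Longrightarrow> \<forall>\<^sub>F x in at b within \<Omega>. x \<in> lowr R"
  and rh_near_gr: "b \<in> frontier \<Omega> \<Longrightarrow> \<bar>hb b\<bar> > R \<Longrightarrow> \<forall>\<^sub>F x in at b within \<Omega>. x \<in> highr R"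
proof -
  have evO: "\<forall>\<^sub>F x in at b within \<Omega>. x \<in> \<Omega>" by (simp add: eventually_at_filter)
  assume b: "b \<in> frontier \<Omega>"
  have l: "(rh 0 \<longlongrightarrow> \<bar>hb b\<bar>) (at b within \<Omega>)" using rh_lim[OF b, of 0] by simp
  show "\<forall>\<^sub>F x in at b within \<Omega>. x \<in> lowr R" if "\<bar>hb b\<bar> < R"
    using order_tendstoD(2)[OF l that] evO by eventually_elim (simp add: lowr_def)
  show "\<forall>\<^sub>F x in at b within \<Omega>. x \<in> highr R" if "\<bar>hb b\<bar> > R"
    using order_tendstoD(1)[OF l that] evO by eventually_elim (simp add: highr_def)
qed

text \<open>If \<open>lowr R\<close> were unbounded, it would separate the two ends of the boundary: by the Fashoda theorem
  a component of \<open>highr R\<close> could not reach both. Then \<open>highr_one_sided\<close> bounds \<open>q\<close> everywhere.\<close>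

theorem bounded_lowr: "bounded (lowr R)"
proof (rule ccontr)
  assume unb: "\<not> bounded (lowr R)"
  \<comment> \<open>Beyond \<open>R0\<close> the boundary consists of the two unbounded edges only,
    and \<open>highr_one_sided\<close> needs a positive radius.\<close>
  define R' where "R' = max R (max R0 1)"
  have R': "R' \<ge> R" "R' \<ge> R0" "R' > 0" by (auto simp: R'_def)
  have "lowr R \<subseteq> lowr R'" using R' by (auto simp: lowr_def)
  then have unb': "\<not> bounded (lowr R')" using unb bounded_subset by blast
  have far: "\<exists>x\<in>lowr R'. ff x > N" for N
  proof (rule ccontr)
    assume "\<not> ?thesis"
    then have "lowr R' \<subseteq> {x\<in>P. ff x \<le> N}" using interior_subset by (force simp: lowr_def)
    then show False using unb' bounded_ff bounded_subset by blast
  qed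
  have qb: "q x \<le> 2 * R'\<^sup>2" if x: "x \<in> highr R'" for x
  proof -
    define V where "V = connected_component_set (highr R') x"
    have VO: "V \<subseteq> highr R'" unfolding V_def by (rule connected_component_subset)
    have xV: "x \<in> V" using x by (simp add: V_def)
    have hO: "highr R' \<subseteq> \<Omega>" "lowr R' \<subseteq> \<Omega>" by (auto simp: highr_def lowr_def)
    show ?thesis
    proof (cases "\<exists>bm\<in>frontier V \<inter> frontier \<Omega>. hb bm < - R'")
      case False
      show ?thesis by (rule highr_one_sided[of 1, OF _ R'(3) x V_def]) (use False in force)+
    next
      case True
      then obtain bm where bm: "bm \<in> frontier V" "bm \<in> frontier \<Omega>" "hb bm < - R'" by blast
      show ?thesis
      proof (cases "\<exists>bp\<in>frontier V \<inter> frontier \<Omega>. hb bp > R'")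
        case False
        show ?thesis by (rule highr_one_sided[of "-1", OF _ R'(3) x V_def]) (use False in force)+
      next
        case True
        then obtain bp where bp: "bp \<in> frontier V" "bp \<in> frontier \<Omega>" "hb bp > R'" by blast
        obtain g1 where g1: "path g1" "pathstart g1 = bm" "pathfinish g1 = x" "path_image g1 \<subseteq> insert bm V"
          by (rule component_path[OF open_highr hO(1) V_def xV bm(1,2) rh_near_gr[OF bm(2)]]) (use bm that in auto)
        obtain g2 where g2: "path g2" "pathstart g2 = bp" "pathfinish g2 = x" "path_image g2 \<subseteq> insert bp V"
          by (rule component_path[OF open_highr hO(1) V_def xV bp(1,2) rh_near_gr[OF bp(2)]]) (use bp that in auto)
        define \<alpha>' where "\<alpha>' = g1 +++ reversepath g2"
        have \<alpha>: "path \<alpha>'" "pathstart \<alpha>' = bm" "pathfinish \<alpha>' = bp" "path_image \<alpha>' \<subseteq> {bm, bp} \<union> highr R'"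
          using g1 g2 VO path_image_join_subset[of g1 "reversepath g2"] by (auto simp: \<alpha>'_def)
        have "compact (ff ` path_image \<alpha>')"
          using \<alpha>(1) by (intro compact_continuous_image compact_path_image) (auto simp: ff_affine intro!: continuous_intros)
        then obtain N where N: "\<And>y. y \<in> path_image \<alpha>' \<Longrightarrow> \<bar>ff y\<bar> \<le> N"
          using compact_imp_bounded bounded_real by (metis imageI)
        obtain x0 where x0: "x0 \<in> lowr R'" "ff x0 > N" using far by blast
        define V' where "V' = connected_component_set (lowr R') x0"
        obtain b0 where b0: "b0 \<in> frontier V'" "b0 \<in> frontier \<Omega>" "\<bar>hb b0\<bar> < R'"
          using lowr_component_touches[OF x0(1) V'_def] by blast
        have x0V: "x0 \<in> V'" using x0 by (simp add: V'_def)
        obtain \<gamma> where \<gamma>: "path \<gamma>" "pathstart \<gamma> = b0" "pathfinish \<gamma> = x0" "path_image \<gamma> \<subseteq> insert b0 V'"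
          by (rule component_path[OF open_lowr hO(2) V'_def x0V b0(1,2) rh_near_less[OF b0(2,3)]]) (rule that)
        have "V' \<subseteq> lowr R'" unfolding V'_def by (rule connected_component_subset)
        then have \<gamma>4: "path_image \<gamma> \<subseteq> {b0} \<union> lowr R'" using \<gamma>(4) by blast
        have False
        proof (rule no_crossing[OF \<alpha> bm(2) bp(2) _ _ _ _ \<gamma>(1-3) \<gamma>4 b0(2)])
          show "bm \<in> eg d" using far_left[OF bm(2)] bm(3) R' by simp
          show "bp \<in> eg 1" using far_right[OF bp(2)] bp(3) R' by simp
          show "hb bm < hb b0" "hb b0 < hb bp" using b0(3) bm(3) bp(3) by auto
          show "x0 \<in> \<Omega>" using x0 hO by blast
          show "ff y < ff x0" if "y \<in> path_image \<alpha>'" for y using N[OF that] x0 by simp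
        qed
        then show ?thesis ..
      qed
    qed
  qed
  obtain x where x: "x \<in> \<Omega>" "q x > 2 * R'\<^sup>2" using q_unbounded by blast
  have "\<not> rh 0 x > R'" using qb[of x] x by (force simp: highr_def)
  then have "(rh 0 x)\<^sup>2 \<le> R'\<^sup>2" using rh_pos[OF x(1), of 0] by (intro power_mono) auto
  then have "q x \<le> R'\<^sup>2" using rh_sq[OF x(1), of 0] zero_le_power2[of "H x + 0"] by linarith
  then show False using x zero_le_power2[of R'] by linarith
qed

end

section \<open>Comparison with the model solutions\<close>

context conjugate_pair
begin

definition harm :: "(real^2 \<Rightarrow> real) \<Rightarrow> bool" where
  "harm s \<longleftrightarrow> smooth_fun \<Omega> s \<and> (\<forall>x\<in>\<Omega>. Lop s x = 0)"

lemma harm_affine: "harm (\<lambda>x. x \<bullet> v + c)"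
  by (simp add: harm_def smooth_fun_affine)

lemma harm_const: "harm (\<lambda>x. c)"
  by (simp add: harm_def smooth_fun_const)

lemma harm_add: "harm s \<Longrightarrow> harm t \<Longrightarrow> harm (\<lambda>x. s x + t x)"
  and harm_diff: "harm s \<Longrightarrow> harm t \<Longrightarrow> harm (\<lambda>x. s x - t x)"
  by (simp_all add: harm_def Lop_add Lop_diff smooth_fun_add smooth_fun_diff open_\<Omega>)

lemma harm_cmult: "harm s \<Longrightarrow> harm (\<lambda>x. c * s x)"
  by (simp add: harm_def Lop_cmult smooth_fun_mult smooth_fun_const open_\<Omega>)

lemma harm_sum: "(\<And>i. i \<in> A \<Longrightarrow> harm (s i)) \<Longrightarrow> harm (\<lambda>x. \<Sum>i\<in>A. s i x)"
  by (simp add: harm_def Lop_sum smooth_fun_sum open_\<Omega>)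

lemma harm_H: "harm H" and harm_q: "harm q" and harm_rh: "harm (rh c)" and harm_cs: "harm (cs c)"
  by (simp_all add: harm_def smooth_H Lop_H smooth_q Lop_q smooth_rh Lop_rh smooth_cs Lop_cs)

lemmas harm_intros = harm_const harm_add harm_diff harm_cmult harm_sum harm_H harm_q harm_rh harm_cs

lemma rh_diff_le: assumes x: "x \<in> \<Omega>" shows "\<bar>rh a x - rh c x\<bar> \<le> \<bar>a - c\<bar>"
proof -
  have p: "rh a x > 0" "rh c x > 0" using rh_pos[OF x] by auto
  have "(rh a x - rh c x) * (rh a x + rh c x) = (a - c) * ((H x + a) + (H x + c))"
    using rh_sq[OF x, of a] rh_sq[OF x, of c] by (simp add: algebra_simps power2_eq_square)
  then have "\<bar>rh a x - rh c x\<bar> * (rh a x + rh c x) = \<bar>a - c\<bar> * \<bar>(H x + a) + (H x + c)\<bar>"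
    using p by (metis abs_mult abs_of_pos add_pos_pos)
  also have "\<dots> \<le> \<bar>a - c\<bar> * (rh a x + rh c x)"
    using abs_Hc_less[OF x, of a] abs_Hc_less[OF x, of c] by (intro mult_left_mono) auto
  finally show ?thesis using p by simp
qed

end

context toric_normalized
begin

abbreviation Lm :: "nat \<Rightarrow> real" where "Lm \<equiv> Lam d \<nu> lam"

definition hm :: "real \<Rightarrow> real^2 \<Rightarrow> real" where "hm c x = H x + c - rh c x"

text \<open>The map \<open>z\<close> of \<open>x_chart\<close> for the parameter 0, expressed by
  \<open>H\<close> and \<open>q\<close>. Then \<open>yy w\<close> is the product with
  \<open>w\<close> of the difference between \<open>x\<close> and the model point.\<close>

definition zc :: "real^2 \<Rightarrow> real^2" where
  "zc x = H x *\<^sub>R nv 1 + (1/2) *\<^sub>R (\<Sum>i=1..d-1. hm (aa i) x *\<^sub>R (nv (i+1) - nv i))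
     - (1/2) *\<^sub>R (\<Sum>k\<in>I. (Lm k * (1 - cs (aa (k-1)) x)) *\<^sub>R nv k)"

definition yy :: "real^2 \<Rightarrow> real^2 \<Rightarrow> real" where
  "yy w x = x \<bullet> w + sh \<bullet> w - det2 w (zc x)"

lemma det2_zc: "det2 w (zc x) = det2 w (nv 1) * H x
    + 1/2 * (\<Sum>i=1..d-1. (det2 w (nv (i+1)) - det2 w (nv i)) * hm (aa i) x)
    - 1/2 * (\<Sum>k\<in>I. (Lm k * det2 w (nv k)) * (1 - cs (aa (k-1)) x))"
  by (simp add: zc_def det2_add2 det2_diff2 det2_scale2 det2_sum2 mult_ac)

lemma harm_hm: "harm (hm c)"
  unfolding hm_def[abs_def] by (intro harm_intros)

lemma harm_yy: "harm (yy w)"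
  unfolding yy_def[abs_def] det2_zc by (intro harm_diff harm_affine harm_intros harm_hm)

lemma aa_pred: assumes "k \<in> I" shows "aa (k - 1) = aa k"
  using aa_Suc[of "k - 1"] I_range[OF assms] assms by simp

lemma aa_less: assumes "1 \<le> i" "Suc i < d" "Suc i \<notin> I" shows "aa i < aa (Suc i)"
  using aa_Suc[of i] ap_less[of i] assms by simp

text \<open>\<open>hb\<close> is monotone along the boundary and constant only on edges in
  \<open>I\<close>, no two of which are adjacent; so the value \<open>- aa k\<close> is taken on
  edge \<open>k\<close> alone. Elsewhere \<open>cs (aa (k - 1))\<close> therefore has a
  limit.\<close>

lemma hb_not_cusp:
  assumes b: "b \<in> frontier \<Omega>" "b \<notin> cusps" and k: "k \<in> I"
  shows "hb b + aa (k - 1) \<noteq> 0"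
proof
  assume "hb b + aa (k - 1) = 0"
  then have hk: "hb b = - aa k" "hb b = - aa (k - 1)" using aa_pred[OF k] by auto
  obtain j where j: "j \<in> {1..d}" "b \<in> eg j" by (rule frontier_edge[OF b(1)]) (rule that)
  have jI: "j \<notin> I" using b(2) j by (auto simp: cusps_def)
  have bP: "b \<in> P" using b by (simp add: mem_frontier)
  have nb: "b \<notin> eg k" using b(2) k by (auto simp: cusps_def)
  note kr = I_range[OF k]
  show False
  proof (cases "k < j")
    case True
    define i where "i = j - 1"
    have i: "j = Suc i" "1 \<le> i" "i < d" using True kr j by (auto simp: i_def)
    have h: "hb b = - aa i - ll i b" "ll i b \<ge> 0"
      using hb_right[of i b] eg_param_right(2)[of i b] j jI i by auto
    have "aa k \<le> aa i" using aa_mono[of k i] True i kr by simp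
    then have e: "aa k = aa i" "ll i b = 0" using h hk by auto
    then have "k \<noteq> i" using nb bP by (auto simp: mem_eg)
    then have "Suc k \<le> i" using True i by simp
    then have "aa (Suc k) \<le> aa i" using aa_mono[of "Suc k" i] i by simp
    moreover have "aa k < aa (Suc k)" using aa_less[of k] I_Suc[OF k] kr \<open>Suc k \<le> i\<close> i by simp
    ultimately show False using e by simp
  next
    case False
    then have jk: "j < k" using jI k by (metis linorder_neqE_nat)
    have h: "hb b = - aa j + ll (Suc j) b" "ll (Suc j) b \<ge> 0"
      using hb_left[of j b] eg_param_left(2)[of j b] j jI jk kr by auto
    have "aa j \<le> aa (k - 1)" using aa_mono[of j "k - 1"] jk j kr by simp
    then have e: "aa j = aa (k - 1)" "ll (Suc j) b = 0" using h hk by auto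
    then have "k \<noteq> Suc j" using nb bP by (auto simp: mem_eg)
    then have j2: "j \<le> k - 2" "k - 1 = Suc (k - 2)" "1 \<le> k - 2" using jk j by auto
    have "k - 1 \<notin> I" using I_Suc[of "k - 1"] k kr by auto
    then have "aa (k - 2) < aa (k - 1)" using aa_less[of "k - 2"] j2 kr by simp
    moreover have "aa j \<le> aa (k - 2)" using aa_mono[of j "k - 2"] j2 j kr by simp
    ultimately show False using e by simp
  qed
qed

text \<open>Abel summation: \<open>aa i\<close> differs from \<open>ap i\<close> by a partial sum of
  the \<open>Lam k\<close>, and these partial sums telescope against the differences of the
  normals.\<close>

lemma aa_telescope:
  assumes "1 \<le> j"
  shows "(\<Sum>i=1..<j. aa i *\<^sub>R (nv (i+1) - nv i)) - (\<Sum>k\<in>{k\<in>I. k < j}. Lm k *\<^sub>R nv k)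
    = (\<Sum>i=1..<j. ap i *\<^sub>R (nv (i+1) - nv i)) - (\<Sum>k\<in>{k\<in>I. k < j}. Lm k) *\<^sub>R nv j"
  using assms
proof (induction j rule: dec_induct)
  case base
  have "{k\<in>I. k < 1} = {}" using I_range by force
  then show ?case by (simp only: atLeastLessThan_empty_iff2) simp
next
  case (step j)
  define T where "T = (\<Sum>k\<in>{k\<in>I. k < j}. Lm k *\<^sub>R nv k)"
  define L where "L = (\<Sum>k\<in>{k\<in>I. k < j}. Lm k)"
  define e where "e = (if j \<in> I then Lm j else 0)"
  have s: "{k\<in>I. k < Suc j} = {k\<in>I. k < j} \<union> (if j \<in> I then {j} else {})" "{k\<in>I. k \<le> j} = {k\<in>I. k < j} \<union> (if j \<in> I then {j} else {})"
    by (auto simp: less_Suc_eq le_eq_less_or_eq)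
  have 1: "(\<Sum>k\<in>{k\<in>I. k < Suc j}. Lm k *\<^sub>R nv k) = T + e *\<^sub>R nv j"
    and 2: "(\<Sum>k\<in>{k\<in>I. k < Suc j}. Lm k) = L + e" and 3: "(\<Sum>k\<in>{k\<in>I. k \<le> j}. Lm k) = L + e"
    using finite_I unfolding s T_def L_def e_def by simp_all
  have a: "aa j = ap j - (L + e)" by (simp add: aa_def 3)
  have iv: "{1..<Suc j} = insert j {1..<j}" using step(1) by auto
  show ?case unfolding iv 1 2
    using step.IH unfolding T_def[symmetric] L_def[symmetric]
    by (simp add: a algebra_simps)
qed

text \<open>The boundary value of \<open>zc\<close> where \<open>H\<close> tends to \<open>h\<close>.\<close>

definition zb :: "real \<Rightarrow> real^2" where
  "zb h = h *\<^sub>R nv 1 + (1/2) *\<^sub>R (\<Sum>i=1..d-1. ((h + aa i) - \<bar>h + aa i\<bar>) *\<^sub>R (nv (i+1) - nv i))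
     - (1/2) *\<^sub>R (\<Sum>k\<in>I. (Lm k * (1 - sgn (h + aa (k-1)))) *\<^sub>R nv k)"

text \<open>For \<open>h\<close> in the range of edge \<open>j\<close> every term degenerates: those
  with \<open>i < j\<close> are linear in \<open>h\<close>, those with \<open>i \<ge> j\<close>
  vanish, and the sign terms contribute fully for \<open>k < j\<close> and not at all otherwise. The
  slope in \<open>h\<close> is \<open>nv j\<close>.\<close>

lemma zb_eq:
  assumes j: "j \<in> {1..d}" and l: "\<And>i. 1 \<le> i \<Longrightarrow> i < j \<Longrightarrow> h + aa i \<le> 0" and r: "\<And>i. j \<le> i \<Longrightarrow> i < d \<Longrightarrow> h + aa i \<ge> 0"
    and nz: "\<And>k. k \<in> I \<Longrightarrow> h + aa (k - 1) \<noteq> 0" and jI: "j \<notin> I"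
  shows "zb h = (\<Sum>i=1..<j. ap i *\<^sub>R (nv (i+1) - nv i)) + (h - (\<Sum>k\<in>{k\<in>I. k < j}. Lm k)) *\<^sub>R nv j"
proof -
  have iv: "{1..d-1} = {1..<d}" using d2 by auto
  have iv2: "{1..<d} = {1..<j} \<union> {j..<d}" using j by auto
  have "(\<Sum>i=1..d-1. ((h + aa i) - \<bar>h + aa i\<bar>) *\<^sub>R (nv (i+1) - nv i))
      = (\<Sum>i=1..<j. ((h + aa i) - \<bar>h + aa i\<bar>) *\<^sub>R (nv (i+1) - nv i)) + (\<Sum>i=j..<d. ((h + aa i) - \<bar>h + aa i\<bar>) *\<^sub>R (nv (i+1) - nv i))"
    unfolding iv unfolding iv2 by (rule sum.union_disjoint) auto
  also have "(\<Sum>i=j..<d. ((h + aa i) - \<bar>h + aa i\<bar>) *\<^sub>R (nv (i+1) - nv i)) = 0"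
    by (rule sum.neutral) (use r in auto)
  also have "(\<Sum>i=1..<j. ((h + aa i) - \<bar>h + aa i\<bar>) *\<^sub>R (nv (i+1) - nv i))
      = (\<Sum>i=1..<j. 2 *\<^sub>R (h *\<^sub>R (nv (i+1) - nv i) + aa i *\<^sub>R (nv (i+1) - nv i)))"
  proof (rule sum.cong[OF refl])
    fix i assume "i \<in> {1..<j}"
    then have "\<bar>h + aa i\<bar> = - (h + aa i)" using l[of i] by simp
    then have "(h + aa i) - \<bar>h + aa i\<bar> = 2 * (h + aa i)" by simp
    then show "((h + aa i) - \<bar>h + aa i\<bar>) *\<^sub>R (nv (i+1) - nv i) = 2 *\<^sub>R (h *\<^sub>R (nv (i+1) - nv i) + aa i *\<^sub>R (nv (i+1) - nv i))"
      by (simp only: scaleR_add_left[symmetric] scaleR_scaleR)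
  qed
  also have "\<dots> = 2 *\<^sub>R (h *\<^sub>R (nv j - nv 1) + (\<Sum>i=1..<j. aa i *\<^sub>R (nv (i+1) - nv i)))"
    using j sum_Suc_diff'[of 1 j nv] by (simp add: scaleR_sum_right[symmetric] sum.distrib del: scaleR_right_diff_distrib)
  finally have A: "(\<Sum>i=1..d-1. ((h + aa i) - \<bar>h + aa i\<bar>) *\<^sub>R (nv (i+1) - nv i))
    = 2 *\<^sub>R (h *\<^sub>R (nv j - nv 1) + (\<Sum>i=1..<j. aa i *\<^sub>R (nv (i+1) - nv i)))" by simp
  have "(\<Sum>k\<in>I. (Lm k * (1 - sgn (h + aa (k-1)))) *\<^sub>R nv k) = (\<Sum>k\<in>{k\<in>I. k < j}. 2 *\<^sub>R (Lm k *\<^sub>R nv k))"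
  proof (rule sum.mono_neutral_cong_right[OF finite_I])
    show "\<forall>k\<in>I - {k\<in>I. k < j}. (Lm k * (1 - sgn (h + aa (k-1)))) *\<^sub>R nv k = 0"
    proof
      fix k assume k: "k \<in> I - {k\<in>I. k < j}"
      then have "j \<le> k - 1" "k - 1 < d" using jI I_range[of k] by (auto simp: not_less le_eq_less_or_eq)
      then have "h + aa (k - 1) > 0" using r[of "k - 1"] nz[of k] k by force
      then show "(Lm k * (1 - sgn (h + aa (k-1)))) *\<^sub>R nv k = 0" by simp
    qed
    fix k assume k: "k \<in> {k\<in>I. k < j}"
    then have "h + aa (k - 1) < 0" using l[of "k - 1"] nz[of k] I_range[of k] by force
    then show "(Lm k * (1 - sgn (h + aa (k-1)))) *\<^sub>R nv k = 2 *\<^sub>R (Lm k *\<^sub>R nv k)" by simp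
  qed auto
  then have B: "(\<Sum>k\<in>I. (Lm k * (1 - sgn (h + aa (k-1)))) *\<^sub>R nv k) = 2 *\<^sub>R (\<Sum>k\<in>{k\<in>I. k < j}. Lm k *\<^sub>R nv k)"
    by (simp add: scaleR_sum_right)
  have "zb h = h *\<^sub>R nv j + ((\<Sum>i=1..<j. aa i *\<^sub>R (nv (i+1) - nv i)) - (\<Sum>k\<in>{k\<in>I. k < j}. Lm k *\<^sub>R nv k))"
    unfolding zb_def A B by (simp add: algebra_simps)
  also have "\<dots> = (\<Sum>i=1..<j. ap i *\<^sub>R (nv (i+1) - nv i)) + (h - (\<Sum>k\<in>{k\<in>I. k < j}. Lm k)) *\<^sub>R nv j"
    using aa_telescope[of j] j by (simp add: algebra_simps)
  finally show ?thesis .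
qed

text \<open>The model map and the identity agree at the vertices and have the same slope
  \<open>ev j\<close> in \<open>hb\<close> along each edge outside \<open>I\<close>.\<close>

lemma zb_hb:
  assumes b: "b \<in> frontier \<Omega>" "b \<notin> cusps"
  shows "rot (zb (hb b)) - sh = b"
proof -
  obtain j where j: "j \<in> {1..d}" "b \<in> eg j" by (rule frontier_edge[OF b(1)]) (rule that)
  have jI: "j \<notin> I" using b(2) j by (auto simp: cusps_def)
  have l: "hb b + aa i \<le> 0" if "1 \<le> i" "i < j" for i
  proof -
    obtain c where c: "j = Suc c" using less_imp_Suc_add[OF \<open>i < j\<close>] by blast
    have "hb b \<le> - aa c" using hb_right[of c b] eg_param_right(2)[of c b] j jI c that by simp
    moreover have "aa i \<le> aa c" using aa_mono[of i c] that c j by simp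
    ultimately show ?thesis by simp
  qed
  have r: "hb b + aa i \<ge> 0" if "j \<le> i" "i < d" for i
    using hb_bounds(1)[OF j(2)] aa_mono[of j i] that j by simp
  have z: "zb (hb b) = (\<Sum>i=1..<j. ap i *\<^sub>R (nv (i+1) - nv i)) + (hb b - (\<Sum>k\<in>{k\<in>I. k < j}. Lm k)) *\<^sub>R nv j"
    by (rule zb_eq[OF j(1)]) (use l r hb_not_cusp[OF b] jI in auto)
  have s: "{k\<in>I. k < j} = {k\<in>I. k \<le> j}" using jI by (auto simp: le_eq_less_or_eq)
  show ?thesis
  proof (cases "j < d")
    case True
    have h: "hb b = - aa j + ll (Suc j) b" using hb_left[of j b] True j jI by simp
    have "zb (hb b) = zv j + ll (Suc j) b *\<^sub>R nv j"
      unfolding z s zv_def by (simp add: h aa_def algebra_simps)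
    then have "rot (zb (hb b)) - sh = vx j + ll (Suc j) b *\<^sub>R ev j"
      by (simp add: rot_add rot_scale vx_def ev_def)
    then show ?thesis using eg_param_left(1)[of j b] True j by simp
  next
    case False
    have jd: "j = d" using False j(1) by simp
    obtain c where c: "j = Suc c" "1 \<le> c" "c < d" using jd d2 that[of "d - 1"] by simp
    have h: "hb b = - aa c - ll c b" using hb_right[of c b] c j jI by simp
    have s: "{k\<in>I. k < j} = {k\<in>I. k \<le> c}" using c by auto
    have iv: "{1..<j} = {1..c}" using c by auto
    have "zb (hb b) = zv c - ll c b *\<^sub>R nv j"
      unfolding z s iv zv_alt[OF c(2)] by (simp add: h aa_def c(1) algebra_simps)
    then have "rot (zb (hb b)) - sh = vx c - ll c b *\<^sub>R ev j"
      by (simp add: rot_diff rot_scale vx_def ev_def)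
    then show ?thesis using eg_param_right(1)[of c b] c j by simp
  qed
qed

lemma yy_lim:
  assumes b: "b \<in> frontier \<Omega>" "b \<notin> cusps"
  shows "(yy w \<longlongrightarrow> 0) (at b within \<Omega>)"
proof -
  have "(yy w \<longlongrightarrow> b \<bullet> w + sh \<bullet> w - (det2 w (nv 1) * hb b
    + 1/2 * (\<Sum>i=1..d-1. (det2 w (nv (i+1)) - det2 w (nv i)) * (hb b + aa i - \<bar>hb b + aa i\<bar>))
    - 1/2 * (\<Sum>k\<in>I. (Lm k * det2 w (nv k)) * (1 - sgn (hb b + aa (k-1)))))) (at b within \<Omega>)"
    unfolding yy_def[abs_def] det2_zc hm_def
    by (intro tendsto_intros H_lim rh_lim cs_lim hb_not_cusp b)
  also have "b \<bullet> w + sh \<bullet> w - (det2 w (nv 1) * hb b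
    + 1/2 * (\<Sum>i=1..d-1. (det2 w (nv (i+1)) - det2 w (nv i)) * (hb b + aa i - \<bar>hb b + aa i\<bar>))
    - 1/2 * (\<Sum>k\<in>I. (Lm k * det2 w (nv k)) * (1 - sgn (hb b + aa (k-1))))) = b \<bullet> w + sh \<bullet> w - det2 w (zb (hb b))"
    by (simp add: zb_def det2_add2 det2_diff2 det2_scale2 det2_sum2 mult_ac)
  also have "\<dots> = 0"
    using arg_cong[OF zb_hb[OF b], of "\<lambda>z. z \<bullet> w"] by (simp add: inner_diff_left rot_inner)
  finally show ?thesis .
qed

text \<open>Here properness enters: \<open>x\<close> itself is bounded on \<open>lowr R\<close>, and
  the model map is bounded in terms of \<open>R\<close>.\<close>

lemma yy_bounded: "\<exists>C. \<forall>x\<in>lowr R. \<bar>yy w x\<bar> \<le> C"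
proof -
  obtain B where B: "\<And>x. x \<in> lowr R \<Longrightarrow> norm x \<le> B" using bounded_lowr[of R] unfolding bounded_iff by blast
  define C where "C = B * norm w + \<bar>sh \<bullet> w\<bar> + (\<bar>det2 w (nv 1)\<bar> * R
      + (\<Sum>i=1..d-1. \<bar>det2 w (nv (i+1)) - det2 w (nv i)\<bar> * (2 * R + 2 * \<bar>aa i\<bar>))
      + (\<Sum>k\<in>I. \<bar>Lm k * det2 w (nv k)\<bar> * 2))"
  have "\<bar>yy w x\<bar> \<le> C" if x: "x \<in> lowr R" for x
  proof -
    have xO: "x \<in> \<Omega>" and r: "rh 0 x < R" using x by (auto simp: lowr_def)
    have Hx: "\<bar>H x\<bar> \<le> R" using abs_Hc_less[OF xO, of 0] r by simp
    have hmx: "\<bar>hm c x\<bar> \<le> 2 * R + 2 * \<bar>c\<bar>" for c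
      using rh_diff_le[OF xO, of c 0] r Hx rh_pos[OF xO, of c] by (simp add: hm_def)
    have csx: "\<bar>1 - cs c x\<bar> \<le> 2" for c using abs_cs_less[OF xO, of c] by simp
    have "\<bar>x \<bullet> w\<bar> \<le> norm x * norm w" by (rule Cauchy_Schwarz_ineq2)
    also have "\<dots> \<le> B * norm w" using B[OF x] by (intro mult_right_mono) auto
    finally have 1: "\<bar>x \<bullet> w\<bar> \<le> B * norm w" .
    have 2: "\<bar>det2 w (nv 1) * H x\<bar> \<le> \<bar>det2 w (nv 1)\<bar> * R" using Hx by (simp add: abs_mult mult_left_mono)
    have 3: "\<bar>\<Sum>i=1..d-1. (det2 w (nv (i+1)) - det2 w (nv i)) * hm (aa i) x\<bar>
       \<le> (\<Sum>i=1..d-1. \<bar>det2 w (nv (i+1)) - det2 w (nv i)\<bar> * (2 * R + 2 * \<bar>aa i\<bar>))"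
      by (intro order_trans[OF sum_abs] sum_mono) (simp add: abs_mult mult_left_mono hmx del: of_nat_Suc)
    have 4: "\<bar>\<Sum>k\<in>I. (Lm k * det2 w (nv k)) * (1 - cs (aa (k-1)) x)\<bar> \<le> (\<Sum>k\<in>I. \<bar>Lm k * det2 w (nv k)\<bar> * 2)"
      by (intro order_trans[OF sum_abs] sum_mono) (subst abs_mult, intro mult_left_mono csx abs_ge_zero)
    have "\<bar>a + b - (c + 1/2 * s - 1/2 * t)\<bar> \<le> a' + \<bar>b\<bar> + (c' + s' + t')"
      if "\<bar>a\<bar> \<le> a'" "\<bar>c\<bar> \<le> c'" "\<bar>s\<bar> \<le> s'" "\<bar>t\<bar> \<le> t'" for a b c s t a' c' s' t' :: real
      using that by linarith
    from this[OF 1 2 3 4] show ?thesis unfolding yy_def det2_zc C_def .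
  qed
  then show ?thesis by blast
qed

text \<open>The function \<open>det2 w (zc x)\<close> grows like \<open>D / 2 * (rh 0 x - \<sigma> * H x)\<close>. Subtracting the same multiple
  of \<open>rh (\<sigma> * N) - \<sigma> * (H + \<sigma> * N)\<close>, which tends to 0 pointwise as \<open>N\<close> tends to infinity, makes it bounded
  above, as the maximum principle requires.\<close>

lemma yy_nonneg:
  assumes \<sigma>: "\<sigma> = 1 \<or> \<sigma> = (-1::real)" and D: "D \<ge> 0" "det2 w (nv d) - det2 w (nv 1) = - D" "det2 w (nv 1) = (1 - \<sigma>) * D / 2"
    and lower: "\<And>x. x \<in> \<Omega> \<Longrightarrow> x \<bullet> w + sh \<bullet> w \<ge> C" and x0: "x0 \<in> \<Omega>"
  shows "yy w x0 \<ge> 0"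
proof -
  define K where "K = (\<Sum>i=1..d-1. \<bar>det2 w (nv (i+1)) - det2 w (nv i)\<bar> * (2 * \<bar>aa i\<bar>)) + (\<Sum>k\<in>I. \<bar>Lm k * det2 w (nv k)\<bar> * 2)"
  have growth: "det2 w (zc x) \<le> D / 2 * (rh 0 x - \<sigma> * H x) + K" if x: "x \<in> \<Omega>" for x
  proof -
    let ?c = "\<lambda>i. det2 w (nv (i+1)) - det2 w (nv i)"
    have h: "\<bar>hm c x - hm 0 x\<bar> \<le> 2 * \<bar>c\<bar>" for c
      using rh_diff_le[OF x, of c 0] by (simp add: hm_def)
    have csx: "\<bar>1 - cs c x\<bar> \<le> 2" for c using abs_cs_less[OF x, of c] by simp
    have iv: "{1..d-1} = {1..<d}" using d2 by auto
    have "(\<Sum>i=1..d-1. ?c i) = - D" unfolding iv using sum_Suc_diff'[of 1 d "\<lambda>i. det2 w (nv i)"] d2 D by simp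
    then have s: "(\<Sum>i=1..d-1. ?c i * hm 0 x) = - D * hm 0 x" by (simp only: sum_distrib_right[symmetric])
    have "(\<Sum>i=1..d-1. ?c i * hm (aa i) x) = (\<Sum>i=1..d-1. ?c i * hm 0 x) + (\<Sum>i=1..d-1. ?c i * (hm (aa i) x - hm 0 x))"
      by (simp only: sum.distrib[symmetric] distrib_left[symmetric]) simp
    moreover have "\<bar>\<Sum>i=1..d-1. ?c i * (hm (aa i) x - hm 0 x)\<bar> \<le> (\<Sum>i=1..d-1. \<bar>?c i\<bar> * (2 * \<bar>aa i\<bar>))"
      by (rule order_trans[OF sum_abs]) (auto simp only: abs_mult abs_ge_zero intro!: sum_mono mult_left_mono h)
    moreover have "\<bar>\<Sum>k\<in>I. (Lm k * det2 w (nv k)) * (1 - cs (aa (k-1)) x)\<bar> \<le> (\<Sum>k\<in>I. \<bar>Lm k * det2 w (nv k)\<bar> * 2)"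
      by (intro order_trans[OF sum_abs] sum_mono) (subst abs_mult, intro mult_left_mono csx abs_ge_zero)
    moreover have "(\<Sum>i=1..d-1. \<bar>?c i\<bar> * (2 * \<bar>aa i\<bar>)) \<ge> 0" "(\<Sum>k\<in>I. \<bar>Lm k * det2 w (nv k)\<bar> * 2) \<ge> 0"
      by (intro sum_nonneg mult_nonneg_nonneg; simp)+
    ultimately have "det2 w (zc x) \<le> det2 w (nv 1) * H x + 1/2 * (- D * hm 0 x) + K"
      unfolding det2_zc K_def s by linarith
    also have "det2 w (nv 1) * H x + 1/2 * (- D * hm 0 x) = D / 2 * (rh 0 x - \<sigma> * H x)"
      unfolding D(3) hm_def by (simp add: field_simps)
    finally show ?thesis by simp
  qed
  have N: "- yy w x0 \<le> D / 2 * (rh (\<sigma> * N) x0 - \<sigma> * (H x0 + \<sigma> * N))" if N: "N > 0" for N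
  proof -
    let ?g = "\<lambda>x. rh (\<sigma> * N) x - \<sigma> * (H x + \<sigma> * N)"
    let ?s = "\<lambda>x. (- 1) * yy w x - D / 2 * ?g x"
    have hs: "harm ?s" by (intro harm_intros harm_yy)
    have "?s x0 \<le> 0"
    proof (rule max_principle[OF open_\<Omega> order_refl _ _ _ _ _ x0])
      show "smooth_fun \<Omega> ?s" "\<And>x. x \<in> \<Omega> \<Longrightarrow> Lop ?s x \<ge> 0" using hs by (simp_all add: harm_def)
      fix x assume x: "x \<in> \<Omega>"
      have ss: "\<sigma> * \<sigma> = 1" using \<sigma> by auto
      have an: "\<bar>\<sigma> * N\<bar> = N" using \<sigma> N by auto
      have "\<sigma> * (H x + \<sigma> * N) = \<sigma> * H x + N" using ss by (simp add: distrib_left mult.assoc[symmetric])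
      then have "?g x \<ge> rh 0 x - \<sigma> * H x - 2 * N" using rh_diff_le[OF x, of "\<sigma> * N" 0] an by (simp add: abs_le_iff)
      then have "D / 2 * ?g x \<ge> D / 2 * (rh 0 x - \<sigma> * H x - 2 * N)" using D(1) by (intro mult_left_mono) auto
      then have "D / 2 * ?g x \<ge> D / 2 * (rh 0 x - \<sigma> * H x) - D * N" by (simp add: right_diff_distrib)
      then show "?s x \<le> K + D * N - C" using growth[OF x] lower[OF x] by (simp add: yy_def)
    next
      show "b \<in> frontier \<Omega> \<Longrightarrow> b \<in> \<Omega> \<Longrightarrow> ?s b \<le> 0" for b using frontier_notin by blast
    next
      fix b and \<epsilon> :: real assume b: "b \<in> frontier \<Omega>" "b \<notin> cusps" and \<epsilon>: "\<epsilon> > 0"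
      have "(?s \<longlongrightarrow> (-1) * 0 - D / 2 * (\<bar>hb b + \<sigma> * N\<bar> - \<sigma> * (hb b + \<sigma> * N))) (at b within \<Omega>)"
        by (intro tendsto_intros yy_lim rh_lim H_lim b)
      moreover have "\<bar>hb b + \<sigma> * N\<bar> - \<sigma> * (hb b + \<sigma> * N) \<ge> 0" using \<sigma> by auto
      then have "D / 2 * (\<bar>hb b + \<sigma> * N\<bar> - \<sigma> * (hb b + \<sigma> * N)) \<ge> 0" using D(1) by (intro mult_nonneg_nonneg) auto
      then have "(-1) * 0 - D / 2 * (\<bar>hb b + \<sigma> * N\<bar> - \<sigma> * (hb b + \<sigma> * N)) < \<epsilon>" using \<epsilon> by simp
      ultimately have "\<forall>\<^sub>F x in at b within \<Omega>. ?s x < \<epsilon>" by (rule order_tendstoD)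
      then show "\<forall>\<^sub>F x in at b within \<Omega>. x \<in> \<Omega> \<longrightarrow> ?s x < \<epsilon>" by eventually_elim simp
    qed
    then show ?thesis by simp
  qed
  show ?thesis
  proof (rule field_le_epsilon)
    fix e :: real assume e: "e > 0"
    \<comment> \<open>Since \<open>(?r - ?t) * (?r + ?t) = q x0\<close>, the excess
      \<open>?r - ?t\<close> is at most \<open>q x0 / (N - \<bar>H x0\<bar>)\<close>. This
      \<open>N\<close> makes \<open>D\<close> times it smaller than \<open>e\<close>.\<close>
    define N where "N = D * q x0 / e + \<bar>H x0\<bar> + 1"
    have qp: "q x0 > 0" by (rule q_pos[OF x0])
    have "D * q x0 / e \<ge> 0" using e qp D(1) by simp
    then have N0: "N > 0" "N - \<bar>H x0\<bar> > 0" unfolding N_def by linarith+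
    have "e * (N - \<bar>H x0\<bar>) = D * q x0 + e" using e by (simp add: N_def algebra_simps)
    then have N3: "e * (N - \<bar>H x0\<bar>) > D * q x0" using e by simp
    let ?r = "rh (\<sigma> * N) x0" and ?t = "\<sigma> * (H x0 + \<sigma> * N)"
    have ss: "\<sigma> * \<sigma> = 1" using \<sigma> by auto
    have t: "?t = \<sigma> * H x0 + N" using ss by (simp add: distrib_left mult.assoc[symmetric])
    then have t1: "?t \<ge> N - \<bar>H x0\<bar>" using \<sigma> by auto
    have sq: "?r\<^sup>2 = ?t\<^sup>2 + q x0" using rh_sq[OF x0, of "\<sigma> * N"] \<sigma> by (auto simp: power_mult_distrib)
    have rp: "?r > 0" by (rule rh_pos[OF x0])
    have g0: "?r - ?t \<ge> 0" using abs_Hc_less[OF x0, of "\<sigma> * N"] \<sigma> by auto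
    have "(?r - ?t) * (N - \<bar>H x0\<bar>) \<le> (?r - ?t) * (?r + ?t)" using t1 rp g0 by (intro mult_left_mono) auto
    also have "\<dots> = q x0" using sq by (simp add: algebra_simps power2_eq_square)
    finally have "D * ((?r - ?t) * (N - \<bar>H x0\<bar>)) \<le> D * q x0" using D(1) by (rule mult_left_mono)
    also have "\<dots> < e * (N - \<bar>H x0\<bar>)" by (rule N3)
    finally have "(D * (?r - ?t)) * (N - \<bar>H x0\<bar>) < e * (N - \<bar>H x0\<bar>)" by (simp only: mult.assoc)
    then have "D * (?r - ?t) < e" using N0(2) by (simp only: mult_less_cancel_right_pos)
    moreover have "D * (?r - ?t) \<ge> 0" using D(1) g0 by (rule mult_nonneg_nonneg)
    ultimately show "0 \<le> yy w x0 + e" using N[OF N0(1)] by simp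
  qed
qed

lemma yy_1_nonneg: "x \<in> \<Omega> \<Longrightarrow> yy (nv 1) x \<ge> 0"
proof (rule yy_nonneg[of 1 "- DD 1 d" "nv 1" 0])
  fix x assume x: "x \<in> \<Omega>"
  have "ll 1 x > 0" using x d2 by (simp add: interior_P)
  moreover have "lam 1 = sh \<bullet> nv 1" using lams_1 by (simp add: lams_eq)
  ultimately show "x \<bullet> nv 1 + sh \<bullet> nv 1 \<ge> 0" by (simp add: ll_eq)
qed (use DD_1d in \<open>auto simp: det2_self\<close>)

lemma yy_d_nonneg: "x \<in> \<Omega> \<Longrightarrow> yy (nv d) x \<ge> 0"
proof (rule yy_nonneg[of "-1" "- DD 1 d" "nv d" "- lams d"])
  fix x assume x: "x \<in> \<Omega>"
  have "ll d x > 0" using x d2 by (simp add: interior_P)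
  then show "x \<bullet> nv d + sh \<bullet> nv d \<ge> - lams d" by (simp add: ll_eq lams_eq)
qed (use DD_1d det2_swap[of "nv d" "nv 1"] in \<open>auto simp: det2_self\<close>)

end

section \<open>Almost every level of a solution is regular\<close>

lemma second_order_estimate:
  fixes f :: "real^2 \<Rightarrow> real"
  assumes O: "open W" "smooth_fun W f" and seg: "closed_segment x y \<subseteq> W"
    and z1: "dir_deriv (y - x) f x = 0"
    and le: "\<And>z. z \<in> closed_segment x y \<Longrightarrow> \<bar>dir_deriv (y - x) (dir_deriv (y - x) f) z\<bar> \<le> M"
  shows "\<bar>f y - f x\<bar> \<le> M"
proof -
  define v where "v = y - x"
  have in_seg: "x + t *\<^sub>R v \<in> closed_segment x y" if "0 \<le> t" "t \<le> 1" for t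
    unfolding closed_segment_def using that by (auto simp: v_def algebra_simps intro!: exI[of _ t])
  have d0: "((\<lambda>t. f (x + t *\<^sub>R v)) has_real_derivative dir_deriv v f (x + t *\<^sub>R v)) (at t)" if "0 \<le> t" "t \<le> 1" for t
    using in_seg[OF that] seg by (intro DERIV_along_line smooth_fun_differentiable[OF O(2)]) auto
  have d1: "((\<lambda>t. dir_deriv v f (x + t *\<^sub>R v)) has_real_derivative dir_deriv v (dir_deriv v f) (x + t *\<^sub>R v)) (at t)" if "0 \<le> t" "t \<le> 1" for t
    using in_seg[OF that] seg by (intro DERIV_along_line smooth_fun_differentiable[OF smooth_fun_dir_deriv[OF O(2)]]) auto
  have M0: "M \<ge> 0" using le[of x] by force
  obtain t where t: "0 < t" "t < 1" "f (x + 1 *\<^sub>R v) - f (x + 0 *\<^sub>R v) = (1 - 0) * dir_deriv v f (x + t *\<^sub>R v)"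
    using MVT2[of 0 1 "\<lambda>t. f (x + t *\<^sub>R v)" "\<lambda>t. dir_deriv v f (x + t *\<^sub>R v)"] d0 by auto
  obtain s where s: "0 < s" "s < t" "dir_deriv v f (x + t *\<^sub>R v) - dir_deriv v f (x + 0 *\<^sub>R v) = (t - 0) * dir_deriv v (dir_deriv v f) (x + s *\<^sub>R v)"
    using MVT2[OF t(1), of "\<lambda>t. dir_deriv v f (x + t *\<^sub>R v)" "\<lambda>t. dir_deriv v (dir_deriv v f) (x + t *\<^sub>R v)"] d1 t by auto
  have "f y - f x = t * dir_deriv v (dir_deriv v f) (x + s *\<^sub>R v)"
    using t(3) s(3) z1 by (simp add: v_def)
  also have "\<bar>\<dots>\<bar> \<le> 1 * M"
    unfolding abs_mult using t s le[OF in_seg[of s]] M0 by (intro mult_mono) (auto simp: v_def)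
  finally show ?thesis by simp
qed

text \<open>On a grid of mesh \<open>1 / N\<close> there are \<open>O(N\<^sup>2)\<close> cells, and the values taken in a cell at degenerate
  points lie within \<open>o(1 / N\<^sup>2)\<close> of each other.\<close>

lemma negligible_degenerate_values_cbox:
  fixes f :: "real^2 \<Rightarrow> real"
  assumes O: "open W" "smooth_fun W f" and K: "cbox p r \<subseteq> W"
    and A: "A \<subseteq> cbox p r" "\<And>x v. x \<in> A \<Longrightarrow> dir_deriv v f x = 0" "\<And>x v w. x \<in> A \<Longrightarrow> dir_deriv v (dir_deriv w f) x = 0"
  shows "negligible (f ` A)"
  unfolding negligible_outer_le
proof (intro allI impI)
  fix e :: real assume e: "e > 0"
  obtain B0 where B0: "\<And>x. x \<in> cbox p r \<Longrightarrow> norm x \<le> B0" using bounded_cbox[of p r] unfolding bounded_iff by blast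
  obtain B :: nat where B: "real B > B0 + 1" "B > 0" using reals_Archimedean2[of "max (B0 + 1) 0"] by (metis max_less_iff_conj of_nat_0_less_iff)
  \<comment> \<open>There will be at most \<open>(3 * B * N)^2\<close> cells, each contributing an
    interval of length \<open>8 * \<epsilon> / N^2\<close>. The total length is then at most
    \<open>72 * B^2 * \<epsilon> = e / 4\<close>.\<close>
  define \<epsilon> where "\<epsilon> = e / (288 * (real B)\<^sup>2)"
  have \<epsilon>: "\<epsilon> > 0" using e B by (simp add: \<epsilon>_def)
  let ?h = "\<lambda>a b. dir_deriv a (dir_deriv b f)"
  have uc: "\<exists>\<delta>>0. \<forall>x\<in>cbox p r. \<forall>y\<in>cbox p r. dist y x < \<delta> \<longrightarrow> \<bar>?h a b y - ?h a b x\<bar> < \<epsilon>" for a b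
  proof -
    have "continuous_on (cbox p r) (?h a b)"
      by (rule continuous_on_subset[OF smooth_fun_continuous_on[OF smooth_fun_dir_deriv[OF smooth_fun_dir_deriv[OF O(2)]]] K])
    then have "uniformly_continuous_on (cbox p r) (?h a b)" by (simp add: compact_uniformly_continuous)
    then show ?thesis using \<epsilon> unfolding uniformly_continuous_on_def by (simp add: dist_real_def)
  qed
  obtain \<delta>1 where \<delta>1: "\<delta>1 > 0" "\<And>x y. x \<in> cbox p r \<Longrightarrow> y \<in> cbox p r \<Longrightarrow> dist y x < \<delta>1 \<Longrightarrow> \<bar>?h E1 E1 y - ?h E1 E1 x\<bar> < \<epsilon>" using uc by blast
  obtain \<delta>2 where \<delta>2: "\<delta>2 > 0" "\<And>x y. x \<in> cbox p r \<Longrightarrow> y \<in> cbox p r \<Longrightarrow> dist y x < \<delta>2 \<Longrightarrow> \<bar>?h E1 E2 y - ?h E1 E2 x\<bar> < \<epsilon>" using uc by blast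
  obtain \<delta>3 where \<delta>3: "\<delta>3 > 0" "\<And>x y. x \<in> cbox p r \<Longrightarrow> y \<in> cbox p r \<Longrightarrow> dist y x < \<delta>3 \<Longrightarrow> \<bar>?h E2 E2 y - ?h E2 E2 x\<bar> < \<epsilon>" using uc by blast
  define \<delta> where "\<delta> = min \<delta>1 (min \<delta>2 \<delta>3)"
  have \<delta>: "\<delta> > 0" using \<delta>1 \<delta>2 \<delta>3 by (simp add: \<delta>_def)
  have est: "\<bar>f y - f x\<bar> \<le> 4 * \<epsilon> * s\<^sup>2" if x: "x \<in> A" and y: "y \<in> A" and s: "\<bar>(y - x)$1\<bar> \<le> s" "\<bar>(y - x)$2\<bar> \<le> s" "2 * s < \<delta>" for x y s
  proof (rule second_order_estimate[OF O])
    have xy: "x \<in> cbox p r" "y \<in> cbox p r" using x y A by auto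
    have sg: "closed_segment x y \<subseteq> cbox p r" using xy by (intro closed_segment_subset convex_box)
    then show "closed_segment x y \<subseteq> W" using K by blast
    show "dir_deriv (y - x) f x = 0" using A x by blast
    fix z assume z: "z \<in> closed_segment x y"
    have "norm (y - x) \<le> \<bar>(y - x)$1\<bar> + \<bar>(y - x)$2\<bar>" using norm_le_l1_cart[of "y - x"] by (simp add: sum_2)
    then have "dist z x < \<delta>" using s segment_bound[OF z] by (simp add: dist_norm norm_minus_commute)
    then have h: "\<bar>?h E1 E1 z\<bar> < \<epsilon>" "\<bar>?h E1 E2 z\<bar> < \<epsilon>" "\<bar>?h E2 E2 z\<bar> < \<epsilon>"
      using \<delta>1(2)[of x z] \<delta>2(2)[of x z] \<delta>3(2)[of x z] xy sg z A(3)[OF x] by (auto simp: \<delta>_def)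
    define v where "v = y - x"
    have s0: "s \<ge> 0" using s(1) by linarith
    have vv: "\<bar>v$i * (v$j * c)\<bar> \<le> s * (s * \<epsilon>)" if "\<bar>v$i\<bar> \<le> s" "\<bar>v$j\<bar> \<le> s" "\<bar>c\<bar> < \<epsilon>" for i j :: 2 and c
      unfolding abs_mult using that s0 by (intro mult_mono) auto
    have v: "\<bar>v$1\<bar> \<le> s" "\<bar>v$2\<bar> \<le> s" using s by (simp_all add: v_def)
    have "?h v v z = v$1 * (v$1 * ?h E1 E1 z) + v$1 * (v$2 * ?h E1 E2 z) + v$2 * (v$1 * ?h E1 E2 z) + v$2 * (v$2 * ?h E2 E2 z)"
      using second_expand[OF O, of z v v] sg K z by (auto simp: algebra_simps)
    moreover have "s * (s * \<epsilon>) = \<epsilon> * s\<^sup>2" by (simp add: power2_eq_square mult_ac)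
    ultimately have "\<bar>?h v v z\<bar> \<le> 4 * (\<epsilon> * s\<^sup>2)"
      using vv[OF v(1) v(1) h(1)] vv[OF v(1) v(2) h(2)] vv[OF v(2) v(1) h(2)] vv[OF v(2) v(2) h(3)] by linarith
    then show "\<bar>?h (y - x) (y - x) z\<bar> \<le> 4 * \<epsilon> * s\<^sup>2" by (simp add: v_def)
  qed
  obtain N :: nat where N: "N > 0" "2 * (1 / real N) < \<delta>"
  proof -
    obtain N where "N > 0" "inverse (real N) < \<delta> / 2" using reals_Archimedean[of "\<delta> / 2"] \<delta> by (metis half_gt_zero zero_less_Suc)
    then show ?thesis using that[of N] by (simp add: inverse_eq_divide)
  qed
  define cell where "cell = (\<lambda>x::real^2. (\<lfloor>real N * x$1\<rfloor>, \<lfloor>real N * x$2\<rfloor>))"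
  define M where "M = int (B * N)"
  have cellM: "cell x \<in> {-M..M} \<times> {-M..M}" if x: "x \<in> A" for x
  proof -
    have nx: "\<bar>x$i\<bar> \<le> B" for i using component_le_norm_cart[of x i] B0[of x] A(1) x B(1) by force
    have "real N * \<bar>x$i\<bar> \<le> real N * real B" for i using nx[of i] by (intro mult_left_mono) auto
    then have "\<bar>real N * x$i\<bar> \<le> real N * real B" for i by (simp add: abs_mult)
    then have "- real_of_int M \<le> real N * x$i \<and> real N * x$i \<le> real_of_int M" for i
      by (simp add: M_def abs_le_iff mult.commute minus_le_iff)
    then have "\<lfloor>real N * x$i\<rfloor> \<in> {-M..M}" for i by (simp add: le_floor_iff floor_le_iff)
      (metis add.commute less_add_one order_le_less_trans)
    then show ?thesis by (simp add: cell_def)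
  qed
  define J where "J = cell ` A"
  have J: "J \<subseteq> {-M..M} \<times> {-M..M}" unfolding J_def by (rule image_subsetI) (rule cellM)
  then have fJ: "finite J" by (rule finite_subset) simp
  have "card J \<le> card ({-M..M} \<times> {-M..M})" using J by (intro card_mono) auto
  also have "\<dots> = nat (2 * M + 1) * nat (2 * M + 1)" by (simp add: card_cartesian_product)
  finally have cJ: "real (card J) \<le> (3 * real B * real N)\<^sup>2"
  proof -
    assume le: "card J \<le> nat (2 * M + 1) * nat (2 * M + 1)"
    have "0 < B * N" using B(2) N(1) by simp
    then have M1: "M \<ge> 1" unfolding M_def by linarith
    have "real (card J) \<le> real (nat (2 * M + 1)) * real (nat (2 * M + 1))" using le by (metis of_nat_le_iff of_nat_mult)
    also have "real (nat (2 * M + 1)) = 2 * real_of_int M + 1" using M1 by simp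
    also have "(2 * real_of_int M + 1) * (2 * real_of_int M + 1) \<le> (3 * real_of_int M) * (3 * real_of_int M)"
      using M1 by (intro mult_mono) auto
    also have "\<dots> = (3 * real B * real N)\<^sup>2" by (simp add: M_def power2_eq_square mult_ac)
    finally show ?thesis .
  qed
  define c where "c = (\<lambda>j. SOME x. x \<in> A \<and> cell x = j)"
  have c: "c j \<in> A" "cell (c j) = j" if "j \<in> J" for j
    using someI_ex[of "\<lambda>x. x \<in> A \<and> cell x = j"] that unfolding c_def J_def by auto
  define \<eta> where "\<eta> = 4 * \<epsilon> * (1 / real N)\<^sup>2"
  have \<eta>: "\<eta> \<ge> 0" using \<epsilon> by (simp add: \<eta>_def)
  define T where "T = (\<Union>j\<in>J. cball (f (c j)) \<eta>)"
  have "f ` A \<subseteq> T"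
  proof
    fix t assume "t \<in> f ` A"
    then obtain y where y: "y \<in> A" "t = f y" by blast
    define j where "j = cell y"
    have jJ: "j \<in> J" using y by (simp add: J_def j_def)
    have "\<bar>real N * y$i - real N * c j$i\<bar> \<le> 1" if "\<lfloor>real N * y$i\<rfloor> = \<lfloor>real N * c j$i\<rfloor>" for i using that by linarith
    moreover have "cell y = cell (c j)" using c(2)[OF jJ] by (simp add: j_def)
    ultimately have "\<bar>real N * y$1 - real N * c j$1\<bar> \<le> 1" "\<bar>real N * y$2 - real N * c j$2\<bar> \<le> 1" by (simp_all add: cell_def)
    moreover have "\<bar>real N * y$i - real N * c j$i\<bar> = real N * \<bar>(y - c j)$i\<bar>" for i
      by (simp add: right_diff_distrib[symmetric] abs_mult)
    ultimately have "\<bar>(y - c j)$1\<bar> \<le> 1 / real N" "\<bar>(y - c j)$2\<bar> \<le> 1 / real N"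
      using N by (simp_all add: field_simps)
    then have "\<bar>f y - f (c j)\<bar> \<le> \<eta>" unfolding \<eta>_def by (intro est c(1) jJ y N)
    then show "t \<in> T" using jJ y by (auto simp: T_def dist_real_def abs_minus_commute)
  qed
  moreover have "T \<in> lmeasurable" unfolding T_def by (rule lmeasurable_compact) (auto intro!: compact_UN fJ)
  moreover have "measure lebesgue T \<le> e"
  proof -
    have "measure lebesgue T \<le> (\<Sum>j\<in>J. measure lebesgue (cball (f (c j)) \<eta>))"
      unfolding T_def by (rule measure_UNION_le[OF fJ]) simp
    also have "\<dots> = real (card J) * (2 * \<eta>)" using \<eta> by (simp add: cball_eq_atLeastAtMost)
    also have "\<dots> \<le> (3 * real B * real N)\<^sup>2 * (2 * \<eta>)" using cJ \<eta> by (intro mult_right_mono) auto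
    also have "\<dots> = 72 * (real B)\<^sup>2 * \<epsilon>" using N by (simp add: \<eta>_def field_simps power2_eq_square)
    also have "\<dots> \<le> e" using B e by (simp add: \<epsilon>_def)
    finally show ?thesis .
  qed
  ultimately show "\<exists>T. f ` A \<subseteq> T \<and> T \<in> lmeasurable \<and> measure lebesgue T \<le> e" by blast
qed

lemma negligible_degenerate_values:
  fixes f :: "real^2 \<Rightarrow> real"
  assumes O: "open W" "smooth_fun W f"
  shows "negligible (f ` {x\<in>W. (\<forall>v. dir_deriv v f x = 0) \<and> (\<forall>v w. dir_deriv v (dir_deriv w f) x = 0)})" (is "negligible (f ` ?A)")
proof -
  obtain D where D: "countable D" "D \<subseteq> Pow W" "\<And>X. X \<in> D \<Longrightarrow> \<exists>a b. X = cbox a b" "\<Union>D = W"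
    using open_countable_Union_open_cbox[OF O(1)] by metis
  have "f ` ?A = (\<Union>X\<in>D. f ` (?A \<inter> X))" using D(4) by blast
  moreover have "negligible (f ` (?A \<inter> X))" if X: "X \<in> D" for X
  proof -
    obtain a b where ab: "X = cbox a b" using D(3)[OF X] by blast
    show ?thesis by (rule negligible_degenerate_values_cbox[OF O, of a b]) (use ab X D in auto)
  qed
  ultimately show ?thesis using D(1) by (auto intro!: negligible_countable_Union)
qed

lemma countable_isolated:
  fixes A :: "'a::euclidean_space set"
  assumes "\<And>x. x \<in> A \<Longrightarrow> \<exists>U. open U \<and> A \<inter> U = {x}"
  shows "countable A"
proof -
  obtain U where U: "\<And>x. x \<in> A \<Longrightarrow> open (U x)" "\<And>x. x \<in> A \<Longrightarrow> A \<inter> U x = {x}" using assms by metis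
  obtain F where F: "F \<subseteq> U ` A" "countable F" "\<Union>F = \<Union>(U ` A)"
    using Lindelof[of "U ` A"] U by blast
  have "x \<in> \<Union>(U ` A)" if "x \<in> A" for x using U(2)[OF that] that by (intro UN_I[of x]) auto
  then have "A \<subseteq> (\<Union>X\<in>F. A \<inter> X)" unfolding F(3)[symmetric] by blast
  moreover have "countable (A \<inter> X)" if "X \<in> F" for X
  proof -
    have "X \<in> U ` A" using \<open>X \<in> F\<close> F(1) by blast
    then show ?thesis using U(2) by auto
  qed
  ultimately show ?thesis using F(2) by (meson countable_UN countable_subset)
qed

section \<open>Regular level arcs\<close>

lemma linear_pair_lower:
  fixes a1 a2 b1 b2 :: real
  assumes "a1 * b2 - a2 * b1 \<noteq> 0"
  obtains c where "c > 0" "\<And>v::real^2. c * norm v \<le> \<bar>v$1 * a1 + v$2 * a2\<bar> + \<bar>v$1 * b1 + v$2 * b2\<bar>"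
proof -
  define D where "D = a1 * b2 - a2 * b1"
  define K where "K = \<bar>a1\<bar> + \<bar>a2\<bar> + \<bar>b1\<bar> + \<bar>b2\<bar> + 1"
  have K: "K > 0" by (simp add: K_def)
  have D: "\<bar>D\<bar> > 0" using assms by (simp add: D_def)
  show ?thesis
  proof (rule that[of "\<bar>D\<bar> / K"])
    fix v :: "real^2"
    let ?A = "v$1 * a1 + v$2 * a2" and ?B = "v$1 * b1 + v$2 * b2"
    have e: "D * v$1 = b2 * ?A - a2 * ?B" "D * v$2 = a1 * ?B - b1 * ?A" by (simp_all add: D_def algebra_simps)
    have 1: "\<bar>D\<bar> * \<bar>v$1\<bar> \<le> \<bar>b2\<bar> * \<bar>?A\<bar> + \<bar>a2\<bar> * \<bar>?B\<bar>"
      unfolding abs_mult[symmetric] e(1) by (rule abs_triangle_ineq4)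
    have 2: "\<bar>D\<bar> * \<bar>v$2\<bar> \<le> \<bar>a1\<bar> * \<bar>?B\<bar> + \<bar>b1\<bar> * \<bar>?A\<bar>"
      unfolding abs_mult[symmetric] e(2) by (rule abs_triangle_ineq4)
    have "norm v \<le> \<bar>v$1\<bar> + \<bar>v$2\<bar>" using norm_le_l1_cart[of v] by (simp add: sum_2)
    then have "\<bar>D\<bar> * norm v \<le> \<bar>D\<bar> * (\<bar>v$1\<bar> + \<bar>v$2\<bar>)" using D by (intro mult_left_mono) auto
    also have "\<dots> \<le> (\<bar>b2\<bar> * \<bar>?A\<bar> + \<bar>a2\<bar> * \<bar>?B\<bar>) + (\<bar>a1\<bar> * \<bar>?B\<bar> + \<bar>b1\<bar> * \<bar>?A\<bar>)"
      unfolding distrib_left using 1 2 by (rule add_mono)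
    also have "\<dots> = (\<bar>b2\<bar> + \<bar>b1\<bar>) * \<bar>?A\<bar> + (\<bar>a2\<bar> + \<bar>a1\<bar>) * \<bar>?B\<bar>" by (simp add: algebra_simps)
    also have "\<dots> \<le> K * \<bar>?A\<bar> + K * \<bar>?B\<bar>" by (intro add_mono mult_right_mono) (auto simp: K_def)
    finally show "\<bar>D\<bar> / K * norm v \<le> \<bar>?A\<bar> + \<bar>?B\<bar>" using K by (simp add: field_simps)
  qed (use D K in auto)
qed

text \<open>The injectivity half of the inverse function theorem. As it needs only strict
  derivatives at \<open>b\<close>, it holds at boundary points of the domain too.\<close>

lemma strict_pair_injective:
  fixes f g :: "real^2 \<Rightarrow> real"
  assumes f: "strict_deriv W f (\<lambda>v. v$1 * a1 + v$2 * a2) b" and g: "strict_deriv W g (\<lambda>v. v$1 * b1 + v$2 * b2) b"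
    and D: "a1 * b2 - a2 * b1 \<noteq> 0"
  obtains \<delta> where "\<delta> > 0" "\<And>x y. x \<in> W \<inter> ball b \<delta> \<Longrightarrow> y \<in> W \<inter> ball b \<delta> \<Longrightarrow> f x = f y \<Longrightarrow> g x = g y \<Longrightarrow> x = y"
proof -
  obtain c where c: "c > 0" "\<And>v::real^2. c * norm v \<le> \<bar>v$1 * a1 + v$2 * a2\<bar> + \<bar>v$1 * b1 + v$2 * b2\<bar>"
    by (rule linear_pair_lower[OF D]) (rule that)
  have c4: "c / 4 > 0" using c by simp
  obtain \<delta>1 where \<delta>1: "\<delta>1 > 0" "\<And>x y. x \<in> W \<inter> ball b \<delta>1 \<Longrightarrow> y \<in> W \<inter> ball b \<delta>1 \<Longrightarrow> \<bar>f x - f y - ((x - y)$1 * a1 + (x - y)$2 * a2)\<bar> \<le> c / 4 * norm (x - y)"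
    using f c4 unfolding strict_deriv_def by blast
  obtain \<delta>2 where \<delta>2: "\<delta>2 > 0" "\<And>x y. x \<in> W \<inter> ball b \<delta>2 \<Longrightarrow> y \<in> W \<inter> ball b \<delta>2 \<Longrightarrow> \<bar>g x - g y - ((x - y)$1 * b1 + (x - y)$2 * b2)\<bar> \<le> c / 4 * norm (x - y)"
    using g c4 unfolding strict_deriv_def by blast
  show ?thesis
  proof (rule that[of "min \<delta>1 \<delta>2"])
    fix x y assume "x \<in> W \<inter> ball b (min \<delta>1 \<delta>2)" "y \<in> W \<inter> ball b (min \<delta>1 \<delta>2)" and e: "f x = f y" "g x = g y"
    then have "\<bar>f x - f y - ((x - y)$1 * a1 + (x - y)$2 * a2)\<bar> \<le> c / 4 * norm (x - y)"
      "\<bar>g x - g y - ((x - y)$1 * b1 + (x - y)$2 * b2)\<bar> \<le> c / 4 * norm (x - y)"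
      using \<delta>1(2)[of x y] \<delta>2(2)[of x y] by auto
    then have "\<bar>(x - y)$1 * a1 + (x - y)$2 * a2\<bar> \<le> c / 4 * norm (x - y)" "\<bar>(x - y)$1 * b1 + (x - y)$2 * b2\<bar> \<le> c / 4 * norm (x - y)"
      using e by (simp_all only: diff_self diff_0 abs_minus_cancel)
    then have "c * norm (x - y) \<le> c / 4 * norm (x - y) + c / 4 * norm (x - y)" using c(2)[of "x - y"] by linarith
    then have "c * norm (x - y) \<le> 0" by simp
    then show "x = y" using c(1) by (simp add: mult_le_0_iff)
  qed (use \<delta>1 \<delta>2 in auto)
qed

lemma interval_clopen:
  assumes T: "T \<subseteq> {-R<..<R::real}" and o: "\<And>h. h \<in> T \<Longrightarrow> \<exists>\<epsilon>>0. \<forall>h'. \<bar>h' - h\<bar> < \<epsilon> \<and> \<bar>h'\<bar> < R \<longrightarrow> h' \<in> T"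
    and c: "\<And>f l. (\<And>n. f n \<in> T) \<Longrightarrow> f \<longlonglongrightarrow> l \<Longrightarrow> \<bar>l\<bar> < R \<Longrightarrow> l \<in> T"
  shows "T = {} \<or> T = {-R<..<R}"
proof -
  have "openin (top_of_set {-R<..<R}) T" unfolding openin_contains_ball
  proof (intro conjI ballI T)
    fix h assume "h \<in> T"
    then obtain \<epsilon> where e: "\<epsilon> > 0" "\<And>h'. \<bar>h' - h\<bar> < \<epsilon> \<Longrightarrow> \<bar>h'\<bar> < R \<Longrightarrow> h' \<in> T" using o by blast
    have "ball h \<epsilon> \<inter> {-R<..<R} \<subseteq> T" using e(2) by (auto simp: dist_real_def abs_minus_commute abs_less_iff)
    then show "\<exists>\<epsilon>>0. ball h \<epsilon> \<inter> {-R<..<R} \<subseteq> T" using e(1) by blast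
  qed
  moreover have "closedin (top_of_set {-R<..<R}) T" unfolding closedin_limpt
  proof (intro conjI allI impI T)
    fix l assume l: "l islimpt T \<and> l \<in> {-R<..<R}"
    then obtain f where f: "\<And>n. f n \<in> T - {l}" "f \<longlonglongrightarrow> l" unfolding islimpt_sequential by blast
    have "\<bar>l\<bar> < R" using l by (simp add: abs_less_iff)
    then show "l \<in> T" using c[of f l] f by blast
  qed
  moreover have "connected {-R<..<R}" by (rule is_interval_connected) (rule is_interval_oo)
  ultimately show ?thesis unfolding connected_clopen by blast
qed

context convex_potential
begin

lemma smooth_strict_deriv:
  assumes s: "smooth_fun \<Omega> s" and b: "b \<in> \<Omega>"
  shows "strict_deriv \<Omega> s (\<lambda>v. v$1 * dir_deriv E1 s b + v$2 * dir_deriv E2 s b) b"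
proof (rule strict_derivI[OF convex_\<Omega> _ open_\<Omega> b _ _, where C = 1])
  show "isCont (dir_deriv E1 s) b" "isCont (dir_deriv E2 s) b" by (rule isCont_smooth[OF smooth_fun_dir_deriv[OF s] b])+
  show "x \<in> \<Omega> \<Longrightarrow> s differentiable at x" for x by (rule smooth_fun_differentiable[OF s])
  show "x \<in> \<Omega> \<inter> \<Omega> \<Longrightarrow> dir_deriv v s x = v$1 * dir_deriv E1 s x + v$2 * dir_deriv E2 s x" for x v
    by (rule dir_deriv_vec2[OF smooth_fun_differentiable[OF s]]) simp
  show "\<bar>v$1\<bar> \<le> 1 * norm v" "\<bar>v$2\<bar> \<le> 1 * norm v" for v :: "real^2"
    using component_le_norm_cart[of v] by simp_all
qed simp

text \<open>The Hessian of a solution is trace-free with respect to a positive definite form, hence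
  nondegenerate unless it vanishes.\<close>

lemma isolated_critical_point:
  assumes s: "smooth_fun \<Omega> s" and L: "Lop s x = 0" and x: "x \<in> \<Omega>"
    and nz: "\<not> (\<forall>v w. dir_deriv v (dir_deriv w s) x = 0)"
    and z: "dir_deriv E1 s x = 0" "dir_deriv E2 s x = 0"
  shows "\<exists>U. open U \<and> {y\<in>\<Omega>. dir_deriv E1 s y = 0 \<and> dir_deriv E2 s y = 0} \<inter> U = {x}"
proof -
  define r11 r12 r22 where "r11 = dir_deriv E1 (dir_deriv E1 s) x" and "r12 = dir_deriv E1 (dir_deriv E2 s) x" and "r22 = dir_deriv E2 (dir_deriv E2 s) x"
  have r21: "dir_deriv E2 (dir_deriv E1 s) x = r12" unfolding r12_def by (rule dir_deriv_commute[OF open_\<Omega> s x])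
  have L0: "hs E2 E2 x * r11 - 2 * hs E1 E2 x * r12 + hs E1 E1 x * r22 = 0"
    using L by (simp add: Lop_def r11_def r12_def r22_def)
  have n: "\<not> (r11 = 0 \<and> r12 = 0 \<and> r22 = 0)"
  proof
    assume "r11 = 0 \<and> r12 = 0 \<and> r22 = 0"
    then have "dir_deriv v (dir_deriv w s) x = 0" for v w
      using second_expand[OF open_\<Omega> s x, of v w] unfolding r11_def[symmetric] r12_def[symmetric] r22_def[symmetric] by simp
    then show False using nz by blast
  qed
  have "r11 * r22 - r12 * r12 \<noteq> 0"
  proof
    assume 0: "r11 * r22 - r12 * r12 = 0"
    define h11 h12 h22 where "h11 = hs E1 E1 x" and "h12 = hs E1 E2 x" and "h22 = hs E2 E2 x"
    have p: "h11 > 0" "h11 * h22 - h12 * h12 > 0" using hs11_pos[OF x] hdet_pos[OF x] by (simp_all add: h11_def h12_def h22_def hdet_def)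
    have L1: "h22 * r11 + h11 * r22 = 2 * h12 * r12" using L0 by (simp add: h11_def h12_def h22_def)
    \<comment> \<open>The equation reduces this sum of nonnegative terms to
      \<open>- h11 * h22\<close> times the Hessian determinant. So if the determinant vanishes, all
      second derivatives do.\<close>
    have "(h11 * r22 - h12 * r12)\<^sup>2 + (h11 * h22 - h12 * h12) * r12\<^sup>2
        = h11 * r22 * (h11 * r22 + h22 * r11 - 2 * h12 * r12) - h11 * h22 * (r11 * r22 - r12 * r12)"
      by (simp add: power2_eq_square algebra_simps)
    also have "\<dots> = 0" using L1 0 by simp
    finally have e: "(h11 * r22 - h12 * r12)\<^sup>2 + (h11 * h22 - h12 * h12) * r12\<^sup>2 = 0" .
    have nn: "(h11 * h22 - h12 * h12) * r12\<^sup>2 \<ge> 0" using p by simp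
    have "(h11 * h22 - h12 * h12) * r12\<^sup>2 = 0" using e nn zero_le_power2[of "h11 * r22 - h12 * r12"] by linarith
    then have r12: "r12 = 0" using p by simp
    then have "r22 = 0" using e p by simp
    then have "h22 * r11 = 0" using L1 r12 by simp
    moreover have "h22 \<noteq> 0" using p by (auto simp: zero_less_mult_iff)
    ultimately show False using n r12 \<open>r22 = 0\<close> by simp
  qed
  then obtain \<delta> where \<delta>: "\<delta> > 0" "\<And>y y'. y \<in> \<Omega> \<inter> ball x \<delta> \<Longrightarrow> y' \<in> \<Omega> \<inter> ball x \<delta> \<Longrightarrow>
      dir_deriv E1 s y = dir_deriv E1 s y' \<Longrightarrow> dir_deriv E2 s y = dir_deriv E2 s y' \<Longrightarrow> y = y'"
    using strict_pair_injective[OF smooth_strict_deriv[OF smooth_fun_dir_deriv[OF s] x] smooth_strict_deriv[OF smooth_fun_dir_deriv[OF s] x], of E1 E2]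
    unfolding r21 r11_def[symmetric] r12_def[symmetric] r22_def[symmetric] by blast
  have "{y\<in>\<Omega>. dir_deriv E1 s y = 0 \<and> dir_deriv E2 s y = 0} \<inter> ball x \<delta> = {x}"
    using \<delta> x z by auto
  then show ?thesis using open_ball by blast
qed

text \<open>A form of Sard's theorem for solutions. Critical points with nonzero Hessian are
  isolated, hence countable in number; the others are covered by
  \<open>negligible_degenerate_values\<close>, for which second-order estimates suffice.\<close>

lemma negligible_critical_values:
  assumes s: "smooth_fun \<Omega> s" and L: "\<And>x. x \<in> \<Omega> \<Longrightarrow> Lop s x = 0"
  shows "negligible (s ` {x\<in>\<Omega>. dir_deriv E1 s x = 0 \<and> dir_deriv E2 s x = 0})"
proof -
  define C where "C = {x\<in>\<Omega>. dir_deriv E1 s x = 0 \<and> dir_deriv E2 s x = 0}"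
  define A where "A = {x\<in>\<Omega>. (\<forall>v. dir_deriv v s x = 0) \<and> (\<forall>v w. dir_deriv v (dir_deriv w s) x = 0)}"
  have z: "dir_deriv v s x = 0" if "x \<in> C" for x v
    using that dir_deriv_vec2[OF smooth_fun_differentiable[OF s], of x v] by (simp add: C_def)
  have "countable (C - A)"
  proof (rule countable_isolated)
    fix x assume x: "x \<in> C - A"
    then have xC: "x \<in> \<Omega>" "dir_deriv E1 s x = 0" "dir_deriv E2 s x = 0" by (simp_all add: C_def)
    have "\<forall>v. dir_deriv v s x = 0" using z x by blast
    moreover have "x \<notin> A" using x by blast
    ultimately have n: "\<not> (\<forall>v w. dir_deriv v (dir_deriv w s) x = 0)" using xC(1) unfolding A_def by blast
    obtain U where "open U" "C \<inter> U = {x}"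
      using isolated_critical_point[OF s L[OF xC(1)] xC(1) n xC(2,3)] unfolding C_def by blast
    then show "\<exists>U. open U \<and> (C - A) \<inter> U = {x}" using x by blast
  qed
  then have "negligible (s ` (C - A))" 
    by (intro negligible_iff_null_sets[THEN iffD2] null_sets_completionI countable_imp_null_set_lborel countable_image)
  moreover have "negligible (s ` A)" unfolding A_def by (rule negligible_degenerate_values[OF open_\<Omega> s])
  ultimately have "negligible (s ` (C - A) \<union> s ` A)" by (rule negligible_Un)
  then show ?thesis unfolding C_def[symmetric] by (rule negligible_subset) blast
qed

end

section \<open>Regular levels are mapped bijectively onto half-circles\<close>

context toric_normalized
begin

text \<open>\<open>R > R0\<close> places the ends of the level on the two unbounded edges;
  \<open>S > 0\<close> makes \<open>(H, q)\<close> a local diffeomorphism along it.\<close>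

definition regular :: "real \<Rightarrow> bool" where
  "regular R \<longleftrightarrow> R > R0 \<and> R > 0 \<and> (\<forall>x\<in>\<Omega>. rh 0 x = R \<longrightarrow> S x > 0)"

text \<open>\<open>Gam (rh 0) (rh 0) = S\<close>, so zeros of \<open>S\<close> are critical points
  of \<open>rh 0\<close>, and critical values are negligible.\<close>

lemma exists_regular: "\<exists>R>N. regular R"
proof -
  define M where "M = max N (max R0 0)"
  define V where "V = rh 0 ` {x\<in>\<Omega>. dir_deriv E1 (rh 0) x = 0 \<and> dir_deriv E2 (rh 0) x = 0}"
  have "negligible V" unfolding V_def by (rule negligible_critical_values[OF smooth_rh Lop_rh])
  moreover have "\<not> negligible {M<..<M+1}" by (rule open_not_negligible) auto
  ultimately obtain R where R: "R \<in> {M<..<M+1}" "R \<notin> V" using negligible_subset by blast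
  have "S x > 0" if x: "x \<in> \<Omega>" "rh 0 x = R" for x
  proof (rule ccontr)
    assume "\<not> S x > 0"
    then have "Gam (rh 0) (rh 0) x = 0" using S_nonneg[OF x(1)] Gam_rh_rh[OF x(1)] by simp
    then have "dir_deriv E1 (rh 0) x = 0" "dir_deriv E2 (rh 0) x = 0" using Gam_eq_0[OF x(1)] by auto
    then show False using R(2) x by (auto simp: V_def)
  qed
  then show ?thesis using R(1) by (intro exI[of _ R]) (auto simp: regular_def M_def)
qed

definition inj_near :: "real^2 \<Rightarrow> bool" where
  "inj_near p \<longleftrightarrow> (\<exists>\<delta>>0. \<forall>y\<in>\<Omega> \<inter> ball p \<delta>. \<forall>y'\<in>\<Omega> \<inter> ball p \<delta>. H y = H y' \<longrightarrow> q y = q y' \<longrightarrow> y = y')"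

lemma injective_near:
  assumes x: "x \<in> \<Omega>" and S: "S x > 0"
  shows "inj_near x"
proof -
  have "dir_deriv E1 H x * dir_deriv E2 q x - dir_deriv E2 H x * dir_deriv E1 q x \<noteq> 0"
    unfolding jacobian_eq[OF x] using S q_pos[OF x] by simp
  from strict_pair_injective[OF smooth_strict_deriv[OF smooth_H x] smooth_strict_deriv[OF smooth_q x] this]
  obtain \<delta> where "\<delta> > 0" "\<And>y y'. y \<in> \<Omega> \<inter> ball x \<delta> \<Longrightarrow> y' \<in> \<Omega> \<inter> ball x \<delta> \<Longrightarrow> H y = H y' \<Longrightarrow> q y = q y' \<Longrightarrow> y = y'"
    by blast
  then show ?thesis unfolding inj_near_def by (intro exI[of _ \<delta>]) simp
qed

text \<open>Local injectivity gives openness by invariance of domain.\<close>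

lemma open_near:
  assumes x: "x \<in> \<Omega>" and S: "S x > 0" and \<epsilon>: "\<epsilon> > 0"
  shows "\<exists>\<delta>>0. \<forall>h k. \<bar>h - H x\<bar> < \<delta> \<and> \<bar>k - q x\<bar> < \<delta> \<longrightarrow> (\<exists>y\<in>\<Omega>. dist x y < \<epsilon> \<and> H y = h \<and> q y = k)"
proof -
  obtain \<delta>0 where \<delta>0: "\<delta>0 > 0" "\<And>y y'. y \<in> \<Omega> \<inter> ball x \<delta>0 \<Longrightarrow> y' \<in> \<Omega> \<inter> ball x \<delta>0 \<Longrightarrow> H y = H y' \<Longrightarrow> q y = q y' \<Longrightarrow> y = y'"
    using injective_near[OF x S] unfolding inj_near_def by blast
  define U where "U = \<Omega> \<inter> ball x (min \<delta>0 \<epsilon>)"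
  define z where "z = (\<lambda>y. H y *\<^sub>R E1 + q y *\<^sub>R E2)"
  have z12: "z y $ 1 = H y" "z y $ 2 = q y" for y by (simp_all add: z_def axis_def)
  have "open (z ` U)"
  proof (rule invariance_of_domain)
    have "continuous_on U H" "continuous_on U q"
      by (rule continuous_on_subset[OF smooth_fun_continuous_on[OF smooth_H]], simp add: U_def)
        (rule continuous_on_subset[OF smooth_fun_continuous_on[OF smooth_q]], simp add: U_def)
    then show "continuous_on U z" unfolding z_def by (intro continuous_intros)
    show "open U" by (simp add: U_def open_\<Omega> open_Int)
    show "inj_on z U"
    proof (rule inj_onI)
      fix y y' assume y: "y \<in> U" "y' \<in> U" "z y = z y'"
      then have "H y = H y'" "q y = q y'" using z12 by metis+
      then show "y = y'" using \<delta>0(2) y by (auto simp: U_def)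
    qed
  qed
  moreover have "z x \<in> z ` U" using x \<delta>0 \<epsilon> by (auto simp: U_def)
  ultimately obtain \<eta> where \<eta>: "\<eta> > 0" "ball (z x) \<eta> \<subseteq> z ` U" using open_contains_ball by blast
  have "\<exists>y\<in>\<Omega>. dist x y < \<epsilon> \<and> H y = h \<and> q y = k" if h: "\<bar>h - H x\<bar> < \<eta> / 2" "\<bar>k - q x\<bar> < \<eta> / 2" for h k
  proof -
    define w where "w = h *\<^sub>R E1 + k *\<^sub>R E2"
    have w12: "w $ 1 = h" "w $ 2 = k" by (simp_all add: w_def axis_def)
    have "norm (w - z x) \<le> \<bar>h - H x\<bar> + \<bar>k - q x\<bar>" using norm_le_l1_cart[of "w - z x"] by (simp add: sum_2 w12 z12)
    then have "w \<in> ball (z x) \<eta>" using h by (simp add: dist_norm norm_minus_commute)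
    then obtain y where y: "y \<in> U" "w = z y" using \<eta> by blast
    then have "H y = h" "q y = k" using w12 z12 by metis+
    then show ?thesis using y(1) by (auto simp: U_def)
  qed
  then show ?thesis using \<eta>(1) by (intro exI[of _ "\<eta> / 2"]) auto
qed

definition br :: "real \<Rightarrow> real^2" where "br R = vx 1 + (R + aa 1) *\<^sub>R ev 1"

lemma frontier_at: assumes b: "b \<in> frontier \<Omega>" "hb b = R" and R: "R > R0" shows "b = br R" "b \<in> eg 1" "ll 2 b > 0"
proof -
  show e: "b \<in> eg 1" using far_right b R by simp
  have i: "1 \<notin> I" using I_range by blast
  have "hb b = - aa 1 + ll 2 b" using hb_left[of 1 b] e i d2 by (simp add: numeral_2_eq_2)
  then have l: "ll 2 b = R + aa 1" using b by simp
  then show "b = br R" using eg_param_left(1)[of 1 b] e d2 by (simp add: br_def numeral_2_eq_2)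
  show "ll 2 b > 0" using l aa_le_R0[of 1] d2 R by simp
qed

text \<open>Up to the boundary, \<open>H\<close> has slope 1 along edge 1, while
  \<open>q = 2 * ll 1 * kap\<close> has slope 0 along it and a nonzero one transversally. The
  Jacobian at \<open>b\<close> is therefore \<open>2 * \<kappa>\<close>.\<close>

lemma injective_near_edge:
  assumes b: "b \<in> eg 1" "ll 2 b > 0"
  shows "inj_near b"
proof -
  have b1: "ll 1 b = 0" using b by (simp add: mem_eg)
  have fr: "b \<in> frontier \<Omega>" using eg_frontier[OF _ b(1)] d2 by simp
  obtain i Act where i: "1 \<le> i" "i < d" and A: "Act \<subseteq> {i, Suc i}" "Act = {j\<in>{1..d}. ll j b = 0}" and bN: "b \<in> Nb i Act"
    by (rule boundary_pair[OF fr]) (rule that)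
  have "1 \<in> Act" using A(2) b1 d2 by simp
  then have i1: "i = 1" using A(1) i by auto
  have n2: "Suc i \<notin> Act" using A(2) b(2) i1 by (simp add: numeral_2_eq_2)
  have iA: "i \<in> Act" using \<open>1 \<in> Act\<close> i1 by simp
  have iI: "i \<notin> I" using I_range i1 by blast
  let ?D1 = "- ev (Suc i)" and ?D2 = "ev i"
  have dn: "den i Act b > 0" using bN by (simp add: Nb_def[OF i A(1)])
  define \<kappa> where "\<kappa> = kap i Act b"
  have \<kappa>: "\<kappa> > 0" using dn by (simp add: \<kappa>_def kap_def[OF i A(1)])
  note fr = frame[OF i A(1)]
  have qq: "qq i Act = (\<lambda>x. 2 * ll i x * kap i Act x)"
    unfolding qq_def[OF i A(1), abs_def] mu_def using iA iI n2 by simp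
  have kd: "kap i Act differentiable (at b)" by (rule smooth_fun_differentiable[OF smooth_kap[OF i A(1)] bN])
  have ld: "(\<lambda>x. 2 * ll i x) differentiable (at b)"
    by (rule smooth_fun_differentiable[of UNIV]) (auto intro!: smooth_intros smooth_ll)
  have ld': "ll i differentiable (at b)" by (rule smooth_fun_differentiable[OF smooth_ll, of b UNIV]) simp
  have dl: "dir_deriv v (\<lambda>x. 2 * ll i x) b = 2 * (v \<bullet> nv i)" for v
    unfolding dir_deriv_cmult[OF ld'] dir_deriv_ll ..
  have dq: "dir_deriv v (qq i Act) b = 2 * (v \<bullet> nv i) * \<kappa>" for v
    unfolding qq dir_deriv_mult[OF ld kd] dl using b1 i1 by (simp add: \<kappa>_def)
  have AHv: "AH i Act b v = det2 v ?D1 * g2 i Act b + det2 ?D2 v * g1 i Act b" for v by (rule AH_def[OF i A(1)])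
  have "AH i Act b (ev i) = 1" using kap_boundary(1)[OF i A(1) bN iA] b1 i1 iI by simp
  then have g2: "g2 i Act b = 1" unfolding AHv fr(1) by (simp add: det2_self)
  define g where "g = g1 i Act b"
  have sH: "strict_deriv \<Omega> H (\<lambda>v. v$1 * (?D1$2 - ?D2$2 * g) + v$2 * (?D2$1 * g - ?D1$1)) b"
  proof -
    have "AH i Act b = (\<lambda>v. v$1 * (?D1$2 - ?D2$2 * g) + v$2 * (?D2$1 * g - ?D1$1))"
      unfolding AHv[abs_def] g2 g_def[symmetric] by (rule ext) (simp add: det2_def algebra_simps)
    then show ?thesis using strict_H[OF i A(1) bN] by simp
  qed
  have sq: "strict_deriv \<Omega> q (\<lambda>v. v$1 * (- ?D2$2 * (2 * \<kappa>)) + v$2 * (?D2$1 * (2 * \<kappa>))) b"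
  proof -
    have "(\<lambda>v. det2 v ?D1 * dir_deriv ?D2 (qq i Act) b + det2 ?D2 v * dir_deriv ?D1 (qq i Act) b)
       = (\<lambda>v. v$1 * (- ?D2$2 * (2 * \<kappa>)) + v$2 * (?D2$1 * (2 * \<kappa>)))"
      unfolding dq fr by (rule ext) (simp add: det2_def algebra_simps)
    then show ?thesis using strict_q[OF i A(1) bN] by simp
  qed
  have "(?D1$2 - ?D2$2 * g) * (?D2$1 * (2 * \<kappa>)) - (?D2$1 * g - ?D1$1) * (- ?D2$2 * (2 * \<kappa>)) = 2 * \<kappa> * det2 ?D2 ?D1"
    by (simp add: det2_def algebra_simps)
  also have "\<dots> \<noteq> 0" unfolding fr(1) using \<kappa> by simp
  finally show ?thesis 
    using strict_pair_injective[OF sH sq] unfolding inj_near_def by (metis (no_types, lifting))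
qed

text \<open>Properness in the form of sequences: a convergent sequence of values of
  \<open>(H, q)\<close> keeps the points inside one of the bounded sets \<open>lowr\<close>. A limit
  on the frontier has \<open>k = 0\<close>, because \<open>q\<close> tends to 0 there.\<close>

lemma fibre_limit:
  assumes x: "\<And>n. x n \<in> \<Omega>" and Hl: "(\<lambda>n. H (x n)) \<longlonglongrightarrow> h" and ql: "(\<lambda>n. q (x n)) \<longlonglongrightarrow> k"
  obtains r p where "strict_mono (r :: nat \<Rightarrow> nat)" "(x \<circ> r) \<longlonglongrightarrow> p"
    "(p \<in> \<Omega> \<and> H p = h \<and> q p = k) \<or>
     (p \<in> frontier \<Omega> \<and> hb p = h \<and> k = 0 \<and> filterlim (x \<circ> r) (at p within \<Omega>) sequentially)"
proof -
  have "(\<lambda>n. rh 0 (x n)) \<longlonglongrightarrow> sqrt (h * h + k)"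
    unfolding rh_def rho2_def add_0_right by (intro tendsto_intros Hl ql)
  then have "Bseq (\<lambda>n. rh 0 (x n))" by (rule convergent_imp_Bseq[OF convergentI])
  then obtain B where B: "\<And>n. \<bar>rh 0 (x n)\<bar> \<le> B" unfolding Bseq_def by auto
  have "x n \<in> lowr (B + 1)" for n using B[of n] x by (simp add: lowr_def)
  then have bx: "bounded (range x)" by (intro bounded_subset[OF bounded_lowr[of "B + 1"]] image_subsetI)
  obtain p r where r: "strict_mono (r :: nat \<Rightarrow> nat)" "(x \<circ> r) \<longlonglongrightarrow> p"
    using bounded_imp_convergent_subsequence[OF bx] by blast
  have Hr: "(\<lambda>n. H ((x \<circ> r) n)) \<longlonglongrightarrow> h" "(\<lambda>n. q ((x \<circ> r) n)) \<longlonglongrightarrow> k"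
    using LIMSEQ_subseq_LIMSEQ[OF Hl r(1)] LIMSEQ_subseq_LIMSEQ[OF ql r(1)] by (simp_all add: comp_def)
  have "p \<in> closure \<Omega>" unfolding closure_sequential using r(2) x by (intro exI[of _ "x \<circ> r"]) auto
  then consider "p \<in> \<Omega>" | "p \<in> frontier \<Omega>" by (auto simp: frontier_def interior_open open_\<Omega>)
  then show ?thesis
  proof cases
    case 1
    have "(\<lambda>n. H ((x \<circ> r) n)) \<longlonglongrightarrow> H p" "(\<lambda>n. q ((x \<circ> r) n)) \<longlonglongrightarrow> q p"
      using isCont_tendsto_compose[OF isCont_smooth[OF smooth_H 1] r(2)] isCont_tendsto_compose[OF isCont_smooth[OF smooth_q 1] r(2)] by simp_all
    then have "H p = h" "q p = k" using Hr LIMSEQ_unique by blast+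
    then show ?thesis using that[OF r] 1 by blast
  next
    case 2
    have f: "filterlim (x \<circ> r) (at p within \<Omega>) sequentially"
      unfolding filterlim_at
    proof
      have "x (r n) \<noteq> p" for n using x[of "r n"] frontier_notin[OF 2] by metis
      then show "\<forall>\<^sub>F n in sequentially. (x \<circ> r) n \<in> \<Omega> \<and> (x \<circ> r) n \<noteq> p" using x by (intro always_eventually) simp
    qed (rule r(2))
    have "hb p = h" "k = 0"
      using filterlim_compose[OF H_lim[OF 2] f] filterlim_compose[OF q_lim[OF 2] f] Hr LIMSEQ_unique by blast+
    then show ?thesis using that[OF r] 2 f by simp
  qed
qed

lemma fibre_limit_pair:
  assumes a: "\<And>n. a n \<in> \<Omega>" "\<And>n. a' n \<in> \<Omega>" "\<And>n. H (a n) = H (a' n)" "\<And>n. q (a n) = q (a' n)" "\<And>n. a n \<noteq> a' n"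
    and Hl: "(\<lambda>n. H (a n)) \<longlonglongrightarrow> h" and ql: "(\<lambda>n. q (a n)) \<longlonglongrightarrow> k"
  obtains p p' where "(p \<in> \<Omega> \<and> H p = h \<and> q p = k) \<or> (p \<in> frontier \<Omega> \<and> hb p = h \<and> k = 0)"
    "(p' \<in> \<Omega> \<and> H p' = h \<and> q p' = k) \<or> (p' \<in> frontier \<Omega> \<and> hb p' = h \<and> k = 0)"
    "p = p' \<Longrightarrow> \<not> inj_near p"
proof -
  obtain r p where r: "strict_mono (r :: nat \<Rightarrow> nat)" "(a \<circ> r) \<longlonglongrightarrow> p"
    and p: "(p \<in> \<Omega> \<and> H p = h \<and> q p = k) \<or> (p \<in> frontier \<Omega> \<and> hb p = h \<and> k = 0)"
    by (rule fibre_limit[OF a(1) Hl ql]) (use that in blast)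
  have l: "(\<lambda>n. H ((a' \<circ> r) n)) \<longlonglongrightarrow> h" "(\<lambda>n. q ((a' \<circ> r) n)) \<longlonglongrightarrow> k"
    using LIMSEQ_subseq_LIMSEQ[OF Hl r(1)] LIMSEQ_subseq_LIMSEQ[OF ql r(1)] by (simp_all add: comp_def a(3,4))
  obtain r' p' where r': "strict_mono (r' :: nat \<Rightarrow> nat)" "((a' \<circ> r) \<circ> r') \<longlonglongrightarrow> p'"
    and p': "(p' \<in> \<Omega> \<and> H p' = h \<and> q p' = k) \<or> (p' \<in> frontier \<Omega> \<and> hb p' = h \<and> k = 0)"
    by (rule fibre_limit[OF _ l]) (use a(2) that in \<open>simp, blast\<close>)
  have "\<not> inj_near p" if pp: "p = p'"
  proof
    assume "inj_near p"
    then obtain \<delta> where \<delta>: "\<delta> > 0" "\<And>y y'. y \<in> \<Omega> \<inter> ball p \<delta> \<Longrightarrow> y' \<in> \<Omega> \<inter> ball p \<delta> \<Longrightarrow> H y = H y' \<Longrightarrow> q y = q y' \<Longrightarrow> y = y'"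
      unfolding inj_near_def by blast
    have "((a \<circ> r) \<circ> r') \<longlonglongrightarrow> p" by (rule LIMSEQ_subseq_LIMSEQ[OF r(2) r'(1)])
    then have "\<forall>\<^sub>F n in sequentially. dist (((a \<circ> r) \<circ> r') n) p < \<delta>" "\<forall>\<^sub>F n in sequentially. dist (((a' \<circ> r) \<circ> r') n) p < \<delta>"
      using tendstoD[OF _ \<delta>(1)] r'(2)[folded pp] by blast+
    then have "\<forall>\<^sub>F n in sequentially. False"
    proof eventually_elim
      case (elim n)
      have "a (r (r' n)) = a' (r (r' n))" using a(1-4) elim by (intro \<delta>(2)) (auto simp: dist_commute)
      then show ?case using a(5) by blast
    qed
    then show False by simp
  qed
  then show ?thesis using that[OF p p'] by blast
qed

lemma abs_less_sq: "\<bar>h\<bar> < R \<Longrightarrow> (h::real)\<^sup>2 < R\<^sup>2"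
  using power_strict_mono[of "\<bar>h\<bar>" R 2] by simp

lemma rh_eq_iff: assumes x: "x \<in> \<Omega>" and R: "R > 0" shows "rh 0 x = R \<longleftrightarrow> q x = R\<^sup>2 - (H x)\<^sup>2"
proof -
  have "rh 0 x = R \<longleftrightarrow> (rh 0 x)\<^sup>2 = R\<^sup>2" using rh_pos[OF x, of 0] R by (simp add: power2_eq_iff_nonneg)
  then show ?thesis using rh_sq[OF x, of 0] by auto
qed

definition on_arc :: "real \<Rightarrow> real \<Rightarrow> real^2 \<Rightarrow> bool" where
  "on_arc R h p \<longleftrightarrow> p \<in> \<Omega> \<and> H p = h \<and> q p = R\<^sup>2 - h\<^sup>2"

lemma arc_iff: "R > 0 \<Longrightarrow> on_arc R h x \<longleftrightarrow> x \<in> \<Omega> \<and> rh 0 x = R \<and> H x = h"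
  using rh_eq_iff by (auto simp: on_arc_def)

lemma arc_less: "R > 0 \<Longrightarrow> on_arc R h x \<Longrightarrow> \<bar>h\<bar> < R"
  using abs_Hc_less[of x 0] by (auto simp: arc_iff)

lemma arc_open:
  assumes R: "regular R" and p: "on_arc R h p" and \<epsilon>: "\<epsilon> > 0"
  shows "\<exists>\<delta>>0. \<forall>h'. \<bar>h' - h\<bar> < \<delta> \<longrightarrow> (\<exists>y. dist p y < \<epsilon> \<and> on_arc R h' y)"
proof -
  have pO: "p \<in> \<Omega>" "H p = h" "q p = R\<^sup>2 - h\<^sup>2" using p by (auto simp: on_arc_def)
  have "S p > 0" using R p arc_iff[of R h p] by (auto simp: regular_def)
  then obtain \<delta> where \<delta>: "\<delta> > 0" "\<And>h' k. \<bar>h' - h\<bar> < \<delta> \<Longrightarrow> \<bar>k - (R\<^sup>2 - h\<^sup>2)\<bar> < \<delta> \<Longrightarrow> \<exists>y\<in>\<Omega>. dist p y < \<epsilon> \<and> H y = h' \<and> q y = k"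
    using open_near[OF pO(1) _ \<epsilon>] unfolding pO by blast
  have "isCont (\<lambda>h'. R\<^sup>2 - h'\<^sup>2) h" by (intro continuous_intros)
  then obtain \<delta>' where \<delta>': "\<delta>' > 0" "\<And>h'. dist h' h < \<delta>' \<Longrightarrow> dist (R\<^sup>2 - h'\<^sup>2) (R\<^sup>2 - h\<^sup>2) < \<delta>"
    using \<delta>(1) unfolding continuous_at_eps_delta by metis
  have "\<exists>y. dist p y < \<epsilon> \<and> on_arc R h' y" if h': "\<bar>h' - h\<bar> < min \<delta> \<delta>'" for h'
  proof -
    have "\<bar>(R\<^sup>2 - h'\<^sup>2) - (R\<^sup>2 - h\<^sup>2)\<bar> < \<delta>" using \<delta>'(2)[of h'] h' by (simp add: dist_real_def)
    then show ?thesis using \<delta>(2)[of h' "R\<^sup>2 - h'\<^sup>2"] h' unfolding on_arc_def by auto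
  qed
  then show ?thesis using \<delta>(1) \<delta>'(1) by (intro exI[of _ "min \<delta> \<delta>'"]) simp
qed

text \<open>The set of \<open>h\<close> with at least two points on the arc over \<open>h\<close> is open and closed in the interval
  from \<open>- R\<close> to \<open>R\<close>, and \<open>(H, q)\<close> is injective near the end of the arc on the first edge.\<close>

lemma arc_injective:
  assumes R: "regular R" and x: "on_arc R h0 x" and y: "on_arc R h0 y"
  shows "x = y"
proof (rule ccontr)
  assume ne: "x \<noteq> y"
  have R0: "R > R0" "R > 0" using R by (auto simp: regular_def)
  define T where "T = {h. \<bar>h\<bar> < R \<and> (\<exists>p p'. p \<noteq> p' \<and> on_arc R h p \<and> on_arc R h p')}"
  have pair: "\<exists>p p'. ((p \<in> \<Omega> \<and> H p = l \<and> q p = R\<^sup>2 - l\<^sup>2) \<or> (p \<in> frontier \<Omega> \<and> hb p = l \<and> R\<^sup>2 - l\<^sup>2 = 0)) \<and>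
      ((p' \<in> \<Omega> \<and> H p' = l \<and> q p' = R\<^sup>2 - l\<^sup>2) \<or> (p' \<in> frontier \<Omega> \<and> hb p' = l \<and> R\<^sup>2 - l\<^sup>2 = 0)) \<and> (p = p' \<longrightarrow> \<not> inj_near p)"
    if f: "\<And>n. f n \<in> T" "f \<longlonglongrightarrow> l" for f l
  proof -
    have "\<forall>n. \<exists>p p'. p \<noteq> p' \<and> on_arc R (f n) p \<and> on_arc R (f n) p'" using f(1) by (simp add: T_def)
    then obtain a a' where a: "\<And>n. a n \<noteq> a' n" "\<And>n. on_arc R (f n) (a n)" "\<And>n. on_arc R (f n) (a' n)" by metis
    note a' = a(2)[unfolded on_arc_def] a(3)[unfolded on_arc_def]
    have l: "(\<lambda>n. H (a n)) \<longlonglongrightarrow> l" "(\<lambda>n. q (a n)) \<longlonglongrightarrow> R\<^sup>2 - l\<^sup>2" using f(2) a' by (auto intro!: tendsto_intros)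
    show ?thesis by (rule fibre_limit_pair[of a a', OF _ _ _ _ a(1) l]) (use a' in auto)
  qed
  have "T = {} \<or> T = {-R<..<R}"
  proof (rule interval_clopen)
    show "T \<subseteq> {-R<..<R}" by (auto simp: T_def abs_less_iff)
  next
    fix h assume "h \<in> T"
    then obtain p p' where p: "p \<noteq> p'" "on_arc R h p" "on_arc R h p'" by (auto simp: T_def)
    define \<epsilon> where "\<epsilon> = dist p p' / 2"
    have \<epsilon>: "\<epsilon> > 0" using p by (simp add: \<epsilon>_def)
    obtain \<delta> where \<delta>: "\<delta> > 0" "\<And>h'. \<bar>h' - h\<bar> < \<delta> \<Longrightarrow> \<exists>y. dist p y < \<epsilon> \<and> on_arc R h' y" using arc_open[OF R p(2) \<epsilon>] by blast
    obtain \<delta>' where \<delta>': "\<delta>' > 0" "\<And>h'. \<bar>h' - h\<bar> < \<delta>' \<Longrightarrow> \<exists>y. dist p' y < \<epsilon> \<and> on_arc R h' y" using arc_open[OF R p(3) \<epsilon>] by blast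
    have "h' \<in> T" if h': "\<bar>h' - h\<bar> < min \<delta> \<delta>'" "\<bar>h'\<bar> < R" for h'
    proof -
      obtain y y' where y: "dist p y < \<epsilon>" "on_arc R h' y" "dist p' y' < \<epsilon>" "on_arc R h' y'"
        using \<delta>(2)[of h'] \<delta>'(2)[of h'] h' by auto
      have "y \<noteq> y'"
      proof
        assume "y = y'"
        then have "dist p p' < \<epsilon> + \<epsilon>" using dist_triangle2[of p p' y] y(1,3) by simp
        then show False by (simp add: \<epsilon>_def)
      qed
      then show ?thesis using y(2,4) h'(2) by (auto simp: T_def)
    qed
    then show "\<exists>\<epsilon>>0. \<forall>h'. \<bar>h' - h\<bar> < \<epsilon> \<and> \<bar>h'\<bar> < R \<longrightarrow> h' \<in> T"
      using \<delta>(1) \<delta>'(1) by (intro exI[of _ "min \<delta> \<delta>'"]) simp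
  next
    fix f l assume f: "\<And>n. f n \<in> T" "f \<longlonglongrightarrow> l" and l: "\<bar>l\<bar> < R"
    have lR: "R\<^sup>2 - l\<^sup>2 \<noteq> 0" using abs_less_sq[OF l] by simp
    obtain p p' where p: "on_arc R l p" "on_arc R l p'" "p = p' \<longrightarrow> \<not> inj_near p" using pair[OF f] lR unfolding on_arc_def by blast
    have "S p > 0" using R p(1) arc_iff[of R l p] by (auto simp: regular_def)
    then have "inj_near p" using injective_near p(1) by (simp add: on_arc_def)
    then have "p \<noteq> p'" using p(3) by blast
    then show "l \<in> T" using p(1,2) l unfolding T_def by blast
  qed
  moreover have "h0 \<in> T" using x y ne arc_less[OF R0(2) x] by (auto simp: T_def)
  ultimately have Te: "T = {-R<..<R}" by blast
  \<comment> \<open>As \<open>f n\<close> tends to \<open>R\<close>, the two distinct points over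
    \<open>f n\<close> both converge to the only boundary point with \<open>hb = R\<close>, near
    which \<open>(H, q)\<close> is injective.\<close>
  define f where "f n = R - R / real (Suc n)" for n
  have f: "f n \<in> T" for n
  proof -
    have "R / real (Suc n) > 0" "R / real (Suc n) \<le> R" using R0 by (simp_all add: field_simps)
    then show ?thesis using R0 unfolding Te f_def by auto
  qed
  have "(\<lambda>n. R - R / real (Suc n)) \<longlonglongrightarrow> R - 0"
    by (intro tendsto_intros LIMSEQ_Suc[OF lim_const_over_n])
  then have fl: "f \<longlonglongrightarrow> R" by (simp add: f_def[abs_def])
  have qz: "\<not> (p \<in> \<Omega> \<and> H p = R \<and> q p = R\<^sup>2 - R\<^sup>2)" for p using q_pos[of p] by auto
  obtain p p' where p: "p \<in> frontier \<Omega>" "hb p = R" "p' \<in> frontier \<Omega>" "hb p' = R" "p = p' \<longrightarrow> \<not> inj_near p"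
    using pair[OF f fl] qz by blast
  have "p = p'" using frontier_at(1)[OF p(1,2) R0(1)] frontier_at(1)[OF p(3,4) R0(1)] by simp
  then show False using p(5) injective_near_edge[OF frontier_at(2,3)[OF p(1,2) R0(1)]] by blast
qed

text \<open>The set of attained \<open>h\<close> is open by regularity and closed by properness. It
  is nonempty because \<open>rh 0\<close> takes small values near the first vertex and arbitrarily
  large ones where \<open>q\<close> is large.\<close>

lemma arc_surjective:
  assumes R: "regular R" and h: "\<bar>h\<bar> < R"
  shows "\<exists>x. on_arc R h x"
proof -
  have R0: "R > R0" "R > 0" using R by (auto simp: regular_def)
  define T where "T = {h. \<bar>h\<bar> < R \<and> (\<exists>p. on_arc R h p)}"
  have "T = {} \<or> T = {-R<..<R}"
  proof (rule interval_clopen)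
    show "T \<subseteq> {-R<..<R}" by (auto simp: T_def abs_less_iff)
    show "\<exists>\<epsilon>>0. \<forall>h'. \<bar>h' - h\<bar> < \<epsilon> \<and> \<bar>h'\<bar> < R \<longrightarrow> h' \<in> T" if "h \<in> T" for h
      using that arc_open[OF R _ zero_less_one] unfolding T_def by blast
  next
    fix f l assume f: "\<And>n. f n \<in> T" "f \<longlonglongrightarrow> l" and l: "\<bar>l\<bar> < R"
    have "\<forall>n. \<exists>p. on_arc R (f n) p" using f(1) by (simp add: T_def)
    then obtain a where "\<And>n. on_arc R (f n) (a n)" by metis
    then have a: "\<And>n. a n \<in> \<Omega>" "\<And>n. H (a n) = f n" "\<And>n. q (a n) = R\<^sup>2 - (f n)\<^sup>2" by (auto simp: on_arc_def)
    have L: "(\<lambda>n. H (a n)) \<longlonglongrightarrow> l" "(\<lambda>n. q (a n)) \<longlonglongrightarrow> R\<^sup>2 - l\<^sup>2" unfolding a by (intro tendsto_intros f(2))+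
    have lR: "R\<^sup>2 - l\<^sup>2 \<noteq> 0" using abs_less_sq[OF l] by simp
    obtain p where "on_arc R l p" by (rule fibre_limit[OF a(1) L]) (use that lR in \<open>auto simp: on_arc_def\<close>)
    then show "l \<in> T" using l by (auto simp: T_def)
  qed
  moreover have "T \<noteq> {}"
  proof -
    have v: "vx 1 \<in> frontier \<Omega>" using vx_in_P[of 1] ll_vx(1)[of 1] d2 unfolding mem_frontier by force
    have "\<bar>hb (vx 1)\<bar> < R" using hb_vx[of 1] aa_le_R0[of 1] d2 R0 by simp
    then have "\<forall>\<^sub>F x in at (vx 1) within \<Omega>. x \<in> lowr R" by (rule rh_near_less[OF v])
    then obtain x1 where x1: "x1 \<in> lowr R" by (blast dest: eventually_happens'[OF at_frontier_nontrivial[OF v]])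
    obtain x2 where x2: "x2 \<in> \<Omega>" "q x2 > R\<^sup>2" using q_unbounded by blast
    have "(rh 0 x2)\<^sup>2 \<ge> R\<^sup>2" using rh_sq[OF x2(1), of 0] x2(2) zero_le_power2[of "H x2 + 0"] by linarith
    then have "rh 0 x2 \<ge> R" by (rule power2_le_imp_le) (use rh_pos[OF x2(1), of 0] in simp)
    moreover have "connected (rh 0 ` \<Omega>)"
      by (intro connected_continuous_image smooth_fun_continuous_on[OF smooth_rh] convex_connected convex_\<Omega>)
    ultimately have "R \<in> rh 0 ` \<Omega>"
      using connectedD_interval[of "rh 0 ` \<Omega>" "rh 0 x1" "rh 0 x2" R] x1 x2 by (auto simp: lowr_def)
    then obtain x where "on_arc R (H x) x" using arc_iff[OF R0(2)] by auto
    then show ?thesis using arc_less[OF R0(2)] unfolding T_def by blast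
  qed
  ultimately show ?thesis using h by (auto simp: T_def abs_less_iff)
qed

text \<open>By bijectivity, \<open>Y\<close> on the level is a function of \<open>cs 0\<close>. Its
  continuity follows from properness, at the ends together with the boundary values of
  \<open>Y\<close>.\<close>

lemma level_profile:
  assumes R: "regular R" and Y: "continuous_on \<Omega> Y"
    and lim: "\<And>b. b \<in> frontier \<Omega> \<Longrightarrow> b \<notin> cusps \<Longrightarrow> (Y \<longlongrightarrow> 0) (at b within \<Omega>)"
  obtains g where "continuous_on {-1..1} g" "g (-1) = 0" "g 1 = (0::real)"
    "\<And>x. x \<in> \<Omega> \<Longrightarrow> rh 0 x = R \<Longrightarrow> Y x = g (cs 0 x)"
proof -
  have R0: "R > R0" "R > 0" using R by (auto simp: regular_def)
  define e where "e h = (SOME x. on_arc R h x)" for h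
  have e: "on_arc R h (e h)" if "\<bar>h\<bar> < R" for h
    using someI_ex[OF arc_surjective[OF R that]] unfolding e_def .
  have eu: "x = e (H x)" if "x \<in> \<Omega>" "rh 0 x = R" for x
  proof -
    have x: "on_arc R (H x) x" using that arc_iff[OF R0(2)] by simp
    show ?thesis by (rule arc_injective[OF R x e[OF arc_less[OF R0(2) x]]])
  qed
  define g where "g s = (if \<bar>s\<bar> < 1 then Y (e (R * s)) else 0)" for s
  have Rs: "\<bar>R * s\<bar> < R" if "\<bar>s\<bar> < 1" for s using that R0 by (simp add: abs_mult)
  have "continuous_on {-1..1} g" unfolding continuous_on_iff
  proof (intro ballI allI impI)
    fix s \<epsilon> :: real assume s: "s \<in> {-1..1}" and \<epsilon>: "\<epsilon> > 0"
    show "\<exists>\<delta>>0. \<forall>s'\<in>{-1..1}. dist s' s < \<delta> \<longrightarrow> dist (g s') (g s) < \<epsilon>"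
    proof (rule ccontr)
      assume no: "\<not> ?thesis"
      define \<eta> where "\<eta> = (if \<bar>s\<bar> < 1 then 1 - \<bar>s\<bar> else 1)"
      have \<eta>: "\<eta> > 0" by (simp add: \<eta>_def)
      have "\<exists>s'\<in>{-1..1}. dist s' s < min \<eta> (1 / real (Suc n)) \<and> dist (g s') (g s) \<ge> \<epsilon>" for n
      proof -
        have "min \<eta> (1 / real (Suc n)) > 0" using \<eta> by simp
        then show ?thesis using no by (meson not_less)
      qed
      then obtain t where t: "\<And>n. t n \<in> {-1..1}" "\<And>n. dist (t n) s < min \<eta> (1 / real (Suc n))" "\<And>n. dist (g (t n)) (g s) \<ge> \<epsilon>" by metis
      have tl: "t \<longlonglongrightarrow> s"
      proof (rule metric_LIMSEQ_I)
        fix r :: real assume "r > 0"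
        then obtain N where N: "1 / real (Suc N) < r" using nat_approx_posE by blast
        have "dist (t n) s < r" if "n \<ge> N" for n
        proof -
          have "1 / real (Suc n) \<le> 1 / real (Suc N)" using that by (intro divide_left_mono) auto
          then show ?thesis using t(2)[of n] N by simp
        qed
        then show "\<exists>N. \<forall>n\<ge>N. dist (t n) s < r" by blast
      qed
      have t1: "\<bar>t n\<bar> < 1" for n
      proof (cases "\<bar>s\<bar> < 1")
        case True
        then have "\<bar>t n - s\<bar> < 1 - \<bar>s\<bar>" using t(2)[of n] by (simp add: \<eta>_def dist_real_def)
        then show ?thesis by linarith
      next
        case False
        show ?thesis
        proof (rule ccontr)
          assume "\<not> \<bar>t n\<bar> < 1"
          then show False using False t(3)[of n] \<epsilon> by (simp add: g_def)
        qed
      qed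
      define x where "x n = e (R * t n)" for n
      have "on_arc R (R * t n) (x n)" for n using e[OF Rs[OF t1]] by (simp add: x_def)
      then have x: "x n \<in> \<Omega>" "H (x n) = R * t n" "q (x n) = R\<^sup>2 - (R * t n)\<^sup>2" for n by (simp_all add: on_arc_def)
      have gt: "g (t n) = Y (x n)" for n using t1 by (simp add: g_def x_def)
      have l: "(\<lambda>n. H (x n)) \<longlonglongrightarrow> R * s" "(\<lambda>n. q (x n)) \<longlonglongrightarrow> R\<^sup>2 - (R * s)\<^sup>2" unfolding x by (intro tendsto_intros tl)+
      obtain r p where r: "strict_mono (r :: nat \<Rightarrow> nat)" "(x \<circ> r) \<longlonglongrightarrow> p" and p:
        "(p \<in> \<Omega> \<and> H p = R * s \<and> q p = R\<^sup>2 - (R * s)\<^sup>2) \<or> (p \<in> frontier \<Omega> \<and> hb p = R * s \<and> R\<^sup>2 - (R * s)\<^sup>2 = 0 \<and> filterlim (x \<circ> r) (at p within \<Omega>) sequentially)"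
        by (rule fibre_limit[OF x(1) l]) (rule that)
      have "(\<lambda>n. Y ((x \<circ> r) n)) \<longlonglongrightarrow> g s"
      proof (cases "\<bar>s\<bar> < 1")
        case True
        have "(R * s)\<^sup>2 < R\<^sup>2" by (rule abs_less_sq[OF Rs[OF True]])
        then have p1: "p \<in> \<Omega>" "H p = R * s" "q p = R\<^sup>2 - (R * s)\<^sup>2" using p by auto
        then have "rh 0 p = R" using rh_eq_iff[OF p1(1) R0(2)] by simp
        then have "p = e (R * s)" using eu[OF p1(1)] p1(2) by simp
        then have "g s = Y p" using True by (simp add: g_def)
        moreover have "(\<lambda>n. Y ((x \<circ> r) n)) \<longlonglongrightarrow> Y p"
          by (rule continuous_on_tendsto_compose[OF Y r(2) p1(1)]) (simp add: x(1))
        ultimately show ?thesis by simp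
      next
        case False
        then have s1: "\<bar>s\<bar> = 1" using s by auto
        then have "(R * s)\<^sup>2 = R\<^sup>2" by (simp add: power_mult_distrib abs_square_eq_1)
        then have p1: "p \<in> frontier \<Omega>" "hb p = R * s" "filterlim (x \<circ> r) (at p within \<Omega>) sequentially"
          using p q_pos[of p] by auto
        \<comment> \<open>The ends of a regular level lie beyond \<open>R0\<close>, whereas on edges
          in \<open>I\<close> the value of \<open>hb\<close> is at most \<open>R0\<close> in
          absolute value; so the boundary condition is available at the ends.\<close>
        have "\<bar>hb p\<bar> = R" using p1(2) s1 R0 by (simp add: abs_mult)
        moreover have "\<bar>hb p\<bar> \<le> R0" if pc: "p \<in> cusps"
        proof -
          obtain k where k: "k \<in> I" "p \<in> eg k" using pc by (auto simp: cusps_def)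
          then show ?thesis using hb_cusp[OF k] aa_le_R0[of k] I_range[OF k(1)] by simp
        qed
        ultimately have "p \<notin> cusps" using R0(1) by force
        then have "(\<lambda>n. Y ((x \<circ> r) n)) \<longlonglongrightarrow> 0" by (rule filterlim_compose[OF lim[OF p1(1)] p1(3)])
        then show ?thesis using False by (simp add: g_def)
      qed
      then have "\<forall>\<^sub>F n in sequentially. dist (Y ((x \<circ> r) n)) (g s) < \<epsilon>" using \<epsilon> by (rule tendstoD)
      then obtain n where "dist (Y (x (r n))) (g s) < \<epsilon>" using eventually_happens by fastforce
      then show False using t(3)[of "r n"] gt[of "r n"] by simp
    qed
  qed
  moreover have "Y x = g (cs 0 x)" if x: "x \<in> \<Omega>" "rh 0 x = R" for x
  proof -
    have "R * cs 0 x = H x" using x(2) R0 by (simp add: cs_def)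
    then show ?thesis using eu[OF x] abs_cs_less[OF x(1), of 0] by (simp add: g_def)
  qed
  ultimately show ?thesis using that[of g] by (simp add: g_def)
qed

end

section \<open>A Liouville theorem\<close>

text \<open>Coefficients of the polynomial solution of degree \<open>k\<close> of
  \<open>((1 - s\<^sup>2) T)'' = - (k + 1) (k + 2) T\<close>.\<close>

fun gcoeff :: "nat \<Rightarrow> nat \<Rightarrow> real" where
  "gcoeff k 0 = (if even k then 1 else 0)"
| "gcoeff k (Suc 0) = (if odd k then 1 else 0)"
| "gcoeff k (Suc (Suc j)) = (1 - real ((k + 1) * (k + 2)) / real ((j + 1) * (j + 2))) * gcoeff k j"

lemma gcoeff_parity: "even j \<noteq> even k \<Longrightarrow> gcoeff k j = 0"
  by (induction k j rule: gcoeff.induct) auto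

lemma gcoeff_nz: "even j = even k \<Longrightarrow> j \<le> k \<Longrightarrow> gcoeff k j \<noteq> 0"
proof (induction k j rule: gcoeff.induct)
  case (3 k j)
  have "(j + 1) * (j + 2) < (k + 1) * (k + 2)" using 3(3) by (intro mult_strict_mono) auto
  then have "real ((j + 1) * (j + 2)) < real ((k + 1) * (k + 2))" by (simp only: of_nat_less_iff)
  moreover have "real ((j + 1) * (j + 2)) > 0" unfolding of_nat_0_less_iff by simp
  ultimately have "1 - real ((k + 1) * (k + 2)) / real ((j + 1) * (j + 2)) \<noteq> 0" by (simp only: right_minus_eq eq_divide_eq) auto
  then show ?case using 3 by simp
qed auto

lemma gcoeff_gt: "j > k \<Longrightarrow> gcoeff k j = 0"
proof (induction k j rule: gcoeff.induct)
  case (3 k j)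
  consider "even j \<noteq> even k" | "j = k" | "even j = even k" "j > k" | "Suc j = k" using 3(2) by linarith
  then show ?case
  proof cases
    case 2
    have "real ((k + 1) * (k + 2)) > 0" unfolding of_nat_0_less_iff by simp
    then show ?thesis using 2 by (simp only: gcoeff.simps divide_self_if) simp
  qed (use 3 gcoeff_parity[of j k] in auto)
qed auto

definition geg_poly :: "nat \<Rightarrow> real poly" where "geg_poly k = Poly (map (gcoeff k) [0..<Suc k])"

lemma coeff_geg_poly: "coeff (geg_poly k) j = gcoeff k j"
proof (cases "j \<le> k")
  case True
  then show ?thesis unfolding geg_poly_def coeff_Poly_eq by (simp add: nth_default_def del: upt_Suc)
next
  case False
  then show ?thesis unfolding geg_poly_def coeff_Poly_eq by (simp add: nth_default_def gcoeff_gt del: upt_Suc)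
qed

lemma geg_poly_0: "geg_poly 0 = 1"
  by (rule poly_eqI) (auto simp: coeff_geg_poly gcoeff_gt split: nat.split)

definition wpoly :: "real poly" where "wpoly = [:1, 0, -1:]"

lemma poly_wpoly: "poly wpoly s = 1 - s\<^sup>2"
  by (simp add: wpoly_def power2_eq_square)

text \<open>Up to normalisation \<open>geg_poly k\<close> is the Gegenbauer polynomial of index 3/2,
  and \<open>1 - s^2\<close> is its weight. The product is the angular part of the separated
  solution of degree \<open>k + 2\<close>.\<close>

definition gsol :: "nat \<Rightarrow> real poly" where "gsol k = wpoly * geg_poly k"

lemma poly_gsol: "poly (gsol k) s = (1 - s\<^sup>2) * poly (geg_poly k) s"
  by (simp add: gsol_def poly_wpoly)

lemma gsol_ode: "pderiv (pderiv (gsol k)) = smult (- real ((k + 1) * (k + 2))) (geg_poly k)"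
proof (rule poly_eqI)
  fix j
  have e: "gsol k = geg_poly k - pCons 0 (pCons 0 (geg_poly k))"
    by (simp add: gsol_def wpoly_def algebra_simps)
  have c: "coeff (gsol k) (Suc (Suc j)) = gcoeff k (Suc (Suc j)) - gcoeff k j"
    by (simp add: e coeff_geg_poly)
  have "real ((j + 1) * (j + 2)) \<noteq> 0" unfolding of_nat_eq_0_iff by simp
  then have "real ((j + 1) * (j + 2)) * (gcoeff k (Suc (Suc j)) - gcoeff k j) = - real ((k + 1) * (k + 2)) * gcoeff k j"
  proof -
    have "e * ((1 - c / e) * g - g) = - c * g" if "e \<noteq> 0" for e c g :: real using that by (simp add: field_simps)
    then show ?thesis unfolding gcoeff.simps using \<open>real ((j + 1) * (j + 2)) \<noteq> 0\<close> by blast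
  qed
  moreover have "coeff (pderiv (pderiv (gsol k))) j = real ((j + 1) * (j + 2)) * (gcoeff k (Suc (Suc j)) - gcoeff k j)"
    unfolding coeff_pderiv c by (simp add: algebra_simps)
  ultimately show "coeff (pderiv (pderiv (gsol k))) j = coeff (smult (- real ((k + 1) * (k + 2))) (geg_poly k)) j"
    by (simp add: coeff_geg_poly del: of_nat_mult of_nat_add)
qed

lemma geg_poly_expansion: "degree t \<le> N \<Longrightarrow> \<exists>b. t = (\<Sum>k\<le>N. smult (b k) (geg_poly k))"
proof (induction N arbitrary: t)
  case 0
  then obtain a where "t = [:a:]" using degree_eq_zeroE by auto
  then show ?case by (intro exI[of _ "\<lambda>_. a"]) (simp add: geg_poly_0)
next
  case (Suc N)
  define a where "a = coeff t (Suc N) / gcoeff (Suc N) (Suc N)"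
  define t' where "t' = t - smult a (geg_poly (Suc N))"
  have nz: "gcoeff (Suc N) (Suc N) \<noteq> 0" by (rule gcoeff_nz) auto
  have "degree t' \<le> N"
  proof (rule degree_le, intro allI impI)
    fix i assume "i > N"
    then consider "i = Suc N" | "i > Suc N" by linarith
    then show "coeff t' i = 0"
    proof cases
      case 1
      then show ?thesis using nz by (simp add: t'_def a_def coeff_geg_poly del: gcoeff.simps)
    next
      case 2
      then show ?thesis using Suc.prems by (simp add: t'_def coeff_geg_poly gcoeff_gt coeff_eq_0 del: gcoeff.simps)
    qed
  qed
  then obtain b where b: "t' = (\<Sum>k\<le>N. smult (b k) (geg_poly k))" using Suc.IH by blast
  have "t = t' + smult a (geg_poly (Suc N))" by (simp add: t'_def)
  also have "\<dots> = (\<Sum>k\<le>Suc N. smult ((b(Suc N := a)) k) (geg_poly k))" unfolding b by simp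
  finally show ?case by blast
qed

text \<open>No weight appears, because the Gegenbauer weight is already a factor of
  \<open>gsol\<close>.\<close>

definition ip :: "(real \<Rightarrow> real) \<Rightarrow> (real \<Rightarrow> real) \<Rightarrow> real" where
  "ip f g = integral {-1..1} (\<lambda>s. f s * g s)"

lemma continuous_poly [continuous_intros]: "continuous_on A (poly (p :: real poly))"
  by (rule continuous_on_poly) (rule continuous_on_id)

lemma ip_integrable: "continuous_on {-1..1::real} f \<Longrightarrow> continuous_on {-1..1} g \<Longrightarrow> (\<lambda>s. f s * g s :: real) integrable_on {-1..1}"
  by (intro integrable_continuous_real continuous_intros)

lemma ip_add: "continuous_on {-1..1} f \<Longrightarrow> continuous_on {-1..1} f' \<Longrightarrow> continuous_on {-1..1} g \<Longrightarrow>
    ip (\<lambda>s. f s + f' s) g = ip f g + ip f' g"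
  unfolding ip_def by (simp only: distrib_right) (rule integral_add; rule ip_integrable)

lemma ip_cmult: "ip (\<lambda>s. c * f s) g = c * ip f g"
  unfolding ip_def by (simp only: mult.assoc integral_mult_right)

lemma ip_sum: "finite A \<Longrightarrow> (\<And>k. k \<in> A \<Longrightarrow> continuous_on {-1..1} (f k)) \<Longrightarrow> continuous_on {-1..1} g \<Longrightarrow>
    ip (\<lambda>s. \<Sum>k\<in>A. f k s) g = (\<Sum>k\<in>A. ip (f k) g)"
  unfolding ip_def sum_distrib_right by (rule integral_sum) (auto intro: ip_integrable)

lemma ip_bound:
  assumes f: "continuous_on {-1..1} f" and g: "continuous_on {-1..1} g"
    and b: "\<And>s. s \<in> {-1..1} \<Longrightarrow> \<bar>f s\<bar> \<le> a" "\<And>s. s \<in> {-1..1} \<Longrightarrow> \<bar>g s\<bar> \<le> c"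
  shows "\<bar>ip f g\<bar> \<le> 2 * (a * c)"
proof -
  have a0: "a \<ge> 0" using b(1)[of 0] by (simp add: order_trans[OF abs_ge_zero])
  have "norm (ip f g) \<le> integral {-1..1} (\<lambda>s::real. a * c)"
    unfolding ip_def
    by (rule integral_norm_bound_integral[OF ip_integrable[OF f g]]) (auto simp: abs_mult intro!: mult_mono b a0)
  then show ?thesis by simp
qed

text \<open>The Wronskian of \<open>gsol j\<close> and \<open>gsol k\<close> vanishes at both ends,
  and its derivative is a nonzero multiple of \<open>gsol j * geg_poly k\<close>.\<close>

lemma ip_gsol_orthogonal:
  assumes "j \<noteq> k"
  shows "ip (poly (gsol j)) (poly (geg_poly k)) = 0"
proof -
  define w where "w = pderiv (gsol j) * gsol k - gsol j * pderiv (gsol k)"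
  define c where "c k = real ((k + 1) * (k + 2))" for k
  have w: "pderiv w = smult (c k - c j) (gsol j * geg_poly k)"
    unfolding w_def pderiv_diff pderiv_mult gsol_ode c_def by (simp add: gsol_def algebra_simps smult_diff_left)
  have w0: "poly w 1 = 0" "poly w (-1) = 0" by (simp_all add: w_def poly_gsol)
  have "((\<lambda>s. poly (pderiv w) s) has_integral poly w 1 - poly w (-1)) {-1..1}"
    by (rule fundamental_theorem_of_calculus)
      (auto simp: has_real_derivative_iff_has_vector_derivative[symmetric] intro: DERIV_subset[OF poly_DERIV])
  then have "integral {-1..1} (\<lambda>s. (c k - c j) * (poly (gsol j) s * poly (geg_poly k) s)) = 0"
    unfolding w w0 poly_smult poly_mult diff_self by (rule integral_unique)
  then have "(c k - c j) * ip (poly (gsol j)) (poly (geg_poly k)) = 0"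
    unfolding ip_def by simp
  moreover have "c k \<noteq> c j"
  proof -
    have "c a < c b" if "a < b" for a b unfolding c_def of_nat_less_iff using that by (intro mult_strict_mono) auto
    then show ?thesis using assms by (metis less_irrefl linorder_neqE_nat)
  qed
  ultimately show ?thesis by simp
qed

lemma ip_self_eq_0:
  assumes f: "continuous_on {-1..1} f" and 0: "ip f f = 0" and s: "s \<in> {-1..1}"
  shows "f s = 0"
proof -
  have "((\<lambda>s. f s * f s) has_integral 0) (cbox (-1) 1)"
    using integrable_integral[OF ip_integrable[OF f f]] 0 by (simp add: ip_def)
  moreover have "continuous_on (cbox (-1) 1) (\<lambda>s. f s * f s)" using f by (auto intro!: continuous_intros)
  ultimately have "f s * f s = 0"
    by (intro has_integral_0_cbox_imp_0[of "-1" 1 "\<lambda>s. f s * f s" s]) (use s in auto)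
  then show ?thesis by simp
qed

lemma weierstrass_poly:
  fixes f :: "real \<Rightarrow> real"
  assumes f: "continuous_on {-1..1} f" and e: "e > 0"
  shows "\<exists>p. \<forall>s\<in>{-1..1}. \<bar>f s - poly p s\<bar> < e"
proof -
  have "\<exists>g. (\<exists>p. g = poly p) \<and> (\<forall>s\<in>{-1..1}. \<bar>f s - g s\<bar> < e)"
  proof (rule Stone_Weierstrass_HOL[OF _ _ _ _ _ _ f e])
    show "\<exists>p. (\<lambda>x. c) = poly p" for c :: real by (intro exI[of _ "[:c:]"]) (simp add: fun_eq_iff)
    show "\<exists>p. (\<lambda>x. f x + g x) = poly p" if "(\<exists>p. f = poly p) \<and> (\<exists>p. g = poly p)" for f g :: "real \<Rightarrow> real"
    proof -
      from that obtain p r where "f = poly p" "g = poly r" by blast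
      then show ?thesis by (intro exI[of _ "p + r"]) (simp add: fun_eq_iff)
    qed
    show "\<exists>p. (\<lambda>x. f x * g x) = poly p" if "(\<exists>p. f = poly p) \<and> (\<exists>p. g = poly p)" for f g :: "real \<Rightarrow> real"
    proof -
      from that obtain p r where "f = poly p" "g = poly r" by blast
      then show ?thesis by (intro exI[of _ "p * r"]) (simp add: fun_eq_iff)
    qed
    show "\<exists>f. (\<exists>p. f = poly p) \<and> f x \<noteq> f y" if "x \<in> {-1..1} \<and> y \<in> {-1..1} \<and> x \<noteq> y" for x y :: real
      using that by (intro exI[of _ "poly [:0, 1:]"]) auto
    show "continuous_on {-1..1} g" if "\<exists>p. g = poly p" for g :: "real \<Rightarrow> real" using that continuous_poly by blast
  qed simp
  then show ?thesis by blast
qed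

text \<open>The linear interpolation \<open>l\<close> of an approximating polynomial at the two ends
  is small, since \<open>g\<close> vanishes there. Without it the polynomial vanishes at both ends
  and is divisible by \<open>1 - s^2\<close>.\<close>

lemma weierstrass_wpoly:
  fixes g :: "real \<Rightarrow> real"
  assumes g: "continuous_on {-1..1} g" "g (-1) = 0" "g 1 = 0" and e: "e > 0"
  shows "\<exists>t. \<forall>s\<in>{-1..1}. \<bar>g s - (1 - s\<^sup>2) * poly t s\<bar> < e"
proof -
  obtain p where p: "\<And>s. s \<in> {-1..1} \<Longrightarrow> \<bar>g s - poly p s\<bar> < e / 2"
    using weierstrass_poly[OF g(1) half_gt_zero[OF e]] by blast
  define l where "l = [: (poly p 1 + poly p (-1)) / 2, (poly p 1 - poly p (-1)) / 2 :]"
  have ends: "\<bar>poly p 1\<bar> < e / 2" "\<bar>poly p (-1)\<bar> < e / 2" using p[of 1] p[of "-1"] g by auto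
  have l: "\<bar>poly l s\<bar> < e / 2" if s: "s \<in> {-1..1}" for s
  proof -
    have "poly l s = (1 + s) / 2 * poly p 1 + (1 - s) / 2 * poly p (-1)" by (simp add: l_def field_simps)
    also have "\<bar>\<dots>\<bar> \<le> (1 + s) / 2 * \<bar>poly p 1\<bar> + (1 - s) / 2 * \<bar>poly p (-1)\<bar>"
      using s by (intro order_trans[OF abs_triangle_ineq]) (simp add: abs_mult)
    also have "\<dots> \<le> (1 + s) / 2 * max \<bar>poly p 1\<bar> \<bar>poly p (-1)\<bar> + (1 - s) / 2 * max \<bar>poly p 1\<bar> \<bar>poly p (-1)\<bar>"
      using s by (intro add_mono mult_left_mono) auto
    also have "\<dots> = max \<bar>poly p 1\<bar> \<bar>poly p (-1)\<bar>" by (simp add: field_simps)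
    also have "\<dots> < e / 2" using ends by simp
    finally show ?thesis .
  qed
  define p' where "p' = p - l"
  have "poly p' 1 = 0" "poly p' (-1) = 0" by (simp_all add: p'_def l_def field_simps)
  then obtain r where r: "p' = [:-1, 1:] * r" by (auto simp: poly_eq_0_iff_dvd dvd_def)
  then have "poly r (-1) = 0" using \<open>poly p' (-1) = 0\<close> by simp
  then obtain t where t: "r = [:1, 1:] * t" by (auto simp: poly_eq_0_iff_dvd dvd_def)
  have "poly p' s = (1 - s\<^sup>2) * poly (- t) s" for s
    unfolding r t by (simp add: power2_eq_square algebra_simps)
  moreover have "\<bar>g s - poly p' s\<bar> < e" if "s \<in> {-1..1}" for s using p[OF that] l[OF that] unfolding p'_def poly_diff by linarith
  ultimately show ?thesis by (intro exI[of _ "- t"]) simp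
qed

lemma orthogonal_to_polys:
  assumes f: "continuous_on {-1..1} f" and o: "\<And>k. ip f (poly (geg_poly k)) = 0" and s: "s \<in> {-1..1}"
  shows "f s = 0"
proof (rule ip_self_eq_0[OF f _ s])
  have p0: "ip f (poly p) = 0" for p
  proof -
    obtain b where b: "p = (\<Sum>k\<le>degree p. smult (b k) (geg_poly k))" using geg_poly_expansion[of p "degree p"] by blast
    have sw: "ip f g = ip g f" for g by (simp add: ip_def mult.commute)
    have "poly p = (\<lambda>s. \<Sum>k\<le>degree p. b k * poly (geg_poly k) s)" by (subst b) (simp add: fun_eq_iff poly_sum)
    then have "ip f (poly p) = (\<Sum>k\<le>degree p. ip (\<lambda>s. b k * poly (geg_poly k) s) f)"
      unfolding sw by (simp add: ip_sum f continuous_intros)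
    also have "\<dots> = 0" unfolding ip_cmult sw[symmetric] o by simp
    finally show ?thesis .
  qed
  obtain M where M: "\<And>s. s \<in> {-1..1} \<Longrightarrow> \<bar>f s\<bar> \<le> M"
    using compact_imp_bounded[OF compact_continuous_image[OF f compact_Icc]] unfolding bounded_iff real_norm_def by blast
  have M0: "M \<ge> 0" using M[of 0] by (simp add: order_trans[OF abs_ge_zero])
  have "\<bar>ip f f\<bar> \<le> 0"
  proof (rule field_le_epsilon)
    fix e :: real assume e: "e > 0"
    have e': "e / (2 * (M + 1)) > 0" using e M0 by simp
    obtain p where p: "\<And>s. s \<in> {-1..1} \<Longrightarrow> \<bar>f s - poly p s\<bar> < e / (2 * (M + 1))"
      using weierstrass_poly[OF f e'] by blast
    have "ip (\<lambda>s. f s + (-1) * poly p s) f = ip f f + (-1) * ip (poly p) f"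
      unfolding ip_cmult[symmetric] by (intro ip_add continuous_intros f)
    moreover have "ip (poly p) f = 0" using p0[of p] by (simp add: ip_def mult.commute)
    moreover have "\<bar>ip (\<lambda>s. f s + (-1) * poly p s) f\<bar> \<le> 2 * (e / (2 * (M + 1)) * M)"
      by (rule ip_bound) (use p M f in \<open>auto intro!: continuous_intros simp: less_imp_le\<close>)
    moreover have "2 * (e / (2 * (M + 1)) * M) \<le> e" using e M0 by (simp add: field_simps)
    ultimately show "\<bar>ip f f\<bar> \<le> 0 + e" by simp
  qed
  then show "ip f f = 0" by simp
qed

section \<open>Tame solutions and their moments on regular levels\<close>

context toric_normalized
begin

text \<open>What the maximum principle on each \<open>lowr R\<close> and the existence of profiles
  require; at the edges in \<open>I\<close> only boundedness is imposed.\<close>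

definition tame :: "(real^2 \<Rightarrow> real) \<Rightarrow> bool" where
  "tame Y \<longleftrightarrow> harm Y \<and> (\<forall>b\<in>frontier \<Omega> - cusps. (Y \<longlongrightarrow> 0) (at b within \<Omega>)) \<and>
     (\<forall>R. \<exists>C. \<forall>x\<in>lowr R. \<bar>Y x\<bar> \<le> C)"

lemma tame_lim: "tame Y \<Longrightarrow> b \<in> frontier \<Omega> \<Longrightarrow> b \<notin> cusps \<Longrightarrow> (Y \<longlongrightarrow> 0) (at b within \<Omega>)"
  by (simp add: tame_def)

lemma tame_bounded: "tame Y \<Longrightarrow> \<exists>C. \<forall>x\<in>lowr R. \<bar>Y x\<bar> \<le> C"
  by (simp add: tame_def)

lemma tame_continuous: "tame Y \<Longrightarrow> continuous_on \<Omega> Y"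
  by (auto simp: tame_def harm_def intro: smooth_fun_continuous_on)

lemma tame_yy: "tame (yy w)"
  unfolding tame_def using harm_yy yy_lim yy_bounded by blast

lemma tame_cmult: assumes "tame Y" shows "tame (\<lambda>x. c * Y x)"
  unfolding tame_def
proof (intro conjI ballI allI)
  show "harm (\<lambda>x. c * Y x)" using assms by (simp add: tame_def harm_cmult)
  show "((\<lambda>x. c * Y x) \<longlongrightarrow> 0) (at b within \<Omega>)" if "b \<in> frontier \<Omega> - cusps" for b
    using tendsto_mult_right_zero[OF tame_lim[OF assms, of b]] that by simp
  fix R
  obtain C where "\<forall>x\<in>lowr R. \<bar>Y x\<bar> \<le> C" using tame_bounded[OF assms] by blast
  then have "\<forall>x\<in>lowr R. \<bar>c * Y x\<bar> \<le> \<bar>c\<bar> * C" by (simp add: abs_mult mult_left_mono)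
  then show "\<exists>C. \<forall>x\<in>lowr R. \<bar>c * Y x\<bar> \<le> C" by blast
qed

lemma tame_add: assumes "tame Y" "tame Z" shows "tame (\<lambda>x. Y x + Z x)"
  unfolding tame_def
proof (intro conjI ballI allI)
  show "harm (\<lambda>x. Y x + Z x)" using assms by (simp add: tame_def harm_add)
  show "((\<lambda>x. Y x + Z x) \<longlongrightarrow> 0) (at b within \<Omega>)" if "b \<in> frontier \<Omega> - cusps" for b
    using tendsto_add[OF tame_lim[OF assms(1), of b] tame_lim[OF assms(2), of b]] that by simp
  fix R
  obtain C C' where "\<forall>x\<in>lowr R. \<bar>Y x\<bar> \<le> C" "\<forall>x\<in>lowr R. \<bar>Z x\<bar> \<le> C'" using assms tame_bounded by metis
  then have "\<forall>x\<in>lowr R. \<bar>Y x + Z x\<bar> \<le> C + C'" by (meson abs_triangle_ineq add_mono order_trans)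
  then show "\<exists>C. \<forall>x\<in>lowr R. \<bar>Y x + Z x\<bar> \<le> C" by blast
qed

lemma tame_sum: "(\<And>k. k \<in> A \<Longrightarrow> tame (Y k)) \<Longrightarrow> tame (\<lambda>x. \<Sum>k\<in>A. Y k x)"
proof (induction A rule: infinite_finite_induct)
  case (insert k A)
  then show ?case by (simp add: tame_add)
qed (auto simp: tame_def harm_const)

lemma cs_mem: "x \<in> \<Omega> \<Longrightarrow> cs c x \<in> {-1..1}"
  using abs_cs_less[of x c] by (simp add: abs_less_iff)

text \<open>The separated solutions, homogeneous of degree \<open>k + 2\<close> in
  \<open>(H, r)\<close>; for \<open>k = 0\<close> it is \<open>q\<close>.\<close>

definition gharm :: "nat \<Rightarrow> real^2 \<Rightarrow> real" where
  "gharm k x = rh 0 x ^ Suc (Suc k) * poly (gsol k) (cs 0 x)"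

lemma gharm_q: "x \<in> \<Omega> \<Longrightarrow> gharm k x = q x * (rh 0 x ^ k * poly (geg_poly k) (cs 0 x))"
  unfolding gharm_def poly_gsol q_eq_rh_cs[of x 0] by (simp add: power2_eq_square algebra_simps)

lemma tame_gharm: "tame (gharm k)"
proof -
  obtain C where C: "\<And>s. s \<in> {-1..1} \<Longrightarrow> \<bar>poly (geg_poly k) s\<bar> \<le> C"
    using compact_imp_bounded[OF compact_continuous_image[OF continuous_poly compact_Icc]] unfolding bounded_iff real_norm_def by blast
  have C0: "C \<ge> 0" using C[of 0] by (simp add: order_trans[OF abs_ge_zero])
  have b: "\<bar>gharm k x\<bar> \<le> q x * (rh 0 x ^ k * C)" if x: "x \<in> \<Omega>" for x
    unfolding gharm_q[OF x] using q_pos[OF x] rh_pos[OF x, of 0] C[OF cs_mem[OF x, of 0]]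
    by (auto simp: abs_mult intro!: mult_left_mono)
  show ?thesis unfolding tame_def
  proof (intro conjI ballI allI)
    have "smooth_fun \<Omega> (\<lambda>x. rh 0 x ^ Suc (Suc k) * poly (gsol k) (cs 0 x))"
      by (intro smooth_intros smooth_fun_poly open_\<Omega> smooth_rh smooth_cs)
    moreover have "Lop (gharm k) x = 0" if x: "x \<in> \<Omega>" for x
    proof -
      have "real (Suc (Suc k)) * real (Suc k) = real ((k + 1) * (k + 2))" by (simp add: algebra_simps)
      then have "real (Suc (Suc k)) * real (Suc k) * poly (gsol k) (cs 0 x)
          + (1 - (cs 0 x)\<^sup>2) * poly (pderiv (pderiv (gsol k))) (cs 0 x) = 0"
        unfolding gsol_ode poly_smult poly_gsol by (simp del: of_nat_mult of_nat_Suc)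
      then show ?thesis
        unfolding gharm_def[abs_def] Lop_rh_power_poly[OF x] by simp
    qed
    ultimately show "harm (gharm k)" by (simp add: harm_def gharm_def[abs_def])
  next
    fix b assume "b \<in> frontier \<Omega> - cusps"
    then have b': "b \<in> frontier \<Omega>" by blast
    have "((\<lambda>x. q x * (rh 0 x ^ k * C)) \<longlongrightarrow> 0 * (\<bar>hb b + 0\<bar> ^ k * C)) (at b within \<Omega>)"
      by (intro tendsto_intros q_lim rh_lim b')
    then have l: "((\<lambda>x. q x * (rh 0 x ^ k * C)) \<longlongrightarrow> 0) (at b within \<Omega>)" by simp
    show "(gharm k \<longlongrightarrow> 0) (at b within \<Omega>)"
      by (rule Lim_null_comparison[OF _ l]) (auto simp: eventually_at_filter intro!: always_eventually b)
  next
    fix R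
    have "\<bar>gharm k x\<bar> \<le> R\<^sup>2 * (R ^ k * C)" if x: "x \<in> lowr R" for x
    proof -
      have xO: "x \<in> \<Omega>" "rh 0 x \<le> R" using x by (auto simp: lowr_def)
      have "(rh 0 x)\<^sup>2 \<le> R\<^sup>2" using xO rh_pos[OF xO(1), of 0] by (intro power_mono) auto
      then have "q x \<le> R\<^sup>2" using rh_sq[OF xO(1), of 0] zero_le_power2[of "H x + 0"] by linarith
      moreover have "rh 0 x ^ k \<le> R ^ k" using xO rh_pos[OF xO(1), of 0] by (intro power_mono) auto
      ultimately have "q x * (rh 0 x ^ k * C) \<le> R\<^sup>2 * (R ^ k * C)"
        using C0 rh_pos[OF xO(1), of 0] by (intro mult_mono mult_right_mono) auto
      then show ?thesis using b[OF xO(1)] by linarith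
    qed
    then show "\<exists>C. \<forall>x\<in>lowr R. \<bar>gharm k x\<bar> \<le> C" by blast
  qed
qed

lemma tame_le:
  assumes Y: "tame Y" and e: "\<epsilon> \<ge> 0" and le: "\<And>x. x \<in> \<Omega> \<Longrightarrow> rh 0 x = R \<Longrightarrow> Y x \<le> \<epsilon>" and x: "x \<in> lowr R"
  shows "Y x \<le> \<epsilon>"
proof -
  obtain C where C: "\<And>x. x \<in> lowr R \<Longrightarrow> \<bar>Y x\<bar> \<le> C" using tame_bounded[OF Y] by blast
  have h: "harm (\<lambda>x. Y x - \<epsilon>)" using Y by (simp add: tame_def harm_diff harm_const)
  have lO: "lowr R \<subseteq> \<Omega>" by (auto simp: lowr_def)
  have "Y x - \<epsilon> \<le> 0"
  proof (rule max_principle[OF open_lowr lO _ _ _ _ _ x])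
    show "smooth_fun \<Omega> (\<lambda>x. Y x - \<epsilon>)" "\<And>x. x \<in> lowr R \<Longrightarrow> Lop (\<lambda>x. Y x - \<epsilon>) x \<ge> 0"
      using h lO by (auto simp: harm_def)
    show "x \<in> lowr R \<Longrightarrow> Y x - \<epsilon> \<le> C" for x using C[of x] e by linarith
  next
    fix b assume b: "b \<in> frontier (lowr R)" "b \<in> \<Omega>"
    have "b \<notin> lowr R" using b(1) open_lowr by (simp add: frontier_def interior_open)
    then have 1: "rh 0 b \<ge> R" using b(2) by (simp add: lowr_def)
    have "b \<in> closure (lowr R)" using b(1) by (simp add: frontier_def)
    then obtain f where f: "\<And>n. f n \<in> lowr R" "f \<longlonglongrightarrow> b" unfolding closure_sequential by blast
    have "(\<lambda>n. rh 0 (f n)) \<longlonglongrightarrow> rh 0 b" by (rule isCont_tendsto_compose[OF isCont_smooth[OF smooth_rh b(2)] f(2)])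
    then have "rh 0 b \<le> R" by (rule LIMSEQ_le_const2) (use f(1) in \<open>auto simp: lowr_def less_imp_le\<close>)
    then show "Y b - \<epsilon> \<le> 0" using le[OF b(2)] 1 by simp
  next
    fix b \<eta> assume b: "b \<in> frontier \<Omega>" "b \<notin> cusps" and \<eta>: "(\<eta>::real) > 0"
    have "((\<lambda>x. Y x - \<epsilon>) \<longlongrightarrow> 0 - \<epsilon>) (at b within \<Omega>)" by (intro tendsto_intros tame_lim Y b)
    then have "\<forall>\<^sub>F x in at b within \<Omega>. Y x - \<epsilon> < \<eta>" by (rule order_tendstoD) (use e \<eta> in simp)
    then show "\<forall>\<^sub>F x in at b within \<Omega>. x \<in> lowr R \<longrightarrow> Y x - \<epsilon> < \<eta>" by eventually_elim simp
  qed
  then show ?thesis by simp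
qed

lemma tame_abs_le:
  assumes Y: "tame Y" and Z: "tame Z" and e: "\<epsilon> \<ge> 0" and le: "\<And>x. x \<in> \<Omega> \<Longrightarrow> rh 0 x = R \<Longrightarrow> \<bar>Y x - Z x\<bar> \<le> \<epsilon>"
    and x: "x \<in> \<Omega>" "rh 0 x \<le> R"
  shows "\<bar>Y x - Z x\<bar> \<le> \<epsilon>"
proof (cases "rh 0 x = R")
  case False
  then have xl: "x \<in> lowr R" using x by (simp add: lowr_def)
  have 1: "tame (\<lambda>x. Y x + (-1) * Z x)" "tame (\<lambda>x. Z x + (-1) * Y x)"
    by (rule tame_add[OF Y tame_cmult[OF Z]], rule tame_add[OF Z tame_cmult[OF Y]])
  have "Y x + (-1) * Z x \<le> \<epsilon>" by (rule tame_le[OF 1(1) e _ xl]) (use le in \<open>force simp: abs_le_iff\<close>)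
  moreover have "Z x + (-1) * Y x \<le> \<epsilon>" by (rule tame_le[OF 1(2) e _ xl]) (use le in \<open>force simp: abs_le_iff\<close>)
  ultimately show ?thesis by simp
qed (use le x in simp)

definition profile :: "(real^2 \<Rightarrow> real) \<Rightarrow> real \<Rightarrow> real \<Rightarrow> real" where
  "profile Y R = (SOME g. continuous_on {-1..1} g \<and> g (-1) = 0 \<and> g 1 = 0 \<and> (\<forall>x\<in>\<Omega>. rh 0 x = R \<longrightarrow> Y x = g (cs 0 x)))"

lemma profile:
  assumes Y: "tame Y" and R: "regular R"
  shows "continuous_on {-1..1} (profile Y R)" "profile Y R (-1) = 0" "profile Y R 1 = 0"
    "x \<in> \<Omega> \<Longrightarrow> rh 0 x = R \<Longrightarrow> Y x = profile Y R (cs 0 x)"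
proof -
  have "\<exists>g. continuous_on {-1..1} g \<and> g (-1) = 0 \<and> g 1 = 0 \<and> (\<forall>x\<in>\<Omega>. rh 0 x = R \<longrightarrow> Y x = g (cs 0 x))"
    by (rule level_profile[OF R tame_continuous[OF Y] tame_lim[OF Y]]) blast+
  from someI_ex[OF this]
  have "continuous_on {-1..1} (profile Y R) \<and> profile Y R (-1) = 0 \<and> profile Y R 1 = 0 \<and>
      (\<forall>x\<in>\<Omega>. rh 0 x = R \<longrightarrow> Y x = profile Y R (cs 0 x))" unfolding profile_def .
  then show "continuous_on {-1..1} (profile Y R)" "profile Y R (-1) = 0" "profile Y R 1 = 0"
    "x \<in> \<Omega> \<Longrightarrow> rh 0 x = R \<Longrightarrow> Y x = profile Y R (cs 0 x)" by blast+
qed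

lemma arc_point:
  assumes R: "regular R" and s: "\<bar>s\<bar> < 1"
  obtains x where "x \<in> \<Omega>" "rh 0 x = R" "cs 0 x = s"
proof -
  have R0: "R > 0" using R by (simp add: regular_def)
  have "\<bar>R * s\<bar> < R" using s R0 by (simp add: abs_mult)
  then obtain x where x: "x \<in> \<Omega>" "rh 0 x = R" "H x = R * s" using arc_surjective[OF R] arc_iff[OF R0] by blast
  then show ?thesis using that[of x] R0 by (simp add: cs_def)
qed

lemma profile_cases:
  assumes "\<And>x. x \<in> \<Omega> \<Longrightarrow> rh 0 x = R \<Longrightarrow> Q (cs 0 x)" "Q (-1)" "Q 1" "regular R" "s \<in> {-1..1}"
  shows "Q s"
proof (cases "\<bar>s\<bar> < 1")
  case True
  then show ?thesis using arc_point[OF assms(4) True] assms(1) by metis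
next
  case False
  then have "s = -1 \<or> s = 1" using assms(5) by auto
  then show ?thesis using assms(2,3) by blast
qed

text \<open>Up to a constant factor depending on \<open>k\<close>, the coefficient of
  \<open>gsol k\<close> in the expansion of the profile.\<close>

definition moment :: "(real^2 \<Rightarrow> real) \<Rightarrow> nat \<Rightarrow> real \<Rightarrow> real" where
  "moment Y k R = ip (profile Y R) (poly (geg_poly k))"

lemma geg_bound: obtains C where "C > 0" "\<And>s. s \<in> {-1..1} \<Longrightarrow> \<bar>poly (geg_poly k) s\<bar> \<le> C"
proof -
  obtain C where C: "\<And>s. s \<in> {-1..1} \<Longrightarrow> \<bar>poly (geg_poly k) s\<bar> \<le> C"
    using compact_imp_bounded[OF compact_continuous_image[OF continuous_poly compact_Icc]] unfolding bounded_iff real_norm_def by blast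
  show ?thesis
  proof (rule that[of "\<bar>C\<bar> + 1"])
    show "\<bar>poly (geg_poly k) s\<bar> \<le> \<bar>C\<bar> + 1" if "s \<in> {-1..1}" for s using C[OF that] by linarith
  qed simp
qed

text \<open>On the level \<open>R\<close> the profile is approximated uniformly by a combination of
  the \<open>gsol j\<close>. By the maximum principle the corresponding combination \<open>Z\<close>
  of the \<open>gharm j\<close> is equally close to \<open>Y\<close> on the level \<open>r\<close>.
  For \<open>Z\<close> the scaling is exact, by orthogonality and homogeneity.\<close>

lemma moment_scaling:
  assumes Y: "tame Y" and r: "regular r" and R: "regular R" and rR: "r \<le> R"
  shows "moment Y k r = (r / R) ^ Suc (Suc k) * moment Y k R"
proof -
  have R0: "R > 0" "r > 0" using R r by (auto simp: regular_def)
  obtain C where C: "C > 0" "\<And>s. s \<in> {-1..1} \<Longrightarrow> \<bar>poly (geg_poly k) s\<bar> \<le> C" by (rule geg_bound) (rule that)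
  define \<theta> where "\<theta> = r / R"
  have \<theta>: "0 \<le> \<theta>" "\<theta> \<le> 1" using R0 rR by (auto simp: \<theta>_def)
  have "\<bar>moment Y k r - \<theta> ^ Suc (Suc k) * moment Y k R\<bar> \<le> 0"
  proof (rule field_le_epsilon)
    fix e :: real assume e: "e > 0"
    define \<epsilon> where "\<epsilon> = e / (4 * C)"
    have \<epsilon>: "\<epsilon> > 0" using e C by (simp add: \<epsilon>_def)
    obtain t where t: "\<And>s. s \<in> {-1..1} \<Longrightarrow> \<bar>profile Y R s - (1 - s\<^sup>2) * poly t s\<bar> < \<epsilon>"
      using weierstrass_wpoly[OF profile(1-3)[OF Y R] \<epsilon>] by blast
    define N where "N = max (degree t) k"
    obtain b where b: "t = (\<Sum>j\<le>N. smult (b j) (geg_poly j))" using geg_poly_expansion[of t N] by (auto simp: N_def)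
    have pt: "(1 - s\<^sup>2) * poly t s = (\<Sum>j\<le>N. b j * poly (gsol j) s)" for s
      unfolding b poly_sum poly_gsol sum_distrib_left by (simp add: mult_ac)
    define Z where "Z x = (\<Sum>j\<le>N. (b j / R ^ Suc (Suc j)) * gharm j x)" for x
    have Z: "tame Z" unfolding Z_def[abs_def] by (intro tame_sum tame_cmult tame_gharm)
    have ZR: "Z x = (\<Sum>j\<le>N. b j * (rh 0 x / R) ^ Suc (Suc j) * poly (gsol j) (cs 0 x))" for x
      unfolding Z_def gharm_def power_divide by (simp add: mult_ac del: power_Suc)
    have YZ: "\<bar>Y x - Z x\<bar> \<le> \<epsilon>" if x: "x \<in> \<Omega>" "rh 0 x \<le> R" for x
    proof (rule tame_abs_le[OF Y Z _ _ x])
      fix y assume y: "y \<in> \<Omega>" "rh 0 y = R"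
      have "Z y = (1 - (cs 0 y)\<^sup>2) * poly t (cs 0 y)" unfolding ZR pt using y R0 by simp
      then show "\<bar>Y y - Z y\<bar> \<le> \<epsilon>" using t[OF cs_mem[OF y(1), of 0]] profile(4)[OF Y R y] by simp
    qed (use \<epsilon> in simp)
    define z where "z \<eta> s = (\<Sum>j\<le>N. b j * \<eta> ^ Suc (Suc j) * poly (gsol j) s)" for \<eta> s
    have zc: "continuous_on A (z \<eta>)" for A \<eta> unfolding z_def[abs_def] by (intro continuous_intros)
    have z1: "z \<eta> 1 = 0" "z \<eta> (-1) = 0" for \<eta> by (simp_all add: z_def poly_gsol)
    have ipz: "ip (z \<eta>) (poly (geg_poly k)) = b k * \<eta> ^ Suc (Suc k) * ip (poly (gsol k)) (poly (geg_poly k))" for \<eta>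
    proof -
      have "ip (z \<eta>) (poly (geg_poly k)) = (\<Sum>j\<le>N. ip (\<lambda>s. b j * \<eta> ^ Suc (Suc j) * poly (gsol j) s) (poly (geg_poly k)))"
        unfolding z_def[abs_def] by (intro ip_sum continuous_intros) auto
      also have "\<dots> = (\<Sum>j\<le>N. if j = k then b k * \<eta> ^ Suc (Suc k) * ip (poly (gsol k)) (poly (geg_poly k)) else 0)"
        by (rule sum.cong) (auto simp: ip_cmult ip_gsol_orthogonal)
      also have "\<dots> = b k * \<eta> ^ Suc (Suc k) * ip (poly (gsol k)) (poly (geg_poly k))" by (simp add: N_def)
      finally show ?thesis .
    qed
    have close: "\<bar>moment Y k R' - ip (z (R' / R)) (poly (geg_poly k))\<bar> \<le> 2 * (\<epsilon> * C)" if R': "regular R'" "R' \<le> R" for R'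
    proof -
      let ?f = "\<lambda>s. profile Y R' s + (-1) * z (R' / R) s"
      have "\<bar>?f s\<bar> \<le> \<epsilon>" if "s \<in> {-1..1}" for s
      proof (rule profile_cases[OF _ _ _ R'(1) that])
        show "\<bar>?f (cs 0 x)\<bar> \<le> \<epsilon>" if x: "x \<in> \<Omega>" "rh 0 x = R'" for x
          using YZ[of x] R'(2) profile(4)[OF Y R'(1) x] x ZR[of x] by (simp add: z_def)
      qed (use profile(2,3)[OF Y R'(1)] z1 \<epsilon> in auto)
      then have "\<bar>ip ?f (poly (geg_poly k))\<bar> \<le> 2 * (\<epsilon> * C)"
        by (intro ip_bound continuous_intros profile(1)[OF Y R'(1)] zc C(2))
      moreover have "ip ?f (poly (geg_poly k)) = moment Y k R' + (-1) * ip (z (R' / R)) (poly (geg_poly k))"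
        unfolding moment_def ip_cmult[symmetric] by (intro ip_add continuous_intros profile(1)[OF Y R'(1)] zc)
      ultimately show ?thesis by simp
    qed
    define A where "A = b k * ip (poly (gsol k)) (poly (geg_poly k))"
    have 1: "\<bar>moment Y k r - \<theta> ^ Suc (Suc k) * A\<bar> \<le> 2 * (\<epsilon> * C)"
      using close[OF r rR] unfolding ipz A_def \<theta>_def by (simp add: mult_ac del: power_Suc)
    have 2: "\<bar>moment Y k R - A\<bar> \<le> 2 * (\<epsilon> * C)"
      using close[OF R order_refl] R0 unfolding ipz A_def by simp
    have "\<bar>\<theta> ^ Suc (Suc k) * (moment Y k R - A)\<bar> \<le> 1 * (2 * (\<epsilon> * C))"
      unfolding abs_mult using 2 \<theta> by (intro mult_mono) (auto simp: power_le_one simp del: power_Suc)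
    then have "\<bar>moment Y k r - \<theta> ^ Suc (Suc k) * moment Y k R\<bar> \<le> 4 * (\<epsilon> * C)"
      using 1 unfolding right_diff_distrib by linarith
    also have "\<dots> = e" using C by (simp add: \<epsilon>_def)
    finally show "\<bar>moment Y k r - \<theta> ^ Suc (Suc k) * moment Y k R\<bar> \<le> 0 + e" by simp
  qed
  then show ?thesis by (simp add: \<theta>_def del: power_Suc)
qed

text \<open>The moment scales like \<open>r ^ (k + 2)\<close>, but for nonnegative \<open>Y\<close> it is bounded by a multiple of the
  moment with \<open>k = 0\<close>, which scales like \<open>r\<^sup>2\<close>.\<close>

lemma moment_vanishes:
  assumes Y: "tame Y" and pos: "\<And>x. x \<in> \<Omega> \<Longrightarrow> Y x \<ge> 0" and r: "regular r" and k: "k > 0"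
  shows "moment Y k r = 0"
proof -
  obtain C where C: "C > 0" "\<And>s. s \<in> {-1..1} \<Longrightarrow> \<bar>poly (geg_poly k) s\<bar> \<le> C" by (rule geg_bound) (rule that)
  have r0: "r > 0" using r by (simp add: regular_def)
  have m0: "moment Y 0 R = integral {-1..1} (profile Y R)" for R by (simp add: moment_def ip_def geg_poly_0)
  have nn: "profile Y R s \<ge> 0" if "regular R" "s \<in> {-1..1}" for R s
    by (rule profile_cases[OF _ _ _ that]) (use profile(2-4)[OF Y that(1)] pos in \<open>auto, metis\<close>)
  have le: "\<bar>moment Y k R\<bar> \<le> C * moment Y 0 R" if R: "regular R" for R
  proof -
    have "norm (moment Y k R) \<le> integral {-1..1} (\<lambda>s. C * profile Y R s)"
      unfolding moment_def ip_def
    proof (rule integral_norm_bound_integral[OF ip_integrable])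
      show "continuous_on {-1..1} (profile Y R)" by (rule profile(1)[OF Y R])
      show "continuous_on {-1..1} (poly (geg_poly k))" by (rule continuous_poly)
      show "(\<lambda>s. C * profile Y R s) integrable_on {-1..1}"
        by (intro integrable_continuous_real continuous_intros profile(1)[OF Y R])
      show "norm (profile Y R s * poly (geg_poly k) s) \<le> C * profile Y R s" if "s \<in> {-1..1}" for s
        using nn[OF R that] C(2)[OF that] by (simp add: abs_mult mult.commute mult_right_mono)
    qed
    then show ?thesis by (simp add: m0)
  qed
  have m0n: "moment Y 0 r \<ge> 0"
    using le[OF r] C(1) by (metis abs_ge_zero order_trans zero_le_mult_iff not_less less_le)
  have bound: "\<bar>moment Y k r\<bar> \<le> (r / R) * (C * moment Y 0 r)" if R: "regular R" "R \<ge> r" for R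
  proof -
    have R0: "R > 0" using R by (simp add: regular_def)
    define \<theta> where "\<theta> = r / R"
    have \<theta>: "\<theta> > 0" "\<theta> \<le> 1" using R0 r0 R by (auto simp: \<theta>_def)
    have "\<bar>moment Y k r\<bar> = \<theta> ^ Suc (Suc k) * \<bar>moment Y k R\<bar>"
      using moment_scaling[OF Y r R, of k] \<theta> by (simp add: \<theta>_def abs_mult del: power_Suc)
    also have "\<dots> \<le> \<theta> ^ Suc (Suc k) * (C * moment Y 0 R)" using le[OF R(1)] \<theta> by (intro mult_left_mono) auto
    also have "\<dots> = \<theta> ^ k * (C * (\<theta> ^ Suc (Suc 0) * moment Y 0 R))" by simp
    also have "\<theta> ^ Suc (Suc 0) * moment Y 0 R = moment Y 0 r" using moment_scaling[OF Y r R, of 0] by (simp add: \<theta>_def)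
    also have "\<theta> ^ k * (C * moment Y 0 r) \<le> \<theta> * (C * moment Y 0 r)"
    proof (rule mult_right_mono)
      obtain j where "k = Suc j" using k gr0_implies_Suc by blast
      then show "\<theta> ^ k \<le> \<theta>" using \<theta> by (simp add: mult_left_le power_le_one)
    qed (use C m0n in simp)
    finally show ?thesis by (simp add: \<theta>_def)
  qed
  show ?thesis
  proof (rule ccontr)
    assume nz: "moment Y k r \<noteq> 0"
    \<comment> \<open>The radius at which \<open>bound\<close> would become an equality; larger
      regular radii contradict it.\<close>
    define N where "N = r * (C * moment Y 0 r) / \<bar>moment Y k r\<bar>"
    obtain R where R: "regular R" "R > max r N" using exists_regular by blast
    have "R > 0" using R r0 by simp
    then have "\<bar>moment Y k r\<bar> * R \<le> r * (C * moment Y 0 r)" using bound[of R] R by (simp add: field_simps)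
    moreover have "r * (C * moment Y 0 r) < \<bar>moment Y k r\<bar> * R" using R nz by (simp add: N_def field_simps)
    ultimately show False by simp
  qed
qed

text \<open>All moments with \<open>k > 0\<close> vanish, so on a regular level the profile is a
  multiple of \<open>gsol 0\<close>, and the maximum principle carries \<open>Y = c * q\<close> from
  the level to \<open>lowr R\<close>. The constants agree because all these sets contain a common
  point once \<open>R\<close> is large.\<close>

theorem liouville:
  assumes Y: "tame Y" and pos: "\<And>x. x \<in> \<Omega> \<Longrightarrow> Y x \<ge> 0"
  shows "\<exists>\<kappa>\<ge>0. \<forall>x\<in>\<Omega>. Y x = \<kappa> * q x"
proof -
  have level: "\<exists>c. \<forall>x\<in>lowr R. Y x = c * q x" if R: "regular R" for R
  proof -
    have R0: "R > 0" using R by (simp add: regular_def)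
    define n0 where "n0 = ip (poly (gsol 0)) (poly (geg_poly 0))"
    \<comment> \<open>Otherwise \<open>gsol 0\<close> would be orthogonal to every polynomial and
      hence zero.\<close>
    have n0: "n0 \<noteq> 0"
    proof
      assume "n0 = 0"
      then have *: "ip (poly (gsol 0)) (poly (geg_poly k)) = 0" for k
        using \<open>n0 = 0\<close> by (cases "k = 0") (auto simp: n0_def ip_gsol_orthogonal)
      have "poly (gsol 0) 0 = 0" by (rule orthogonal_to_polys[OF continuous_poly *]) simp
      then show False by (simp add: poly_gsol geg_poly_0)
    qed
    define c where "c = moment Y 0 R / n0"
    let ?f = "\<lambda>s. profile Y R s + (- c) * poly (gsol 0) s"
    have fc: "continuous_on {-1..1} ?f" by (intro continuous_intros profile(1)[OF Y R])
    have "ip ?f (poly (geg_poly k)) = 0" for k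
    proof -
      have "ip ?f (poly (geg_poly k)) = moment Y k R + (- c) * ip (poly (gsol 0)) (poly (geg_poly k))"
        unfolding moment_def ip_cmult[symmetric] by (intro ip_add continuous_intros profile(1)[OF Y R])
      also have "\<dots> = 0"
      proof (cases "k = 0")
        case True
        then show ?thesis using n0 by (simp add: c_def n0_def)
      next
        case False
        then show ?thesis using moment_vanishes[OF Y pos R, of k] by (simp add: ip_gsol_orthogonal)
      qed
      finally show ?thesis .
    qed
    then have f0: "?f s = 0" if "s \<in> {-1..1}" for s using orthogonal_to_polys[OF fc _ that] by blast
    have Z: "tame (\<lambda>x. c / R\<^sup>2 * gharm 0 x)" by (intro tame_cmult tame_gharm)
    have "\<bar>Y x - c / R\<^sup>2 * gharm 0 x\<bar> \<le> 0" if x: "x \<in> \<Omega>" "rh 0 x \<le> R" for x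
    proof (rule tame_abs_le[OF Y Z _ _ x])
      fix y assume y: "y \<in> \<Omega>" "rh 0 y = R"
      have "Y y = c * poly (gsol 0) (cs 0 y)"
        using f0[OF cs_mem[OF y(1), of 0]] profile(4)[OF Y R y] by simp
      also have "\<dots> = c / R\<^sup>2 * gharm 0 y" using y R0 by (simp add: gharm_def power2_eq_square)
      finally show "\<bar>Y y - c / R\<^sup>2 * gharm 0 y\<bar> \<le> 0" by simp
    qed simp
    then have "Y x = c / R\<^sup>2 * q x" if "x \<in> lowr R" for x
      using that gharm_q[of x 0] by (force simp: lowr_def geg_poly_0)
    then show ?thesis by blast
  qed
  obtain x1 where x1: "x1 \<in> \<Omega>" using nonempty_\<Omega> by blast
  define \<kappa> where "\<kappa> = Y x1 / q x1"
  have "Y x = \<kappa> * q x" if x: "x \<in> \<Omega>" for x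
  proof -
    obtain R where R: "regular R" "R > max (rh 0 x) (rh 0 x1)" using exists_regular by blast
    obtain c where c: "\<And>x. x \<in> lowr R \<Longrightarrow> Y x = c * q x" using level[OF R(1)] by blast
    have "x \<in> lowr R" "x1 \<in> lowr R" using R x x1 by (auto simp: lowr_def)
    then show ?thesis using c[of x] c[of x1] q_pos[OF x1] by (simp add: \<kappa>_def)
  qed
  moreover have "\<kappa> \<ge> 0" using pos[OF x1] q_pos[OF x1] by (simp add: \<kappa>_def)
  ultimately show ?thesis by blast
qed

end

section \<open>Conjugate functions and the gradient of the potential\<close>

context conjugate_pair
begin

text \<open>For \<open>s\<close> and \<open>t\<close> functions of \<open>H\<close> and \<open>r\<close>, where \<open>r\<^sup>2 = q\<close>, this says that
  \<open>r t\<^sub>r = s\<^sub>H\<close> and \<open>- r t\<^sub>H = s\<^sub>r\<close>.\<close>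

definition conjug :: "(real^2 \<Rightarrow> real) \<Rightarrow> (real^2 \<Rightarrow> real) \<Rightarrow> bool" where
  "conjug s t \<longleftrightarrow> smooth_fun \<Omega> s \<and> smooth_fun \<Omega> t \<and>
     (\<forall>x\<in>\<Omega>. \<forall>v. dir_deriv v t x = hs v E2 x * dir_deriv E1 s x - hs v E1 x * dir_deriv E2 s x)"

text \<open>The conjugate of \<open>H\<close> is \<open>ln r\<close> and that of \<open>q\<close> is
  \<open>- 2 * H\<close>. For functions of \<open>H\<close> and \<open>q\<close> the chain rule does
  the rest.\<close>

lemma conjugI:
  assumes s: "smooth_fun \<Omega> s" and t: "smooth_fun \<Omega> t"
    and ds: "\<And>x v. x \<in> \<Omega> \<Longrightarrow> dir_deriv v s x = A x * dir_deriv v H x + B x * dir_deriv v q x"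
    and dt: "\<And>x v. x \<in> \<Omega> \<Longrightarrow> dir_deriv v t x = A x * (dir_deriv v q x / (2 * q x)) - 2 * B x * dir_deriv v H x"
  shows "conjug s t"
  unfolding conjug_def
proof (intro conjI s t ballI allI)
  fix x v assume x: "x \<in> \<Omega>"
  have q0: "2 * q x \<noteq> 0" using q_pos[OF x] by simp
  have Tq: "2 * dir_deriv v H x = hs v E1 x * dir_deriv E2 q x - hs v E2 x * dir_deriv E1 q x"
    by (rule dir_deriv_H_frame[OF x]) (simp add: det2_def axis_def)
  have "2 * (hs v E2 x * dir_deriv E1 H x - hs v E1 x * dir_deriv E2 H x) = hdet x * dir_deriv v q x"
    unfolding dir_deriv_H_E[OF x] conj1_def conj2_def hs_expand[OF x, of v E1] hs_expand[OF x, of v E2]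
      dir_deriv_vec2[OF smooth_fun_differentiable[OF smooth_q x], of v] hdet_def
    by (simp add: axis_def algebra_simps)
  then have "2 * q x * (hs v E2 x * dir_deriv E1 H x - hs v E1 x * dir_deriv E2 H x) = (hdet x * q x) * dir_deriv v q x" by (simp add: mult_ac)
  then have TH: "hs v E2 x * dir_deriv E1 H x - hs v E1 x * dir_deriv E2 H x = dir_deriv v q x / (2 * q x)"
    using q0 unfolding hdet_q[OF x] by (simp add: nonzero_eq_divide_eq mult_ac)
  have "hs v E2 x * dir_deriv E1 s x - hs v E1 x * dir_deriv E2 s x
    = A x * (hs v E2 x * dir_deriv E1 H x - hs v E1 x * dir_deriv E2 H x)
      - B x * (hs v E1 x * dir_deriv E2 q x - hs v E2 x * dir_deriv E1 q x)"
    unfolding ds[OF x] by (simp add: algebra_simps)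
  also have "\<dots> = A x * (dir_deriv v q x / (2 * q x)) - 2 * B x * dir_deriv v H x"
    unfolding TH Tq[symmetric] by simp
  finally show "dir_deriv v t x = hs v E2 x * dir_deriv E1 s x - hs v E1 x * dir_deriv E2 s x"
    unfolding dt[OF x] by simp
qed

lemma conjug_const: "conjug (\<lambda>x. a) (\<lambda>x. c)"
  by (simp add: conjug_def smooth_fun_const)

lemma conjug_add: assumes "conjug s t" "conjug s' t'" shows "conjug (\<lambda>x. s x + s' x) (\<lambda>x. t x + t' x)"
proof -
  have sm: "smooth_fun \<Omega> s" "smooth_fun \<Omega> t" "smooth_fun \<Omega> s'" "smooth_fun \<Omega> t'" using assms by (auto simp: conjug_def)
  note d = sm[THEN smooth_fun_differentiable]
  show ?thesis unfolding conjug_def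
  proof (intro conjI ballI allI smooth_fun_add open_\<Omega> sm)
    fix x v assume x: "x \<in> \<Omega>"
    have e: "dir_deriv v t x = hs v E2 x * dir_deriv E1 s x - hs v E1 x * dir_deriv E2 s x"
      "dir_deriv v t' x = hs v E2 x * dir_deriv E1 s' x - hs v E1 x * dir_deriv E2 s' x"
      using assms x by (simp_all add: conjug_def)
    show "dir_deriv v (\<lambda>x. t x + t' x) x = hs v E2 x * dir_deriv E1 (\<lambda>x. s x + s' x) x - hs v E1 x * dir_deriv E2 (\<lambda>x. s x + s' x) x"
      unfolding dir_deriv_add[OF d(2)[OF x] d(4)[OF x]] dir_deriv_add[OF d(1)[OF x] d(3)[OF x]] e by (simp add: algebra_simps)
  qed
qed

lemma conjug_cmult: assumes "conjug s t" shows "conjug (\<lambda>x. c * s x) (\<lambda>x. c * t x)"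
proof -
  have sm: "smooth_fun \<Omega> s" "smooth_fun \<Omega> t" using assms by (auto simp: conjug_def)
  note d = sm[THEN smooth_fun_differentiable]
  show ?thesis unfolding conjug_def
  proof (intro conjI ballI allI smooth_fun_mult smooth_fun_const open_\<Omega> sm)
    fix x v assume x: "x \<in> \<Omega>"
    have e: "dir_deriv v t x = hs v E2 x * dir_deriv E1 s x - hs v E1 x * dir_deriv E2 s x"
      using assms x by (simp add: conjug_def)
    show "dir_deriv v (\<lambda>x. c * t x) x = hs v E2 x * dir_deriv E1 (\<lambda>x. c * s x) x - hs v E1 x * dir_deriv E2 (\<lambda>x. c * s x) x"
      unfolding dir_deriv_cmult[OF d(1)[OF x]] dir_deriv_cmult[OF d(2)[OF x]] e by (simp add: algebra_simps)
  qed
qed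

lemma conjug_diff: assumes "conjug s t" "conjug s' t'" shows "conjug (\<lambda>x. s x - s' x) (\<lambda>x. t x - t' x)"
  using conjug_add[OF assms(1) conjug_cmult[OF assms(2), of "-1"]] by simp

lemma conjug_sum: "(\<And>i. i \<in> A \<Longrightarrow> conjug (s i) (t i)) \<Longrightarrow> conjug (\<lambda>x. \<Sum>i\<in>A. s i x) (\<lambda>x. \<Sum>i\<in>A. t i x)"
  by (induction A rule: infinite_finite_induct) (auto intro: conjug_const conjug_add)

lemma dir_deriv_rh:
  assumes x: "x \<in> \<Omega>"
  shows "dir_deriv v (rh c) x = cs c x * dir_deriv v H x + dir_deriv v q x / (2 * rh c x)"
proof -
  have dH: "(\<lambda>x. H x + c) differentiable (at x)" by (rule smooth_fun_differentiable[OF smooth_Hc x])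
  have dq: "q differentiable (at x)" by (rule smooth_fun_differentiable[OF smooth_q x])
  have "dir_deriv v (\<lambda>x. H x + c) x = dir_deriv v H x"
    using dir_deriv_add[OF smooth_fun_differentiable[OF smooth_H x], of "\<lambda>_. c" v] by simp
  then have "dir_deriv v (rho2 c) x = 2 * (H x + c) * dir_deriv v H x + dir_deriv v q x"
    unfolding rho2_def[abs_def] dir_deriv_add[OF differentiable_mult[OF dH dH] dq] dir_deriv_mult[OF dH dH] by simp
  moreover have "dir_deriv v (rh c) x = inverse (sqrt (rho2 c x)) / 2 * dir_deriv v (rho2 c) x"
    unfolding rh_def[abs_def] by (rule comp_differentiable(2)[OF smooth_fun_differentiable[OF smooth_rho2 x] sqrt_deriv2(1)[OF rho2_pos[OF x]]])
  ultimately show ?thesis using rh_pos[OF x, of c] by (simp add: cs_def rh_def[symmetric] field_simps)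
qed

lemma conjug_H: "conjug H (\<lambda>x. 1/2 * ln (q x))"
proof (rule conjugI[where A = "\<lambda>_. 1" and B = "\<lambda>_. 0"])
  show "smooth_fun \<Omega> H" "smooth_fun \<Omega> (\<lambda>x. 1/2 * ln (q x))" by (intro smooth_intros open_\<Omega> smooth_H smooth_q q_pos, assumption?)+
  fix x v assume x: "x \<in> \<Omega>"
  have "dir_deriv v (\<lambda>x. 1/2 * ln (q x)) x = 1/2 * (1 / q x) * dir_deriv v q x"
    by (rule comp_differentiable(2)[OF smooth_fun_differentiable[OF smooth_q x]]) (use q_pos[OF x] in \<open>auto intro!: derivative_eq_intros simp: field_simps\<close>)
  then show "dir_deriv v (\<lambda>x. 1/2 * ln (q x)) x = 1 * (dir_deriv v q x / (2 * q x)) - 2 * 0 * dir_deriv v H x" by simp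
qed simp

lemma conjug_q: "conjug (\<lambda>x. (-1/2) * q x) H"
proof (rule conjugI[where A = "\<lambda>_. 0" and B = "\<lambda>_. -1/2"])
  show "smooth_fun \<Omega> H" "smooth_fun \<Omega> (\<lambda>x. (-1/2) * q x)" by (intro smooth_intros open_\<Omega> smooth_H smooth_q)+
  fix x v assume x: "x \<in> \<Omega>"
  show "dir_deriv v (\<lambda>x. (-1/2) * q x) x = 0 * dir_deriv v H x + (-1/2) * dir_deriv v q x"
    unfolding dir_deriv_cmult[OF smooth_fun_differentiable[OF smooth_q x]] by simp
qed simp

lemma Hc_rh_pos: assumes x: "x \<in> \<Omega>" shows "(H x + c) + rh c x > 0"
  using abs_Hc_less[OF x, of c] by linarith

lemma conjug_rh: "conjug (\<lambda>x. (H x + c) - rh c x) (\<lambda>x. ln ((H x + c) + rh c x))"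
proof (rule conjugI[where A = "\<lambda>x. 1 - cs c x" and B = "\<lambda>x. - 1 / (2 * rh c x)"])
  have sm: "smooth_fun \<Omega> (\<lambda>x. (H x + c) + rh c x)" by (intro smooth_intros open_\<Omega> smooth_H smooth_rh)
  show "smooth_fun \<Omega> (\<lambda>x. (H x + c) - rh c x)" by (intro smooth_intros open_\<Omega> smooth_H smooth_rh)
  show "smooth_fun \<Omega> (\<lambda>x. ln ((H x + c) + rh c x))" by (rule smooth_fun_ln[OF open_\<Omega> sm Hc_rh_pos])
  fix x v assume x: "x \<in> \<Omega>"
  have dc: "dir_deriv v (\<lambda>x. H x + c) x = dir_deriv v H x"
    using dir_deriv_add[OF smooth_fun_differentiable[OF smooth_H x], of "\<lambda>_. c" v] by simp
  have d: "(\<lambda>x. H x + c) differentiable (at x)" "rh c differentiable (at x)"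
    by (rule smooth_fun_differentiable[OF smooth_Hc x] smooth_fun_differentiable[OF smooth_rh x])+
  show "dir_deriv v (\<lambda>x. (H x + c) - rh c x) x = (1 - cs c x) * dir_deriv v H x + (- 1 / (2 * rh c x)) * dir_deriv v q x"
    unfolding dir_deriv_diff[OF d] dc dir_deriv_rh[OF x] by (simp add: algebra_simps)
  define h r Q where "h = H x + c" and "r = rh c x" and "Q = q x"
  have p: "h + r > 0" "r > 0" "Q > 0" and Q: "Q = (r - h) * (r + h)"
    using Hc_rh_pos[OF x, of c] rh_pos[OF x, of c] q_pos[OF x] rh_sq[OF x, of c]
    by (auto simp: h_def r_def Q_def power2_eq_square algebra_simps)
  have r0: "r \<noteq> 0" "r + h \<noteq> 0" "r - h \<noteq> 0" using p Q by auto
  have csx: "cs c x = h / r" by (simp add: cs_def h_def r_def)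
  have "dir_deriv v (\<lambda>x. ln ((H x + c) + rh c x)) x = (1 / ((H x + c) + rh c x)) * dir_deriv v (\<lambda>x. (H x + c) + rh c x) x"
    by (rule comp_differentiable(2)[OF smooth_fun_differentiable[OF sm x]]) (use Hc_rh_pos[OF x, of c] in \<open>auto intro!: derivative_eq_intros\<close>)
  also have "\<dots> = (1 / (h + r)) * (dir_deriv v H x + (h / r * dir_deriv v H x + dir_deriv v q x / (2 * r)))"
    unfolding dir_deriv_add[OF d] dc dir_deriv_rh[OF x] csx by (simp add: h_def r_def)
  also have "\<dots> = (1 - h / r) * (dir_deriv v q x / (2 * Q)) - 2 * (- 1 / (2 * r)) * dir_deriv v H x"
  proof -
    have "(1 / m) * (a + (h / r * a + b / (2 * r))) = (l / r) * (b / (2 * (l * m))) - 2 * (- 1 / (2 * r)) * a"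
      if m: "m = h + r" "m \<noteq> 0" "l \<noteq> 0" for a b l m
    proof -
      have "a + h / r * a = m / r * a" using r0 m by (simp add: field_simps)
      then have "(1 / m) * (a + (h / r * a + b / (2 * r))) = (1 / m) * (m / r * a + b / (2 * r))" by simp
      also have "\<dots> = (l / r) * (b / (2 * (l * m))) - 2 * (- 1 / (2 * r)) * a" using r0 m(2,3) by (simp add: field_simps)
      finally show ?thesis .
    qed
    moreover have "1 - h / r = (r - h) / r" using r0 by (simp add: diff_divide_distrib)
    moreover have "h + r \<noteq> 0" using r0 by (simp add: add.commute)
    ultimately show ?thesis unfolding Q add.commute[of r h] using r0(3) by presburger
  qed
  finally show "dir_deriv v (\<lambda>x. ln ((H x + c) + rh c x)) x
      = (1 - cs c x) * (dir_deriv v q x / (2 * q x)) - 2 * (- 1 / (2 * rh c x)) * dir_deriv v H x"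
    by (simp add: csx r_def Q_def)
qed

lemma conjug_cs: "conjug (\<lambda>x. 1 - cs c x) (\<lambda>x. 1 / rh c x)"
proof (rule conjugI[where A = "\<lambda>x. - q x / rh c x ^ 3" and B = "\<lambda>x. (H x + c) / (2 * rh c x ^ 3)"])
  have sr: "smooth_fun \<Omega> (\<lambda>x. 1 / rh c x)"
    by (intro smooth_intros open_\<Omega> smooth_rh) (metis rh_pos less_irrefl)
  show "smooth_fun \<Omega> (\<lambda>x. 1 - cs c x)" by (intro smooth_intros open_\<Omega> smooth_cs)
  show "smooth_fun \<Omega> (\<lambda>x. 1 / rh c x)" by (rule sr)
  fix x v assume x: "x \<in> \<Omega>"
  have dc: "dir_deriv v (\<lambda>x. H x + c) x = dir_deriv v H x"
    using dir_deriv_add[OF smooth_fun_differentiable[OF smooth_H x], of "\<lambda>_. c" v] by simp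
  have d: "(\<lambda>x. H x + c) differentiable (at x)" "(\<lambda>x. 1 / rh c x) differentiable (at x)" "cs c differentiable (at x)"
    by (rule smooth_fun_differentiable[OF smooth_Hc x] smooth_fun_differentiable[OF sr x] smooth_fun_differentiable[OF smooth_cs x])+
  define h r Q where "h = H x + c" and "r = rh c x" and "Q = q x"
  have p: "r > 0" "Q > 0" and Q: "Q = r * r - h * h"
    using rh_pos[OF x, of c] q_pos[OF x] rh_sq[OF x, of c] by (auto simp: h_def r_def Q_def power2_eq_square)
  have csx: "cs c x = h / r" by (simp add: cs_def h_def r_def)
  have "dir_deriv v (\<lambda>x. 1 / rh c x) x = (- 1 / (rh c x * rh c x)) * dir_deriv v (rh c) x"
    by (rule comp_differentiable(2)[OF smooth_fun_differentiable[OF smooth_rh x]]) (use rh_pos[OF x, of c] in \<open>auto intro!: derivative_eq_intros\<close>)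
  then have di: "dir_deriv v (\<lambda>x. 1 / rh c x) x = (- 1 / (r * r)) * (h / r * dir_deriv v H x + dir_deriv v q x / (2 * r))"
    unfolding dir_deriv_rh[OF x] csx by (simp add: r_def)
  show "dir_deriv v (\<lambda>x. 1 / rh c x) x = - q x / rh c x ^ 3 * (dir_deriv v q x / (2 * q x)) - 2 * ((H x + c) / (2 * rh c x ^ 3)) * dir_deriv v H x"
    unfolding di h_def[symmetric] r_def[symmetric] Q_def[symmetric] using p by (simp add: field_simps power3_eq_cube)
  have "dir_deriv v (\<lambda>x. 1 - cs c x) x = - dir_deriv v (cs c) x"
    by (simp add: dir_deriv_diff[OF differentiable_const d(3)])
  also have "dir_deriv v (cs c) x = dir_deriv v (\<lambda>x. (H x + c) * (1 / rh c x)) x" by (simp add: cs_def[abs_def])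
  also have "\<dots> = h * dir_deriv v (\<lambda>x. 1 / rh c x) x + 1 / r * dir_deriv v H x"
    unfolding dir_deriv_mult[OF d(1,2)] dc by (simp add: h_def r_def)
  also have "- \<dots> = - Q / r ^ 3 * dir_deriv v H x + h / (2 * r ^ 3) * dir_deriv v q x"
    unfolding di Q using p by (simp add: field_simps power3_eq_cube)
  finally show "dir_deriv v (\<lambda>x. 1 - cs c x) x = - q x / rh c x ^ 3 * dir_deriv v H x + (H x + c) / (2 * rh c x ^ 3) * dir_deriv v q x"
    by (simp add: h_def r_def Q_def)
qed

text \<open>What conjugation is for: linear functions of \<open>x\<close> have the components of the
  rotated gradient of \<open>u\<close> as conjugates. So \<open>du\<close> can be recovered from
  \<open>x\<close> as a function of \<open>(H, r)\<close>.\<close>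

lemma conjug_linear: "conjug (\<lambda>x. x \<bullet> w + c) (\<lambda>x. w$1 * dir_deriv E2 u x - w$2 * dir_deriv E1 u x)"
proof -
  have su: "smooth_fun \<Omega> (dir_deriv a u)" for a using ssc by (intro smooth_fun_dir_deriv) (simp add: smooth_strictly_convex_def)
  note d = smooth_fun_differentiable[OF su]
  have w: "E1 \<bullet> w = w$1" "E2 \<bullet> w = w$2" by (simp_all add: inner_axis')
  show ?thesis unfolding conjug_def
  proof (intro conjI ballI allI)
    show "smooth_fun \<Omega> (\<lambda>x. x \<bullet> w + c)" by (rule smooth_fun_affine)
    show "smooth_fun \<Omega> (\<lambda>x. w$1 * dir_deriv E2 u x - w$2 * dir_deriv E1 u x)" by (intro smooth_intros open_\<Omega> su)
    fix x v assume x: "x \<in> \<Omega>"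
    have "dir_deriv v (\<lambda>x. w$1 * dir_deriv E2 u x - w$2 * dir_deriv E1 u x) x = w$1 * hs v E2 x - w$2 * hs v E1 x"
      using d[OF x] by (simp add: dir_deriv_diff dir_deriv_cmult differentiable_mult hs_def)
    then show "dir_deriv v (\<lambda>x. w$1 * dir_deriv E2 u x - w$2 * dir_deriv E1 u x) x =
        hs v E2 x * dir_deriv E1 (\<lambda>x. x \<bullet> w + c) x - hs v E1 x * dir_deriv E2 (\<lambda>x. x \<bullet> w + c) x"
      by (simp add: w mult.commute)
  qed
qed

lemma conjug_unique:
  assumes "conjug s t" "conjug s' t'" and e: "\<And>x. x \<in> \<Omega> \<Longrightarrow> s x = s' x"
  obtains k where "\<And>x. x \<in> \<Omega> \<Longrightarrow> t x = t' x + k"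
proof -
  have sm: "smooth_fun \<Omega> t" "smooth_fun \<Omega> t'" using assms by (auto simp: conjug_def)
  have "((\<lambda>x. t x - t' x) has_derivative (\<lambda>h. 0)) (at x within \<Omega>)" if x: "x \<in> \<Omega>" for x
  proof -
    have d: "t differentiable (at x)" "t' differentiable (at x)" using sm[THEN smooth_fun_differentiable] x by auto
    have "dir_deriv v t x = dir_deriv v t' x" for v
      using assms(1,2) x dir_deriv_cong[OF open_\<Omega> x e, of _ E1] dir_deriv_cong[OF open_\<Omega> x e, of _ E2] by (simp add: conjug_def)
    then have "dir_deriv h (\<lambda>x. t x - t' x) x = 0" for h by (simp add: dir_deriv_diff[OF d])
    then show ?thesis using has_derivative_dir_deriv[OF differentiable_diff[OF d]] by (simp add: has_derivative_at_withinI)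
  qed
  then have "\<exists>c. \<forall>x\<in>\<Omega>. t x - t' x = c"
    by (rule has_derivative_zero_constant[OF convex_\<Omega>])
  then show ?thesis using that by (metis diff_eq_eq add.commute)
qed

end

section \<open>Identification with the model chart and gradient\<close>

context toric_normalized
begin

lemma H_shift_eq: "H_shift d \<nu> lam I h j = h + aa j"
  by (simp add: H_shift_def aa_def)

lemma rho_eq: "x \<in> \<Omega> \<Longrightarrow> rho d \<nu> lam I (H x) (sqrt (q x)) j = rh (aa j) x"
  using q_pos[of x] by (simp add: rho_def H_shift_eq rh_def rho2_def power2_eq_square[symmetric])

lemma x_chart_eq:
  assumes x: "x \<in> \<Omega>"
  shows "x_chart d \<nu> lam I n (H x) (sqrt (q x)) = rot (zc x - (q x / 2) *\<^sub>R n) - sh"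
proof -
  have r: "(sqrt (q x))\<^sup>2 = q x" using q_pos[OF x] by simp
  have c: "(zc x - (q x / 2) *\<^sub>R n) $ c = real_vec (\<nu> 1) $ c * H x
        + 1/2 * (\<Sum>i=1..d-1. (real_vec (\<nu> (i+1)) $ c - real_vec (\<nu> i) $ c)
                   * (H_shift d \<nu> lam I (H x) i - rho d \<nu> lam I (H x) (sqrt (q x)) i))
        - 1/2 * (\<Sum>k\<in>I. Lam d \<nu> lam k * real_vec (\<nu> k) $ c
                   * (1 - H_shift d \<nu> lam I (H x) (k-1) / rho d \<nu> lam I (H x) (sqrt (q x)) (k-1)))
        - n $ c / 2 * (sqrt (q x))\<^sup>2" for c
    unfolding r rho_eq[OF x] H_shift_eq zc_def hm_def cs_def nv_def by (simp add: mult_ac)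
  show ?thesis unfolding x_chart_def Let_def c[symmetric] rot_def ..
qed

text \<open>A component of \<open>xi\<close> as a function on the polygon; term by term it is
  conjugate to the corresponding component of the chart, see \<open>conjug_tx\<close>.\<close>

definition tx :: "real^2 \<Rightarrow> real^2 \<Rightarrow> real^2 \<Rightarrow> real" where
  "tx n w x = det2 w (nv 1) * (1/2 * ln (q x))
    + 1/2 * (\<Sum>i=1..d-1. (det2 w (nv (i+1)) - det2 w (nv i)) * ln ((H x + aa i) + rh (aa i) x))
    - 1/2 * (\<Sum>k\<in>I. (Lm k * det2 w (nv k)) * (1 / rh (aa (k-1)) x)) + det2 w n * H x"

lemma xi_eq:
  assumes x: "x \<in> \<Omega>"
  shows "det2 w (xi d \<nu> lam I n (H x) (sqrt (q x))) = tx n w x"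
proof -
  have l: "ln (sqrt (q x)) = 1/2 * ln (q x)" using q_pos[OF x] by (simp add: ln_sqrt)
  have "xi d \<nu> lam I n (H x) (sqrt (q x)) = (1/2 * ln (q x)) *\<^sub>R nv 1
    + (1/2) *\<^sub>R (\<Sum>i=1..d-1. ln ((H x + aa i) + rh (aa i) x) *\<^sub>R (nv (i+1) - nv i))
    - (1/2) *\<^sub>R (\<Sum>k\<in>I. (Lm k / rh (aa (k-1)) x) *\<^sub>R nv k) + H x *\<^sub>R n"
    unfolding xi_def rho_eq[OF x] H_shift_eq l nv_def by (simp add: vec_eq_iff mult_ac)
  then show ?thesis
    by (simp add: tx_def det2_add2 det2_diff2 det2_scale2 det2_sum2 mult_ac)
qed

lemma conjug_tx: "conjug (\<lambda>x. det2 w (zc x - (q x / 2) *\<^sub>R n)) (tx n w)"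
proof -
  have "conjug (\<lambda>x. det2 w (nv 1) * H x
    + 1/2 * (\<Sum>i=1..d-1. (det2 w (nv (i+1)) - det2 w (nv i)) * ((H x + aa i) - rh (aa i) x))
    - 1/2 * (\<Sum>k\<in>I. (Lm k * det2 w (nv k)) * (1 - cs (aa (k-1)) x)) + det2 w n * ((-1/2) * q x)) (tx n w)"
    unfolding tx_def[abs_def]
    by (intro conjug_add conjug_diff conjug_cmult conjug_sum conjug_H conjug_q conjug_rh conjug_cs)
  moreover have "det2 w (zc x - (q x / 2) *\<^sub>R n) = det2 w (nv 1) * H x
    + 1/2 * (\<Sum>i=1..d-1. (det2 w (nv (i+1)) - det2 w (nv i)) * ((H x + aa i) - rh (aa i) x))
    - 1/2 * (\<Sum>k\<in>I. (Lm k * det2 w (nv k)) * (1 - cs (aa (k-1)) x)) + det2 w n * ((-1/2) * q x)" for x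
    unfolding det2_diff2 det2_zc hm_def det2_scale2 by simp
  ultimately show ?thesis by simp
qed

text \<open>Needed because \<open>u_nu\<close> is specified at all \<open>(H, r)\<close> with
  \<open>r > 0\<close>. The image is open in the half-plane by invariance of domain and closed by
  properness.\<close>

lemma chart_surjective:
  assumes inj: "\<And>x y. x \<in> \<Omega> \<Longrightarrow> y \<in> \<Omega> \<Longrightarrow> H x = H y \<Longrightarrow> q x = q y \<Longrightarrow> x = y" and k: "k > 0"
  shows "\<exists>x\<in>\<Omega>. H x = h \<and> q x = k"
proof -
  define z where "z = (\<lambda>y. H y *\<^sub>R E1 + q y *\<^sub>R E2)"
  have z12: "z y $ 1 = H y" "z y $ 2 = q y" for y by (simp_all add: z_def axis_def)
  have HP: "{w::real^2. w $ 2 > 0} = {w. E2 \<bullet> w > 0}" by (simp add: inner_axis')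
  have cz: "continuous_on \<Omega> z"
    unfolding z_def by (intro continuous_intros smooth_fun_continuous_on[OF smooth_H] smooth_fun_continuous_on[OF smooth_q])
  have oz: "open (z ` \<Omega>)"
  proof (rule invariance_of_domain[OF cz open_\<Omega>])
    show "inj_on z \<Omega>" by (rule inj_onI) (metis inj z12)
  qed
  have sub: "z ` \<Omega> \<subseteq> {w. w $ 2 > 0}" using q_pos z12 by auto
  have "closedin (top_of_set {w. w $ 2 > 0}) (z ` \<Omega>)" unfolding closedin_limpt
  proof (intro conjI allI impI sub)
    fix l assume l: "l islimpt z ` \<Omega> \<and> l \<in> {w. w $ 2 > 0}"
    then obtain f where f: "\<And>n. f n \<in> z ` \<Omega>" "f \<longlonglongrightarrow> l" unfolding islimpt_sequential by blast
    have "\<forall>n. \<exists>x. x \<in> \<Omega> \<and> f n = z x" using f(1) by blast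
    then obtain x where x: "\<And>n. x n \<in> \<Omega>" "\<And>n. f n = z (x n)" by metis
    have Hl: "(\<lambda>n. H (x n)) \<longlonglongrightarrow> l $ 1" "(\<lambda>n. q (x n)) \<longlonglongrightarrow> l $ 2"
      using tendsto_vec_nth[OF f(2), of 1] tendsto_vec_nth[OF f(2), of 2] by (simp_all add: x(2) z12)
    obtain p where "(p \<in> \<Omega> \<and> H p = l $ 1 \<and> q p = l $ 2) \<or> l $ 2 = 0"
      by (rule fibre_limit[OF x(1) Hl]) (use that in blast)
    then have p: "p \<in> \<Omega>" "H p = l $ 1" "q p = l $ 2" using l by auto
    then have "l = z p" by (simp add: vec_eq_iff forall_2 z12)
    then show "l \<in> z ` \<Omega>" using p(1) by blast
  qed
  moreover have "openin (top_of_set {w. w $ 2 > 0}) (z ` \<Omega>)" by (rule open_subset[OF sub oz])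
  moreover have "connected {w::real^2. w $ 2 > 0}" unfolding HP by (intro convex_connected convex_halfspace_gt)
  ultimately have "z ` \<Omega> = {} \<or> z ` \<Omega> = {w. w $ 2 > 0}" unfolding connected_clopen by blast
  then have "z ` \<Omega> = {w. w $ 2 > 0}" using nonempty_\<Omega> by blast
  moreover have "h *\<^sub>R E1 + k *\<^sub>R E2 \<in> {w. w $ 2 > 0}" using k by (simp add: axis_def)
  ultimately obtain x where x: "x \<in> \<Omega>" "h *\<^sub>R E1 + k *\<^sub>R E2 = z x" by blast
  have "(h *\<^sub>R E1 + k *\<^sub>R E2) $ 1 = h" "(h *\<^sub>R E1 + k *\<^sub>R E2) $ 2 = k" by (simp_all add: axis_def)
  then show ?thesis using x z12[of x] by auto
qed

theorem hessian_eq: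
  "\<exists>n. det2 n (nv 1) \<ge> 0 \<and> det2 n (nv d) \<ge> 0 \<and> (\<forall>x\<in>\<Omega>. hessian u x = hessian (u_nu d \<nu> lam I n) x)"
proof -
  obtain c1 where c1: "c1 \<ge> 0" "\<And>x. x \<in> \<Omega> \<Longrightarrow> yy (nv 1) x = c1 * q x"
    using liouville[OF tame_yy yy_1_nonneg] by blast
  obtain cd where cd: "cd \<ge> 0" "\<And>x. x \<in> \<Omega> \<Longrightarrow> yy (nv d) x = cd * q x"
    using liouville[OF tame_yy yy_d_nonneg] by blast
  \<comment> \<open>Cramer's rule for \<open>det2 n (nv 1) = 2 * c1\<close> and
    \<open>det2 n (nv d) = 2 * cd\<close>. The factor 2 is due to the term \<open>r^2 / 2\<close> of
    the chart; \<open>c1, cd \<ge> 0\<close> are the two sign conditions.\<close>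
  define n where "n = (2 * cd / DD 1 d) *\<^sub>R nv 1 - (2 * c1 / DD 1 d) *\<^sub>R nv d"
  have D0: "DD 1 d \<noteq> 0" using DD_1d by simp
  have n1: "det2 n (nv 1) = 2 * c1" and nd: "det2 n (nv d) = 2 * cd"
    using D0 det2_swap[of "nv d" "nv 1"] by (simp_all add: n_def det2_diff1 det2_scale1 det2_self)
  have inner: "x \<bullet> w + sh \<bullet> w = det2 w (zc x - (q x / 2) *\<^sub>R n)" if "yy w x = det2 n w / 2 * q x" for x w
  proof -
    have "det2 w (zc x - (q x / 2) *\<^sub>R n) = det2 w (zc x) + det2 n w / 2 * q x"
      unfolding det2_diff2 det2_scale2 det2_swap[of w n] by simp
    then show ?thesis using that unfolding yy_def by linarith
  qed
  have chart: "x = rot (zc x - (q x / 2) *\<^sub>R n) - sh" if x: "x \<in> \<Omega>" for x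
  proof (rule inner_determines[OF D0])
    show "x \<bullet> nv 1 = (rot (zc x - (q x / 2) *\<^sub>R n) - sh) \<bullet> nv 1"
      using inner[of "nv 1" x] c1(2)[OF x] n1 by (simp add: inner_diff_left rot_inner)
    show "x \<bullet> nv d = (rot (zc x - (q x / 2) *\<^sub>R n) - sh) \<bullet> nv d"
      using inner[of "nv d" x] cd(2)[OF x] nd by (simp add: inner_diff_left rot_inner)
  qed
  have lin: "x \<bullet> w + sh \<bullet> w = det2 w (zc x - (q x / 2) *\<^sub>R n)" if x: "x \<in> \<Omega>" for x w
    using arg_cong[OF chart[OF x], of "\<lambda>y. y \<bullet> w"] by (simp add: inner_diff_left rot_inner)
  have xc: "x_chart d \<nu> lam I n (H x) (sqrt (q x)) = x" if x: "x \<in> \<Omega>" for x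
    using x_chart_eq[OF x, of n] chart[OF x] by simp
  \<comment> \<open>Only now is \<open>(H, q)\<close> seen to be injective, as \<open>x\<close> is
    an explicit function of it.\<close>
  have inj: "x = y" if "x \<in> \<Omega>" "y \<in> \<Omega>" "H x = H y" "q x = q y" for x y
    using xc[OF that(1)] xc[OF that(2)] that(3,4) by metis
  let ?g = "\<lambda>x. xi d \<nu> lam I n (H x) (sqrt (q x))"
  have ex: "\<exists>k. \<forall>x\<in>\<Omega>. w$1 * dir_deriv E2 u x - w$2 * dir_deriv E1 u x = det2 w (?g x) + k" for w
  proof -
    obtain k where k: "\<And>x. x \<in> \<Omega> \<Longrightarrow> w$1 * dir_deriv E2 u x - w$2 * dir_deriv E1 u x = tx n w x + k"
      by (rule conjug_unique[OF conjug_linear[of w "sh \<bullet> w"] conjug_tx[of w n] lin]) (use that in auto)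
    then show ?thesis using xi_eq by (intro exI[of _ k]) simp
  qed
  have E: "E1 $ 1 = (1::real)" "E1 $ 2 = (0::real)" "E2 $ 1 = (0::real)" "E2 $ 2 = (1::real)" by (simp_all add: axis_def)
  obtain k1 where k1': "\<forall>x\<in>\<Omega>. E1$1 * dir_deriv E2 u x - E1$2 * dir_deriv E1 u x = det2 E1 (?g x) + k1"
    using ex by blast
  obtain k2 where k2': "\<forall>x\<in>\<Omega>. E2$1 * dir_deriv E2 u x - E2$2 * dir_deriv E1 u x = det2 E2 (?g x) + k2"
    using ex by blast
  have k1: "dir_deriv E2 u x = ?g x $ 2 + k1" if x: "x \<in> \<Omega>" for x
    using bspec[OF k1' x] unfolding det2_def E by simp
  have k2: "dir_deriv E1 u x = ?g x $ 1 - k2" if x: "x \<in> \<Omega>" for x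
    using bspec[OF k2' x] unfolding det2_def E by simp
  \<comment> \<open>Conjugates are unique up to constants only, so the two gradients differ by a
    constant vector, which does not affect Hessians.\<close>
  define \<kappa> where "\<kappa> = (- k2) *\<^sub>R E1 + k1 *\<^sub>R E2"
  have su: "smooth_fun \<Omega> u" using ssc by (simp add: smooth_strictly_convex_def)
  have du: "dir_deriv h u x = ?g x \<bullet> h + h \<bullet> \<kappa>" if x: "x \<in> \<Omega>" for x h
  proof -
    have "dir_deriv h u x = h$1 * dir_deriv E1 u x + h$2 * dir_deriv E2 u x"
      by (rule dir_deriv_vec2[OF smooth_fun_differentiable[OF su x]])
    then show ?thesis unfolding k1[OF x] k2[OF x] by (simp add: inner_vec2 \<kappa>_def axis_def algebra_simps)
  qed
  have "\<forall>h r. r > 0 \<longrightarrow> ((\<lambda>x. u x - x \<bullet> \<kappa>) has_derivative (\<lambda>v. xi d \<nu> lam I n h r \<bullet> v)) (at (x_chart d \<nu> lam I n h r))"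
  proof (intro allI impI)
    fix h r :: real assume r: "r > 0"
    then have "r\<^sup>2 > 0" by simp
    then obtain x where x: "x \<in> \<Omega>" "H x = h" "q x = r\<^sup>2" using chart_surjective[OF inj] by blast
    have sq: "sqrt (q x) = r" using x r by simp
    have "((\<lambda>x. u x - x \<bullet> \<kappa>) has_derivative (\<lambda>v. dir_deriv v u x - v \<bullet> \<kappa>)) (at x)"
      by (intro has_derivative_diff has_derivative_dir_deriv smooth_fun_differentiable[OF su x(1)] has_derivative_inner_left has_derivative_ident)
    moreover have "(\<lambda>v. dir_deriv v u x - v \<bullet> \<kappa>) = (\<lambda>v. xi d \<nu> lam I n h r \<bullet> v)"
      using du[OF x(1)] x(2) sq by (simp add: fun_eq_iff)
    moreover have "x_chart d \<nu> lam I n h r = x" using xc[OF x(1)] x(2) sq by simp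
    ultimately show "((\<lambda>x. u x - x \<bullet> \<kappa>) has_derivative (\<lambda>v. xi d \<nu> lam I n h r \<bullet> v)) (at (x_chart d \<nu> lam I n h r))" by simp
  qed
  \<comment> \<open>Since \<open>u\<close> minus a linear function meets the condition in the
    definition of \<open>u_nu\<close>, the function chosen there meets it as well.\<close>
  then have "\<forall>h r. r > 0 \<longrightarrow> (u_nu d \<nu> lam I n has_derivative (\<lambda>v. xi d \<nu> lam I n h r \<bullet> v)) (at (x_chart d \<nu> lam I n h r))"
    unfolding u_nu_def
    by (rule someI[where P = "\<lambda>v. \<forall>h r. r > 0 \<longrightarrow> (v has_derivative (\<lambda>w. xi d \<nu> lam I n h r \<bullet> w)) (at (x_chart d \<nu> lam I n h r))"])
  then have dn: "dir_deriv v (u_nu d \<nu> lam I n) x = dir_deriv v u x - v \<bullet> \<kappa>" if x: "x \<in> \<Omega>" for v x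
  proof -
    assume *: "\<forall>h r. r > 0 \<longrightarrow> (u_nu d \<nu> lam I n has_derivative (\<lambda>v. xi d \<nu> lam I n h r \<bullet> v)) (at (x_chart d \<nu> lam I n h r))"
    have "sqrt (q x) > 0" using q_pos[OF x] by simp
    then have "(u_nu d \<nu> lam I n has_derivative (\<lambda>v. ?g x \<bullet> v)) (at x)" using * xc[OF x] by metis
    then show ?thesis using dir_deriv_eqI du[OF x, of v] by simp
  qed
  have "dir_deriv a (dir_deriv v (u_nu d \<nu> lam I n)) x = dir_deriv a (dir_deriv v u) x" if x: "x \<in> \<Omega>" for a v x
  proof -
    have dd: "dir_deriv v u differentiable (at x)" by (rule smooth_fun_differentiable[OF smooth_fun_dir_deriv[OF su] x])
    have "dir_deriv a (dir_deriv v (u_nu d \<nu> lam I n)) x = dir_deriv a (\<lambda>x. dir_deriv v u x - v \<bullet> \<kappa>) x"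
      by (rule dir_deriv_cong[OF open_\<Omega> x dn])
    then show ?thesis by (simp add: dir_deriv_diff[OF dd differentiable_const])
  qed
  then have "\<forall>x\<in>\<Omega>. hessian u x = hessian (u_nu d \<nu> lam I n) x"
    by (simp add: hessian_def partial_deriv_def vec_eq_iff)
  then show ?thesis using n1 nd c1(1) cd(1) by (intro exI[of _ n]) simp
qed

end

text \<open>That \<open>H\<close> has a limit at the first vertex is a result of the boundary
  analysis. So the locale \<open>toric\<close> is first interpreted with an arbitrary conjugate
  function \<open>H0\<close>, which is then shifted by a constant.\<close>

lemma normalized_conjugate_exists:
  fixes d :: nat and \<nu> :: "nat \<Rightarrow> int^2" and lam :: "nat \<Rightarrow> real"
  assumes su: "strictly_unbounded d \<nu> lam" and dv: "divisor_indices d \<nu> lam I"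
    and ssc: "smooth_strictly_convex (interior (polytope_of d \<nu> lam)) u"
    and flat: "scalar_flat (polytope_of d \<nu> lam) u"
    and pos: "\<forall>k\<in>I. \<alpha> k > 0" and S: "S_type d \<nu> lam I \<alpha> \<beta> u"
  obtains H W vext where "toric_normalized d \<nu> lam u H I \<alpha> \<beta> W vext"
proof -
  interpret moment_polygon d \<nu> lam by unfold_locales (rule su)
  interpret convex_potential "interior P" u
  proof
    show "convex (interior P)" by (rule convex_interior[OF convex_P])
    show "interior P \<noteq> {}" by (rule interior_nonempty)
  qed (use ssc flat in \<open>auto simp: scalar_flat_def\<close>)
  obtain W vext where W: "open W" "P \<subseteq> W" "smooth_fun W vext"
    "\<And>x. x \<in> P - (\<Union>k\<in>I. eg k) \<Longrightarrow> u x + (\<Sum>k\<in>I. (\<alpha> k + \<beta> k * ll k x) * ln (ll k x))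
              - 1/2 * (\<Sum>i\<in>{1..d} - I. ll i x * ln (ll i x)) = vext x"
    using S unfolding S_type_def extends_smoothly_def by blast
  obtain H0 where H0: "\<And>x. x \<in> interior P \<Longrightarrow> (H0 has_derivative (\<lambda>h. conj1 x * h$1 + conj2 x * h$2)) (at x)"
    using conjugate_exists by blast
  have toric: "toric d \<nu> lam u H I \<alpha> \<beta> W vext"
    if H: "\<And>x. x \<in> interior P \<Longrightarrow> (H has_derivative (\<lambda>h. conj1 x * h$1 + conj2 x * h$2)) (at x)" for H
    using H W dv pos S by unfold_locales (auto simp: S_type_def)
  interpret T: toric d \<nu> lam u H0 I \<alpha> \<beta> W vext by (rule toric[OF H0])
  have v: "vx 1 \<in> frontier (interior P)" using vx_in_P[of 1] ll_vx(1)[of 1] d2 unfolding mem_frontier by force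
  define c where "c = - ap 1 - T.hb (vx 1)"
  have H1: "((\<lambda>x. H0 x + c) has_derivative (\<lambda>h. conj1 x * h$1 + conj2 x * h$2)) (at x)" if "x \<in> interior P" for x
    using has_derivative_add[OF H0[OF that] has_derivative_const[of c]] by simp
  have "((\<lambda>x. H0 x + c) \<longlongrightarrow> T.hb (vx 1) + c) (at (vx 1) within interior P)"
    by (intro tendsto_intros T.H_lim[OF v])
  then have "Lim (at (vx 1) within interior P) (\<lambda>x. H0 x + c) = - ap 1"
    using tendsto_Lim[OF T.at_frontier_nontrivial[OF v]] by (simp add: c_def)
  then have "toric_normalized d \<nu> lam u (\<lambda>x. H0 x + c) I \<alpha> \<beta> W vext"
    using toric[OF H1] by (simp add: toric_normalized_def toric_normalized_axioms_def)
  then show ?thesis by (rule that)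
qed

theorem theorem1p4:
  fixes d :: nat and \<nu> :: "nat \<Rightarrow> int^2" and lam :: "nat \<Rightarrow> real" and I :: "nat set"
    and g :: metric_tensor and u :: "real^2 \<Rightarrow> real" and \<alpha> \<beta> :: "nat \<Rightarrow> real"
  assumes "strictly_unbounded d \<nu> lam"
    and "divisor_indices d \<nu> lam I"
    and "is_toric_kaehler_metric (polytope_of d \<nu> lam) g u"
    and "scalar_flat (polytope_of d \<nu> lam) u"
    and "\<forall>k\<in>I. \<alpha> k > 0"
    and "S_type d \<nu> lam I \<alpha> \<beta> u"
  shows "\<exists>n :: real^2. det2 n (real_vec (\<nu> 1)) \<ge> 0 \<and> det2 n (real_vec (\<nu> d)) \<ge> 0 \<and>
           (\<forall>x\<in>interior (polytope_of d \<nu> lam). \<forall>\<theta>. g (x, \<theta>) = g_nu d \<nu> lam I n (x, \<theta>))"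
proof -
  have ssc: "smooth_strictly_convex (interior (polytope_of d \<nu> lam)) u"
    and g: "\<And>x \<theta>. x \<in> interior (polytope_of d \<nu> lam) \<Longrightarrow> g (x, \<theta>) = toric_metric u (x, \<theta>)"
    using assms(3) by (auto simp: is_toric_kaehler_metric_def)
  obtain H W vext where "toric_normalized d \<nu> lam u H I \<alpha> \<beta> W vext"
    by (rule normalized_conjugate_exists[OF assms(1,2) ssc assms(4-6)])
  then interpret toric_normalized d \<nu> lam u H I \<alpha> \<beta> W vext .
  obtain n where n: "det2 n (nv 1) \<ge> 0" "det2 n (nv d) \<ge> 0" "\<And>x. x \<in> \<Omega> \<Longrightarrow> hessian u x = hessian (u_nu d \<nu> lam I n) x"
    using hessian_eq by blast
  have "g (x, \<theta>) = g_nu d \<nu> lam I n (x, \<theta>)" if "x \<in> \<Omega>" for x \<theta>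
    unfolding g[OF that] g_nu_def toric_metric_def using n(3)[OF that] by simp
  then show ?thesis using n(1,2) by (intro exI[of _ n]) (simp add: nv_def)
qed

end
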